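(* In the setting of the vintage capital problem with convex-linear cost described in the context, let $$w_1=-A^{-1}BM_{\frac1{2\beta}}B^*(\lambda-A_0^* )^{-1}\alpha,\qquad w_2=A^{-1}BM_{\frac1{2\beta}}q,$$ and set $c_1:=\langle\alpha,w_1\rangle$, $c_2:=\langle\alpha,w_2\rangle$. Then there exists a unique equilibrium point $\bar x$ in each of the following cases: (i) If $R(Q)=-aQ^2+bQ$ (with $a\ge0$, $b\in\mathbb R$), then $$\bar x=w_2-\frac{2ac_2-b}{1+2ac_1}\,w_1 .$$ (ii) If $R(Q)=\ln(1+Q)$ for $Q\ge0$ and $R(Q)=Q$ for $Q<0$, then $$\bar x=w_2+\frac{\sqrt{(1+c_2)^2+4c_1}-(1+c_2)}{2c_1}\,w_1 .$$ (iii) If $R(Q)=(1+Q)^\gamma-1$ for $Q\ge0$ and $R(Q)=\gamma Q$ for $Q<0$, with $\gamma\in(0,1)$, then $\bar x=w_2+\bar\eta\,w_1$, where $\bar\eta$ is the unique positive solution of $$\eta=\frac{\gamma}{(1+c_1\eta+c_2)^{1-\gamma}} .$$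
   Context: Spaces and operators. Let $\bar s\in(0,+\infty]$, $\mu>0$, $\lambda>0$, $H=L^2(0,\bar s)$, $U=\mathbb R\times H$. $A_0f=-f'-\mu f$ with $D(A_0)=\{f\in H^1(0,\bar s): f(0)=0\}$, the generator of a strongly continuous semigroup on $H$. Its adjoint is $A_0^*f=f'-\mu f$ on $V:=D(A_0^* )=\{f\in H^1(0,\bar s): f(\bar s)=0\}$, endowed with $(v|w)_V=(v|w)_H+(A_0^*v|A_0^*w)_H$. $V'$ is the dual of $V$, with $V\subset H\equiv H'\subset V'$ and duality pairing $\langle\cdot,\cdot\rangle$. The semigroup extends to a strongly continuous semigroup $e^{tA}$ on $V'$ with generator $A$, $D(A)=H$, extending $A_0$; $A$ is invertible with bounded inverse on $V'$. $B\in L(U,V')$ is $B(u_0,u_1)=u_1+u_0\delta_0$, with $\delta_0$ the Dirac delta at $0$; its adjoint is $B^*:V\to U$, $B^*f=(f(0),f)$. Data. $\alpha\in V$ is positive and $g_0(x)=-R(\langle\alpha,x\rangle)$ for $x\in V'$, with $R:\mathbb R\to\mathbb R$ as specified in each case. The control cost is $$h_0(u)=\int_0^{\bar s}u_1(s)[\beta_1(s)u_1(s)+q_1(s)]\,ds+u_0[\beta_0u_0+q_0],\qquad u=(u_0,u_1)\in U,$$ where $\beta=(\beta_0,\beta_1)\in\mathbb R\times L^\infty(0,\bar s)$ with $\beta_0\ge\epsilon$ and $\beta_1(s)\ge\epsilon$ for some $\epsilon>0$, and $q=(q_0,q_1)\in U$. $M_{\frac1{2\beta}}:U\to U$ is $M_{\frac1{2\beta}}(u_0,u_1)=\left(\frac{u_0}{2\beta_0},\frac{u_1(\cdot)}{2\beta_1(\cdot)}\right)$.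 The convex conjugate $h_0^*$ of $h_0$ has derivative $(h_0^* )'(u)=M_{\frac1{2\beta}}(u-q)$. Value function and equilibrium points. For $x\in V'$ and $u\in L^2_\lambda(0,+\infty;U)=\{u:\ \tau\mapsto u(\tau)e^{-\lambda\tau/2}\in L^2(0,+\infty;U)\}$, let $y(\tau)=e^{\tau A}x+\int_0^\tau e^{(\tau-\sigma)A}Bu(\sigma)\,d\sigma$ and $$\Psi(x)=\inf_{u\in L^2_\lambda(0,+\infty;U)}\int_0^{+\infty}e^{-\lambda\tau}[g_0(y(\tau))+h_0(u(\tau))]\,d\tau .$$ $\Psi'$ denotes the Fréchet derivative of $\Psi$, viewed as a $V$-valued map on $V'$. An equilibrium point is a stationary solution of the closed loop equation, i.e. $x\in D(A)$ such that $Ax+B(h_0^* )'(-B^*\Psi'(x))=0$.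
   Formalization: The formulas for x̄ in (ii) and (iii) are claimed only if c_1+c_2≥0, resp. γc_1+c_2≥0; otherwise they are false (x̄=w_2+w_1, resp. w_2+γw_1). Existence and uniqueness of x̄ and η̄ need no such condition; in (iii) solutions have 1+c_1η+c_2>0. *)

theory Defs
  imports "HOL-Analysis.Analysis" "HOL-Library.Function_Algebras"
begin

text \<open>
  Functions carry the pointwise vector space structure.  The spaces \<open>H\<close>, \<open>V\<close>, \<open>V'\<close>, \<open>U\<close> depend on
  the parameter \<open>sbar\<close>, so they are carrier sets with explicit norms rather than types.  Elements of
  \<open>H = L\<^sup>2(0, sbar)\<close> are representatives, two of them being identified when the seminorm of their
  difference vanishes; elements of \<open>V\<close> and \<open>V'\<close> are represented uniquely.
\<close>

instantiation "fun" :: (type, real_vector) real_vector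
begin
definition "scaleR c f = (\<lambda>x. c *\<^sub>R f x)"
instance
  by standard (simp_all add: scaleR_fun_def fun_eq_iff scaleR_add_right scaleR_add_left)
end

type_synonym fn = "real \<Rightarrow> real"
type_synonym ctrl = "real \<times> fn"
type_synonym funct = "fn \<Rightarrow> real"

subsection \<open>Normed carriers, semigroups, generators, gradients\<close>

text \<open>Strong continuity means that all orbit maps are continuous on \<open>[0, \<infinity>)\<close>.  Equalities are modulo
  null elements of the seminorm \<open>N\<close>; boundedness makes the operators well defined on classes.\<close>

definition C0_semigroup ::
  "'x::real_vector set \<Rightarrow> ('x \<Rightarrow> real) \<Rightarrow> (real \<Rightarrow> 'x \<Rightarrow> 'x) \<Rightarrow> bool" where
  "C0_semigroup X N S \<longleftrightarrow>
     (\<forall>t\<ge>0. \<forall>x\<in>X. S t x \<in> X) \<and>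
     (\<forall>t\<ge>0. \<forall>x\<in>X. \<forall>y\<in>X. \<forall>a b. N (S t (a *\<^sub>R x + b *\<^sub>R y) - (a *\<^sub>R S t x + b *\<^sub>R S t y)) = 0) \<and>
     (\<forall>t\<ge>0. \<exists>C. \<forall>x\<in>X. N (S t x) \<le> C * N x) \<and>
     (\<forall>x\<in>X. N (S 0 x - x) = 0) \<and>
     (\<forall>t\<ge>0. \<forall>r\<ge>0. \<forall>x\<in>X. N (S (t + r) x - S t (S r x)) = 0) \<and>
     (\<forall>x\<in>X. \<forall>t\<ge>0. ((\<lambda>r. N (S r x - S t x)) \<longlongrightarrow> 0) (at t within {0..}))"

definition generator ::
  "'x::real_vector set \<Rightarrow> ('x \<Rightarrow> real) \<Rightarrow> (real \<Rightarrow> 'x \<Rightarrow> 'x) \<Rightarrow> ('x \<times> 'x) set" where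
  "generator X N S =
     {(x, y). x \<in> X \<and> y \<in> X \<and> ((\<lambda>t. N ((1 / t) *\<^sub>R (S t x - x) - y)) \<longlongrightarrow> 0) (at_right 0)}"

text \<open>The Frechet derivative of \<open>F\<close> at \<open>x\<close> is the (linear) functional \<open>L\<close>.\<close>

definition frechet_deriv_on ::
  "'x::real_vector set \<Rightarrow> ('x \<Rightarrow> real) \<Rightarrow> ('x \<Rightarrow> real) \<Rightarrow> 'x \<Rightarrow> ('x \<Rightarrow> real) \<Rightarrow> bool" where
  "frechet_deriv_on X N F x L \<longleftrightarrow>
     (\<forall>e>0. \<exists>d>0. \<forall>k\<in>X. N k < d \<longrightarrow> \<bar>F (x + k) - F x - L k\<bar> \<le> e * N k)"

text \<open>Strong (Bochner) measurability on \<open>(0, \<infinity>)\<close>, for representatives that are limits of simple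
  functions everywhere.\<close>

definition bochner_measurable ::
  "'x::real_vector set \<Rightarrow> ('x \<Rightarrow> real) \<Rightarrow> (real \<Rightarrow> 'x) \<Rightarrow> bool" where
  "bochner_measurable X N u \<longleftrightarrow>
     (\<forall>\<tau>>0. u \<tau> \<in> X) \<and>
     (\<exists>\<phi> :: nat \<Rightarrow> real \<Rightarrow> 'x.
        (\<forall>n. finite (\<phi> n ` {0<..}) \<and> \<phi> n ` {0<..} \<subseteq> X \<and>
             (\<forall>x. {\<tau>. 0 < \<tau> \<and> \<phi> n \<tau> = x} \<in> sets borel)) \<and>
        (\<forall>\<tau>>0. (\<lambda>n. N (\<phi> n \<tau> - u \<tau>)) \<longlonglongrightarrow> 0))"

subsection \<open>The spaces \<open>H\<close> and \<open>V\<close>\<close>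

definition ages :: "ereal \<Rightarrow> real set" where
  "ages sbar = {s. 0 < s \<and> ereal s < sbar}"

definition ageM :: "ereal \<Rightarrow> real measure" where
  "ageM sbar = restrict_space lborel (ages sbar)"

definition spH :: "ereal \<Rightarrow> fn set" where
  "spH sbar = {f \<in> borel_measurable (ageM sbar). integrable (ageM sbar) (\<lambda>s. (f s)\<^sup>2)}"

definition innerH :: "ereal \<Rightarrow> fn \<Rightarrow> fn \<Rightarrow> real" where
  "innerH sbar f g = (LINT s|ageM sbar. f s * g s)"

definition normH :: "ereal \<Rightarrow> fn \<Rightarrow> real" where
  "normH sbar f = sqrt (innerH sbar f f)"

text \<open>\<open>f\<close> is the continuous representative, on \<open>[0, sbar]\<close> (resp. \<open>[0, \<infinity>)\<close>), of an element of
  \<open>H\<^sup>1(0, sbar)\<close>, and \<open>g\<close> is (a representative of) its weak derivative.\<close>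

definition H1_deriv :: "ereal \<Rightarrow> fn \<Rightarrow> fn \<Rightarrow> bool" where
  "H1_deriv sbar f g \<longleftrightarrow> f \<in> spH sbar \<and> g \<in> spH sbar \<and>
     (\<forall>s t. 0 \<le> s \<longrightarrow> s \<le> t \<longrightarrow> ereal t \<le> sbar \<longrightarrow> f t - f s = (LBINT r:{s<..<t}. g r))"

text \<open>The graph of \<open>A\<^sub>0 f = -f' - \<mu> f\<close> on \<open>{f \<in> H\<^sup>1. f(0) = 0}\<close>, saturated under a.e. equality.\<close>

definition A0_graph :: "ereal \<Rightarrow> real \<Rightarrow> (fn \<times> fn) set" where
  "A0_graph sbar \<mu> = {(f, h). f \<in> spH sbar \<and> h \<in> spH sbar \<and>
     (\<exists>F G. H1_deriv sbar F G \<and> F 0 = 0 \<and>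
        (AE s in ageM sbar. f s = F s) \<and> (AE s in ageM sbar. h s = - G s - \<mu> * F s))}"

text \<open>Elements of \<open>V\<close> are continuous representatives, set to zero outside \<open>[0, sbar]\<close>.  When
  \<open>sbar = \<infinity>\<close> the boundary condition \<open>f(sbar) = 0\<close> is a limit.\<close>

definition spV :: "ereal \<Rightarrow> fn set" where
  "spV sbar = {f. (\<exists>g. H1_deriv sbar f g) \<and>
     (if sbar = \<infinity> then (f \<longlongrightarrow> 0) at_top else f (real_of_ereal sbar) = 0) \<and>
     (\<forall>s. s < 0 \<or> sbar < ereal s \<longrightarrow> f s = 0)}"

definition weak_deriv :: "ereal \<Rightarrow> fn \<Rightarrow> fn" where
  "weak_deriv sbar f = (SOME g. H1_deriv sbar f g)"

definition A0_star :: "ereal \<Rightarrow> real \<Rightarrow> fn \<Rightarrow> fn" where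
  "A0_star sbar \<mu> f = weak_deriv sbar f - \<mu> *\<^sub>R f"

definition innerV :: "ereal \<Rightarrow> real \<Rightarrow> fn \<Rightarrow> fn \<Rightarrow> real" where
  "innerV sbar \<mu> v w = innerH sbar v w + innerH sbar (A0_star sbar \<mu> v) (A0_star sbar \<mu> w)"

definition normV :: "ereal \<Rightarrow> real \<Rightarrow> fn \<Rightarrow> real" where
  "normV sbar \<mu> v = sqrt (innerV sbar \<mu> v v)"

text \<open>\<open>(\<lambda> - A\<^sub>0\<^sup>*)\<^sup>-\<^sup>1 f\<close>\<close>

definition resolvent_star :: "ereal \<Rightarrow> real \<Rightarrow> real \<Rightarrow> fn \<Rightarrow> fn" where
  "resolvent_star sbar \<mu> lam f =
     (THE v. v \<in> spV sbar \<and> (AE s in ageM sbar. lam * v s - A0_star sbar \<mu> v s = f s))"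

subsection \<open>The dual space \<open>V'\<close>\<close>

text \<open>Functionals vanish by convention outside \<open>V\<close>; the duality pairing of \<open>v \<in> V\<close> and \<open>x \<in> V'\<close> is
  the application \<open>x v\<close>.\<close>

definition spVd :: "ereal \<Rightarrow> real \<Rightarrow> funct set" where
  "spVd sbar \<mu> = {x. (\<forall>v. v \<notin> spV sbar \<longrightarrow> x v = 0) \<and>
     (\<forall>v\<in>spV sbar. \<forall>w\<in>spV sbar. \<forall>a b. x (a *\<^sub>R v + b *\<^sub>R w) = a * x v + b * x w) \<and>
     (\<exists>C. \<forall>v\<in>spV sbar. \<bar>x v\<bar> \<le> C * normV sbar \<mu> v)}"

definition normVd :: "ereal \<Rightarrow> real \<Rightarrow> funct \<Rightarrow> real" where
  "normVd sbar \<mu> x = (SUP v\<in>{v \<in> spV sbar. normV sbar \<mu> v \<le> 1}. \<bar>x v\<bar>)"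

text \<open>The embedding \<open>H \<equiv> H' \<subseteq> V'\<close>.\<close>

definition emb :: "ereal \<Rightarrow> fn \<Rightarrow> funct" where
  "emb sbar h = (\<lambda>v. if v \<in> spV sbar then innerH sbar h v else 0)"

definition delta0 :: "ereal \<Rightarrow> funct" where
  "delta0 sbar = (\<lambda>v. if v \<in> spV sbar then v 0 else 0)"

text \<open>\<open>S\<close> is the semigroup on \<open>H\<close> generated by \<open>A\<^sub>0\<close>, and \<open>T\<close> its extension \<open>e\<^sup>t\<^sup>A\<close> to \<open>V'\<close>.\<close>

definition generates_A0 :: "ereal \<Rightarrow> real \<Rightarrow> (real \<Rightarrow> fn \<Rightarrow> fn) \<Rightarrow> bool" where
  "generates_A0 sbar \<mu> S \<longleftrightarrow>
     C0_semigroup (spH sbar) (normH sbar) S \<and> generator (spH sbar) (normH sbar) S = A0_graph sbar \<mu>"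

definition extends_to_Vd ::
  "ereal \<Rightarrow> real \<Rightarrow> (real \<Rightarrow> fn \<Rightarrow> fn) \<Rightarrow> (real \<Rightarrow> funct \<Rightarrow> funct) \<Rightarrow> bool" where
  "extends_to_Vd sbar \<mu> S T \<longleftrightarrow> C0_semigroup (spVd sbar \<mu>) (normVd sbar \<mu>) T \<and>
     (\<forall>t\<ge>0. \<forall>h\<in>spH sbar. T t (emb sbar h) = emb sbar (S t h))"

definition genA :: "ereal \<Rightarrow> real \<Rightarrow> (real \<Rightarrow> funct \<Rightarrow> funct) \<Rightarrow> (funct \<times> funct) set" where
  "genA sbar \<mu> T = generator (spVd sbar \<mu>) (normVd sbar \<mu>) T"

definition A_inv :: "ereal \<Rightarrow> real \<Rightarrow> (real \<Rightarrow> funct \<Rightarrow> funct) \<Rightarrow> funct \<Rightarrow> funct" where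
  "A_inv sbar \<mu> T z = (THE x. (x, z) \<in> genA sbar \<mu> T)"

subsection \<open>Controls and costs\<close>

definition spU :: "ereal \<Rightarrow> ctrl set" where
  "spU sbar = UNIV \<times> spH sbar"

definition innerU :: "ereal \<Rightarrow> ctrl \<Rightarrow> ctrl \<Rightarrow> real" where
  "innerU sbar u w = fst u * fst w + innerH sbar (snd u) (snd w)"

definition normU :: "ereal \<Rightarrow> ctrl \<Rightarrow> real" where
  "normU sbar u = sqrt (innerU sbar u u)"

definition opB :: "ereal \<Rightarrow> ctrl \<Rightarrow> funct" where
  "opB sbar u = emb sbar (snd u) + fst u *\<^sub>R delta0 sbar"

definition opB_star :: "fn \<Rightarrow> ctrl" where
  "opB_star f = (f 0, f)"

text \<open>The operator \<open>M\<close> with index \<open>1/(2\<beta>)\<close>.\<close>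

definition opM :: "ctrl \<Rightarrow> ctrl \<Rightarrow> ctrl" where
  "opM \<beta> u = (fst u / (2 * fst \<beta>), \<lambda>s. snd u s / (2 * snd \<beta> s))"

definition h0 :: "ereal \<Rightarrow> ctrl \<Rightarrow> ctrl \<Rightarrow> ctrl \<Rightarrow> real" where
  "h0 sbar \<beta> q u =
     (LINT s|ageM sbar. snd u s * (snd \<beta> s * snd u s + snd q s)) + fst u * (fst \<beta> * fst u + fst q)"

definition h0_conj :: "ereal \<Rightarrow> ctrl \<Rightarrow> ctrl \<Rightarrow> ctrl \<Rightarrow> real" where
  "h0_conj sbar \<beta> q w = (SUP u\<in>spU sbar. innerU sbar w u - h0 sbar \<beta> q u)"

definition admissible :: "ereal \<Rightarrow> real \<Rightarrow> (real \<Rightarrow> ctrl) set" where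
  "admissible sbar lam = {u. bochner_measurable (spU sbar) (normU sbar) u \<and>
     set_integrable lborel {0<..} (\<lambda>\<tau>. (normU sbar (exp (- lam * \<tau> / 2) *\<^sub>R u \<tau>))\<^sup>2)}"

text \<open>The \<open>V'\<close>-valued convolution integral is evaluated on each \<open>v \<in> V\<close>.\<close>

definition state ::
  "ereal \<Rightarrow> (real \<Rightarrow> funct \<Rightarrow> funct) \<Rightarrow> funct \<Rightarrow> (real \<Rightarrow> ctrl) \<Rightarrow> real \<Rightarrow> funct" where
  "state sbar T x u \<tau> = (\<lambda>v. T \<tau> x v + (LBINT \<sigma>:{0<..<\<tau>}. T (\<tau> - \<sigma>) (opB sbar (u \<sigma>)) v))"

definition value_fun ::
  "ereal \<Rightarrow> real \<Rightarrow> (real \<Rightarrow> funct \<Rightarrow> funct) \<Rightarrow> ctrl \<Rightarrow> ctrl \<Rightarrow> fn \<Rightarrow> (real \<Rightarrow> real) \<Rightarrow> funct \<Rightarrow> real" where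
  "value_fun sbar lam T \<beta> q \<alpha> R x =
     (INF u\<in>admissible sbar lam.
        LBINT \<tau>:{0<..}. exp (- lam * \<tau>) * (- R (state sbar T x u \<tau> \<alpha>) + h0 sbar \<beta> q (u \<tau>)))"

text \<open>\<open>p\<close> is the \<open>V\<close>-valued derivative of the value function at \<open>x\<close>, and \<open>w\<close> is the gradient of the
  convex conjugate of the control cost at \<open>-B\<^sup>* p\<close>.\<close>

definition equilibrium ::
  "ereal \<Rightarrow> real \<Rightarrow> real \<Rightarrow> (real \<Rightarrow> funct \<Rightarrow> funct) \<Rightarrow> ctrl \<Rightarrow> ctrl \<Rightarrow> fn \<Rightarrow> (real \<Rightarrow> real) \<Rightarrow> funct \<Rightarrow> bool"
  where
  "equilibrium sbar \<mu> lam T \<beta> q \<alpha> R x \<longleftrightarrow>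
     (\<exists>p\<in>spV sbar. \<exists>w\<in>spU sbar. \<exists>y.
        frechet_deriv_on (spVd sbar \<mu>) (normVd sbar \<mu>) (value_fun sbar lam T \<beta> q \<alpha> R) x (\<lambda>k. k p) \<and>
        frechet_deriv_on (spU sbar) (normU sbar) (h0_conj sbar \<beta> q) (- opB_star p) (innerU sbar w) \<and>
        (x, y) \<in> genA sbar \<mu> T \<and> y + opB sbar w = 0)"

end

theory Submission
  imports Defs
begin

text \<open>
  The semigroup generated by \<open>A\<^sub>0\<^sup>*\<close> on \<open>V\<close> is the explicit translation \<open>L(t) v = exp(- \<mu> t) v(\<cdot> + t)\<close>, and
  \<open>e\<^sup>t\<^sup>A x = x \<circ> L(t)\<close>.  With costate \<open>p = - R'(\<langle>\<alpha>, x\<rangle>) (\<lambda> - A\<^sub>0\<^sup>*)\<^sup>-\<^sup>1 \<alpha>\<close> and a stationary point \<open>x\<close> of the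
  corresponding closed loop, convexity of the cost and Fubini show that staying at \<open>x\<close> is optimal and that \<open>p\<close>
  is the derivative of the value function at \<open>x\<close>.  Conversely, if \<open>p\<close> is the derivative of the convex value function
  at an equilibrium point \<open>x\<close>, dynamic programming on \<open>[0, t]\<close> with \<open>t \<rightarrow> 0\<close> shows that the constant control is
  optimal, and comparing the value function with the cost of constant controls identifies \<open>p\<close>.  Hence the
  equilibrium points are the \<open>w2 + \<eta> w1\<close> with \<open>\<eta> = R'(c2 + \<eta> c1)\<close>.  As \<open>c1 > 0\<close> and \<open>R'\<close> is nonincreasing, this scalar
  equation has exactly one solution.
\<close>

section \<open>Square-integrable functions\<close>

text \<open>No Hamilton-Jacobi-Bellman equation is solved: an equilibrium point supplies a
  derivative of the value function at that point only, and all comparisons start there. In the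
  converse, other controls might beat staying put; strong convexity of the control cost, with the
  constant \<epsilon>, excludes it. Over a short time \<open>t\<close> a deviation of size
  \<open>f\<close> gains at most \<open>m * f\<close>, with \<open>m\<close> tending to 0, and costs
  a multiple of \<open>f^2\<close>. The net gain is at most of order \<open>t * m^2\<close>, less
  than the gain of order \<open>t\<close> that a value below the stationary cost would require. Both
  semigroups are given abstractly, the one on H only up to null sets. They are identified with
  translations by adjointness, and the formula reaches all of V' because A maps H onto V'. The
  closed formulas in (ii) and (iii) solve the scalar equation on the branch
  \<open>Q \<ge> 0\<close>. On the branch \<open>Q < 0\<close> the slope is constant, so \<eta> is 1
  or \<gamma> and \<open>Q = c2 + \<eta> * c1\<close>. The conditions \<open>c1 + c2 \<ge> 0\<close>
  and \<open>\<gamma> * c1 + c2 \<ge> 0\<close> therefore say exactly that the solution lies on the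
  first branch.\<close>

definition L2 :: "'a measure \<Rightarrow> ('a \<Rightarrow> real) set" where
  "L2 M = {f \<in> borel_measurable M. integrable M (\<lambda>x. (f x)\<^sup>2)}"

definition l2norm :: "'a measure \<Rightarrow> ('a \<Rightarrow> real) \<Rightarrow> real" where
  "l2norm M f = sqrt (LINT x|M. (f x)\<^sup>2)"

lemma L2_measurable [measurable_dest]: "f \<in> L2 M \<Longrightarrow> f \<in> borel_measurable M"
  by (simp add: L2_def)

lemma L2_integrable_sq: "f \<in> L2 M \<Longrightarrow> integrable M (\<lambda>x. (f x)\<^sup>2)"
  by (simp add: L2_def)

lemma L2_integrable_mult:
  assumes "f \<in> L2 M" "g \<in> L2 M"
  shows "integrable M (\<lambda>x. f x * g x)"
proof (rule Bochner_Integration.integrable_bound)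
  show "integrable M (\<lambda>x. (f x)\<^sup>2 + (g x)\<^sup>2)"
    using assms by (auto simp: L2_def)
  have "\<bar>a * b\<bar> \<le> a\<^sup>2 + b\<^sup>2" for a b :: real
    using sum_squares_bound[of a b] sum_squares_bound[of a "-b"]
      zero_le_power2[of a] zero_le_power2[of b] unfolding abs_le_iff by auto
  then show "AE x in M. norm (f x * g x) \<le> norm ((f x)\<^sup>2 + (g x)\<^sup>2)"
    by auto
  show "(\<lambda>x. f x * g x) \<in> borel_measurable M"
    using assms by measurable
qed

lemma L2_lincomb:
  assumes "f \<in> L2 M" "g \<in> L2 M"
  shows "(\<lambda>x. a * f x + b * g x) \<in> L2 M"
proof -
  have "(\<lambda>x. (a * f x + b * g x)\<^sup>2) =
      (\<lambda>x. a\<^sup>2 * (f x)\<^sup>2 + b\<^sup>2 * (g x)\<^sup>2 + 2 * a * b * (f x * g x))"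
    by (auto simp: power2_eq_square algebra_simps)
  then have "integrable M (\<lambda>x. (a * f x + b * g x)\<^sup>2)"
    using L2_integrable_mult[OF assms] assms by (auto simp: L2_def)
  then show ?thesis using assms by (auto simp: L2_def)
qed

lemma L2_diff: "f \<in> L2 M \<Longrightarrow> g \<in> L2 M \<Longrightarrow> (\<lambda>x. f x - g x) \<in> L2 M"
  using L2_lincomb[of f M g 1 "-1"] by simp

lemma L2_cmult: "f \<in> L2 M \<Longrightarrow> (\<lambda>x. a * f x) \<in> L2 M"
  using L2_lincomb[of f M f a 0] by simp

lemma L2_bound:
  assumes "f \<in> L2 M" "g \<in> borel_measurable M" "AE x in M. \<bar>g x\<bar> \<le> C * \<bar>f x\<bar>"
  shows "g \<in> L2 M"
proof -
  have "integrable M (\<lambda>x. (g x)\<^sup>2)"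
  proof (rule Bochner_Integration.integrable_bound)
    show "integrable M (\<lambda>x. C\<^sup>2 * (f x)\<^sup>2)"
      using assms by (auto simp: L2_def)
    show "AE x in M. norm ((g x)\<^sup>2) \<le> norm (C\<^sup>2 * (f x)\<^sup>2)"
      using assms(3)
    proof eventually_elim
      case (elim x)
      then have "\<bar>g x\<bar>\<^sup>2 \<le> (C * \<bar>f x\<bar>)\<^sup>2" by (intro power_mono) auto
      then show ?case by (simp add: power_mult_distrib)
    qed
  qed (use assms in measurable)
  then show ?thesis using assms by (auto simp: L2_def)
qed

lemma l2norm_nonneg [simp]: "0 \<le> l2norm M f"
  by (simp add: l2norm_def)

lemma l2norm_power2: "(l2norm M f)\<^sup>2 = (LINT x|M. (f x)\<^sup>2)"
  by (simp add: l2norm_def)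

lemma l2norm_lincomb_power2:
  assumes "f \<in> L2 M" "g \<in> L2 M"
  shows "(l2norm M (\<lambda>x. a * f x + b * g x))\<^sup>2 =
    a\<^sup>2 * (l2norm M f)\<^sup>2 + b\<^sup>2 * (l2norm M g)\<^sup>2 + 2 * a * b * (LINT x|M. f x * g x)"
proof -
  have "(\<lambda>x. (a * f x + b * g x)\<^sup>2) =
      (\<lambda>x. a\<^sup>2 * (f x)\<^sup>2 + b\<^sup>2 * (g x)\<^sup>2 + 2 * a * b * (f x * g x))"
    by (auto simp: power2_eq_square algebra_simps)
  then show ?thesis
    using L2_integrable_mult[OF assms] assms by (simp add: l2norm_power2 L2_def)
qed

lemma L2_Cauchy_Schwarz:
  assumes "f \<in> L2 M" "g \<in> L2 M"
  shows "\<bar>LINT x|M. f x * g x\<bar> \<le> l2norm M f * l2norm M g"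
proof -
  define F G P where "F = l2norm M f" and "G = l2norm M g" and "P = (LINT x|M. f x * g x)"
  have quad: "0 \<le> a\<^sup>2 * F\<^sup>2 + b\<^sup>2 * G\<^sup>2 + 2 * a * b * P" for a b
    using l2norm_lincomb_power2[OF assms, of a b] unfolding F_def G_def P_def
    by (metis zero_le_power2)
  have "P\<^sup>2 \<le> F\<^sup>2 * G\<^sup>2"
  proof (cases "G = 0")
    case True
    have "P = 0"
    proof (rule ccontr)
      assume "P \<noteq> 0"
      \<comment> \<open>With \<open>G = 0\<close> the form is affine in its second coefficient; this
        choice makes its value -1.\<close>
      then show False
        using quad[of 1 "- (F\<^sup>2 + 1) / (2 * P)"] True by (auto simp: field_simps)
    qed
    then show ?thesis by simp
  next
    case False
    \<comment> \<open>For the first coefficient \<open>G^2\<close> the form is smallest when the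
      second one is \<open>- P\<close>.\<close>
    have "0 \<le> G\<^sup>2 * (F\<^sup>2 * G\<^sup>2 - P\<^sup>2)"
      using quad[of "G\<^sup>2" "- P"] by (simp add: algebra_simps power2_eq_square)
    then show ?thesis using False by (simp add: zero_le_mult_iff)
  qed
  then have "P\<^sup>2 \<le> (F * G)\<^sup>2" by (simp add: power_mult_distrib)
  then have "\<bar>P\<bar> \<le> F * G"
    by (rule power2_le_imp_le[of "\<bar>P\<bar>", simplified]) (simp_all add: F_def G_def)
  then show ?thesis by (simp add: P_def F_def G_def)
qed

lemma l2norm_triangle:
  assumes "f \<in> L2 M" "g \<in> L2 M"
  shows "l2norm M (\<lambda>x. f x + g x) \<le> l2norm M f + l2norm M g"
proof (rule power2_le_imp_le)
  show "(l2norm M (\<lambda>x. f x + g x))\<^sup>2 \<le> (l2norm M f + l2norm M g)\<^sup>2"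
    using l2norm_lincomb_power2[OF assms, of 1 1] L2_Cauchy_Schwarz[OF assms]
    by (simp add: power2_sum)
qed simp

lemma l2norm_cmult: "l2norm M (\<lambda>x. a * f x) = \<bar>a\<bar> * l2norm M f"
  by (simp add: l2norm_def power_mult_distrib real_sqrt_mult)

lemma l2norm_zero [simp]: "l2norm M (\<lambda>x. 0) = 0"
  by (simp add: l2norm_def)

lemma L2_zero [simp]: "(\<lambda>x. 0) \<in> L2 M"
  by (simp add: L2_def)

lemma l2norm_cong_AE:
  assumes "f \<in> borel_measurable M" "g \<in> borel_measurable M" "AE x in M. f x = g x"
  shows "l2norm M f = l2norm M g"
  unfolding l2norm_def
  by (intro arg_cong[where f = sqrt] integral_cong_AE) (use assms in auto)

lemma l2norm_eq_0_iff:
  assumes "f \<in> L2 M" shows "l2norm M f = 0 \<longleftrightarrow> (AE x in M. f x = 0)"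
  using integral_nonneg_eq_0_iff_AE[of M "\<lambda>x. (f x)\<^sup>2"] assms by (simp add: l2norm_def L2_def)

text \<open>Along a subsequence with \<open>l2norm M (d k) < 1 / 2 ^ k\<close>, where \<open>d k\<close> are the successive differences, the function
  \<open>\<Sum>k. 2 ^ k * (d k x)\<^sup>2\<close> is integrable, which forces pointwise geometric convergence.\<close>

lemma L2_complete:
  fixes f :: "nat \<Rightarrow> 'a \<Rightarrow> real"
  assumes f: "\<And>n. f n \<in> L2 M"
    and cauchy: "\<And>e. 0 < e \<Longrightarrow> \<exists>N. \<forall>m\<ge>N. \<forall>n\<ge>N. l2norm M (\<lambda>x. f m x - f n x) < e"
  obtains h where "h \<in> L2 M" "(\<lambda>n. l2norm M (\<lambda>x. f n x - h x)) \<longlonglongrightarrow> 0"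
proof -
  have [measurable]: "f n \<in> borel_measurable M" for n using f by (simp add: L2_def)
  have "\<exists>N. \<forall>m\<ge>N. \<forall>n\<ge>N. l2norm M (\<lambda>x. f m x - f n x) < (1/2)^k" for k :: nat
    by (rule cauchy) simp
  then obtain N where N: "\<And>k m n. m \<ge> N k \<Longrightarrow> n \<ge> N k \<Longrightarrow>
      l2norm M (\<lambda>x. f m x - f n x) < (1/2)^k"
    by metis
  \<comment> \<open>Partial sums, instead of \<open>N\<close> itself, make the chosen indices
    monotone while keeping them above \<open>N\<close>.\<close>
  define r where "r = (\<lambda>k. \<Sum>i\<le>k. N i)"
  have rN: "r k \<ge> N k" for k unfolding r_def by (simp add: member_le_sum)
  have r_mono: "mono r" unfolding r_def by (intro monoI sum_mono2) auto
  define d where "d = (\<lambda>k x. f (r (Suc k)) x - f (r k) x)"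
  have [measurable]: "d k \<in> borel_measurable M" for k unfolding d_def by measurable
  have d_norm: "(LINT x|M. (d k x)\<^sup>2) \<le> (1/4)^k" for k
  proof -
    have "l2norm M (d k) < (1/2)^k"
      unfolding d_def using rN[of k] r_mono by (intro N) (auto simp: mono_def intro: order_trans)
    then have "(l2norm M (d k))\<^sup>2 \<le> ((1/2)^k)\<^sup>2" by (intro power_mono) auto
    moreover have "((1/2::real)^k)\<^sup>2 = (1/4)^k"
      by (induction k) (simp_all add: power2_eq_square)
    ultimately show ?thesis by (simp only: l2norm_power2)
  qed
  have d_int: "integrable M (\<lambda>x. (d k x)\<^sup>2)" for k
    using L2_diff[OF f f] unfolding d_def by (simp add: L2_def)
  have "(\<integral>\<^sup>+x. (\<Sum>k. ennreal (2^k * (d k x)\<^sup>2)) \<partial>M) = (\<Sum>k. \<integral>\<^sup>+x. ennreal (2^k * (d k x)\<^sup>2) \<partial>M)"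
    by (intro nn_integral_suminf) measurable
  also have "\<dots> = (\<Sum>k. ennreal (2^k * (LINT x|M. (d k x)\<^sup>2)))"
    using d_int by (subst nn_integral_eq_integral) auto
  also have "\<dots> \<le> (\<Sum>k. ennreal ((1/2)^k))"
  proof (intro suminf_le allI)
    fix k
    have "2^k * (LINT x|M. (d k x)\<^sup>2) \<le> 2^k * (1/4)^k"
      by (intro mult_left_mono d_norm) auto
    also have "(2::real)^k * (1/4)^k = (1/2)^k" by (simp flip: power_mult_distrib)
    finally show "ennreal (2^k * (LINT x|M. (d k x)\<^sup>2)) \<le> ennreal ((1/2)^k)"
      by (rule ennreal_leI)
  qed auto
  also have "\<dots> < \<infinity>"
  proof -
    have "(\<Sum>k. ennreal ((1/2)^k)) = ennreal (\<Sum>k. (1/2)^k)"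
      by (intro suminf_ennreal2 summable_geometric) auto
    then show ?thesis by (simp only: infinity_ennreal_def ennreal_less_top)
  qed
  finally have "AE x in M. (\<Sum>k. ennreal (2^k * (d k x)\<^sup>2)) \<noteq> \<infinity>"
    by (intro nn_integral_PInf_AE) (auto simp: top.not_eq_extremum)
  then have conv: "AE x in M. convergent (\<lambda>k. f (r k) x)"
  proof eventually_elim
    case (elim x)
    then have "summable (\<lambda>k. 2^k * (d k x)\<^sup>2)"
      by (intro summable_suminf_not_top) (auto)
    moreover have "summable (\<lambda>k. (1/2::real)^k)" by (simp add: summable_geometric)
    ultimately have "summable (\<lambda>k. 2^k * (d k x)\<^sup>2 + (1/2)^k)" by (rule summable_add)
    then have "summable (\<lambda>k. d k x)"
    proof (rule summable_comparison_test[rotated], intro exI allI impI)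
      fix k
      \<comment> \<open>Expanding the square gives
        \<open>2 * \<bar>d k x\<bar> \<le> 2^k * (d k x)^2 + (1/2)^k\<close>, which turns the
        summable weighted squares into absolute summability.\<close>
      have "0 \<le> ((2::real)^k * \<bar>d k x\<bar> - 1)\<^sup>2 / 2^k" by simp
      also have "\<dots> = 2^k * (d k x)\<^sup>2 + (1/2)^k - 2 * \<bar>d k x\<bar>"
        by (simp add: power2_diff power_mult_distrib power_divide add_divide_distrib diff_divide_distrib)
          (simp add: power2_eq_square)
      finally show "norm (d k x) \<le> 2^k * (d k x)\<^sup>2 + (1/2)^k" by simp
    qed
    then have "convergent (\<lambda>n. \<Sum>k<n. d k x)" by (simp add: summable_iff_convergent)
    moreover have "(\<Sum>k<n. d k x) = f (r n) x - f (r 0) x" for n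
      unfolding d_def by (rule sum_lessThan_telescope)
    ultimately have "convergent (\<lambda>n. (f (r n) x - f (r 0) x) + f (r 0) x)"
      by (intro convergent_add) (auto simp: convergent_const)
    then show ?case by simp
  qed
  define h where "h = (\<lambda>x. lim (\<lambda>k. f (r k) x))"
  have [measurable]: "h \<in> borel_measurable M" unfolding h_def by measurable
  have lim: "AE x in M. (\<lambda>k. f (r k) x) \<longlonglongrightarrow> h x"
    using conv by eventually_elim (simp add: h_def convergent_LIMSEQ_iff)
  \<comment> \<open>Fatou in the index of the subsequence: a bound on the distances to all late
    \<open>f (r k)\<close> survives as a bound on the distance to the a.e. limit. Square
    integrability of that distance is inferred from it only afterwards.\<close>
  have fatou: "(\<integral>\<^sup>+x. ennreal ((f n x - h x)\<^sup>2) \<partial>M) \<le> ennreal (e\<^sup>2)"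
    if e: "0 < e" "\<And>k. k \<ge> K \<Longrightarrow> l2norm M (\<lambda>x. f n x - f (r k) x) \<le> e" for n K e
  proof -
    have "(\<integral>\<^sup>+x. ennreal ((f n x - h x)\<^sup>2) \<partial>M) = (\<integral>\<^sup>+x. liminf (\<lambda>k. ennreal ((f n x - f (r k) x)\<^sup>2)) \<partial>M)"
    proof (intro nn_integral_cong_AE, use lim in eventually_elim)
      case (elim x)
      then have "(\<lambda>k. ennreal ((f n x - f (r k) x)\<^sup>2)) \<longlonglongrightarrow> ennreal ((f n x - h x)\<^sup>2)"
        by (intro tendsto_intros tendsto_ennrealI)
      then show ?case by (intro lim_imp_Liminf[symmetric] trivial_limit_sequentially)
    qed
    also have "\<dots> \<le> liminf (\<lambda>k. \<integral>\<^sup>+x. ennreal ((f n x - f (r k) x)\<^sup>2) \<partial>M)"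
      by (intro nn_integral_liminf) measurable
    also have "\<dots> \<le> limsup (\<lambda>k. \<integral>\<^sup>+x. ennreal ((f n x - f (r k) x)\<^sup>2) \<partial>M)"
      by (rule Liminf_le_Limsup) simp
    also have "\<dots> \<le> ennreal (e\<^sup>2)"
    proof (rule Limsup_bounded, rule eventually_sequentiallyI[of K])
      fix k assume "K \<le> k"
      have "(\<integral>\<^sup>+x. ennreal ((f n x - f (r k) x)\<^sup>2) \<partial>M) = ennreal ((l2norm M (\<lambda>x. f n x - f (r k) x))\<^sup>2)"
        using L2_diff[OF f f, of n "r k"]
        by (subst nn_integral_eq_integral) (auto simp: L2_def l2norm_power2)
      also have "\<dots> \<le> ennreal (e\<^sup>2)"
        using e(2)[OF \<open>K \<le> k\<close>] by (intro ennreal_leI power_mono) auto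
      finally show "(\<integral>\<^sup>+x. ennreal ((f n x - f (r k) x)\<^sup>2) \<partial>M) \<le> ennreal (e\<^sup>2)" .
    qed
    finally show ?thesis .
  qed
  have r_ge: "r k \<ge> N j" if "k \<ge> j" for k j
    using rN[of j] r_mono that by (auto simp: mono_def intro: order_trans)
  have close: "(\<integral>\<^sup>+x. ennreal ((f n x - h x)\<^sup>2) \<partial>M) \<le> ennreal (((1/2)^j)\<^sup>2)" if "n \<ge> N j" for n j
    by (rule fatou[of _ j]) (use that r_ge in \<open>auto intro!: less_imp_le[OF N]\<close>)
  have diffL2: "(\<lambda>x. f n x - h x) \<in> L2 M" if "n \<ge> N j" for n j
  proof -
    have "(\<integral>\<^sup>+x. ennreal ((f n x - h x)\<^sup>2) \<partial>M) < \<infinity>"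
      using close[OF that] by (rule le_less_trans) auto
    then have "integrable M (\<lambda>x. (f n x - h x)\<^sup>2)"
      by (intro integrableI_nonneg) auto
    then show ?thesis by (auto simp: L2_def)
  qed
  have "(\<lambda>x. f (N 0) x - (f (N 0) x - h x)) \<in> L2 M"
    by (intro L2_diff f diffL2) auto
  then have hL2: "h \<in> L2 M" by simp
  have "l2norm M (\<lambda>x. f n x - h x) \<le> (1/2)^j" if "n \<ge> N j" for n j
  proof -
    have "ennreal ((l2norm M (\<lambda>x. f n x - h x))\<^sup>2) \<le> ennreal (((1/2)^j)\<^sup>2)"
      using close[OF that] L2_integrable_sq[OF diffL2[OF that]]
      by (subst (asm) nn_integral_eq_integral) (auto simp: l2norm_power2)
    then have "(l2norm M (\<lambda>x. f n x - h x))\<^sup>2 \<le> ((1/2)^j)\<^sup>2"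
      by (subst (asm) ennreal_le_iff) auto
    then show ?thesis by (rule power2_le_imp_le) auto
  qed
  note bound = this
  have "(\<lambda>n. l2norm M (\<lambda>x. f n x - h x)) \<longlonglongrightarrow> 0"
  proof (rule LIMSEQ_I)
    fix e :: real assume "0 < e"
    then obtain j where "(1/2)^j < e" using real_arch_pow_inv[of e "1/2"] by auto
    then show "\<exists>no. \<forall>n\<ge>no. norm (l2norm M (\<lambda>x. f n x - h x) - 0) < e"
      using bound by (intro exI[of _ "N j"]) (auto intro: le_less_trans)
  qed
  then show ?thesis using hL2 that by blast
qed

text \<open>The representative is the minimiser of \<open>J f = |f|^2 - 2 * F f\<close>. The
  parallelogram identity makes minimising sequences Cauchy, completeness provides a limit, and the
  vanishing first variation there is the representation formula. Working with \<open>J\<close>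
  avoids orthogonal complements and quotients by null functions.\<close>

lemma L2_Riesz:
  fixes F :: "('a \<Rightarrow> real) \<Rightarrow> real"
  assumes lin: "\<And>f g a b. f \<in> L2 M \<Longrightarrow> g \<in> L2 M \<Longrightarrow>
      F (\<lambda>x. a * f x + b * g x) = a * F f + b * F g"
    and bdd: "\<And>f. f \<in> L2 M \<Longrightarrow> \<bar>F f\<bar> \<le> C * l2norm M f"
  obtains h where "h \<in> L2 M" "\<And>f. f \<in> L2 M \<Longrightarrow> F f = (LINT x|M. h x * f x)"
proof -
  define J where "J = (\<lambda>f. (l2norm M f)\<^sup>2 - 2 * F f)"
  have J_lb: "- (C\<^sup>2) \<le> J f" if "f \<in> L2 M" for f
  proof -
    have "0 \<le> (l2norm M f - C)\<^sup>2" by simp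
    also have "\<dots> = (l2norm M f)\<^sup>2 - 2 * (C * l2norm M f) + C\<^sup>2" by (simp add: power2_diff)
    also have "\<dots> \<le> J f + C\<^sup>2" using bdd[OF that] unfolding J_def by auto
    finally show ?thesis by simp
  qed
  define m where "m = (INF f\<in>L2 M. J f)"
  have bb: "bdd_below (J ` L2 M)" using J_lb by (intro bdd_belowI2[of _ "- (C\<^sup>2)"]) auto
  have mJ: "m \<le> J f" if "f \<in> L2 M" for f unfolding m_def by (rule cINF_lower[OF bb that])
  have "\<exists>f\<in>L2 M. J f < m + 1 / real (Suc n)" for n
  proof (rule ccontr)
    assume "\<not> ?thesis"
    then have "m + 1 / real (Suc n) \<le> m" unfolding m_def
      by (intro cINF_greatest) (auto intro: L2_zero simp: not_less m_def)
    then show False by simp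
  qed
  then obtain f where f: "\<And>n. f n \<in> L2 M" "\<And>n. J (f n) < m + 1 / real (Suc n)" by metis
  \<comment> \<open>The midpoint convexity defect of \<open>J\<close> is exactly half the squared
    distance, and near-minimality of both functions makes it small.\<close>
  have par: "(l2norm M (\<lambda>x. f i x - f j x))\<^sup>2 \<le> 2 / real (Suc i) + 2 / real (Suc j)" for i j
  proof -
    have mid: "(\<lambda>x. 1/2 * f i x + 1/2 * f j x) \<in> L2 M" by (intro L2_lincomb f)
    have "J (f i) + J (f j) - 2 * J (\<lambda>x. 1/2 * f i x + 1/2 * f j x) = (l2norm M (\<lambda>x. f i x - f j x))\<^sup>2 / 2"
      using l2norm_lincomb_power2[OF f(1)[of i] f(1)[of j], of "1/2" "1/2"]
        l2norm_lincomb_power2[OF f(1)[of i] f(1)[of j], of 1 "-1"]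
        lin[OF f(1)[of i] f(1)[of j], of "1/2" "1/2"]
      unfolding J_def by (simp add: power2_eq_square)
    then show ?thesis using mJ[OF mid] f(2)[of i] f(2)[of j] by simp
  qed
  obtain h where h: "h \<in> L2 M" "(\<lambda>n. l2norm M (\<lambda>x. f n x - h x)) \<longlonglongrightarrow> 0"
  proof (rule L2_complete[OF f(1)])
    fix e :: real assume e: "0 < e"
    then obtain n where n: "1 / real (Suc n) < e\<^sup>2 / 4"
      using reals_Archimedean[of "e\<^sup>2 / 4"] by (auto simp: inverse_eq_divide)
    have "l2norm M (\<lambda>x. f i x - f j x) < e" if "i \<ge> n" "j \<ge> n" for i j
    proof (rule power2_less_imp_less)
      have "1 / real (Suc i) \<le> 1 / real (Suc n)" "1 / real (Suc j) \<le> 1 / real (Suc n)"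
        using that by (auto simp: field_simps)
      then show "(l2norm M (\<lambda>x. f i x - f j x))\<^sup>2 < e\<^sup>2" using par[of i j] n by simp
    qed (use e in simp)
    then show "\<exists>N. \<forall>i\<ge>N. \<forall>j\<ge>N. l2norm M (\<lambda>x. f i x - f j x) < e" by blast
  qed blast
  have var: "J (\<lambda>x. 1 * f0 x + t * g x) = J f0 + t\<^sup>2 * (l2norm M g)\<^sup>2 + 2 * t * ((LINT x|M. f0 x * g x) - F g)"
    if "f0 \<in> L2 M" "g \<in> L2 M" for f0 g t
    unfolding J_def by (subst l2norm_lincomb_power2[OF that], subst lin[OF that])
      (simp add: algebra_simps)
  have Jh: "J h \<le> m"
  proof (rule LIMSEQ_le)
    show "(\<lambda>n. J h) \<longlonglongrightarrow> J h" by simp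
    show "(\<lambda>n. m + 1 / real (Suc n) + 2 * ((l2norm M h + C) * l2norm M (\<lambda>x. f n x - h x))) \<longlonglongrightarrow> m"
    proof -
      have "(\<lambda>n. m + 1 / real (Suc n) + 2 * ((l2norm M h + C) * l2norm M (\<lambda>x. f n x - h x)))
        \<longlonglongrightarrow> m + 0 + 2 * ((l2norm M h + C) * 0)"
        by (intro tendsto_intros h(2) LIMSEQ_Suc[OF lim_1_over_n])
      then show ?thesis by simp
    qed
    show "\<exists>N. \<forall>n\<ge>N. J h \<le> m + 1 / real (Suc n) + 2 * ((l2norm M h + C) * l2norm M (\<lambda>x. f n x - h x))"
    proof (intro exI allI impI)
      fix n
      let ?d = "\<lambda>x. f n x - h x"
      have d: "?d \<in> L2 M" by (intro L2_diff f h)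
      have 1: "J (f n) = J h + (l2norm M ?d)\<^sup>2 + 2 * ((LINT x|M. h x * ?d x) - F ?d)"
        using var[OF h(1) d, of 1] by simp
      have 2: "\<bar>LINT x|M. h x * ?d x\<bar> \<le> l2norm M h * l2norm M ?d"
        by (rule L2_Cauchy_Schwarz[OF h(1) d])
      have arith: "jh \<le> m' + 2 * ((a + C) * N)"
        if "jf = jh + N\<^sup>2 + 2 * (P - Fd)" "\<bar>P\<bar> \<le> a * N" "\<bar>Fd\<bar> \<le> C * N" "jf < m'"
        for jf jh N P Fd m' a :: real
      proof -
        define X Y where "X = a * N" and "Y = C * N"
        have "0 \<le> N\<^sup>2" "\<bar>P\<bar> \<le> X" "\<bar>Fd\<bar> \<le> Y" using that by (simp_all add: X_def Y_def)
        moreover have "(a + C) * N = X + Y" unfolding X_def Y_def by (rule distrib_right)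
        ultimately show ?thesis using that(1,4) by (smt (verit))
      qed
      show "J h \<le> m + 1 / real (Suc n) + 2 * ((l2norm M h + C) * l2norm M ?d)"
        by (rule arith[OF 1 2 bdd[OF d] f(2)])
    qed
  qed
  have "F g = (LINT x|M. h x * g x)" if g: "g \<in> L2 M" for g
  proof (rule ccontr)
    \<comment> \<open>\<open>D\<close> is half the first variation of \<open>J\<close> at
      \<open>h\<close> in the direction \<open>g\<close>. Moving by \<open>- D / G\<close> lowers
      \<open>J\<close> unless \<open>D = 0\<close>; the added 1 in \<open>G\<close> keeps the step
      defined when \<open>g\<close> is null.\<close>
    define D where "D = (LINT x|M. h x * g x) - F g"
    define G where "G = (l2norm M g)\<^sup>2 + 1"
    assume "F g \<noteq> (LINT x|M. h x * g x)"
    then have D: "D \<noteq> 0" by (simp add: D_def)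
    have G: "G > 0" unfolding G_def using zero_le_power2[of "l2norm M g"] by linarith
    have "(\<lambda>x. 1 * h x + (- D / G) * g x) \<in> L2 M" by (intro L2_lincomb h g)
    from mJ[OF this] have "J h \<le> J h + (- D / G)\<^sup>2 * (l2norm M g)\<^sup>2 + 2 * (- D / G) * D"
      unfolding var[OF h(1) g] D_def[symmetric] using Jh by linarith
    moreover have "(l2norm M g)\<^sup>2 = G - 1" by (simp add: G_def)
    ultimately have "0 \<le> (D/G)\<^sup>2 * (G - 1) - 2 * (D/G) * D" by simp
    moreover have "D = D / G * G" using G by simp
    ultimately have "0 \<le> (D/G)\<^sup>2 * (G - 1) - 2 * (D/G) * (D/G * G)" by simp
    also have "\<dots> = - ((D/G)\<^sup>2 * (G + 1))" by (simp only: power2_eq_square) argo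
    also have "\<dots> < 0" using D G by simp
    finally show False by simp
  qed
  then show ?thesis using h(1) that by blast
qed

section \<open>Calculus of integrals\<close>

lemma exp_kernel:
  fixes \<kappa> :: real assumes "0 < \<kappa>"
  shows exp_kernel_integrable: "integrable lborel (\<lambda>x. if 0 < x then exp (- \<kappa> * x) else 0)"
    and exp_kernel_integral: "(LBINT x. if 0 < x then exp (- \<kappa> * x) else 0) = 1 / \<kappa>"
proof -
  have "(\<integral>\<^sup>+x. ennreal (exp (- \<kappa> * x)) * indicator {0..} x \<partial>lborel) = ennreal (0 - (- exp (- \<kappa> * 0) / \<kappa>))"
  proof (rule nn_integral_FTC_atLeast)
    show "((\<lambda>x. - exp (- \<kappa> * x) / \<kappa>) \<longlongrightarrow> 0) at_top"
    proof -
      have "filterlim (\<lambda>x. \<kappa> * x) at_top at_top"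
        by (rule filterlim_tendsto_pos_mult_at_top[OF tendsto_const assms filterlim_ident])
      then have "((\<lambda>x. exp (- (\<kappa> * x))) \<longlongrightarrow> 0) at_top"
        by (intro filterlim_compose[OF exp_at_bot] filterlim_compose[OF filterlim_uminus_at_bot_at_top])
      then have "((\<lambda>x. - exp (- (\<kappa> * x)) / \<kappa>) \<longlongrightarrow> - 0 / \<kappa>) at_top"
        by (intro tendsto_intros) (use assms in auto)
      then show ?thesis by simp
    qed
    show "((\<lambda>x. - exp (- \<kappa> * x) / \<kappa>) has_real_derivative exp (- \<kappa> * x)) (at x)" for x
      using assms by (auto intro!: derivative_eq_intros)
  qed auto
  also have "(\<integral>\<^sup>+x. ennreal (exp (- \<kappa> * x)) * indicator {0..} x \<partial>lborel) =
      (\<integral>\<^sup>+x. ennreal (if 0 < x then exp (- \<kappa> * x) else 0) \<partial>lborel)"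
    by (intro nn_integral_cong_AE) (use AE_lborel_singleton[of 0] in \<open>auto split: split_indicator\<close>)
  finally have *: "(\<integral>\<^sup>+x. ennreal (if 0 < x then exp (- \<kappa> * x) else 0) \<partial>lborel) = ennreal (1 / \<kappa>)"
    by simp
  show "integrable lborel (\<lambda>x. if 0 < x then exp (- \<kappa> * x) else 0)"
    by (rule integrableI_nonneg) (use * in auto)
  show "(LBINT x. if 0 < x then exp (- \<kappa> * x) else 0) = 1 / \<kappa>"
    by (rule has_bochner_integral_integral_eq, rule has_bochner_integral_nn_integral)
      (use * assms in auto)
qed

text \<open>Tonelli: by translation invariance the inner integral of the absolute value is the norm
  of \<open>k\<close> times \<open>\<bar>F y\<bar>\<close>.\<close>

lemma L1_convolution:
  fixes k F :: "real \<Rightarrow> real"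
  assumes k: "integrable lborel k" and F: "integrable lborel F"
  shows "integrable (lborel \<Otimes>\<^sub>M lborel) (\<lambda>(x, y). k (x - y) * F y)"
proof -
  have [measurable]: "k \<in> borel_measurable borel" "F \<in> borel_measurable borel"
    using assms by (auto dest: borel_measurable_integrable)
  have shift: "integrable lborel (\<lambda>x. k (x - y))" for y
    using lborel_integrable_real_affine[OF k, of 1 "- y"] by (simp add: algebra_simps)
  have "integrable (lborel \<Otimes>\<^sub>M lborel) (\<lambda>(y, x). k (x - y) * F y)"
  proof (rule lborel_pair.Fubini_integrable)
    have "(LBINT x. norm (k (x - y) * F y)) = (LBINT x. \<bar>k x\<bar>) * \<bar>F y\<bar>" for y
    proof -
      have "(LBINT x. norm (k (x - y) * F y)) = (LBINT x. \<bar>k (x - y)\<bar>) * \<bar>F y\<bar>"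
        by (simp add: abs_mult)
      also have "(LBINT x. \<bar>k (x - y)\<bar>) = (LBINT x. \<bar>k x\<bar>)"
        using lborel_integral_real_affine[of 1 "\<lambda>x. \<bar>k x\<bar>" "- y"] by (simp add: algebra_simps)
      finally show ?thesis .
    qed
    then show "integrable lborel (\<lambda>y. LBINT x. norm (case (y, x) of (y, x) \<Rightarrow> k (x - y) * F y))"
      using F by simp
  qed (use shift in \<open>auto simp: split_beta'\<close>)
  from lborel_pair.integrable_product_swap[OF this] show ?thesis
    by (simp add: split_beta')
qed

text \<open>Open intervals are an intersection-stable generator of the Borel sets, so the vanishing
  of integrals spreads to all Borel sets by Dynkin induction. The integral over the whole line, a
  limit of intervals, serves the complement step.\<close>

lemma AE_zero_if_zero_interval_integrals:
  fixes f :: "real \<Rightarrow> real"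
  assumes f: "integrable lborel f"
    and zero: "\<And>s t. s \<le> t \<Longrightarrow> (LBINT x. indicator {s<..<t} x * f x) = 0"
  shows "AE x in lborel. f x = 0"
proof (rule sigma_finite_measure.density_zero[OF lborel.sigma_finite_measure_axioms f])
  have [measurable]: "f \<in> borel_measurable borel" using f by auto
  have ind: "integrable lborel (\<lambda>x. indicator A x * f x)" if "A \<in> sets borel" for A :: "real set"
    using integrable_mult_indicator[OF _ f, of A] that by simp
  have whole: "(LBINT x. f x) = 0"
  proof -
    have "(\<lambda>n. LBINT x. indicator {- real n<..<real n} x * f x) \<longlonglongrightarrow> (LBINT x. f x)"
    proof (rule integral_dominated_convergence[where w = "\<lambda>x. \<bar>f x\<bar>"])
      show "AE x in lborel. (\<lambda>n. indicator {- real n<..<real n} x * f x) \<longlonglongrightarrow> f x"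
      proof (rule AE_I2, rule tendsto_eventually)
        fix x :: real
        obtain N :: nat where "\<bar>x\<bar> < real N" using reals_Archimedean2 by blast
        then show "\<forall>\<^sub>F n in sequentially. indicator {- real n<..<real n} x * f x = f x"
          by (intro eventually_sequentiallyI[of N]) (auto split: split_indicator)
      qed
    qed (use f in \<open>auto split: split_indicator\<close>)
    then show ?thesis by (simp add: zero LIMSEQ_const_iff)
  qed
  fix A :: "real set" assume "A \<in> sets lborel"
  then have A: "A \<in> sigma_sets UNIV (range (\<lambda>(a::real, b). {a<..<b}))"
    unfolding sets_lborel borel_eq_box box_real
    by (subst (asm) sets_measure_of) auto
  have Int_stable_intervals: "Int_stable (range (\<lambda>(a::real, b). {a<..<b}))"
    by (auto simp: Int_stable_def)
  have subset_Pow_UNIV: "range (\<lambda>(a::real, b). {a<..<b}) \<subseteq> Pow UNIV" by simp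
  have "(LBINT x. indicator A x * f x) = 0"
    using Int_stable_intervals subset_Pow_UNIV A
  proof (induction A rule: sigma_sets_induct_disjoint)
    case (basic A)
    then obtain a b where "A = {a<..<b}" by auto
    then show ?case using zero[of a b] by (cases "a \<le> b") auto
  next
    case (compl A)
    then have "A \<in> sets borel" unfolding borel_eq_box box_real by (subst sets_measure_of) auto
    then have "(LBINT x. f x - indicator A x * f x) = 0"
      using ind f whole compl by (subst Bochner_Integration.integral_diff) auto
    moreover have "(\<lambda>x. f x - indicator A x * f x) = (\<lambda>x. indicator (UNIV - A) x * f x)"
      by (auto split: split_indicator)
    ultimately show ?case by simp
  next
    case (union A)
    then have A[measurable]: "A i \<in> sets borel" for i
      unfolding borel_eq_box box_real by (subst sets_measure_of) auto
    have "(LINT x:(\<Union>i. A i)|lborel. f x) = (\<Sum>i. LINT x:A i|lborel. f x)"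
      by (rule lebesgue_integral_countable_add)
        (use union(1) f A ind in \<open>auto simp: disjoint_family_on_def set_integrable_def\<close>)
    then show ?case using union(3) by (simp add: set_lebesgue_integral_def)
  qed simp
  then show "set_lebesgue_integral lborel A f = 0" by (simp add: set_lebesgue_integral_def)
qed

text \<open>Semigroup orbits are differentiated only from the right, so the mean value theorem does
  not apply directly. For each slope \<open>e\<close> the times up to which the increment from 0
  stays below \<open>e * x\<close> form an interval that is closed by continuity, and the right
  derivative lets it grow past any time before \<open>t\<close>.\<close>

lemma right_derivative_zero_const:
  fixes f :: "real \<Rightarrow> real"
  assumes t: "0 \<le> t" and cont: "continuous_on {0..t} f"
    and der: "\<And>r. 0 \<le> r \<Longrightarrow> r < t \<Longrightarrow> ((\<lambda>d. (f (r + d) - f r) / d) \<longlongrightarrow> 0) (at_right 0)"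
  shows "f t = f 0"
proof -
  have lip: "\<bar>f t - f 0\<bar> \<le> e * t" if "0 < e" for e
  proof -
    define A where "A = {r\<in>{0..t}. \<forall>x\<in>{0..r}. \<bar>f x - f 0\<bar> \<le> e * x}"
    have A0: "0 \<in> A" using t by (simp add: A_def)
    have bdd: "bdd_above A" by (auto simp: A_def bdd_above_def)
    define s where "s = Sup A"
    have s0: "0 \<le> s" unfolding s_def by (rule cSup_upper[OF A0 bdd])
    have st: "s \<le> t" unfolding s_def by (rule cSup_least) (use A0 in \<open>auto simp: A_def\<close>)
    have below: "\<bar>f x - f 0\<bar> \<le> e * x" if x: "0 \<le> x" "x < s" for x
    proof -
      obtain r where "r \<in> A" "x < r" using x less_cSup_iff[OF _ bdd, of x] A0 by (auto simp: s_def)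
      then show ?thesis using x by (auto simp: A_def)
    qed
    have at_s: "\<bar>f s - f 0\<bar> \<le> e * s"
    proof (cases "s = 0")
      case False
      then have "0 < s" using s0 by simp
      have "(f \<longlongrightarrow> f s) (at s within {0..t})" using cont s0 st by (auto simp: continuous_on_def)
      then have lim: "(f \<longlongrightarrow> f s) (at s within {0<..<s})"
        by (rule tendsto_within_subset) (use st in auto)
      have "at s within {0<..<s} \<noteq> bot" using \<open>0 < s\<close> by (simp add: at_within_eq_bot_iff)
      moreover have "\<forall>\<^sub>F x in at s within {0<..<s}. \<bar>f x - f 0\<bar> \<le> e * x"
        using below by (auto simp: eventually_at_filter)
      moreover have "((\<lambda>x. e * x) \<longlongrightarrow> e * s) (at s within {0<..<s})"
        "((\<lambda>x. \<bar>f x - f 0\<bar>) \<longlongrightarrow> \<bar>f s - f 0\<bar>) (at s within {0<..<s})"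
        by (intro tendsto_intros lim)+
      ultimately show ?thesis
        using tendsto_le by blast
    qed simp
    have "\<bar>f x - f 0\<bar> \<le> e * x" if "x \<in> {0..s}" for x
      using below[of x] at_s that by (cases "x = s") auto
    then have sA: "s \<in> A" using s0 st by (auto simp: A_def)
    have "s = t"
    proof (rule ccontr)
      assume "s \<noteq> t"
      then have "s < t" using st by simp
      from der[OF s0 this] have "\<forall>\<^sub>F d in at_right 0. \<bar>(f (s + d) - f s) / d\<bar> < e"
        using \<open>0 < e\<close> by (auto simp: tendsto_iff dist_real_def)
      then obtain b where b: "0 < b" "\<And>d. 0 < d \<Longrightarrow> d < b \<Longrightarrow> \<bar>(f (s + d) - f s) / d\<bar> < e"
        unfolding eventually_at_right_field by auto
      define r where "r = s + min (b/2) (t - s)"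
      have "\<bar>f x - f 0\<bar> \<le> e * x" if "0 \<le> x" "x \<le> r" for x
      proof (cases "x \<le> s")
        case True then show ?thesis using below at_s \<open>0 \<le> x\<close> by (cases "x = s") auto
      next
        case False
        then have "0 < x - s" "x - s < b" using that b(1) unfolding r_def by auto
        with b(2)[of "x - s"] have "\<bar>f x - f s\<bar> < e * (x - s)" by (simp add: abs_divide divide_less_eq)
        then show ?thesis using at_s by (simp add: algebra_simps)
      qed
      then have "r \<in> A" using s0 b(1) \<open>s < t\<close> by (auto simp: A_def r_def)
      then have "r \<le> s" unfolding s_def by (rule cSup_upper[OF _ bdd])
      then show False using b(1) \<open>s < t\<close> by (auto simp: r_def)
    qed
    then show ?thesis using at_s by simp
  qed
  have "\<bar>f t - f 0\<bar> \<le> e" if "0 < e" for e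
  proof -
    have "\<bar>f t - f 0\<bar> \<le> e / (t + 1) * t" using that t by (intro lip) simp
    also have "\<dots> \<le> e" using t that by (simp add: field_simps)
    finally show ?thesis .
  qed
  then have "\<bar>f t - f 0\<bar> \<le> 0" by (rule field_le_epsilon[of _ 0, simplified]) 
  then show ?thesis by simp
qed

text \<open>Cauchy-Schwarz for \<open>sqrt k\<close> and \<open>sqrt k * f\<close>. With an
  exponential kernel as the weight \<open>k\<close>, it controls convolutions in L2.\<close>

lemma weighted_Jensen:
  fixes k f :: "'a \<Rightarrow> real"
  assumes k: "integrable M k" "\<And>x. 0 \<le> k x" and f: "f \<in> borel_measurable M"
    and kf: "integrable M (\<lambda>x. k x * (f x)\<^sup>2)"
  shows "integrable M (\<lambda>x. k x * f x)"
    and "(LINT x|M. k x * f x)\<^sup>2 \<le> (LINT x|M. k x) * (LINT x|M. k x * (f x)\<^sup>2)"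
proof -
  have [measurable]: "k \<in> borel_measurable M" "f \<in> borel_measurable M" using k f by auto
  have 1: "(\<lambda>x. sqrt (k x)) \<in> L2 M" "(\<lambda>x. sqrt (k x) * f x) \<in> L2 M"
    using assms by (auto simp: L2_def power_mult_distrib)
  have eq: "sqrt (k x) * (sqrt (k x) * f x) = k x * f x" for x
    using k(2)[of x] by (simp flip: mult.assoc)
  show "integrable M (\<lambda>x. k x * f x)"
    using L2_integrable_mult[OF 1] by (simp only: eq)
  have "\<bar>LINT x|M. k x * f x\<bar>\<^sup>2 \<le> (l2norm M (\<lambda>x. sqrt (k x)) * l2norm M (\<lambda>x. sqrt (k x) * f x))\<^sup>2"
    using L2_Cauchy_Schwarz[OF 1] unfolding eq by (intro power_mono) auto
  then show "(LINT x|M. k x * f x)\<^sup>2 \<le> (LINT x|M. k x) * (LINT x|M. k x * (f x)\<^sup>2)"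
    using k(2) by (simp add: power_mult_distrib l2norm_power2)
qed

text \<open>The product of the two increments is a double integral over a square. Splitting the
  square along its diagonal gives two triangles, one for each term of the product rule. Only the
  integral representations of \<open>F\<close> and \<open>G\<close> enter, no pointwise
  derivatives.\<close>

lemma integral_by_parts_AC:
  fixes f g F G :: "real \<Rightarrow> real"
  assumes "a \<le> b"
    and f: "set_integrable lborel {a<..<b} f" and g: "set_integrable lborel {a<..<b} g"
    and F: "\<And>t. a \<le> t \<Longrightarrow> t \<le> b \<Longrightarrow> F t - F a = (LBINT r:{a<..<t}. f r)"
    and G: "\<And>t. a \<le> t \<Longrightarrow> t \<le> b \<Longrightarrow> G t - G a = (LBINT r:{a<..<t}. g r)"
  shows "F b * G b - F a * G a = (LBINT r:{a<..<b}. f r * G r + F r * g r)"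
proof -
  define f' g' where "f' = (\<lambda>r. indicator {a<..<b} r * f r)" and "g' = (\<lambda>r. indicator {a<..<b} r * g r)"
  have f': "integrable lborel f'" and g': "integrable lborel g'"
    using f g by (simp_all add: f'_def g'_def set_integrable_def)
  have [measurable]: "f' \<in> borel_measurable borel" "g' \<in> borel_measurable borel"
    using f' g' by (auto dest: borel_measurable_integrable)
  have prim: "P t - P a = (LBINT r. indicator {..<t} r * p' r)"
    if "\<And>t. a \<le> t \<Longrightarrow> t \<le> b \<Longrightarrow> P t - P a = (LBINT r:{a<..<t}. p r)"
      "p' = (\<lambda>r. indicator {a<..<b} r * p r)" "t \<in> {a..b}" for P p p' :: "real \<Rightarrow> real" and t
  proof -
    have "(\<lambda>r. indicator {..<t} r * p' r) = (\<lambda>r. indicator {a<..<t} r * p r)"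
      using that(2,3) by (intro ext) (auto split: split_indicator)
    then show ?thesis using that(1)[of t] that(3) by (simp add: set_lebesgue_integral_def)
  qed
  note Ft = prim[of F f f', OF F f'_def] and Gt = prim[of G g g', OF G g'_def]
  have total: "P b - P a = (LBINT r. p' r)"
    if "\<And>t. a \<le> t \<Longrightarrow> t \<le> b \<Longrightarrow> P t - P a = (LBINT r:{a<..<t}. p r)"
      "p' = (\<lambda>r. indicator {a<..<b} r * p r)" for P p p' :: "real \<Rightarrow> real"
    using that(1)[of b] \<open>a \<le> b\<close> that(2) by (simp add: set_lebesgue_integral_def)
  have prod: "integrable (lborel \<Otimes>\<^sub>M lborel) (\<lambda>(x, y). f' x * g' y)"
    by (rule lborel_pair.Fubini_integrable) (use f' g' in \<open>auto simp: abs_mult\<close>)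
  have lo: "integrable (lborel \<Otimes>\<^sub>M lborel) (\<lambda>(x, y). f' x * (indicator {..<x} y * g' y))"
    by (rule Bochner_Integration.integrable_bound[OF prod])
      (auto split: split_indicator simp: indicator_def)
  have hi: "integrable (lborel \<Otimes>\<^sub>M lborel) (\<lambda>(x, y). (indicator {..<y} x * f' x) * g' y)"
    by (rule Bochner_Integration.integrable_bound[OF prod])
      (auto split: split_indicator simp: indicator_def)
  have lo1: "integrable lborel (\<lambda>x. f' x * (LBINT y. indicator {..<x} y * g' y))"
    using lborel_pair.integrable_fst[OF lo] by simp
  have hi1: "integrable lborel (\<lambda>y. (LBINT x. indicator {..<y} x * f' x) * g' y)"
    using lborel_pair.integrable_snd[OF hi] by simp
  have "(F b - F a) * (G b - G a) = (LBINT x. LBINT y. f' x * g' y)"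
    using total[of F f f', OF F f'_def] total[of G g g', OF G g'_def] by simp
  also have "\<dots> = (LINT p|(lborel \<Otimes>\<^sub>M lborel). (case p of (x, y) \<Rightarrow> f' x * g' y))"
    by (rule lborel_pair.integral_fst[OF prod])
  also have "\<dots> = (LINT p|(lborel \<Otimes>\<^sub>M lborel). (case p of (x, y) \<Rightarrow> f' x * (indicator {..<x} y * g' y))
      + (case p of (x, y) \<Rightarrow> (indicator {..<y} x * f' x) * g' y))"
  proof (rule integral_cong_AE)
    \<comment> \<open>The diagonal is a null set, so the two strict triangles cover almost all of
      the square.\<close>
    have "AE p in lborel \<Otimes>\<^sub>M lborel. fst p \<noteq> (snd p :: real)"
    proof (rule lborel_pair.AE_pair_measure)
      show "{p \<in> space (lborel \<Otimes>\<^sub>M lborel). fst p \<noteq> (snd p :: real)} \<in> sets (lborel \<Otimes>\<^sub>M lborel)"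
        by measurable
      show "AE x in lborel. AE y in lborel. fst (x, y) \<noteq> (snd (x, y) :: real)"
      proof (rule AE_I2)
        show "AE y in lborel. fst (x, y) \<noteq> (snd (x, y) :: real)" for x :: real
          using AE_lborel_singleton[of x] by eventually_elim simp
      qed
    qed
    then show "AE p in lborel \<Otimes>\<^sub>M lborel. (case p of (x, y) \<Rightarrow> f' x * g' y) =
        (case p of (x, y) \<Rightarrow> f' x * (indicator {..<x} y * g' y))
        + (case p of (x, y) \<Rightarrow> (indicator {..<y} x * f' x) * g' y)"
      by eventually_elim (auto split: split_indicator)
  qed (use prod lo hi in auto)
  also have "\<dots> = (LBINT x. f' x * (LBINT y. indicator {..<x} y * g' y))
      + (LBINT y. (LBINT x. indicator {..<y} x * f' x) * g' y)"
    using lborel_pair.integral_fst[OF lo] lborel_pair.integral_snd[OF hi]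
    by (subst Bochner_Integration.integral_add[OF lo hi]) simp
  also have "(LBINT x. f' x * (LBINT y. indicator {..<x} y * g' y)) = (LBINT x. f' x * (G x - G a))"
    using Gt by (intro Bochner_Integration.integral_cong refl) (auto simp: f'_def split: split_indicator)
  also have "(LBINT y. (LBINT x. indicator {..<y} x * f' x) * g' y) = (LBINT x. (F x - F a) * g' x)"
    using Ft by (intro Bochner_Integration.integral_cong refl) (auto simp: g'_def split: split_indicator)
  finally have 1: "(F b - F a) * (G b - G a) = (LBINT x. f' x * (G x - G a)) + (LBINT x. (F x - F a) * g' x)" .
  have i1: "integrable lborel (\<lambda>x. f' x * (G x - G a))"
    by (rule Bochner_Integration.integrable_cong[THEN iffD1, OF refl _ lo1])
      (use Gt in \<open>auto simp: f'_def split: split_indicator\<close>)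
  have i2: "integrable lborel (\<lambda>x. (F x - F a) * g' x)"
    by (rule Bochner_Integration.integrable_cong[THEN iffD1, OF refl _ hi1])
      (use Ft in \<open>auto simp: g'_def split: split_indicator\<close>)
  have "(LBINT r:{a<..<b}. f r * G r + F r * g r) =
      (LBINT x. f' x * (G x - G a) + (F x - F a) * g' x + (G a * f' x + F a * g' x))"
    unfolding set_lebesgue_integral_def f'_def g'_def
    by (intro Bochner_Integration.integral_cong refl) (simp add: algebra_simps)
  also have "\<dots> = (F b - F a) * (G b - G a) + (G a * (F b - F a) + F a * (G b - G a))"
    using i1 i2 f' g' 1 total[of F f f', OF F f'_def] total[of G g g', OF G g'_def] by simp
  also have "\<dots> = F b * G b - F a * G a" by (simp add: algebra_simps)
  finally show ?thesis by simp
qed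

text \<open>The integrating factor: it turns linear first-order equations for absolutely continuous
  functions into integral formulas.\<close>

lemma exp_times_AC:
  fixes f F :: "real \<Rightarrow> real"
  assumes "a \<le> b"
    and f: "set_integrable lborel {a<..<b} f"
    and F: "\<And>t. a \<le> t \<Longrightarrow> t \<le> b \<Longrightarrow> F t - F a = (LBINT r:{a<..<t}. f r)"
  shows "exp (c * b) * F b - exp (c * a) * F a = (LBINT r:{a<..<b}. exp (c * r) * (f r + c * F r))"
proof -
  have int: "set_integrable lborel {a..b} (\<lambda>r. c * exp (c * r))"
    by (intro borel_integrable_atLeastAtMost' continuous_intros)
  have FTC: "exp (c * t) - exp (c * a) = (LBINT r:{a<..<t}. c * exp (c * r))" if "a \<le> t" "t \<le> b" for t
  proof -
    have "(LBINT r. (c * exp (c * r)) * indicator {a..t} r) = exp (c * t) - exp (c * a)"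
      by (rule integral_FTC_Icc_real[OF \<open>a \<le> t\<close>]) (auto intro!: derivative_eq_intros continuous_intros)
    moreover have "(LBINT r:{a<..<t}. c * exp (c * r)) = (LBINT r. (c * exp (c * r)) * indicator {a..t} r)"
      unfolding set_lebesgue_integral_def
    proof (intro integral_cong_AE)
      show "AE r in lborel. indicator {a<..<t} r *\<^sub>R (c * exp (c * r)) = c * exp (c * r) * indicator {a..t} r"
        using AE_lborel_singleton[of a] AE_lborel_singleton[of t]
        by eventually_elim (auto simp: indicator_def)
    qed auto
    ultimately show ?thesis by simp
  qed
  have "exp (c * b) * F b - exp (c * a) * F a
      = (LBINT r:{a<..<b}. (c * exp (c * r)) * F r + exp (c * r) * f r)"
    by (rule integral_by_parts_AC[OF \<open>a \<le> b\<close> _ f FTC F])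
      (auto intro: set_integrable_subset[OF int])
  also have "\<dots> = (LBINT r:{a<..<b}. exp (c * r) * (f r + c * F r))"
    by (simp add: algebra_simps)
  finally show ?thesis .
qed

section \<open>The spaces \<open>H\<close> and \<open>V\<close>\<close>

text \<open>Kernel of the inverse of \<open>\<kappa> - d/ds\<close> with decay at the right end.
  Integrated over its other argument it is the kernel of the inverse of
  \<open>\<kappa> + d/dr\<close> with initial value 0, which is why the same kernel serves
  \<open>A\<^sub>0\<close> and its adjoint.\<close>

definition ekern :: "real \<Rightarrow> real \<Rightarrow> real \<Rightarrow> real" where
  "ekern \<kappa> s r = (if s < r then exp (- \<kappa> * (r - s)) else 0)"

lemma ekern_nonneg [simp]: "0 \<le> ekern \<kappa> s r"
  by (simp add: ekern_def)

lemma ekern_measurable [measurable]: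
  assumes [measurable]: "f \<in> borel_measurable M" "g \<in> borel_measurable M"
  shows "(\<lambda>x. ekern \<kappa> (f x) (g x)) \<in> borel_measurable M"
  unfolding ekern_def by measurable

text \<open>The factor \<open>c\<close> matches the form \<open>t + c * r\<close> left by affine
  substitutions in the Lebesgue integral.\<close>

lemma ekern_shift: "ekern \<kappa> (t + c * s) (t + c * r) = ekern \<kappa> (c * s) (c * r)"
  by (simp add: ekern_def right_diff_distrib)

lemma ekern_integrable: "0 < \<kappa> \<Longrightarrow> integrable lborel (ekern \<kappa> s)"
  and ekern_integral: "0 < \<kappa> \<Longrightarrow> (LBINT r. ekern \<kappa> s r) = 1 / \<kappa>"
proof -
  assume \<kappa>: "0 < \<kappa>"
  have "(\<lambda>x. if 0 < x then exp (- \<kappa> * x) else 0) = ekern \<kappa> 0" by (simp add: ekern_def fun_eq_iff)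
  with exp_kernel[OF \<kappa>] have 0: "integrable lborel (ekern \<kappa> 0)" "(LBINT r. ekern \<kappa> 0 r) = 1 / \<kappa>"
    by simp_all
  have eq: "ekern \<kappa> 0 (- s + 1 * r) = ekern \<kappa> s r" for r
    using ekern_shift[of \<kappa> "- s" 1 s r] by simp
  show "integrable lborel (ekern \<kappa> s)"
    using lborel_integrable_real_affine[OF 0(1), of 1 "- s"] unfolding eq by simp
  show "(LBINT r. ekern \<kappa> s r) = 1 / \<kappa>"
    using lborel_integral_real_affine[of 1 "ekern \<kappa> 0" "- s"] 0(2) unfolding eq by simp
qed

lemma ekern_power2: "(ekern \<kappa> s r)\<^sup>2 = ekern (2 * \<kappa>) s r"
  by (simp add: ekern_def power2_eq_square flip: exp_add)

lemma ekern_L2: "0 < \<kappa> \<Longrightarrow> ekern \<kappa> s \<in> L2 lborel"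
  using ekern_integrable[of "2 * \<kappa>" s] by (simp add: L2_def ekern_power2)

lemma ekern_l2norm: "0 < \<kappa> \<Longrightarrow> l2norm lborel (ekern \<kappa> s) = 1 / sqrt (2 * \<kappa>)"
  by (simp add: l2norm_def ekern_power2 ekern_integral real_sqrt_divide)

lemma ekern_back_integrable: "0 < \<kappa> \<Longrightarrow> integrable lborel (\<lambda>z. ekern \<kappa> z t)"
  and ekern_back_integral: "0 < \<kappa> \<Longrightarrow> (LBINT z. ekern \<kappa> z t) = 1 / \<kappa>"
proof -
  assume \<kappa>: "0 < \<kappa>"
  have eq: "ekern \<kappa> 0 (t + - 1 * z) = ekern \<kappa> z t" for z by (simp add: ekern_def)
  show "integrable lborel (\<lambda>z. ekern \<kappa> z t)"
    using lborel_integrable_real_affine[OF ekern_integrable[OF \<kappa>], of "- 1" 0 t] unfolding eq by simp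
  show "(LBINT z. ekern \<kappa> z t) = 1 / \<kappa>"
    using lborel_integral_real_affine[of "- 1" "ekern \<kappa> 0" t] ekern_integral[OF \<kappa>, of 0] unfolding eq by simp
qed

lemma L2_indicator_interval: "(\<lambda>r. indicator {a<..<b::real} r) \<in> L2 lborel"
proof -
  have "(indicator {a<..<b} r)\<^sup>2 = (indicator {a<..<b} r :: real)" for r by (simp add: indicator_def)
  moreover have "integrable lborel (indicat_real {a<..<b})"
    by (rule integrable_real_indicator) (use emeasure_bounded_finite[of "{a<..<b}"] in auto)
  ultimately show ?thesis by (simp add: L2_def)
qed

lemma L2_set_integrable: "h \<in> L2 lborel \<Longrightarrow> set_integrable lborel {a<..<b::real} h"
  using L2_integrable_mult[OF L2_indicator_interval, of h a b] by (simp add: set_integrable_def)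

text \<open>Extension by zero turns integrals over ages into integrals over the line, where
  translation preserves the measure.\<close>

definition zx :: "ereal \<Rightarrow> fn \<Rightarrow> fn" where
  "zx sbar f = (\<lambda>s. indicator (ages sbar) s * f s)"

text \<open>The solution \<open>v\<close> of \<open>\<kappa> v - v' = b\<close> that vanishes at the right endpoint.\<close>

definition bres :: "ereal \<Rightarrow> real \<Rightarrow> fn \<Rightarrow> fn" where
  "bres sbar \<kappa> b = (\<lambda>s. if s < 0 then 0 else LBINT r. ekern \<kappa> s r * zx sbar b r)"

lemma ages_sets [measurable, simp]: "ages sbar \<in> sets borel"
proof (cases sbar)
  case (real r)
  then have "ages sbar = {0<..<r}" by (auto simp: ages_def)
  then show ?thesis by simp
next
  case PInf
  then have "ages sbar = {0<..}" by (auto simp: ages_def)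
  then show ?thesis by simp
next
  case MInf
  then have "ages sbar = {}" by (auto simp: ages_def)
  then show ?thesis by simp
qed

lemma AE_ageM: "(AE s in ageM sbar. P s) \<longleftrightarrow> (AE s in lborel. s \<in> ages sbar \<longrightarrow> P s)"
  unfolding ageM_def by (rule AE_restrict_space_iff) simp

lemma integral_ageM: "(LINT s|ageM sbar. f s) = (LBINT s. zx sbar f s)"
  unfolding ageM_def zx_def by (subst integral_restrict_space) auto

lemma integrable_ageM: "integrable (ageM sbar) f \<longleftrightarrow> integrable lborel (zx sbar f)"
  unfolding ageM_def zx_def by (subst integrable_restrict_space) auto

lemma measurable_ageM: "f \<in> borel_measurable (ageM sbar) \<longleftrightarrow> zx sbar f \<in> borel_measurable borel"
  unfolding ageM_def zx_def by (subst borel_measurable_restrict_space_iff) auto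

lemma space_ageM: "space (ageM sbar) = ages sbar"
  by (auto simp: ageM_def space_restrict_space)

lemma zx_mult: "zx sbar f s * zx sbar g s = zx sbar (\<lambda>s. f s * g s) s"
  by (simp add: zx_def indicator_def)

lemma zx_power2: "(zx sbar f s)\<^sup>2 = zx sbar (\<lambda>s. (f s)\<^sup>2) s"
  by (simp add: zx_def indicator_def)

lemma zx_lincomb: "zx sbar (\<lambda>s. a * f s + b * g s) s = a * zx sbar f s + b * zx sbar g s"
  by (simp add: zx_def algebra_simps)

lemma AE_zx_eq: "(AE s in ageM sbar. f s = g s) \<Longrightarrow> AE s in lborel. zx sbar f s = zx sbar g s"
  unfolding AE_ageM by (erule eventually_mono) (auto simp: zx_def indicator_def)

lemma spH_L2: "spH sbar = L2 (ageM sbar)"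
  by (simp add: spH_def L2_def)

lemma spH_zx: "f \<in> spH sbar \<longleftrightarrow> zx sbar f \<in> L2 lborel"
  by (simp add: spH_L2 L2_def measurable_ageM integrable_ageM zx_power2[abs_def])

lemma innerH_zx: "innerH sbar f g = (LBINT s. zx sbar f s * zx sbar g s)"
  by (simp add: innerH_def integral_ageM zx_mult)

lemma normH_l2norm: "normH sbar = l2norm (ageM sbar)"
  by (simp add: fun_eq_iff normH_def innerH_def l2norm_def power2_eq_square)

lemma normH_zx: "normH sbar f = l2norm lborel (zx sbar f)"
  by (simp add: normH_def innerH_zx l2norm_def power2_eq_square)

lemma innerH_commute: "innerH sbar f g = innerH sbar g f"
  by (simp add: innerH_def mult.commute)

lemma innerH_CS: "f \<in> spH sbar \<Longrightarrow> g \<in> spH sbar \<Longrightarrow> \<bar>innerH sbar f g\<bar> \<le> normH sbar f * normH sbar g"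
  unfolding innerH_def normH_l2norm spH_L2 by (rule L2_Cauchy_Schwarz)

lemma innerH_lincomb:
  assumes "f \<in> spH sbar" "g \<in> spH sbar" "h \<in> spH sbar"
  shows "innerH sbar (\<lambda>s. a * f s + b * g s) h = a * innerH sbar f h + b * innerH sbar g h"
  using L2_integrable_mult[of f "ageM sbar" h] L2_integrable_mult[of g "ageM sbar" h] assms
  by (simp add: innerH_def spH_L2 algebra_simps)

lemma innerH_lincomb':
  assumes "f \<in> spH sbar" "g \<in> spH sbar" "h \<in> spH sbar"
  shows "innerH sbar h (\<lambda>s. a * f s + b * g s) = a * innerH sbar h f + b * innerH sbar h g"
  using innerH_lincomb[OF assms] by (simp add: innerH_commute)

lemma innerH_cong_AE:
  assumes "f \<in> borel_measurable (ageM sbar)" "f' \<in> borel_measurable (ageM sbar)"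
    "g \<in> borel_measurable (ageM sbar)" "g' \<in> borel_measurable (ageM sbar)"
    "AE s in ageM sbar. f s = f' s" "AE s in ageM sbar. g s = g' s"
  shows "innerH sbar f g = innerH sbar f' g'"
  unfolding innerH_def
proof (rule integral_cong_AE)
  show "AE s in ageM sbar. f s * g s = f' s * g' s" using assms(5,6) by eventually_elim simp
qed (use assms in auto)

lemma spH_measurable: "f \<in> spH sbar \<Longrightarrow> f \<in> borel_measurable (ageM sbar)"
  by (simp add: spH_def)

lemma spH_lincomb: "f \<in> spH sbar \<Longrightarrow> g \<in> spH sbar \<Longrightarrow> (\<lambda>s. a * f s + b * g s) \<in> spH sbar"
  unfolding spH_L2 by (rule L2_lincomb)

lemma bres_nonneg_arg: "0 \<le> s \<Longrightarrow> bres sbar \<kappa> b s = (LBINT r. ekern \<kappa> s r * zx sbar b r)"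
  by (simp add: bres_def)

lemma bres_outside: "s < 0 \<or> sbar \<le> ereal s \<Longrightarrow> bres sbar \<kappa> b s = 0"
proof (cases "s < 0")
  case False
  assume "s < 0 \<or> sbar \<le> ereal s"
  with False have s: "sbar \<le> ereal s" by simp
  have "ekern \<kappa> s r * zx sbar b r = 0" for r
    using s by (auto simp: ekern_def zx_def ages_def indicator_def dest: order.strict_trans2)
  then have "(\<lambda>r. ekern \<kappa> s r * zx sbar b r) = (\<lambda>r. 0)" by blast
  then show ?thesis by (simp add: bres_def)
qed (simp add: bres_def)

lemma zx_bres: "AE s in lborel. zx sbar (bres sbar \<kappa> b) s = bres sbar \<kappa> b s"
  using AE_lborel_singleton[of 0]
proof eventually_elim
  case (elim s)
  then show ?case
    using bres_outside[of s sbar \<kappa> b] by (cases "s < 0 \<or> sbar \<le> ereal s") (auto simp: zx_def ages_def indicator_def)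
qed

lemma bres_measurable [measurable]:
  assumes "b \<in> spH sbar" shows "bres sbar \<kappa> b \<in> borel_measurable borel"
proof -
  have [measurable]: "zx sbar b \<in> borel_measurable borel" using assms by (simp add: spH_def measurable_ageM)
  show ?thesis unfolding bres_def by measurable
qed

context
  fixes sbar :: ereal and \<kappa> :: real and b :: fn
  assumes \<kappa>: "0 < \<kappa>" and b: "b \<in> spH sbar"
begin

private lemma zb: "zx sbar b \<in> L2 lborel"
  using b by (simp add: spH_zx)

private lemma zb_meas [measurable]: "zx sbar b \<in> borel_measurable borel"
  using b by (simp add: spH_def measurable_ageM)

lemma ekern_zx_integrable: "integrable lborel (\<lambda>r. ekern \<kappa> s r * zx sbar b r)"
  by (intro L2_integrable_mult ekern_L2 \<kappa> zb)

lemma bres_bound: "\<bar>bres sbar \<kappa> b s\<bar> \<le> normH sbar b / sqrt (2 * \<kappa>)"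
proof (cases "s < 0")
  case False
  then have "\<bar>bres sbar \<kappa> b s\<bar> = \<bar>LBINT r. ekern \<kappa> s r * zx sbar b r\<bar>" by (simp add: bres_def)
  also have "\<dots> \<le> l2norm lborel (ekern \<kappa> s) * l2norm lborel (zx sbar b)"
    by (intro L2_Cauchy_Schwarz ekern_L2 \<kappa> zb)
  finally show ?thesis by (simp add: ekern_l2norm[OF \<kappa>] normH_zx)
qed (use \<kappa> in \<open>simp add: bres_def normH_zx\<close>)

text \<open>Young's inequality for a kernel of mass \<open>1 / \<kappa>\<close>: Jensen at each
  point, then Fubini, the kernel having the same mass in both arguments.\<close>

lemma bres_L2: "bres sbar \<kappa> b \<in> L2 lborel" and bres_l2norm: "l2norm lborel (bres sbar \<kappa> b) \<le> normH sbar b / \<kappa>"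
proof -
  define F where "F = (\<lambda>r. (zx sbar b r)\<^sup>2)"
  have F: "integrable lborel F" unfolding F_def by (rule L2_integrable_sq[OF zb])
  have kern: "ekern \<kappa> (s - r) 0 = ekern \<kappa> s r" for s r by (simp add: ekern_def algebra_simps)
  have conv: "integrable (lborel \<Otimes>\<^sub>M lborel) (\<lambda>(s, r). ekern \<kappa> s r * F r)"
    using L1_convolution[OF ekern_back_integrable[OF \<kappa>, of 0] F] by (simp add: kern)
  have int: "integrable lborel (\<lambda>s. LBINT r. ekern \<kappa> s r * F r)"
    using lborel_pair.integrable_fst[OF conv] .
  have val: "(LBINT s. LBINT r. ekern \<kappa> s r * F r) = (1 / \<kappa>) * (normH sbar b)\<^sup>2"
  proof -
    have "(LBINT s. LBINT r. ekern \<kappa> s r * F r) = (LBINT r. LBINT s. ekern \<kappa> s r * F r)"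
      using lborel_pair.Fubini_integral[OF conv] by simp
    also have "\<dots> = (LBINT r. (1 / \<kappa>) * F r)"
      using ekern_back_integral[OF \<kappa>] by simp
    finally show ?thesis by (simp add: F_def normH_zx l2norm_power2)
  qed
  have pw: "(bres sbar \<kappa> b s)\<^sup>2 \<le> (1 / \<kappa>) * (LBINT r. ekern \<kappa> s r * F r)"
    if "integrable lborel (\<lambda>r. ekern \<kappa> s r * F r)" for s
  proof (cases "s < 0")
    case True then show ?thesis using \<kappa> by (simp add: bres_def F_def)
  next
    case False
    then show ?thesis
      using weighted_Jensen(2)[OF ekern_integrable[OF \<kappa>, of s], of "zx sbar b"] that
      by (simp add: bres_def F_def ekern_integral[OF \<kappa>])
  qed
  have AE: "AE s in lborel. (bres sbar \<kappa> b s)\<^sup>2 \<le> (1 / \<kappa>) * (LBINT r. ekern \<kappa> s r * F r)"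
    using lborel_pair.AE_integrable_fst[OF conv] by eventually_elim (rule pw)
  have sq: "integrable lborel (\<lambda>s. (bres sbar \<kappa> b s)\<^sup>2)"
  proof (rule Bochner_Integration.integrable_bound)
    show "integrable lborel (\<lambda>s. (1 / \<kappa>) * (LBINT r. ekern \<kappa> s r * F r))" using int by simp
    show "AE s in lborel. norm ((bres sbar \<kappa> b s)\<^sup>2) \<le> norm ((1 / \<kappa>) * (LBINT r. ekern \<kappa> s r * F r))"
      using AE by eventually_elim (use abs_ge_self order_trans in \<open>auto simp del: abs_divide\<close>)
  qed (use b in simp)
  then show "bres sbar \<kappa> b \<in> L2 lborel" using b by (simp add: L2_def)
  have "(l2norm lborel (bres sbar \<kappa> b))\<^sup>2 \<le> (LBINT s. (1 / \<kappa>) * (LBINT r. ekern \<kappa> s r * F r))"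
    unfolding l2norm_power2 by (rule integral_mono_AE) (use sq int AE in auto)
  also have "\<dots> = (normH sbar b / \<kappa>)\<^sup>2"
    using val by (simp add: power2_eq_square)
  finally show "l2norm lborel (bres sbar \<kappa> b) \<le> normH sbar b / \<kappa>"
    by (rule power2_le_imp_le) (use \<kappa> in \<open>simp add: normH_l2norm\<close>)
qed

lemma bres_spH: "bres sbar \<kappa> b \<in> spH sbar"
  unfolding spH_zx by (rule L2_bound[OF bres_L2, of _ 1]) (use b in \<open>auto simp: zx_def indicator_def\<close>)

lemma bres_normH: "normH sbar (bres sbar \<kappa> b) \<le> normH sbar b / \<kappa>"
proof -
  have "normH sbar (bres sbar \<kappa> b) = l2norm lborel (bres sbar \<kappa> b)"
    unfolding normH_zx by (rule l2norm_cong_AE[OF _ _ zx_bres]) (use b in \<open>auto simp: zx_def\<close>)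
  then show ?thesis using bres_l2norm by simp
qed

lemma bres_diff:
  assumes "0 \<le> s" "s \<le> t"
  shows "bres sbar \<kappa> b t - bres sbar \<kappa> b s = (LBINT r:{s<..<t}. \<kappa> * bres sbar \<kappa> b r - zx sbar b r)"
proof -
  \<comment> \<open>Taking \<open>exp (\<kappa> * s)\<close> out of the kernel leaves a tail
    integral with explicit increments; the integrating factor then yields the differential
    equation.\<close>
  define W where "W = (\<lambda>t. LBINT r. indicator {t<..} r * (exp (- \<kappa> * r) * zx sbar b r))"
  have expint: "integrable lborel (\<lambda>r. exp (- \<kappa> * r) * zx sbar b r)"
  proof -
    \<comment> \<open>The growth of the exponential on the negative axis is harmless, since
      \<open>zx sbar b\<close> lives on positive ages.\<close>
    have "(\<lambda>r. exp (- \<kappa> * r) * zx sbar b r) = (\<lambda>r. ekern \<kappa> 0 r * zx sbar b r)"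
      by (auto simp: ekern_def zx_def ages_def indicator_def)
    then show ?thesis using ekern_zx_integrable by simp
  qed
  have ind: "integrable lborel (\<lambda>r. indicator {t<..} r * (exp (- \<kappa> * r) * zx sbar b r))" for t :: real
    using integrable_mult_indicator[OF _ expint, of "{t<..}"] by simp
  have bW: "bres sbar \<kappa> b r = exp (\<kappa> * r) * W r" if "0 \<le> r" for r
  proof -
    have "exp (\<kappa> * r) * W r = (LBINT r'. exp (\<kappa> * r) * (indicator {r<..} r' * (exp (- \<kappa> * r') * zx sbar b r')))"
      unfolding W_def by simp
    also have "\<dots> = bres sbar \<kappa> b r"
      unfolding bres_nonneg_arg[OF that]
      by (intro Bochner_Integration.integral_cong refl)
        (auto simp: ekern_def indicator_def algebra_simps simp flip: exp_add)
    finally show ?thesis by simp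
  qed
  have "exp (\<kappa> * t) * W t - exp (\<kappa> * s) * W s
      = (LBINT r:{s<..<t}. exp (\<kappa> * r) * (- (exp (- \<kappa> * r) * zx sbar b r) + \<kappa> * W r))"
  proof (rule exp_times_AC[OF assms(2)])
    show "set_integrable lborel {s<..<t} (\<lambda>r. - (exp (- \<kappa> * r) * zx sbar b r))"
      unfolding set_integrable_def using integrable_mult_indicator[OF _ expint, of "{s<..<t}"] by simp
    show "W t' - W s = (LBINT r:{s<..<t'}. - (exp (- \<kappa> * r) * zx sbar b r))" if "s \<le> t'" for t'
    proof -
      have "W t' - W s = (LBINT r. indicator {t'<..} r * (exp (- \<kappa> * r) * zx sbar b r)
          - indicator {s<..} r * (exp (- \<kappa> * r) * zx sbar b r))"
        unfolding W_def using ind by simp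
      also have "\<dots> = (LBINT r:{s<..<t'}. - (exp (- \<kappa> * r) * zx sbar b r))"
        unfolding set_lebesgue_integral_def
      proof (rule integral_cong_AE)
        show "AE r in lborel. indicator {t'<..} r * (exp (- \<kappa> * r) * zx sbar b r)
            - indicator {s<..} r * (exp (- \<kappa> * r) * zx sbar b r)
            = indicator {s<..<t'} r *\<^sub>R - (exp (- \<kappa> * r) * zx sbar b r)"
          using AE_lborel_singleton[of t'] by eventually_elim (use that in \<open>auto simp: indicator_def\<close>)
      qed auto
      finally show ?thesis .
    qed
  qed
  also have "\<dots> = (LBINT r:{s<..<t}. \<kappa> * bres sbar \<kappa> b r - zx sbar b r)"
    unfolding set_lebesgue_integral_def
    by (intro Bochner_Integration.integral_cong refl)
      (use assms in \<open>auto simp: indicator_def bW algebra_simps simp flip: exp_add\<close>)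
  finally show ?thesis using assms by (simp add: bW)
qed

text \<open>Only the part of \<open>b\<close> beyond \<open>s\<close> is seen by the kernel, and the
  L2 norm of that tail tends to 0.\<close>

lemma bres_tendsto: "(bres sbar \<kappa> b \<longlongrightarrow> 0) at_top"
proof -
  define G where "G = (\<lambda>s. l2norm lborel (\<lambda>r. indicator {s<..} r * zx sbar b r) / sqrt (2 * \<kappa>))"
  have "((\<lambda>s. LBINT r. (indicator {s<..} r * zx sbar b r)\<^sup>2) \<longlongrightarrow> (LBINT r::real. (0::real))) at_top"
  proof (rule integral_dominated_convergence_at_top[where w = "\<lambda>r. (zx sbar b r)\<^sup>2"])
    show "AE r in lborel. ((\<lambda>s. (indicator {s<..} r * zx sbar b r)\<^sup>2) \<longlongrightarrow> 0) at_top"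
    proof (rule AE_I2, rule tendsto_eventually)
      fix r :: real
      show "\<forall>\<^sub>F s in at_top. (indicator {s<..} r * zx sbar b r)\<^sup>2 = 0"
        using eventually_ge_at_top[of r] by eventually_elim (auto simp: indicator_def)
    qed
  qed (use L2_integrable_sq[OF zb] in \<open>auto simp: indicator_def\<close>)
  then have "((\<lambda>s. sqrt (LBINT r. (indicator {s<..} r * zx sbar b r)\<^sup>2) / sqrt (2 * \<kappa>)) \<longlongrightarrow> sqrt (LBINT r::real. (0::real)) / sqrt (2 * \<kappa>)) at_top"
    by (intro tendsto_intros) (use \<kappa> in auto)
  then have G: "(G \<longlongrightarrow> 0) at_top" by (simp add: G_def[abs_def] l2norm_def)
  show ?thesis
  proof (rule Lim_null_comparison[OF _ G])
    show "\<forall>\<^sub>F s in at_top. norm (bres sbar \<kappa> b s) \<le> G s"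
      using eventually_ge_at_top[of 0]
    proof eventually_elim
      case (elim s)
      have "bres sbar \<kappa> b s = (LBINT r. ekern \<kappa> s r * (indicator {s<..} r * zx sbar b r))"
        unfolding bres_nonneg_arg[OF elim]
        by (intro Bochner_Integration.integral_cong refl) (auto simp: ekern_def)
      also have "\<bar>\<dots>\<bar> \<le> l2norm lborel (ekern \<kappa> s) * l2norm lborel (\<lambda>r. indicator {s<..} r * zx sbar b r)"
        by (intro L2_Cauchy_Schwarz ekern_L2 \<kappa> L2_bound[OF zb, of _ 1]) (auto simp: indicator_def)
      finally show ?case by (simp add: G_def ekern_l2norm[OF \<kappa>])
    qed
  qed
qed

lemma bres_H1: "H1_deriv sbar (bres sbar \<kappa> b) (\<lambda>r. \<kappa> * bres sbar \<kappa> b r - b r)"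
  unfolding H1_deriv_def
proof (intro conjI allI impI)
  show "bres sbar \<kappa> b \<in> spH sbar" by (rule bres_spH)
  show "(\<lambda>r. \<kappa> * bres sbar \<kappa> b r - b r) \<in> spH sbar"
    using spH_lincomb[OF bres_spH b, of \<kappa> "-1"] by simp
  fix s t :: real assume st: "0 \<le> s" "s \<le> t" "ereal t \<le> sbar"
  have "r \<in> ages sbar" if "s < r" "r < t" for r
    using st that by (auto simp: ages_def intro: order.strict_trans2[of "ereal r" "ereal t"])
  then have "(LBINT r:{s<..<t}. \<kappa> * bres sbar \<kappa> b r - b r) = (LBINT r:{s<..<t}. \<kappa> * bres sbar \<kappa> b r - zx sbar b r)"
    by (intro set_lebesgue_integral_cong) (auto simp: zx_def)
  then show "bres sbar \<kappa> b t - bres sbar \<kappa> b s = (LBINT r:{s<..<t}. \<kappa> * bres sbar \<kappa> b r - b r)"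
    using bres_diff[OF st(1,2)] by simp
qed

lemma bres_spV: "bres sbar \<kappa> b \<in> spV sbar"
  unfolding spV_def
proof (intro CollectI conjI allI impI)
  show "\<exists>g. H1_deriv sbar (bres sbar \<kappa> b) g" using bres_H1 by blast
  show "if sbar = \<infinity> then (bres sbar \<kappa> b \<longlongrightarrow> 0) at_top else bres sbar \<kappa> b (real_of_ereal sbar) = 0"
  proof (cases sbar)
    case (real r) then show ?thesis using bres_outside[of r sbar \<kappa> b] by simp
  next
    case MInf then show ?thesis using bres_outside[of 0 sbar \<kappa> b] by simp
  qed (use bres_tendsto in simp)
  show "bres sbar \<kappa> b s = 0" if "s < 0 \<or> sbar < ereal s" for s
    using that by (intro bres_outside) auto
qed

end

lemma zx_set_integrable: "g \<in> spH sbar \<Longrightarrow> set_integrable lborel {s<..<t} (zx sbar g)"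
  by (intro L2_set_integrable) (simp add: spH_zx)

lemma Ioo_subset_ages: "0 \<le> s \<Longrightarrow> ereal t \<le> sbar \<Longrightarrow> {s<..<t} \<subseteq> ages sbar"
  by (auto simp: ages_def intro: order.strict_trans2[of _ "ereal t"])

lemma Ioo_integral_zx:
  assumes "0 \<le> s" "ereal t \<le> sbar"
  shows "(LBINT r:{s<..<t}. g r) = (LBINT r:{s<..<t}. zx sbar g r)"
  using Ioo_subset_ages[OF assms] by (intro set_lebesgue_integral_cong) (auto simp: zx_def indicator_def)

lemma H1_deriv_lincomb:
  assumes "H1_deriv sbar f g" "H1_deriv sbar f' g'"
  shows "H1_deriv sbar (\<lambda>s. a * f s + b * f' s) (\<lambda>s. a * g s + b * g' s)"
  unfolding H1_deriv_def
proof (intro conjI allI impI)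
  fix s t :: real assume st: "0 \<le> s" "s \<le> t" "ereal t \<le> sbar"
  have *: "(LBINT r:{s<..<t}. a * g r + b * g' r) =
      (LBINT r:{s<..<t}. a * zx sbar g r + b * zx sbar g' r)"
    using Ioo_subset_ages[OF st(1,3)] by (intro set_lebesgue_integral_cong) (auto simp: zx_def)
  have "(LBINT r:{s<..<t}. a * g r + b * g' r) = a * (LBINT r:{s<..<t}. g r) + b * (LBINT r:{s<..<t}. g' r)"
    using assms zx_set_integrable[of g] zx_set_integrable[of g']
    unfolding * Ioo_integral_zx[OF st(1,3), of g] Ioo_integral_zx[OF st(1,3), of g'] H1_deriv_def
    by (subst set_integral_add(2)) auto
  then show "a * f t + b * f' t - (a * f s + b * f' s) = (LBINT r:{s<..<t}. a * g r + b * g' r)"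
    using assms st unfolding H1_deriv_def by (simp add: algebra_simps flip: right_diff_distrib)
qed (use assms in \<open>auto simp: H1_deriv_def intro!: spH_lincomb\<close>)

section \<open>Elements of V as functions on the half-line\<close>

lemma spV_spH: "v \<in> spV sbar \<Longrightarrow> v \<in> spH sbar"
  by (auto simp: spV_def H1_deriv_def)

lemma spV_outside: "v \<in> spV sbar \<Longrightarrow> s < 0 \<or> sbar \<le> ereal s \<Longrightarrow> v s = 0"
  by (cases "sbar = ereal s") (auto simp: spV_def le_less)

lemma spV_zx: "v \<in> spV sbar \<Longrightarrow> 0 < s \<Longrightarrow> zx sbar v s = v s"
  using spV_outside[of v sbar s] by (auto simp: zx_def ages_def indicator_def not_less)

lemma spV_tendsto: 
  assumes "v \<in> spV sbar" shows "(v \<longlongrightarrow> 0) at_top"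
proof (cases sbar)
  case PInf then show ?thesis using assms by (simp add: spV_def)
next
  case (real r)
  have "\<forall>\<^sub>F s in at_top. v s = 0"
    using eventually_ge_at_top[of r] by eventually_elim (use assms real spV_outside in auto)
  then show ?thesis by (rule tendsto_eventually)
next
  case MInf
  have "v s = 0" for s using assms MInf spV_outside[of v sbar s] by auto
  then have "v = (\<lambda>s. 0)" by blast
  then show ?thesis by simp
qed

text \<open>The bound \<open>t \<le> sbar\<close> of \<open>H1_deriv\<close> disappears because
  \<open>v\<close> and \<open>zx sbar g\<close> both vanish beyond \<open>sbar\<close>.\<close>

lemma spV_diff:
  assumes v: "v \<in> spV sbar" and g: "H1_deriv sbar v g" and st: "0 \<le> s" "s \<le> t"
  shows "v t - v s = (LBINT r:{s<..<t}. zx sbar g r)"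
proof (cases "ereal t \<le> sbar")
  case True
  then show ?thesis using g st Ioo_integral_zx[OF st(1) True, of g] by (simp add: H1_deriv_def)
next
  case False
  then have vt: "v t = 0" using spV_outside[OF v, of t] by (simp add: not_le less_imp_le)
  show ?thesis
  proof (cases "ereal s \<le> sbar")
    case True
    then obtain R where R: "sbar = ereal R" "s \<le> R" "R < t" using False by (cases sbar) auto
    have "v R - v s = (LBINT r:{s<..<R}. zx sbar g r)"
      using g st R Ioo_integral_zx[OF st(1), of R sbar g] by (simp add: H1_deriv_def)
    also have "\<dots> = (LBINT r:{s<..<t}. zx sbar g r)"
      unfolding set_lebesgue_integral_def
      by (intro Bochner_Integration.integral_cong refl) (use R in \<open>auto simp: zx_def ages_def indicator_def\<close>)
    finally show ?thesis using vt spV_outside[OF v, of R] R by simp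
  next
    case False
    then have "v s = 0" using spV_outside[OF v, of s] by (simp add: not_le less_imp_le)
    moreover have "zx sbar g r = 0" if "s < r" for r
    proof -
      have "r \<notin> ages sbar" using False that by (cases sbar) (auto simp: ages_def)
      then show ?thesis by (simp add: zx_def)
    qed
    then have "(LBINT r:{s<..<t}. zx sbar g r) = (LBINT r:{s<..<t}. 0)"
      by (intro set_lebesgue_integral_cong) auto
    ultimately show ?thesis using vt by simp
  qed
qed

text \<open>Uniqueness for the Cauchy problem \<open>v' = \<kappa> v - c\<close> with vanishing terminal value.\<close>

lemma spV_eq_bres:
  assumes \<kappa>: "0 < \<kappa>" and v: "v \<in> spV sbar" and g: "H1_deriv sbar v g"
  shows "v = bres sbar \<kappa> (\<lambda>s. \<kappa> * v s - g s)"
proof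
  fix s
  define c where "c = (\<lambda>s. \<kappa> * v s - g s)"
  have gH: "g \<in> spH sbar" and vH: "v \<in> spH sbar" using g by (auto simp: H1_deriv_def)
  have c: "c \<in> spH sbar" using spH_lincomb[OF vH gH, of \<kappa> "-1"] by (simp add: c_def)
  have [measurable]: "zx sbar c \<in> borel_measurable borel" using c by (simp add: spH_def measurable_ageM)
  show "v s = bres sbar \<kappa> c s"
  proof (cases "s < 0")
    case True then show ?thesis using spV_outside[OF v] by (simp add: bres_def)
  next
    case False
    then have s: "0 \<le> s" by simp
    have int: "integrable lborel (\<lambda>r. ekern \<kappa> s r * zx sbar c r)"
      by (rule ekern_zx_integrable[OF \<kappa> c])
    \<comment> \<open>Variation of constants on \<open>[s, t]\<close>. As \<open>t\<close> grows the
      boundary term dies and the integral becomes the one in \<open>bres\<close>.\<close>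
    have eq: "v s = exp (- \<kappa> * (t - s)) * v t + (LBINT r. indicator {..<t} r * (ekern \<kappa> s r * zx sbar c r))"
      if "s \<le> t" for t
    proof -
      have "exp (- \<kappa> * t) * v t - exp (- \<kappa> * s) * v s
          = (LBINT r:{s<..<t}. exp (- \<kappa> * r) * (zx sbar g r + - \<kappa> * v r))"
        by (rule exp_times_AC[OF that zx_set_integrable[OF gH]]) (rule spV_diff[OF v g s])
      also have "exp (\<kappa> * s) * \<dots> = - (LBINT r. indicator {..<t} r * (ekern \<kappa> s r * zx sbar c r))"
        unfolding set_lebesgue_integral_def integral_mult_right_zero[symmetric] integral_minus[symmetric]
      proof (intro Bochner_Integration.integral_cong refl)
        fix r
        have "zx sbar g r + - \<kappa> * v r = - zx sbar c r" if "s < r"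
          using spV_zx[OF v, of r] that s by (simp add: c_def zx_def algebra_simps indicator_def split: if_splits)
        moreover have "exp (\<kappa> * s) * (exp (- \<kappa> * r) * y) = exp (- \<kappa> * (r - s)) * y" for y
          by (simp add: algebra_simps flip: mult.assoc exp_add)
        ultimately show "exp (\<kappa> * s) * (indicator {s<..<t} r *\<^sub>R (exp (- \<kappa> * r) * (zx sbar g r + - \<kappa> * v r)))
            = - (indicator {..<t} r * (ekern \<kappa> s r * zx sbar c r))"
          by (cases "s < r \<and> r < t") (auto simp: ekern_def)
      qed
      finally have "exp (\<kappa> * s) * (exp (- \<kappa> * t) * v t) - exp (\<kappa> * s) * (exp (- \<kappa> * s) * v s)
          = - (LBINT r. indicator {..<t} r * (ekern \<kappa> s r * zx sbar c r))"
        by (simp add: right_diff_distrib)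
      moreover have "exp (\<kappa> * s) * (exp (- \<kappa> * s) * v s) = v s" by (simp flip: mult.assoc exp_add)
      moreover have "exp (\<kappa> * s) * (exp (- \<kappa> * t) * v t) = exp (- \<kappa> * (t - s)) * v t"
        by (simp add: algebra_simps flip: mult.assoc exp_add)
      ultimately show ?thesis by linarith
    qed
    have lim1: "((\<lambda>t. LBINT r. indicator {..<t} r * (ekern \<kappa> s r * zx sbar c r)) \<longlongrightarrow>
        (LBINT r. ekern \<kappa> s r * zx sbar c r)) at_top"
    proof (rule integral_dominated_convergence_at_top[where w = "\<lambda>r. \<bar>ekern \<kappa> s r * zx sbar c r\<bar>"])
      show "AE r in lborel. ((\<lambda>t. indicator {..<t} r * (ekern \<kappa> s r * zx sbar c r)) \<longlongrightarrow> ekern \<kappa> s r * zx sbar c r) at_top"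
      proof (rule AE_I2, rule tendsto_eventually)
        fix r :: real
        show "\<forall>\<^sub>F t in at_top. indicator {..<t} r * (ekern \<kappa> s r * zx sbar c r) = ekern \<kappa> s r * zx sbar c r"
          using eventually_gt_at_top[of r] by eventually_elim (auto simp: indicator_def)
      qed
    qed (use int in \<open>auto simp: indicator_def\<close>)
    have lim2: "((\<lambda>t. exp (- \<kappa> * (t - s)) * v t) \<longlongrightarrow> 0) at_top"
    proof (rule Lim_null_comparison)
      show "\<forall>\<^sub>F t in at_top. norm (exp (- \<kappa> * (t - s)) * v t) \<le> \<bar>v t\<bar>"
        using eventually_ge_at_top[of s]
        by eventually_elim (use \<kappa> in \<open>auto simp: abs_mult intro!: mult_left_le_one_le\<close>)
      show "((\<lambda>t. \<bar>v t\<bar>) \<longlongrightarrow> 0) at_top"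
        using tendsto_rabs[OF spV_tendsto[OF v]] by simp
    qed
    have "((\<lambda>t::real. v s) \<longlongrightarrow> 0 + (LBINT r. ekern \<kappa> s r * zx sbar c r)) at_top"
      by (rule Lim_transform_eventually[OF tendsto_add[OF lim2 lim1]])
        (use eventually_ge_at_top[of s] in \<open>eventually_elim, use eq in auto\<close>)
    then show ?thesis using s by (simp add: bres_def tendsto_const_iff)
  qed
qed

lemma weak_deriv_H1: "v \<in> spV sbar \<Longrightarrow> H1_deriv sbar v (weak_deriv sbar v)"
proof -
  assume "v \<in> spV sbar"
  then obtain g where "H1_deriv sbar v g" by (auto simp: spV_def)
  then show ?thesis unfolding weak_deriv_def by (rule someI[of "H1_deriv sbar v"])
qed

text \<open>\<open>weak_deriv\<close> is a choice among representatives, so every computation with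
  it passes through this comparison. The difference of two derivatives has zero integral over each
  interval.\<close>

lemma H1_deriv_unique:
  assumes v: "v \<in> spV sbar" and g: "H1_deriv sbar v g" "H1_deriv sbar v g'"
  shows "AE s in ageM sbar. g s = g' s"
proof -
  define d where "d = (\<lambda>r. zx sbar g r - zx sbar g' r)"
  have gH: "g \<in> spH sbar" "g' \<in> spH sbar" using g by (auto simp: H1_deriv_def)
  have zero: "(LBINT r:{s<..<t}. d r) = 0" if "0 \<le> s" "s \<le> t" for s t
    using spV_diff[OF v g(1) that] spV_diff[OF v g(2) that] gH
    unfolding d_def by (subst set_integral_diff(2)) (auto intro: zx_set_integrable)
  \<comment> \<open>The difference is square integrable but perhaps not integrable on the half-line,
    so it is cut off at each \<open>n\<close>.\<close>
  have "AE r in lborel. indicator {0<..<real n} r * d r = 0" for n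
  proof (rule AE_zero_if_zero_interval_integrals)
    show "integrable lborel (\<lambda>r. indicator {0<..<real n} r * d r)"
      using set_integral_diff(1)[OF zx_set_integrable[OF gH(1)] zx_set_integrable[OF gH(2)], of 0 "real n"]
      by (simp add: set_integrable_def d_def)
    fix s t :: real assume "s \<le> t"
    have "(LBINT x. indicator {s<..<t} x * (indicator {0<..<real n} x * d x))
        = (LBINT r:{max s 0<..<min t (real n)}. d r)"
      unfolding set_lebesgue_integral_def
      by (intro Bochner_Integration.integral_cong refl) (auto simp: indicator_def)
    also have "\<dots> = 0"
      using zero[of "max s 0" "min t (real n)"] by (cases "max s 0 \<le> min t (real n)") (auto simp: set_lebesgue_integral_def)
    finally show "(LBINT x. indicator {s<..<t} x * (indicator {0<..<real n} x * d x)) = 0" .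
  qed
  then have "AE r in lborel. \<forall>n. indicator {0<..<real n} r * d r = 0" unfolding AE_all_countable by blast
  then have "AE r in lborel. r \<in> ages sbar \<longrightarrow> g r = g' r"
  proof eventually_elim
    case (elim r)
    show ?case
    proof
      assume r: "r \<in> ages sbar"
      obtain n where "r < real n" using reals_Archimedean2 by blast
      then show "g r = g' r" using elim[rule_format, of n] r by (simp add: d_def zx_def ages_def)
    qed
  qed
  then show ?thesis by (simp add: AE_ageM)
qed

text \<open>This is \<open>- A\<^sub>0\<^sup>* v\<close>; the sign makes \<open>bres sbar \<mu>\<close> its inverse.\<close>

definition src :: "ereal \<Rightarrow> real \<Rightarrow> fn \<Rightarrow> fn" where
  "src sbar \<mu> v = (\<lambda>s. \<mu> * v s - weak_deriv sbar v s)"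

lemma A0_star_src: "A0_star sbar \<mu> v = (\<lambda>s. - src sbar \<mu> v s)"
  by (simp add: A0_star_def src_def fun_eq_iff scaleR_fun_def)

lemma src_spH: "v \<in> spV sbar \<Longrightarrow> src sbar \<mu> v \<in> spH sbar"
  using spH_lincomb[of v sbar "weak_deriv sbar v" \<mu> "-1"] weak_deriv_H1[of v sbar]
  by (simp add: src_def H1_deriv_def)

lemma bres_src: "0 < \<mu> \<Longrightarrow> v \<in> spV sbar \<Longrightarrow> bres sbar \<mu> (src sbar \<mu> v) = v"
  unfolding src_def by (rule spV_eq_bres[symmetric]) (auto intro: weak_deriv_H1)

lemma src_bres:
  assumes "0 < \<mu>" "b \<in> spH sbar"
  shows "AE s in ageM sbar. src sbar \<mu> (bres sbar \<mu> b) s = b s"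
  using H1_deriv_unique[OF bres_spV weak_deriv_H1 bres_H1, OF assms bres_spV assms, OF assms]
  by eventually_elim (simp add: src_def)

lemma bres_cong_AE:
  assumes "b \<in> spH sbar" "b' \<in> spH sbar" "AE s in ageM sbar. b s = b' s"
  shows "bres sbar \<kappa> b = bres sbar \<kappa> b'"
proof
  fix s
  have [measurable]: "zx sbar b \<in> borel_measurable borel" "zx sbar b' \<in> borel_measurable borel"
    using assms by (simp_all add: spH_def measurable_ageM)
  have "(LBINT r. ekern \<kappa> s r * zx sbar b r) = (LBINT r. ekern \<kappa> s r * zx sbar b' r)"
  proof (rule integral_cong_AE)
    show "AE r in lborel. ekern \<kappa> s r * zx sbar b r = ekern \<kappa> s r * zx sbar b' r"
      using AE_zx_eq[OF assms(3)] by eventually_elim simp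
  qed auto
  then show "bres sbar \<kappa> b s = bres sbar \<kappa> b' s" by (simp add: bres_def)
qed

lemma bres_lincomb:
  assumes "0 < \<kappa>" "b \<in> spH sbar" "c \<in> spH sbar"
  shows "bres sbar \<kappa> (\<lambda>s. x * b s + y * c s) = (\<lambda>s. x * bres sbar \<kappa> b s + y * bres sbar \<kappa> c s)"
  using ekern_zx_integrable[OF assms(1,2)] ekern_zx_integrable[OF assms(1,3)]
  by (simp add: fun_eq_iff bres_def zx_lincomb distrib_left mult.left_commute[of _ x] mult.left_commute[of _ y])

lemma spV_lincomb_aux:
  assumes "0 < \<mu>" "v \<in> spV sbar" "w \<in> spV sbar"
  shows "(\<lambda>s. x * v s + y * w s) = bres sbar \<mu> (\<lambda>s. x * src sbar \<mu> v s + y * src sbar \<mu> w s)"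
  using assms by (simp add: bres_lincomb src_spH bres_src)

text \<open>V is the range of \<open>bres\<close>, which settles the boundary condition and the
  vanishing outside at once. V does not depend on \<mu>, so the parameter of \<open>bres\<close> is
  taken to be 1.\<close>

lemma spV_lincomb:
  assumes "v \<in> spV sbar" "w \<in> spV sbar"
  shows "(\<lambda>s. x * v s + y * w s) \<in> spV sbar"
  unfolding spV_lincomb_aux[OF zero_less_one assms]
  by (intro bres_spV spH_lincomb src_spH assms) simp

lemma src_lincomb:
  assumes "0 < \<mu>" "v \<in> spV sbar" "w \<in> spV sbar"
  shows "AE s in ageM sbar. src sbar \<mu> (\<lambda>s. x * v s + y * w s) s = x * src sbar \<mu> v s + y * src sbar \<mu> w s"
  unfolding spV_lincomb_aux[OF assms]
  by (intro src_bres spH_lincomb src_spH assms)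

lemma zero_spV: "(\<lambda>s. 0) \<in> spV sbar" if "v \<in> spV sbar"
  using spV_lincomb[OF that that, of 0 0] by simp

lemma normH_nonneg [simp]: "0 \<le> normH sbar f"
  by (simp add: normH_l2norm)

lemma normH_power2: "(normH sbar f)\<^sup>2 = innerH sbar f f"
  unfolding normH_l2norm l2norm_power2 innerH_def by (simp add: power2_eq_square)

lemma normH_uminus: "normH sbar (\<lambda>s. - f s) = normH sbar f"
  by (simp add: normH_l2norm l2norm_def)

lemma normV_power2: "(normV sbar \<mu> v)\<^sup>2 = (normH sbar v)\<^sup>2 + (normH sbar (src sbar \<mu> v))\<^sup>2"
proof -
  have "innerV sbar \<mu> v v = (normH sbar v)\<^sup>2 + (normH sbar (src sbar \<mu> v))\<^sup>2"
    unfolding innerV_def A0_star_src normH_power2[symmetric] normH_uminus ..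
  then show ?thesis by (simp add: normV_def)
qed

lemma normV_nonneg [simp]: "0 \<le> normV sbar \<mu> v"
  unfolding normV_def innerV_def normH_power2[symmetric] by simp

lemma normH_le_normV: "normH sbar v \<le> normV sbar \<mu> v"
  by (rule power2_le_imp_le) (simp_all add: normV_power2)

lemma normH_src_le_normV: "normH sbar (src sbar \<mu> v) \<le> normV sbar \<mu> v"
  by (rule power2_le_imp_le) (simp_all add: normV_power2)

lemma normV_le_sum: "normV sbar \<mu> v \<le> normH sbar v + normH sbar (src sbar \<mu> v)"
  by (rule power2_le_imp_le) (simp_all add: normV_power2 power2_sum)

lemma normH_cong_AE:
  assumes "f \<in> borel_measurable (ageM sbar)" "f' \<in> borel_measurable (ageM sbar)" "AE s in ageM sbar. f s = f' s"
  shows "normH sbar f = normH sbar f'"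
  unfolding normH_l2norm by (rule l2norm_cong_AE[OF assms])

lemma normH_cmult: "normH sbar (\<lambda>s. a * f s) = \<bar>a\<bar> * normH sbar f"
  by (simp add: normH_l2norm l2norm_cmult)

lemma normV_cmult:
  assumes "0 < \<mu>" "v \<in> spV sbar"
  shows "normV sbar \<mu> (\<lambda>s. a * v s) = \<bar>a\<bar> * normV sbar \<mu> v"
proof -
  have eq: "AE s in ageM sbar. src sbar \<mu> (\<lambda>s. a * v s) s = a * src sbar \<mu> v s"
    using src_lincomb[OF assms assms(2), of a 0] by simp
  have V: "(\<lambda>s. a * v s) \<in> spV sbar" using spV_lincomb[OF assms(2) assms(2), of a 0] by simp
  have "normH sbar (src sbar \<mu> (\<lambda>s. a * v s)) = normH sbar (\<lambda>s. a * src sbar \<mu> v s)"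
    using eq src_spH[OF V] spH_lincomb[OF src_spH[OF assms(2)] src_spH[OF assms(2)], of a \<mu> 0 \<mu>]
    by (intro normH_cong_AE spH_measurable) auto
  then have "(normV sbar \<mu> (\<lambda>s. a * v s))\<^sup>2 = (\<bar>a\<bar> * normV sbar \<mu> v)\<^sup>2"
    by (simp add: normV_power2 normH_cmult power_mult_distrib distrib_left)
  then show ?thesis by (simp add: power2_eq_iff_nonneg)
qed

text \<open>Sobolev embedding of V into the bounded functions, read off from the L2 norm of the
  kernel. It puts point evaluations, \<open>delta0\<close> among them, into V'.\<close>

lemma spV_bound:
  assumes "0 < \<mu>" "v \<in> spV sbar"
  shows "\<bar>v s\<bar> \<le> normV sbar \<mu> v / sqrt (2 * \<mu>)"
proof -
  have "\<bar>v s\<bar> \<le> normH sbar (src sbar \<mu> v) / sqrt (2 * \<mu>)"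
    using bres_bound[OF assms(1) src_spH[OF assms(2)], of \<mu> s] assms by (simp add: bres_src)
  also have "\<dots> \<le> normV sbar \<mu> v / sqrt (2 * \<mu>)"
    using assms(1) by (intro divide_right_mono normH_src_le_normV) auto
  finally show ?thesis .
qed

text \<open>Together with \<open>normH_src_le_normV\<close> this makes \<open>src\<close> and
  \<open>bres\<close> bounded and mutually inverse between V and H, up to null functions.\<close>

lemma bres_normV:
  assumes "0 < \<mu>" "b \<in> spH sbar"
  shows "normV sbar \<mu> (bres sbar \<mu> b) \<le> (1 / \<mu> + 1) * normH sbar b"
proof -
  have "normH sbar (src sbar \<mu> (bres sbar \<mu> b)) = normH sbar b"
    using src_bres[OF assms] assms by (intro normH_cong_AE) (auto intro: spH_measurable src_spH bres_spV)
  then show ?thesis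
    using normV_le_sum[of sbar \<mu> "bres sbar \<mu> b"] bres_normH[OF assms] by (simp add: algebra_simps)
qed

section \<open>The dual space V' and its representation by H\<close>

lemma spVd_lincomb:
  assumes "x \<in> spVd sbar \<mu>" "v \<in> spV sbar" "w \<in> spV sbar"
  shows "x (\<lambda>s. a * v s + b * w s) = a * x v + b * x w"
proof -
  have "(\<lambda>s. a * v s + b * w s) = a *\<^sub>R v + b *\<^sub>R w" by (simp add: fun_eq_iff scaleR_fun_def)
  then show ?thesis using assms by (simp add: spVd_def)
qed

lemma spVd_bdd: "x \<in> spVd sbar \<mu> \<Longrightarrow> bdd_above ((\<lambda>v. \<bar>x v\<bar>) ` {v \<in> spV sbar. normV sbar \<mu> v \<le> 1})"
proof -
  assume "x \<in> spVd sbar \<mu>"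
  then obtain C where C: "\<And>v. v \<in> spV sbar \<Longrightarrow> \<bar>x v\<bar> \<le> C * normV sbar \<mu> v" unfolding spVd_def by blast
  have "\<bar>x v\<bar> \<le> \<bar>C\<bar>" if "v \<in> spV sbar" "normV sbar \<mu> v \<le> 1" for v
    using C[OF that(1)] that(2) mult_mono[of C "\<bar>C\<bar>" "normV sbar \<mu> v" 1] abs_ge_self[of C] by simp
  then show ?thesis by (auto simp: bdd_above_def)
qed

lemma spVd_bound:
  assumes "0 < \<mu>" "x \<in> spVd sbar \<mu>" "v \<in> spV sbar"
  shows "\<bar>x v\<bar> \<le> normVd sbar \<mu> x * normV sbar \<mu> v"
proof (cases "normV sbar \<mu> v = 0")
  case True
  obtain C where "\<bar>x v\<bar> \<le> C * normV sbar \<mu> v" using assms by (auto simp: spVd_def)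
  then show ?thesis using True by simp
next
  case False
  define n where "n = normV sbar \<mu> v"
  have n: "0 < n" using False by (simp add: n_def less_le)
  have V: "(\<lambda>s. (1 / n) * v s) \<in> spV sbar" using spV_lincomb[OF assms(3) assms(3), of "1/n" 0] by simp
  have "normV sbar \<mu> (\<lambda>s. (1 / n) * v s) \<le> 1"
    unfolding normV_cmult[OF assms(1,3)] using n by (simp add: n_def)
  then have "\<bar>x (\<lambda>s. (1 / n) * v s)\<bar> \<le> normVd sbar \<mu> x"
    unfolding normVd_def using V by (intro cSUP_upper spVd_bdd assms) simp
  then show ?thesis
    using spVd_lincomb[OF assms(2,3,3), of "1/n" 0] n by (simp add: n_def field_simps)
qed

lemma normVd_le:
  assumes "\<And>v. v \<in> spV sbar \<Longrightarrow> \<bar>x v\<bar> \<le> C * normV sbar \<mu> v" "0 \<le> C" "0 < \<mu>"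
  shows "normVd sbar \<mu> x \<le> C"
  unfolding normVd_def
proof (rule cSUP_least)
  have "(\<lambda>s. 0) \<in> spH sbar" by (simp add: spH_L2)
  then have "(\<lambda>s. 0) \<in> spV sbar" using zero_spV[OF bres_spV[OF zero_less_one]] by blast
  moreover from this have "normV sbar \<mu> (\<lambda>s. 0) \<le> 1"
    using normV_cmult[OF assms(3), of "\<lambda>s. 0" sbar 0] by simp
  ultimately show "{v \<in> spV sbar. normV sbar \<mu> v \<le> 1} \<noteq> {}" by blast
  fix v assume "v \<in> {v \<in> spV sbar. normV sbar \<mu> v \<le> 1}"
  then have "\<bar>x v\<bar> \<le> C * normV sbar \<mu> v" "C * normV sbar \<mu> v \<le> C"
    using assms by (auto intro!: mult_left_le)
  then show "\<bar>x v\<bar> \<le> C" by simp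
qed

text \<open>Since \<open>bres\<close> is bounded from H to V, the composition of \<open>x\<close>
  with \<open>bres\<close> is a bounded functional on H, and \<open>src\<close> translates its Riesz
  representation back to V. This is what later makes A map H onto V'.\<close>

lemma spVd_Riesz:
  assumes \<mu>: "0 < \<mu>" and x: "x \<in> spVd sbar \<mu>"
  obtains h where "h \<in> spH sbar" "\<And>v. v \<in> spV sbar \<Longrightarrow> x v = innerH sbar h (src sbar \<mu> v)"
proof -
  obtain C where C: "\<And>v. v \<in> spV sbar \<Longrightarrow> \<bar>x v\<bar> \<le> C * normV sbar \<mu> v" using x unfolding spVd_def by blast
  obtain h where h: "h \<in> L2 (ageM sbar)" "\<And>f. f \<in> L2 (ageM sbar) \<Longrightarrow> x (bres sbar \<mu> f) = (LINT s|ageM sbar. h s * f s)"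
  proof (rule L2_Riesz[of "ageM sbar" "\<lambda>f. x (bres sbar \<mu> f)" "\<bar>C\<bar> * (1 / \<mu> + 1)"])
    fix f g a b assume "f \<in> L2 (ageM sbar)" "g \<in> L2 (ageM sbar)"
    then show "x (bres sbar \<mu> (\<lambda>s. a * f s + b * g s)) = a * x (bres sbar \<mu> f) + b * x (bres sbar \<mu> g)"
      using \<mu> by (subst bres_lincomb) (auto simp: spH_L2 intro!: spVd_lincomb[OF x] bres_spV)
  next
    fix f assume "f \<in> L2 (ageM sbar)"
    then have f: "f \<in> spH sbar" by (simp add: spH_L2)
    have "\<bar>x (bres sbar \<mu> f)\<bar> \<le> C * normV sbar \<mu> (bres sbar \<mu> f)" by (rule C[OF bres_spV[OF \<mu> f]])
    also have "\<dots> \<le> \<bar>C\<bar> * ((1 / \<mu> + 1) * normH sbar f)"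
      using bres_normV[OF \<mu> f] by (intro mult_mono) auto
    finally show "\<bar>x (bres sbar \<mu> f)\<bar> \<le> \<bar>C\<bar> * (1 / \<mu> + 1) * l2norm (ageM sbar) f"
      by (simp add: normH_l2norm mult.assoc)
  qed blast
  then show ?thesis
    using that[of h] bres_src[OF \<mu>] src_spH by (metis innerH_def spH_L2)
qed

text \<open>\<open>lam * v - A0_star sbar \<mu> v\<close> equals \<open>(lam + \<mu>) * v\<close>
  minus the derivative of \<open>v\<close>, so the resolvent is again a \<open>bres\<close>, now
  with rate \<open>lam + \<mu>\<close>.\<close>

lemma resolvent_star_bres:
  assumes "0 < \<mu>" "0 < lam" "\<alpha> \<in> spV sbar"
  shows "resolvent_star sbar \<mu> lam \<alpha> = bres sbar (lam + \<mu>) \<alpha>"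
  unfolding resolvent_star_def
proof (rule the_equality)
  have \<kappa>: "0 < lam + \<mu>" and \<alpha>: "\<alpha> \<in> spH sbar" using assms spV_spH by auto
  note V = bres_spV[OF \<kappa> \<alpha>]
  have "AE s in ageM sbar. lam * bres sbar (lam + \<mu>) \<alpha> s - A0_star sbar \<mu> (bres sbar (lam + \<mu>) \<alpha>) s = \<alpha> s"
    using H1_deriv_unique[OF V weak_deriv_H1[OF V] bres_H1[OF \<kappa> \<alpha>]]
    by eventually_elim (simp add: A0_star_src src_def algebra_simps)
  then show "bres sbar (lam + \<mu>) \<alpha> \<in> spV sbar \<and>
      (AE s in ageM sbar. lam * bres sbar (lam + \<mu>) \<alpha> s - A0_star sbar \<mu> (bres sbar (lam + \<mu>) \<alpha>) s = \<alpha> s)"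
    using V by simp
  fix v assume v: "v \<in> spV sbar \<and> (AE s in ageM sbar. lam * v s - A0_star sbar \<mu> v s = \<alpha> s)"
  have "v = bres sbar (lam + \<mu>) (\<lambda>s. (lam + \<mu>) * v s - weak_deriv sbar v s)"
    using v by (intro spV_eq_bres \<kappa> weak_deriv_H1) auto
  also have "\<dots> = bres sbar (lam + \<mu>) \<alpha>"
  proof (rule bres_cong_AE[OF _ \<alpha>])
    show "(\<lambda>s. (lam + \<mu>) * v s - weak_deriv sbar v s) \<in> spH sbar"
      using src_spH[of v sbar "lam + \<mu>"] v by (simp add: src_def)
    show "AE s in ageM sbar. (lam + \<mu>) * v s - weak_deriv sbar v s = \<alpha> s"
      using v[THEN conjunct2] by eventually_elim (simp add: A0_star_src src_def algebra_simps)
  qed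
  finally show "v = bres sbar (lam + \<mu>) \<alpha>" .
qed

text \<open>\<open>A0_star\<close> commutes with its resolvent. The function
  \<open>\<alpha> - lam * r\<close> represents \<open>src sbar \<mu> r\<close>, lies in V and solves
  the resolvent equation with right-hand side \<open>src sbar \<mu> \<alpha>\<close>.\<close>

lemma src_bres_shifted:
  assumes \<mu>: "0 < \<mu>" and lam: "0 < lam" and \<alpha>: "\<alpha> \<in> spV sbar"
  shows "AE s in ageM sbar. src sbar \<mu> (bres sbar (lam + \<mu>) \<alpha>) s = bres sbar (lam + \<mu>) (src sbar \<mu> \<alpha>) s"
proof -
  define r where "r = bres sbar (lam + \<mu>) \<alpha>"
  have \<kappa>: "0 < lam + \<mu>" and \<alpha>H: "\<alpha> \<in> spH sbar" using assms spV_spH by auto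
  have r: "r \<in> spV sbar" "H1_deriv sbar r (\<lambda>s. (lam + \<mu>) * r s - \<alpha> s)"
    using bres_spV[OF \<kappa> \<alpha>H] bres_H1[OF \<kappa> \<alpha>H] by (simp_all add: r_def)
  have "(\<lambda>s. \<alpha> s - lam * r s) = bres sbar (lam + \<mu>) (\<lambda>s. (lam + \<mu>) * (\<alpha> s - lam * r s) - (weak_deriv sbar \<alpha> s - lam * ((lam + \<mu>) * r s - \<alpha> s)))"
    using spV_lincomb[OF \<alpha> r(1), of 1 "-lam"] H1_deriv_lincomb[OF weak_deriv_H1[OF \<alpha>] r(2), of 1 "-lam"]
    by (intro spV_eq_bres[OF \<kappa>]) auto
  also have "(\<lambda>s. (lam + \<mu>) * (\<alpha> s - lam * r s) - (weak_deriv sbar \<alpha> s - lam * ((lam + \<mu>) * r s - \<alpha> s))) = src sbar \<mu> \<alpha>"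
    by (simp add: src_def fun_eq_iff algebra_simps)
  finally have eq: "\<alpha> s - lam * r s = bres sbar (lam + \<mu>) (src sbar \<mu> \<alpha>) s" for s by meson
  show ?thesis
    using H1_deriv_unique[OF r(1) weak_deriv_H1[OF r(1)] r(2)]
    unfolding r_def[symmetric] eq[symmetric]
    by eventually_elim (simp add: src_def algebra_simps)
qed

section \<open>Translation semigroups\<close>

text \<open>The left translation semigroup on classes in \<open>H\<close>, and on the everywhere defined elements of \<open>V\<close>.\<close>

definition LH :: "ereal \<Rightarrow> real \<Rightarrow> real \<Rightarrow> fn \<Rightarrow> fn" where
  "LH sbar \<mu> t b = (\<lambda>s. exp (- \<mu> * t) * zx sbar b (s + t))"

definition LV :: "real \<Rightarrow> real \<Rightarrow> fn \<Rightarrow> fn" where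
  "LV \<mu> t v = (\<lambda>s. if s < 0 then 0 else exp (- \<mu> * t) * v (s + t))"

lemma innerH_zx_left: "innerH sbar k f = (LBINT s. zx sbar k s * f s)"
  by (simp add: innerH_zx zx_def indicator_def mult.assoc)
    (intro Bochner_Integration.integral_cong refl, simp)

lemma LH_L2:
  assumes b: "b \<in> spH sbar"
  shows "LH sbar \<mu> t b \<in> L2 lborel" and "l2norm lborel (LH sbar \<mu> t b) = exp (- \<mu> * t) * normH sbar b"
proof -
  have zb: "zx sbar b \<in> L2 lborel" using b by (simp add: spH_zx)
  have [measurable]: "zx sbar b \<in> borel_measurable borel" using zb by (simp add: L2_def)
  have sh: "(\<lambda>s. zx sbar b (s + t)) \<in> L2 lborel"
    using lborel_integrable_real_affine[OF L2_integrable_sq[OF zb], of 1 t] by (simp add: L2_def add.commute)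
  then show "LH sbar \<mu> t b \<in> L2 lborel" unfolding LH_def by (rule L2_cmult)
  have "l2norm lborel (\<lambda>s. zx sbar b (s + t)) = l2norm lborel (zx sbar b)"
    using lborel_integral_real_affine[of 1 "\<lambda>s. (zx sbar b s)\<^sup>2" t] by (simp add: l2norm_def add.commute)
  then show "l2norm lborel (LH sbar \<mu> t b) = exp (- \<mu> * t) * normH sbar b"
    unfolding LH_def by (simp add: l2norm_cmult normH_zx)
qed

lemma zx_l2norm_le: "f \<in> L2 lborel \<Longrightarrow> zx sbar f \<in> L2 lborel \<and> l2norm lborel (zx sbar f) \<le> l2norm lborel f"
proof
  assume f: "f \<in> L2 lborel"
  show z: "zx sbar f \<in> L2 lborel"
    by (rule L2_bound[OF f, of _ 1]) (use f in \<open>auto simp: zx_def indicator_def L2_def\<close>)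
  show "l2norm lborel (zx sbar f) \<le> l2norm lborel f"
    unfolding l2norm_def
    by (intro real_sqrt_le_mono integral_mono L2_integrable_sq f z) (auto simp: zx_def indicator_def)
qed

lemma LH_spH: "b \<in> spH sbar \<Longrightarrow> LH sbar \<mu> t b \<in> spH sbar"
  unfolding spH_zx[of "LH sbar \<mu> t b"] using zx_l2norm_le[OF LH_L2(1)] by blast

lemma LH_normH: "b \<in> spH sbar \<Longrightarrow> normH sbar (LH sbar \<mu> t b) \<le> exp (- \<mu> * t) * normH sbar b"
  unfolding normH_zx[of sbar "LH sbar \<mu> t b"] using zx_l2norm_le[OF LH_L2(1)[of b sbar \<mu> t], of sbar] LH_L2(2)[of b sbar \<mu> t] by simp

lemma zx_LH: "0 < s \<Longrightarrow> 0 \<le> t \<Longrightarrow> zx sbar (LH sbar \<mu> t b) s = LH sbar \<mu> t b s"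
  by (cases sbar) (auto simp: zx_def LH_def ages_def indicator_def)

text \<open>Translation commutes with the inverse of \<open>A0_star\<close>; through this
  intertwining, statements about translation on V and its norm reduce to translation on H.\<close>

lemma LV_bres:
  assumes "0 \<le> t"
  shows "LV \<mu> t (bres sbar \<mu> b) = bres sbar \<mu> (LH sbar \<mu> t b)"
proof
  fix s
  show "LV \<mu> t (bres sbar \<mu> b) s = bres sbar \<mu> (LH sbar \<mu> t b) s"
  proof (cases "s < 0")
    case False
    then have s: "0 \<le> s" by simp
    have "bres sbar \<mu> b (s + t) = (LBINT r. ekern \<mu> (t + 1 * s) (t + 1 * r) * zx sbar b (t + 1 * r))"
      using lborel_integral_real_affine[of 1 "\<lambda>r. ekern \<mu> (t + 1 * s) r * zx sbar b r" t] s assms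
      by (simp add: bres_def add.commute)
    then have "exp (- \<mu> * t) * bres sbar \<mu> b (s + t) = (LBINT r. exp (- \<mu> * t) * (ekern \<mu> s r * zx sbar b (r + t)))"
      unfolding ekern_shift by (simp add: add.commute)
    also have "\<dots> = (LBINT r. ekern \<mu> s r * zx sbar (LH sbar \<mu> t b) r)"
    proof (intro Bochner_Integration.integral_cong refl)
      show "exp (- \<mu> * t) * (ekern \<mu> s r * zx sbar b (r + t)) = ekern \<mu> s r * zx sbar (LH sbar \<mu> t b) r" for r
        using zx_LH[of r t sbar \<mu> b] s assms by (cases "s < r") (auto simp: ekern_def LH_def)
    qed
    finally show ?thesis using s assms by (simp add: LV_def bres_def)
  qed (simp add: LV_def bres_def)
qed

lemma LV_add: "0 \<le> t \<Longrightarrow> 0 \<le> s \<Longrightarrow> LV \<mu> t (LV \<mu> s v) = LV \<mu> (t + s) v"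
  by (auto simp: LV_def fun_eq_iff algebra_simps simp flip: exp_add mult.assoc)

lemma LV_0: "v \<in> spV sbar \<Longrightarrow> LV \<mu> 0 v = v"
  using spV_outside[of v sbar] by (auto simp: LV_def fun_eq_iff)

lemma LV_lincomb: "LV \<mu> t (\<lambda>s. x * v s + y * w s) = (\<lambda>s. x * LV \<mu> t v s + y * LV \<mu> t w s)"
  by (auto simp: LV_def fun_eq_iff algebra_simps)

lemma innerH_LV: 
  assumes "v \<in> spV sbar" "0 \<le> t"
  shows "innerH sbar k (LV \<mu> t v) = innerH sbar k (LH sbar \<mu> t v)"
  unfolding innerH_zx_left[of sbar k]
  by (intro Bochner_Integration.integral_cong refl)
    (use spV_zx[OF assms(1)] assms(2) in \<open>auto simp: LV_def LH_def zx_def ages_def indicator_def\<close>)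

context
  fixes sbar :: ereal and \<mu> :: real
  assumes mu: "0 < \<mu>"
begin

lemma LV_spV: "v \<in> spV sbar \<Longrightarrow> 0 \<le> t \<Longrightarrow> LV \<mu> t v \<in> spV sbar"
  using LV_bres[of t \<mu> sbar "src sbar \<mu> v"] bres_spV[OF mu LH_spH[OF src_spH]] by (simp add: bres_src mu)

lemma src_LV: "v \<in> spV sbar \<Longrightarrow> 0 \<le> t \<Longrightarrow>
    AE s in ageM sbar. src sbar \<mu> (LV \<mu> t v) s = LH sbar \<mu> t (src sbar \<mu> v) s"
  using src_bres[OF mu LH_spH[OF src_spH], of v sbar \<mu> t] LV_bres[of t \<mu> sbar "src sbar \<mu> v"]
  by (simp add: bres_src mu)

lemma innerH_src_LV:
  assumes "v \<in> spV sbar" "0 \<le> t" "k \<in> spH sbar"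
  shows "innerH sbar k (src sbar \<mu> (LV \<mu> t v)) = innerH sbar k (LH sbar \<mu> t (src sbar \<mu> v))"
  by (rule innerH_cong_AE) (use src_LV[OF assms(1,2)] assms in
    \<open>auto intro!: spH_measurable src_spH LH_spH LV_spV\<close>)

lemma LV_normH: "v \<in> spV sbar \<Longrightarrow> 0 \<le> t \<Longrightarrow> normH sbar (LV \<mu> t v) \<le> exp (- \<mu> * t) * normH sbar v"
proof -
  assume v: "v \<in> spV sbar" "0 \<le> t"
  have "AE s in ageM sbar. LV \<mu> t v s = LH sbar \<mu> t v s"
    using spV_zx[OF v(1)] v(2) by (intro AE_I2) (auto simp: space_ageM ages_def LV_def LH_def)
  then have "normH sbar (LV \<mu> t v) = normH sbar (LH sbar \<mu> t v)"
    by (intro normH_cong_AE spH_measurable LH_spH spV_spH LV_spV v)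
  then show ?thesis using LH_normH[OF spV_spH[OF v(1)], of \<mu> t] by simp
qed

text \<open>Both parts of the graph norm contract at rate \<mu>, because \<open>src\<close> turns
  translation on V into translation on H.\<close>

lemma LV_normV:
  assumes "v \<in> spV sbar" "0 \<le> t"
  shows "normV sbar \<mu> (LV \<mu> t v) \<le> exp (- \<mu> * t) * normV sbar \<mu> v"
proof (rule power2_le_imp_le)
  have 1: "normH sbar (src sbar \<mu> (LV \<mu> t v)) = normH sbar (LH sbar \<mu> t (src sbar \<mu> v))"
    using src_LV[OF assms] assms by (intro normH_cong_AE) (auto intro!: spH_measurable src_spH LH_spH LV_spV)
  have "(normH sbar (LV \<mu> t v))\<^sup>2 \<le> (exp (- \<mu> * t) * normH sbar v)\<^sup>2"
    "(normH sbar (src sbar \<mu> (LV \<mu> t v)))\<^sup>2 \<le> (exp (- \<mu> * t) * normH sbar (src sbar \<mu> v))\<^sup>2"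
    unfolding 1 using LV_normH[OF assms] LH_normH[OF src_spH[OF assms(1)], of \<mu> t \<mu>]
    by (auto intro!: power_mono)
  then show "(normV sbar \<mu> (LV \<mu> t v))\<^sup>2 \<le> (exp (- \<mu> * t) * normV sbar \<mu> v)\<^sup>2"
    by (simp add: normV_power2 power_mult_distrib distrib_left)
qed simp

lemma LV_normV_le: "v \<in> spV sbar \<Longrightarrow> 0 \<le> t \<Longrightarrow> normV sbar \<mu> (LV \<mu> t v) \<le> normV sbar \<mu> v"
  using LV_normV[of v t] mu mult_right_mono[of "exp (- \<mu> * t)" 1 "normV sbar \<mu> v"] by simp

text \<open>Integrated form of \<open>d/dt L(t) v = L(t) A\<^sub>0\<^sup>* v\<close>, tested against \<open>k\<close>.\<close>

lemma LV_increment: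
  assumes k: "k \<in> spH sbar" and v: "v \<in> spV sbar" and d: "0 \<le> d"
  shows "set_integrable lborel {0<..<d} (\<lambda>\<rho>. innerH sbar k (LH sbar \<mu> \<rho> (src sbar \<mu> v)))"
    and "innerH sbar k v - innerH sbar k (LV \<mu> d v) = (LBINT \<rho>:{0<..<d}. innerH sbar k (LH sbar \<mu> \<rho> (src sbar \<mu> v)))"
proof -
  define b where "b = src sbar \<mu> v"
  have b: "b \<in> spH sbar" using v by (simp add: b_def src_spH)
  have vb: "v = bres sbar \<mu> b" using v mu by (simp add: b_def bres_src)
  have [measurable]: "zx sbar b \<in> borel_measurable borel" "zx sbar k \<in> borel_measurable borel"
    using b k by (simp_all add: spH_def measurable_ageM)
  have [measurable]: "LH sbar \<mu> \<rho> b \<in> borel_measurable borel" for \<rho> unfolding LH_def by measurable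
  have LHm [measurable]: "(\<lambda>(\<rho>, s). LH sbar \<mu> \<rho> b s) \<in> borel_measurable (lborel \<Otimes>\<^sub>M lborel)"
    unfolding LH_def by measurable
  have zk: "zx sbar k \<in> L2 lborel" using k by (simp add: spH_zx)
  \<comment> \<open>Both \<open>v\<close> and its translate are tail integrals of the same
    exponential density, so they differ by the integral over \<open>(s, s + d)\<close>; the shift by
    \<open>s\<close> then exhibits \<open>LH\<close>.\<close>
  have pw: "v s - LV \<mu> d v s = (LBINT \<rho>. indicator {0<..<d} \<rho> * LH sbar \<mu> \<rho> b s)" if s: "0 < s" for s
  proof -
    have i1: "integrable lborel (\<lambda>r. ekern \<mu> s r * zx sbar b r)" by (rule ekern_zx_integrable[OF mu b])
    have i2: "integrable lborel (\<lambda>r. exp (- \<mu> * d) * (ekern \<mu> (s + d) r * zx sbar b r))"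
      using ekern_zx_integrable[OF mu b, of "s + d"] by simp
    have "v s - LV \<mu> d v s = (LBINT r. ekern \<mu> s r * zx sbar b r) - (LBINT r. exp (- \<mu> * d) * (ekern \<mu> (s + d) r * zx sbar b r))"
      using s d by (simp add: vb LV_def bres_def)
    also have "\<dots> = (LBINT r. ekern \<mu> s r * zx sbar b r - exp (- \<mu> * d) * (ekern \<mu> (s + d) r * zx sbar b r))"
      using i1 i2 by simp
    also have "\<dots> = (LBINT r. indicator {s<..<s + d} r * (exp (- \<mu> * (r - s)) * zx sbar b r))"
    proof (rule integral_cong_AE)
      show "AE r in lborel. ekern \<mu> s r * zx sbar b r - exp (- \<mu> * d) * (ekern \<mu> (s + d) r * zx sbar b r)
          = indicator {s<..<s + d} r * (exp (- \<mu> * (r - s)) * zx sbar b r)"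
        using AE_lborel_singleton[of "s + d"]
      proof eventually_elim
        case (elim r)
        have "exp (- \<mu> * d) * (exp (- \<mu> * (r - (s + d))) * y) = exp (- \<mu> * (r - s)) * y" for y
          by (simp add: algebra_simps flip: mult.assoc exp_add)
        then show ?case using elim d by (auto simp: ekern_def indicator_def)
      qed
    qed (measurable)
    also have "\<dots> = (LBINT \<rho>. indicator {s<..<s + d} (s + 1 * \<rho>) * (exp (- \<mu> * ((s + 1 * \<rho>) - s)) * zx sbar b (s + 1 * \<rho>)))"
      using lborel_integral_real_affine[of 1 "\<lambda>r. indicator {s<..<s + d} r * (exp (- \<mu> * (r - s)) * zx sbar b r)" s]
      by simp
    also have "\<dots> = (LBINT \<rho>. indicator {0<..<d} \<rho> * LH sbar \<mu> \<rho> b s)"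
      by (intro Bochner_Integration.integral_cong refl) (auto simp: indicator_def LH_def)
    finally show ?thesis .
  qed
  \<comment> \<open>Pairing with \<open>k\<close> turns the time integral of H-valued functions into
    a double integral, so Fubini replaces vector-valued integration.\<close>
  define K where "K = (\<lambda>(\<rho>, s). indicator {0<..<d} \<rho> * (zx sbar k s * LH sbar \<mu> \<rho> b s))"
  have Kint: "integrable (lborel \<Otimes>\<^sub>M lborel) K"
  proof (rule lborel_pair.Fubini_integrable)
    show "K \<in> borel_measurable (lborel \<Otimes>\<^sub>M lborel)" unfolding K_def by measurable
    have sl: "integrable lborel (\<lambda>s. zx sbar k s * LH sbar \<mu> \<rho> b s)" for \<rho>
      by (rule L2_integrable_mult[OF zk LH_L2(1)[OF b]])
    then show "AE \<rho> in lborel. integrable lborel (\<lambda>s. K (\<rho>, s))" by (simp add: K_def)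
    show "integrable lborel (\<lambda>\<rho>. LBINT s. norm (K (\<rho>, s)))"
    proof (rule Bochner_Integration.integrable_bound)
      show "integrable lborel (\<lambda>\<rho>. indicator {0<..<d} \<rho> * (normH sbar k * normH sbar b))"
        using L2_set_integrable[OF L2_indicator_interval[of 0 d], of 0 d]
        by (auto intro!: integrable_real_indicator simp: emeasure_lborel_Ioo d)
      show "(\<lambda>\<rho>. LBINT s. norm (K (\<rho>, s))) \<in> borel_measurable lborel" unfolding K_def by measurable
      show "AE \<rho> in lborel. norm (LBINT s. norm (K (\<rho>, s))) \<le> norm (indicator {0<..<d} \<rho> * (normH sbar k * normH sbar b))"
      proof (rule AE_I2)
        fix \<rho>
        show "norm (LBINT s. norm (K (\<rho>, s))) \<le> norm (indicator {0<..<d} \<rho> * (normH sbar k * normH sbar b))"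
        proof (cases "\<rho> \<in> {0<..<d}")
          case True
          have abs: "(\<lambda>x. \<bar>f x\<bar>) \<in> L2 lborel" "l2norm lborel (\<lambda>x. \<bar>f x\<bar>) = l2norm lborel f" if "f \<in> L2 lborel" for f :: fn
            using that by (auto simp: L2_def l2norm_def)
          have "(LBINT s. norm (K (\<rho>, s))) = (LBINT s. \<bar>zx sbar k s\<bar> * \<bar>LH sbar \<mu> \<rho> b s\<bar>)"
            using True by (simp add: K_def abs_mult)
          also have "\<bar>\<dots>\<bar> \<le> l2norm lborel (zx sbar k) * l2norm lborel (LH sbar \<mu> \<rho> b)"
            using L2_Cauchy_Schwarz[OF abs(1)[OF zk] abs(1)[OF LH_L2(1)[OF b]]] by (simp add: abs(2) zk LH_L2(1)[OF b])
          also have "\<dots> \<le> normH sbar k * (1 * normH sbar b)"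
            unfolding LH_L2(2)[OF b] normH_zx[symmetric]
            using True mu by (intro mult_left_mono mult_right_mono) auto
          finally show ?thesis using True by simp
        qed (simp add: K_def)
      qed
    qed
  qed
  have eq: "(LBINT s. K (\<rho>, s)) = indicator {0<..<d} \<rho> * innerH sbar k (LH sbar \<mu> \<rho> b)" for \<rho>
    by (simp add: K_def innerH_zx_left)
  show "set_integrable lborel {0<..<d} (\<lambda>\<rho>. innerH sbar k (LH sbar \<mu> \<rho> (src sbar \<mu> v)))"
    using lborel_pair.integrable_fst'[OF Kint] unfolding eq by (simp add: set_integrable_def b_def)
  have i: "integrable lborel (\<lambda>s. zx sbar k s * f s)" if "f \<in> spH sbar" for f
  proof -
    have "(\<lambda>s. zx sbar k s * zx sbar f s) = (\<lambda>s. zx sbar k s * f s)" by (auto simp: zx_def indicator_def)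
    then show ?thesis using L2_integrable_mult[OF zk, of "zx sbar f"] that by (simp add: spH_zx)
  qed
  have "innerH sbar k v - innerH sbar k (LV \<mu> d v) = (LBINT s. zx sbar k s * v s - zx sbar k s * LV \<mu> d v s)"
    unfolding innerH_zx_left using i[OF spV_spH[OF v]] i[OF spV_spH[OF LV_spV[OF v d]]] by simp
  also have "\<dots> = (LBINT s. LBINT \<rho>. K (\<rho>, s))"
  proof (intro Bochner_Integration.integral_cong refl)
    fix s
    show "zx sbar k s * v s - zx sbar k s * LV \<mu> d v s = (LBINT \<rho>. K (\<rho>, s))"
    proof (cases "0 < s")
      case True
      have "(LBINT \<rho>. K (\<rho>, s)) = (LBINT \<rho>. zx sbar k s * (indicator {0<..<d} \<rho> * LH sbar \<mu> \<rho> b s))"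
        unfolding K_def by (intro Bochner_Integration.integral_cong refl) simp
      also have "\<dots> = zx sbar k s * (v s - LV \<mu> d v s)" unfolding pw[OF True] by simp
      finally show ?thesis by (simp add: right_diff_distrib)
    qed (simp add: K_def zx_def ages_def)
  qed
  also have "\<dots> = (LBINT \<rho>. LBINT s. K (\<rho>, s))"
    using lborel_pair.Fubini_integral[of "\<lambda>\<rho> s. K (\<rho>, s)"] Kint by simp
  finally show "innerH sbar k v - innerH sbar k (LV \<mu> d v) = (LBINT \<rho>:{0<..<d}. innerH sbar k (LH sbar \<mu> \<rho> (src sbar \<mu> v)))"
    unfolding eq by (simp add: set_lebesgue_integral_def b_def)
qed

lemma Ioo_integral_bound:
  fixes f :: "real \<Rightarrow> real"
  assumes "set_integrable lborel {0<..<d} f" "0 \<le> d" "\<And>\<rho>. 0 < \<rho> \<Longrightarrow> \<rho> < d \<Longrightarrow> \<bar>f \<rho>\<bar> \<le> c"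
  shows "\<bar>LBINT \<rho>:{0<..<d}. f \<rho>\<bar> \<le> d * c"
proof -
  have ind: "integrable lborel (\<lambda>\<rho>. indicator {0<..<d} \<rho> * c)"
    by (auto intro!: integrable_real_indicator simp: emeasure_lborel_Ioo assms)
  have "\<bar>LBINT \<rho>:{0<..<d}. f \<rho>\<bar> \<le> (LBINT \<rho>. indicator {0<..<d} \<rho> * c)"
    unfolding set_lebesgue_integral_def
    by (rule integral_abs_bound_integral) (use assms ind in \<open>auto simp: set_integrable_def indicator_def\<close>)
  also have "\<dots> = d * c" using assms(2) by simp
  finally show ?thesis .
qed

text \<open>The increment is paired with itself: the scalar increment formula bounds its squared
  norm, and one factor cancels.\<close>

lemma LV_Lipschitz:
  assumes v: "v \<in> spV sbar" and d: "0 \<le> d"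
  shows "normH sbar (\<lambda>s. v s - LV \<mu> d v s) \<le> d * normH sbar (src sbar \<mu> v)"
proof -
  define k where "k = (\<lambda>s. v s - LV \<mu> d v s)"
  have vH: "v \<in> spH sbar" "LV \<mu> d v \<in> spH sbar" using v d by (auto intro: spV_spH LV_spV)
  have k: "k \<in> spH sbar" using spH_lincomb[OF vH, of 1 "-1"] by (simp add: k_def)
  have "normH sbar k * normH sbar k = innerH sbar k k" using normH_power2[of sbar k] by (simp add: power2_eq_square)
  also have "\<dots> = innerH sbar k v - innerH sbar k (LV \<mu> d v)"
    using innerH_lincomb'[OF vH k, of 1 "-1"] by (simp add: k_def)
  also have "\<dots> \<le> d * (normH sbar k * normH sbar (src sbar \<mu> v))"
    unfolding LV_increment(2)[OF k v d]
  proof (rule order_trans[OF abs_ge_self Ioo_integral_bound[OF LV_increment(1)[OF k v d] d]])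
    fix \<rho> assume \<rho>: "0 < \<rho>" "\<rho> < d"
    have "\<bar>innerH sbar k (LH sbar \<mu> \<rho> (src sbar \<mu> v))\<bar> \<le> normH sbar k * normH sbar (LH sbar \<mu> \<rho> (src sbar \<mu> v))"
      by (intro innerH_CS k LH_spH src_spH v)
    also have "\<dots> \<le> normH sbar k * (exp (- \<mu> * \<rho>) * normH sbar (src sbar \<mu> v))"
      by (intro mult_left_mono LH_normH src_spH v) simp
    also have "\<dots> \<le> normH sbar k * (1 * normH sbar (src sbar \<mu> v))"
      using mu \<rho> by (intro mult_left_mono mult_right_mono) auto
    finally show "\<bar>innerH sbar k (LH sbar \<mu> \<rho> (src sbar \<mu> v))\<bar> \<le> normH sbar k * normH sbar (src sbar \<mu> v)" by simp
  qed
  finally have *: "normH sbar k * normH sbar k \<le> normH sbar k * (d * normH sbar (src sbar \<mu> v))" by (simp add: mult_ac)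
  show ?thesis
    unfolding k_def[symmetric] using * d
    by (cases "normH sbar k = 0") (auto simp: less_le)
qed

end

text \<open>Density of V in H by an energy identity. The function \<open>v = bres sbar 1 a\<close>
  solves \<open>v - v' = a\<close>, and the integral of \<open>v * v'\<close> is
  \<open>- (v 0)^2 / 2\<close>. Testing orthogonality with \<open>v\<close> itself gives
  \<open>0 = |v|^2 + (v 0)^2 / 2\<close>, so \<open>v\<close> vanishes and \<open>a\<close> is
  null.\<close>

lemma spH_orthogonal_spV:
  assumes a: "a \<in> spH sbar" and orth: "\<And>v. v \<in> spV sbar \<Longrightarrow> innerH sbar a v = 0"
  shows "AE s in ageM sbar. a s = 0"
proof -
  define v where "v = bres sbar 1 a"
  have v: "v \<in> spV sbar" unfolding v_def by (intro bres_spV a) simp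
  have diff: "v t - v s = (LBINT r:{s<..<t}. v r - zx sbar a r)" if "0 \<le> s" "s \<le> t" for s t
    using bres_diff[OF zero_less_one a that] by (simp add: v_def)
  have vL: "v \<in> L2 lborel" unfolding v_def by (intro bres_L2 a) simp
  have zL: "zx sbar a \<in> L2 lborel" using a by (simp add: spH_zx)
  have gL: "(\<lambda>r. v r - zx sbar a r) \<in> L2 lborel" by (rule L2_diff[OF vL zL])
  have sq: "v t * v t - v s * v s = (LBINT r:{s<..<t}. 2 * (v r * (v r - zx sbar a r)))" if "0 \<le> s" "s \<le> t" for s t
    using integral_by_parts_AC[OF that(2) L2_set_integrable[OF gL] L2_set_integrable[OF gL], of v v] diff[OF that(1)]
    by (simp add: mult.commute)
  define w where "w = (\<lambda>r. v r * (v r - zx sbar a r))"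
  have w: "integrable lborel w" unfolding w_def by (rule L2_integrable_mult[OF vL gL])
  have "AE r in lborel. v r = zx sbar v r" using zx_bres[of sbar 1 a] by (simp add: v_def eq_commute)
  then have wz: "(LBINT r. w r) = innerH sbar v v - innerH sbar a v"
  proof -
    assume ae: "AE r in lborel. v r = zx sbar v r"
    have zv: "zx sbar v \<in> L2 lborel" using spV_spH[OF v] by (simp add: spH_zx)
    have "(LBINT r. w r) = (LBINT r. zx sbar v r * zx sbar v r - zx sbar a r * zx sbar v r)"
      by (rule integral_cong_AE) (use ae vL zL zv in \<open>auto simp: w_def L2_def algebra_simps\<close>)
    then show ?thesis
      using L2_integrable_mult[OF zv zv] L2_integrable_mult[OF zL zv] by (simp add: innerH_zx)
  qed
  have lim: "((\<lambda>t. LBINT r. indicator {..t} r *\<^sub>R w r) \<longlongrightarrow> (LBINT r. w r)) at_top"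
    by (rule tendsto_integral_at_top[OF _ w]) simp
  have val: "(LBINT r. indicator {..t} r *\<^sub>R w r) = (v t * v t - v 0 * v 0) / 2" if "0 \<le> t" for t
  proof -
    have wm: "w \<in> borel_measurable borel" using w by (auto dest: borel_measurable_integrable)
    have "(LBINT r. indicator {..t} r *\<^sub>R w r) = (LBINT r. indicator {0<..<t} r * w r)"
    proof (rule integral_cong_AE)
      show "AE r in lborel. indicator {..t} r *\<^sub>R w r = indicator {0<..<t} r * w r"
        using AE_lborel_singleton[of 0] AE_lborel_singleton[of t]
        by eventually_elim (use spV_outside[OF v] in \<open>auto simp: indicator_def w_def\<close>)
    qed (use wm in auto)
    also have "\<dots> = (v t * v t - v 0 * v 0) / 2"
      unfolding sq[OF order_refl that] set_integral_mult_right by (simp add: w_def set_lebesgue_integral_def)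
    finally show ?thesis .
  qed
  have "((\<lambda>t. (v t * v t - v 0 * v 0) / 2) \<longlongrightarrow> (LBINT r. w r)) at_top"
    by (rule Lim_transform_eventually[OF lim])
      (use eventually_ge_at_top[of 0] in \<open>eventually_elim, use val in auto\<close>)
  then have "((\<lambda>t. (v t * v t - v 0 * v 0) / 2) \<longlongrightarrow> innerH sbar v v) at_top"
    using orth[OF v] wz by simp
  moreover have "((\<lambda>t. (v t * v t - v 0 * v 0) / 2) \<longlongrightarrow> (0 * 0 - v 0 * v 0) / 2) at_top"
    by (intro tendsto_intros spV_tendsto[OF v]) simp
  ultimately have "innerH sbar v v = - (v 0 * v 0) / 2" using tendsto_unique[OF trivial_limit_at_top_linorder] by fastforce
  then have e: "innerH sbar v v + v 0 * v 0 / 2 = 0" by simp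
  have "0 \<le> innerH sbar v v" by (simp flip: normH_power2)
  moreover have "0 \<le> v 0 * v 0" by simp
  ultimately have "innerH sbar v v = 0" "v 0 * v 0 = 0" using e by linarith+
  then have z: "innerH sbar v v = 0" "v 0 = 0" by simp_all
  have "l2norm lborel v = normH sbar v"
    unfolding normH_zx by (rule l2norm_cong_AE)
      (use zx_bres[of sbar 1 a] vL spH_zx[of v sbar] spV_spH[OF v] in \<open>auto simp: v_def eq_commute L2_def\<close>)
  then have "l2norm lborel v = 0" using z(1) normH_power2[of sbar v] by simp
  then have ae0: "AE r in lborel. v r = 0" using l2norm_eq_0_iff[OF vL] by simp
  have v0: "v t = 0" for t
  proof (cases "0 \<le> t")
    case True
    have "(LBINT r:{0<..<t}. 2 * (v r * (v r - zx sbar a r))) = 0"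
      unfolding set_lebesgue_integral_def by (rule integral_eq_zero_AE) (use ae0 in \<open>eventually_elim, simp\<close>)
    then show ?thesis using sq[OF order_refl True] z(2) by simp
  qed (use spV_outside[OF v] in auto)
  have zero: "(\<lambda>s. 0) \<in> spH sbar" by (simp add: spH_L2)
  have "bres sbar 1 a = bres sbar 1 (\<lambda>s. 0)" using v0 by (auto simp: v_def fun_eq_iff bres_def zx_def)
  with src_bres[OF zero_less_one a] have "AE s in ageM sbar. src sbar 1 (bres sbar 1 (\<lambda>s. 0)) s = a s"
    by simp
  with src_bres[OF zero_less_one zero] show ?thesis by eventually_elim simp
qed

section \<open>The adjoint of \<open>A\<^sub>0\<close>\<close>

lemma exp_times_H1:
  assumes g: "H1_deriv sbar v g" and c: "0 \<le> c"
  shows "H1_deriv sbar (\<lambda>s. exp (- c * s) * v s) (\<lambda>s. exp (- c * s) * (g s - c * v s))"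
  unfolding H1_deriv_def
proof (intro conjI allI impI)
  have vH: "v \<in> spH sbar" and gH: "g \<in> spH sbar" using g by (auto simp: H1_deriv_def)
  have expH: "(\<lambda>s. exp (- c * s) * f s) \<in> spH sbar" if "f \<in> spH sbar" for f
    unfolding spH_L2
  proof (rule L2_bound[of f _ _ 1])
    show "f \<in> L2 (ageM sbar)" using that by (simp add: spH_L2)
    have "(\<lambda>s. exp (- c * s)) \<in> borel_measurable (ageM sbar)"
      unfolding measurable_ageM zx_def by measurable
    then show "(\<lambda>s. exp (- c * s) * f s) \<in> borel_measurable (ageM sbar)"
      using that by (intro borel_measurable_times) (auto simp: spH_def)
    show "AE s in ageM sbar. \<bar>exp (- c * s) * f s\<bar> \<le> 1 * \<bar>f s\<bar>"
      using c by (intro AE_I2) (auto simp: space_ageM ages_def abs_mult intro!: mult_left_le_one_le)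
  qed
  show "(\<lambda>s. exp (- c * s) * v s) \<in> spH sbar" by (rule expH[OF vH])
  show "(\<lambda>s. exp (- c * s) * (g s - c * v s)) \<in> spH sbar"
    using expH[OF spH_lincomb[OF gH vH, of 1 "-c"]] by simp
  fix s t :: real assume st: "0 \<le> s" "s \<le> t" "ereal t \<le> sbar"
  have "exp (- c * t) * v t - exp (- c * s) * v s = (LBINT r:{s<..<t}. exp (- c * r) * (zx sbar g r + - c * v r))"
  proof (rule exp_times_AC[OF st(2) zx_set_integrable[OF gH]])
    fix t' assume t': "s \<le> t'" "t' \<le> t"
    then have "ereal t' \<le> sbar" using st(3) by (auto intro: order_trans[of _ "ereal t"])
    then show "v t' - v s = (LBINT r:{s<..<t'}. zx sbar g r)"
      using g st(1) t' Ioo_integral_zx[of s t' sbar g] by (simp add: H1_deriv_def)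
  qed
  also have "\<dots> = (LBINT r:{s<..<t}. exp (- c * r) * (g r - c * v r))"
    using Ioo_subset_ages[OF st(1,3)] by (intro set_lebesgue_integral_cong) (auto simp: zx_def)
  finally show "exp (- c * t) * v t - exp (- c * s) * v s = (LBINT r:{s<..<t}. exp (- c * r) * (g r - c * v r))" .
qed

text \<open>Multiplying \<open>v \<in> V\<close> by \<open>1 - exp (- n s)\<close> enforces the boundary condition of \<open>A\<^sub>0\<close> at \<open>0\<close> and
  converges to \<open>v\<close> in \<open>H\<close>.\<close>

lemma spH_orthogonal_A0:
  assumes a: "a \<in> spH sbar" and orth: "\<And>f y. (f, y) \<in> A0_graph sbar \<mu> \<Longrightarrow> innerH sbar a f = 0"
  shows "AE s in ageM sbar. a s = 0"
proof (rule spH_orthogonal_spV[OF a])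
  fix v assume v: "v \<in> spV sbar"
  note vH = spV_spH[OF v]
  have int: "integrable (ageM sbar) (\<lambda>s. a s * v s)"
    using L2_integrable_mult a vH by (auto simp: spH_L2)
  define e where "e = (\<lambda>n s. exp (- real n * s) * v s)"
  have eH1: "H1_deriv sbar (e n) (\<lambda>s. exp (- real n * s) * (weak_deriv sbar v s - real n * v s))" for n
    unfolding e_def by (rule exp_times_H1[OF weak_deriv_H1[OF v]]) simp
  have eH: "e n \<in> spH sbar" for n using eH1[of n] by (simp add: H1_deriv_def)
  \<comment> \<open>\<open>v - e n\<close> vanishes at 0 and hence lies in the domain of
    \<open>A\<^sub>0\<close>, so the pairing with \<open>e n\<close> does not depend on
    \<open>n\<close>; letting \<open>n\<close> grow shows that it is 0.\<close>
  have eq: "innerH sbar a (e n) = innerH sbar a v" for n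
  proof -
    define F where "F = (\<lambda>s. 1 * v s + (- 1) * e n s)"
    define G where "G = (\<lambda>s. 1 * weak_deriv sbar v s + (- 1) * (exp (- real n * s) * (weak_deriv sbar v s - real n * v s)))"
    have FG: "H1_deriv sbar F G" unfolding F_def G_def
      by (rule H1_deriv_lincomb[OF weak_deriv_H1[OF v] eH1])
    have "(\<lambda>s. - G s - \<mu> * F s) \<in> spH sbar"
      using FG spH_lincomb[of G sbar F "-1" "-\<mu>"] by (simp add: H1_deriv_def)
    then have "(F, \<lambda>s. - G s - \<mu> * F s) \<in> A0_graph sbar \<mu>"
    proof -
      have "F \<in> spH sbar" using FG by (simp add: H1_deriv_def)
      moreover have "\<exists>F' G'. H1_deriv sbar F' G' \<and> F' 0 = 0 \<and> (AE s in ageM sbar. F s = F' s) \<and>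
          (AE s in ageM sbar. - G s - \<mu> * F s = - G' s - \<mu> * F' s)"
        by (rule exI[of _ F], rule exI[of _ G]) (use FG in \<open>simp, simp add: F_def e_def\<close>)
      moreover assume "(\<lambda>s. - G s - \<mu> * F s) \<in> spH sbar"
      ultimately show ?thesis unfolding A0_graph_def by simp
    qed
    from orth[OF this] show ?thesis
      using innerH_lincomb'[OF vH eH a, of 1 "-1" n] by (simp add: F_def)
  qed
  have "(\<lambda>n. innerH sbar a (e n)) \<longlonglongrightarrow> (LINT s|ageM sbar. 0)"
    unfolding innerH_def
  proof (rule integral_dominated_convergence[where w = "\<lambda>s. \<bar>a s * v s\<bar>"])
    show "AE s in ageM sbar. (\<lambda>n. a s * e n s) \<longlonglongrightarrow> 0"
    proof (rule AE_I2)
      fix s assume "s \<in> space (ageM sbar)"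
      then have s: "0 < s" by (simp add: space_ageM ages_def)
      have p: "(\<lambda>n. exp (- s) ^ n) \<longlonglongrightarrow> 0" by (rule LIMSEQ_power_zero) (use s in simp)
      then have "(\<lambda>n. a s * ((exp (- s) ^ n) * v s)) \<longlonglongrightarrow> a s * (0 * v s)"
        by (intro tendsto_mult tendsto_const)
      then show "(\<lambda>n. a s * e n s) \<longlonglongrightarrow> 0" by (simp add: e_def flip: exp_of_nat_mult)
    qed
    show "AE s in ageM sbar. norm (a s * e n s) \<le> \<bar>a s * v s\<bar>" for n
      by (intro AE_I2) (auto simp: e_def space_ageM ages_def abs_mult intro!: mult_left_mono mult_left_le_one_le)
    show "(\<lambda>s. a s * e n s) \<in> borel_measurable (ageM sbar)" for n
      using a eH[of n] by (intro borel_measurable_times) (auto simp: spH_def)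
  qed (use int in auto)
  then show "innerH sbar a v = 0" unfolding eq by (simp add: LIMSEQ_const_iff)
qed

text \<open>A bounded functional on H is the pairing with some \<open>a\<close>, and orthogonality
  to a dense set makes \<open>a\<close> null. It extends adjointness identities from the domain of
  \<open>A\<^sub>0\<close>, or from V, to H without choosing approximating sequences.\<close>

lemma functional_zero_on_A0:
  assumes lin: "\<And>f g a b. f \<in> spH sbar \<Longrightarrow> g \<in> spH sbar \<Longrightarrow> F (\<lambda>x. a * f x + b * g x) = a * F f + b * F g"
    and bdd: "\<And>f. f \<in> spH sbar \<Longrightarrow> \<bar>F f\<bar> \<le> C * normH sbar f"
    and zero: "(\<forall>f y. (f, y) \<in> A0_graph sbar \<mu> \<longrightarrow> F f = 0) \<or> (\<forall>v\<in>spV sbar. F v = 0)"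
    and f: "f \<in> spH sbar"
  shows "F f = 0"
proof -
  obtain a where a: "a \<in> L2 (ageM sbar)" "\<And>f. f \<in> L2 (ageM sbar) \<Longrightarrow> F f = (LINT x|ageM sbar. a x * f x)"
    using L2_Riesz[of "ageM sbar" F C] lin bdd by (auto simp: spH_L2 normH_l2norm)
  then have aH: "a \<in> spH sbar" and Fa: "F f = innerH sbar a f" if "f \<in> spH sbar" for f
    using that by (simp_all add: spH_L2 innerH_def)
  note aH = aH[OF f]
  have "AE s in ageM sbar. a s = 0"
    using zero
  proof
    assume "\<forall>f y. (f, y) \<in> A0_graph sbar \<mu> \<longrightarrow> F f = 0"
    then show ?thesis by (intro spH_orthogonal_A0[OF aH, of \<mu>]) (auto simp: Fa A0_graph_def)
  next
    assume "\<forall>v\<in>spV sbar. F v = 0"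
    then show ?thesis by (intro spH_orthogonal_spV[OF aH]) (auto simp: Fa[symmetric] spV_spH)
  qed
  then show ?thesis unfolding Fa[OF f] innerH_def
    by (intro integral_eq_zero_AE) (auto elim: eventually_mono)
qed

text \<open>Integration by parts without boundary terms. Because \<open>F 0 = 0\<close> and
  \<open>v\<close> vanishes at the right end, \<open>F\<close> and \<open>v\<close> are integrals of
  \<open>c\<close> and \<open>b\<close> against the same kernel \<open>ekern\<close>, over its first
  and its second argument. Both pairings are then one double integral.\<close>

lemma A0_adjoint:
  assumes mu: "0 < \<mu>" and fy: "(f, y) \<in> A0_graph sbar \<mu>" and v: "v \<in> spV sbar"
  shows "innerH sbar y v = - innerH sbar f (src sbar \<mu> v)"
proof -
  obtain F G where FG: "H1_deriv sbar F G" "F 0 = 0" "AE s in ageM sbar. f s = F s"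
      "AE s in ageM sbar. y s = - G s - \<mu> * F s" and fyH: "f \<in> spH sbar" "y \<in> spH sbar"
    using fy by (auto simp: A0_graph_def)
  define c where "c = (\<lambda>s. G s + \<mu> * F s)"
  define b where "b = src sbar \<mu> v"
  have FH: "F \<in> spH sbar" and GH: "G \<in> spH sbar" using FG(1) by (auto simp: H1_deriv_def)
  have c: "c \<in> spH sbar" using spH_lincomb[OF GH FH, of 1 \<mu>] by (simp add: c_def)
  have b: "b \<in> spH sbar" using v by (simp add: b_def src_spH)
  have vb: "v = bres sbar \<mu> b" using v mu by (simp add: b_def bres_src)
  have zc: "zx sbar c \<in> L2 lborel" and zb: "zx sbar b \<in> L2 lborel" using b c by (simp_all add: spH_zx)
  have [measurable]: "zx sbar b \<in> borel_measurable borel" "zx sbar c \<in> borel_measurable borel"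
    using b c by (simp_all add: spH_def measurable_ageM)
  have Fr: "F r = (LBINT s. ekern \<mu> s r * zx sbar c s)" if r: "r \<in> ages sbar" for r
  proof -
    have r0: "0 < r" "ereal r \<le> sbar" using r by (auto simp: ages_def)
    have "exp (\<mu> * r) * F r - exp (\<mu> * 0) * F 0 = (LBINT s:{0<..<r}. exp (\<mu> * s) * (zx sbar G s + \<mu> * F s))"
    proof (rule exp_times_AC[OF _ zx_set_integrable[OF GH]])
      fix t assume t: "0 \<le> t" "t \<le> r"
      then have "ereal t \<le> sbar" using r0 by (auto intro: order_trans[of _ "ereal r"])
      then show "F t - F 0 = (LBINT r:{0<..<t}. zx sbar G r)"
        using FG(1) t Ioo_integral_zx[of 0 t sbar G] by (simp add: H1_deriv_def)
    qed (use r0 in simp)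
    then have "F r = exp (- \<mu> * r) * (LBINT s:{0<..<r}. exp (\<mu> * s) * (zx sbar G s + \<mu> * F s))"
      using FG(2) by (simp add: exp_minus field_simps)
    also have "\<dots> = (LBINT s. exp (- \<mu> * r) * (indicator {0<..<r} s * (exp (\<mu> * s) * (zx sbar G s + \<mu> * F s))))"
      by (simp add: set_lebesgue_integral_def)
    also have "\<dots> = (LBINT s. ekern \<mu> s r * zx sbar c s)"
    proof (intro Bochner_Integration.integral_cong refl)
      fix s
      have "exp (- \<mu> * r) * (exp (\<mu> * s) * z) = exp (- \<mu> * (r - s)) * z" for z
        by (simp add: algebra_simps flip: mult.assoc exp_add)
      moreover have "s \<in> ages sbar" if "0 < s" "s < r"
        using that r0 Ioo_subset_ages[of 0 r sbar] by auto
      moreover have "s \<notin> ages sbar" if "\<not> 0 < s" using that by (simp add: ages_def)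
      ultimately show "exp (- \<mu> * r) * (indicator {0<..<r} s * (exp (\<mu> * s) * (zx sbar G s + \<mu> * F s))) = ekern \<mu> s r * zx sbar c s"
        by (cases "0 < s \<and> s < r") (auto simp: ekern_def zx_def c_def)
    qed
    finally show ?thesis .
  qed
  define K where "K = (\<lambda>(s, r). zx sbar c s * (ekern \<mu> s r * zx sbar b r))"
  have K: "integrable (lborel \<Otimes>\<^sub>M lborel) K"
  proof (rule lborel_pair.Fubini_integrable)
    show "K \<in> borel_measurable (lborel \<Otimes>\<^sub>M lborel)" unfolding K_def by measurable
    show "AE s in lborel. integrable lborel (\<lambda>r. K (s, r))"
      using ekern_zx_integrable[OF mu b] by (simp add: K_def)
    have absb: "(\<lambda>s. \<bar>b s\<bar>) \<in> spH sbar" using b by (auto simp: spH_L2 L2_def)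
    have "(\<lambda>s. \<bar>zx sbar c s\<bar>) \<in> L2 lborel" using zc by (auto simp: L2_def)
    then have "integrable lborel (\<lambda>s. \<bar>zx sbar c s\<bar> * bres sbar \<mu> (\<lambda>s. \<bar>b s\<bar>) s)"
      by (rule L2_integrable_mult[OF _ bres_L2[OF mu absb]])
    moreover have "\<bar>zx sbar c s\<bar> * bres sbar \<mu> (\<lambda>s. \<bar>b s\<bar>) s = (LBINT r. norm (K (s, r)))" for s
    proof (cases "0 \<le> s")
      case True
      have "zx sbar (\<lambda>s. \<bar>b s\<bar>) r = \<bar>zx sbar b r\<bar>" for r by (simp add: zx_def indicator_def)
      then show ?thesis using True by (simp add: K_def bres_def abs_mult)
    qed (simp add: K_def zx_def ages_def)
    ultimately show "integrable lborel (\<lambda>s. LBINT r. norm (K (s, r)))" by simp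
  qed
  have vm: "v \<in> borel_measurable (ageM sbar)" and bm: "b \<in> borel_measurable (ageM sbar)"
    using spV_spH[OF v] b by (auto simp: spH_def)
  have "innerH sbar y v = innerH sbar (\<lambda>s. (- 1) * c s + 0 * c s) v"
    using FG(4) c fyH vm spH_lincomb[OF c c, of "-1" 0]
    by (intro innerH_cong_AE) (auto simp: spH_def c_def elim!: eventually_mono)
  also have "\<dots> = - innerH sbar c v"
    using innerH_lincomb[OF c c spV_spH[OF v], of "-1" 0] by simp
  also have "innerH sbar c v = (LBINT s. LBINT r. K (s, r))"
    unfolding innerH_zx_left
  proof (intro Bochner_Integration.integral_cong refl)
    show "zx sbar c s * v s = (LBINT r. K (s, r))" for s
      by (cases "0 \<le> s") (auto simp: K_def vb bres_def zx_def ages_def)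
  qed
  also have "\<dots> = (LBINT r. LBINT s. K (s, r))"
    using lborel_pair.Fubini_integral[of "\<lambda>s r. K (s, r)"] K by simp
  also have "\<dots> = (LBINT r. zx sbar b r * F r)"
  proof (intro Bochner_Integration.integral_cong refl)
    fix r
    have "(LBINT s. K (s, r)) = (LBINT s. zx sbar b r * (ekern \<mu> s r * zx sbar c s))"
      unfolding K_def by (intro Bochner_Integration.integral_cong refl) simp
    then show "(LBINT s. K (s, r)) = zx sbar b r * F r"
      using Fr[of r] by (cases "r \<in> ages sbar") (auto simp: zx_def)
  qed
  also have "\<dots> = innerH sbar b F" by (simp add: innerH_zx_left)
  also have "\<dots> = innerH sbar f b"
    unfolding innerH_commute[of sbar b F]
    using FG(3) fyH FH bm by (intro innerH_cong_AE) (auto simp: spH_def elim!: eventually_mono)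
  finally show ?thesis by (simp add: b_def)
qed

lemma normH_diff_zero_iff:
  assumes "f \<in> spH sbar" "g \<in> spH sbar"
  shows "normH sbar (\<lambda>s. f s - g s) = 0 \<longleftrightarrow> (AE s in ageM sbar. f s = g s)"
  unfolding normH_l2norm using L2_diff[of f "ageM sbar" g] assms
  by (subst l2norm_eq_0_iff) (auto simp: spH_L2)

lemma spH_diff: "f \<in> spH sbar \<Longrightarrow> g \<in> spH sbar \<Longrightarrow> (\<lambda>s. f s - g s) \<in> spH sbar"
  unfolding spH_L2 by (rule L2_diff)

lemma innerH_diff_left: "f \<in> spH sbar \<Longrightarrow> g \<in> spH sbar \<Longrightarrow> h \<in> spH sbar \<Longrightarrow>
    innerH sbar (\<lambda>s. f s - g s) h = innerH sbar f h - innerH sbar g h"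
  using innerH_lincomb[of f sbar g h 1 "-1"] by simp

lemma innerH_diff_right: "f \<in> spH sbar \<Longrightarrow> g \<in> spH sbar \<Longrightarrow> h \<in> spH sbar \<Longrightarrow>
    innerH sbar h (\<lambda>s. f s - g s) = innerH sbar h f - innerH sbar h g"
  using innerH_lincomb'[of f sbar g h 1 "-1"] by simp

lemma innerH_cong_AE_left:
  "f \<in> spH sbar \<Longrightarrow> f' \<in> spH sbar \<Longrightarrow> g \<in> spH sbar \<Longrightarrow> AE s in ageM sbar. f s = f' s \<Longrightarrow>
    innerH sbar f g = innerH sbar f' g"
  by (rule innerH_cong_AE) (auto simp: spH_def)

lemma innerH_tendsto:
  assumes f: "\<forall>\<^sub>F x in F. f x \<in> spH sbar" "f0 \<in> spH sbar" "((\<lambda>x. normH sbar (\<lambda>s. f x s - f0 s)) \<longlongrightarrow> 0) F"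
    and g: "\<forall>\<^sub>F x in F. g x \<in> spH sbar" "g0 \<in> spH sbar" "((\<lambda>x. normH sbar (\<lambda>s. g x s - g0 s)) \<longlongrightarrow> 0) F"
  shows "((\<lambda>x. innerH sbar (f x) (g x)) \<longlongrightarrow> innerH sbar f0 g0) F"
proof (rule LIM_zero_cancel, rule Lim_null_comparison)
  let ?df = "\<lambda>x. normH sbar (\<lambda>s. f x s - f0 s)" and ?dg = "\<lambda>x. normH sbar (\<lambda>s. g x s - g0 s)"
  show "\<forall>\<^sub>F x in F. norm (innerH sbar (f x) (g x) - innerH sbar f0 g0)
      \<le> ?df x * ?dg x + ?df x * normH sbar g0 + normH sbar f0 * ?dg x"
    using f(1) g(1)
  proof eventually_elim
    case (elim x)
    let ?f = "\<lambda>s. f x s - f0 s" and ?g = "\<lambda>s. g x s - g0 s"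
    have d: "?f \<in> spH sbar" "?g \<in> spH sbar" using elim f(2) g(2) by (auto intro: spH_diff)
    have "innerH sbar (f x) (g x) - innerH sbar f0 g0 = innerH sbar ?f ?g + innerH sbar ?f g0 + innerH sbar f0 ?g"
      using elim f(2) g(2) d by (simp add: innerH_diff_left innerH_diff_right)
    then show ?case
      using innerH_CS[OF d] innerH_CS[OF d(1) g(2)] innerH_CS[OF f(2) d(2)] by (simp add: abs_le_iff)
  qed
  have "((\<lambda>x. ?df x * ?dg x + ?df x * normH sbar g0 + normH sbar f0 * ?dg x) \<longlongrightarrow> 0 * 0 + 0 * normH sbar g0 + normH sbar f0 * 0) F"
    by (intro tendsto_intros f g)
  then show "((\<lambda>x. ?df x * ?dg x + ?df x * normH sbar g0 + normH sbar f0 * ?dg x) \<longlongrightarrow> 0) F" by simp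
qed

lemma normH_triangle: "f \<in> spH sbar \<Longrightarrow> g \<in> spH sbar \<Longrightarrow> normH sbar (\<lambda>s. f s + g s) \<le> normH sbar f + normH sbar g"
  unfolding spH_L2 normH_l2norm by (rule l2norm_triangle)

section \<open>The given semigroup as the adjoint of translation\<close>

context
  fixes sbar :: ereal and \<mu> :: real and S :: "real \<Rightarrow> fn \<Rightarrow> fn"
  assumes mu: "0 < \<mu>" and S: "generates_A0 sbar \<mu> S"
begin

private lemma C0_S: "C0_semigroup (spH sbar) (normH sbar) S" and gen: "generator (spH sbar) (normH sbar) S = A0_graph sbar \<mu>"
  using S by (auto simp: generates_A0_def)

lemma S_spH: "0 \<le> t \<Longrightarrow> x \<in> spH sbar \<Longrightarrow> S t x \<in> spH sbar"
  using C0_S by (simp add: C0_semigroup_def)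

lemma S_lin:
  assumes "0 \<le> t" "x \<in> spH sbar" "y \<in> spH sbar"
  shows "AE s in ageM sbar. S t (\<lambda>s. a * x s + b * y s) s = a * S t x s + b * S t y s"
proof -
  have eq: "a *\<^sub>R x + b *\<^sub>R y = (\<lambda>s. a * x s + b * y s)" by (simp add: fun_eq_iff scaleR_fun_def)
  have "normH sbar (S t (a *\<^sub>R x + b *\<^sub>R y) - (a *\<^sub>R S t x + b *\<^sub>R S t y)) = 0"
    using C0_S assms by (simp only: C0_semigroup_def)
  then have "normH sbar (\<lambda>s. S t (\<lambda>s. a * x s + b * y s) s - (a * S t x s + b * S t y s)) = 0"
    by (simp add: eq fun_diff_def scaleR_fun_def plus_fun_def)
  then show ?thesis
    using assms by (subst (asm) normH_diff_zero_iff) (auto intro!: S_spH spH_lincomb)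
qed

lemma S_bdd: "0 \<le> t \<Longrightarrow> \<exists>C. \<forall>x\<in>spH sbar. normH sbar (S t x) \<le> C * normH sbar x"
  using C0_S by (simp add: C0_semigroup_def)

lemma S_0: "x \<in> spH sbar \<Longrightarrow> AE s in ageM sbar. S 0 x s = x s"
proof -
  assume x: "x \<in> spH sbar"
  then have "normH sbar (\<lambda>s. S 0 x s - x s) = 0" using C0_S by (simp add: C0_semigroup_def fun_diff_def)
  then show ?thesis using x by (subst (asm) normH_diff_zero_iff) (auto intro: S_spH)
qed

lemma S_add:
  assumes "0 \<le> t" "0 \<le> r" "x \<in> spH sbar"
  shows "AE s in ageM sbar. S (t + r) x s = S t (S r x) s"
proof -
  have "normH sbar (\<lambda>s. S (t + r) x s - S t (S r x) s) = 0"
    using C0_S assms by (simp add: C0_semigroup_def fun_diff_def)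
  then show ?thesis using assms by (subst (asm) normH_diff_zero_iff) (auto intro: S_spH)
qed

lemma S_cont: "0 \<le> t \<Longrightarrow> x \<in> spH sbar \<Longrightarrow> ((\<lambda>r. normH sbar (\<lambda>s. S r x s - S t x s)) \<longlongrightarrow> 0) (at t within {0..})"
  using C0_S by (simp add: C0_semigroup_def fun_diff_def)

lemma A0_graph_iff: "(f, y) \<in> A0_graph sbar \<mu> \<longleftrightarrow> f \<in> spH sbar \<and> y \<in> spH sbar \<and>
    ((\<lambda>t. normH sbar (\<lambda>s. (1 / t) * (S t f s - f s) - y s)) \<longlongrightarrow> 0) (at_right 0)"
  unfolding gen[symmetric] generator_def by (simp add: fun_diff_def scaleR_fun_def)

text \<open>The difference quotient of \<open>S r f\<close> is, up to null sets, \<open>S r\<close>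
  applied to that of \<open>f\<close>, and \<open>S r\<close> is bounded.\<close>

lemma A0_graph_S:
  assumes fy: "(f, y) \<in> A0_graph sbar \<mu>" and r: "0 \<le> r"
  shows "(S r f, S r y) \<in> A0_graph sbar \<mu>"
proof -
  have H: "f \<in> spH sbar" "y \<in> spH sbar" and lim: "((\<lambda>t. normH sbar (\<lambda>s. (1 / t) * (S t f s - f s) - y s)) \<longlongrightarrow> 0) (at_right 0)"
    using fy by (auto simp: A0_graph_iff)
  obtain C where C: "\<And>x. x \<in> spH sbar \<Longrightarrow> normH sbar (S r x) \<le> C * normH sbar x" using S_bdd[OF r] by blast
  have "((\<lambda>t. normH sbar (\<lambda>s. (1 / t) * (S t (S r f) s - S r f s) - S r y s)) \<longlongrightarrow> 0) (at_right 0)"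
  proof (rule Lim_null_comparison)
    show "((\<lambda>t. C * normH sbar (\<lambda>s. (1 / t) * (S t f s - f s) - y s)) \<longlongrightarrow> 0) (at_right 0)"
      using tendsto_mult[OF tendsto_const lim, of C] by simp
    show "\<forall>\<^sub>F t in at_right 0. norm (normH sbar (\<lambda>s. (1 / t) * (S t (S r f) s - S r f s) - S r y s))
        \<le> C * normH sbar (\<lambda>s. (1 / t) * (S t f s - f s) - y s)"
      using eventually_at_right_less[of "0::real"]
    proof eventually_elim
      case (elim t)
      define z where "z = (\<lambda>s. 1 * S t f s + (- 1) * f s)"
      define z' where "z' = (\<lambda>s. (1 / t) * z s + (- 1) * y s)"
      have St: "S t f \<in> spH sbar" using elim H by (intro S_spH) auto
      have z: "z \<in> spH sbar" "z' \<in> spH sbar" unfolding z'_def z_def by (intro spH_lincomb St H)+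
      have "AE s in ageM sbar. (1 / t) * (S t (S r f) s - S r f s) - S r y s = S r z' s"
        using S_lin[OF r z(1) H(2), of "1 / t" "-1", folded z'_def] S_lin[OF r St H(1), of 1 "-1", folded z_def]
          S_add[OF less_imp_le[OF elim] r H(1)] S_add[OF r less_imp_le[OF elim] H(1)]
        by eventually_elim (simp add: add.commute)
      then have "normH sbar (\<lambda>s. (1 / t) * (S t (S r f) s - S r f s) - S r y s) = normH sbar (S r z')"
      proof (intro normH_cong_AE spH_measurable)
        have "(\<lambda>s. (1 / t) * (S t (S r f) s - S r f s) + (- 1) * S r y s) \<in> spH sbar"
          using elim r H by (intro spH_lincomb spH_diff S_spH) auto
        then show "(\<lambda>s. (1 / t) * (S t (S r f) s - S r f s) - S r y s) \<in> spH sbar" by simp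
      qed (use r z in \<open>auto intro: S_spH\<close>)
      also have "\<dots> \<le> C * normH sbar z'" by (rule C[OF z(2)])
      finally show ?case by (simp add: z'_def z_def)
    qed
  qed
  then show ?thesis using H r by (simp add: A0_graph_iff S_spH)
qed

text \<open>Translation by the smaller of the two times can be taken out of the difference, and it
  is a contraction.\<close>

lemma LV_close:
  assumes v: "v \<in> spV sbar" and "0 \<le> a" "0 \<le> b"
  shows "normH sbar (\<lambda>s. LV \<mu> a v s - LV \<mu> b v s) \<le> \<bar>a - b\<bar> * normH sbar (src sbar \<mu> v)"
proof -
  have main: "normH sbar (\<lambda>s. LV \<mu> a v s - LV \<mu> b v s) \<le> (b - a) * normH sbar (src sbar \<mu> v)" if "0 \<le> a" "a \<le> b" for a b
  proof -
    have "normH sbar (\<lambda>s. LV \<mu> a v s - LV \<mu> (b - a) (LV \<mu> a v) s) \<le> (b - a) * normH sbar (src sbar \<mu> (LV \<mu> a v))"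
      by (rule LV_Lipschitz[OF mu LV_spV[OF mu v]]) (use that in auto)
    also have "normH sbar (src sbar \<mu> (LV \<mu> a v)) = normH sbar (LH sbar \<mu> a (src sbar \<mu> v))"
      using src_LV[OF mu v that(1)] v that by (intro normH_cong_AE) (auto intro!: spH_measurable src_spH LH_spH LV_spV mu)
    also have "(b - a) * \<dots> \<le> (b - a) * (exp (- \<mu> * a) * normH sbar (src sbar \<mu> v))"
      using that v by (intro mult_left_mono LH_normH src_spH) auto
    also have "\<dots> \<le> (b - a) * (1 * normH sbar (src sbar \<mu> v))"
      using that mu by (intro mult_left_mono mult_right_mono) auto
    finally show ?thesis using that by (simp add: LV_add)
  qed
  show ?thesis
  proof (cases "a \<le> b")
    case False
    have "normH sbar (\<lambda>s. LV \<mu> a v s - LV \<mu> b v s) = normH sbar (\<lambda>s. LV \<mu> b v s - LV \<mu> a v s)"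
      using normH_uminus[of sbar "\<lambda>s. LV \<mu> a v s - LV \<mu> b v s"] by simp
    then show ?thesis using main[of b a] assms False by simp
  qed (use main[of a b] assms in simp)
qed

lemma LV_tendsto:
  assumes v: "v \<in> spV sbar" and a: "0 \<le> a" and p: "(p \<longlongrightarrow> a) F" "\<forall>\<^sub>F x in F. 0 \<le> p x"
  shows "((\<lambda>x. normH sbar (\<lambda>s. LV \<mu> (p x) v s - LV \<mu> a v s)) \<longlongrightarrow> 0) F"
proof (rule Lim_null_comparison)
  have "((\<lambda>x. \<bar>p x - a\<bar> * normH sbar (src sbar \<mu> v)) \<longlongrightarrow> \<bar>a - a\<bar> * normH sbar (src sbar \<mu> v)) F"
    by (intro tendsto_intros p)
  then show "((\<lambda>x. \<bar>p x - a\<bar> * normH sbar (src sbar \<mu> v)) \<longlongrightarrow> 0) F" by simp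
  show "\<forall>\<^sub>F x in F. norm (normH sbar (\<lambda>s. LV \<mu> (p x) v s - LV \<mu> a v s)) \<le> \<bar>p x - a\<bar> * normH sbar (src sbar \<mu> v)"
    using p(2) by eventually_elim (use LV_close[OF v _ a] in simp)
qed

text \<open>\<open>\<phi>(r) = \<langle>S(r) h, L(t - r) v\<rangle>\<close> has vanishing right derivative, since \<open>A\<^sub>0\<close> and the generator of \<open>L\<close>
  are adjoint to each other.\<close>

lemma S_adjoint_domain:
  assumes hy: "(h, y) \<in> A0_graph sbar \<mu>" and v: "v \<in> spV sbar" and t: "0 \<le> t"
  shows "innerH sbar (S t h) v = innerH sbar h (LV \<mu> t v)"
proof -
  define \<phi> where "\<phi> = (\<lambda>r. innerH sbar (S r h) (LV \<mu> (t - r) v))"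
  have hH: "h \<in> spH sbar" using hy by (simp add: A0_graph_iff)
  have LvH: "LV \<mu> a v \<in> spH sbar" if "0 \<le> a" for a using that v by (intro spV_spH LV_spV mu)
  have "\<phi> t = \<phi> 0"
  proof (rule right_derivative_zero_const[OF t])
    show "continuous_on {0..t} \<phi>"
      unfolding continuous_on_def \<phi>_def
    proof (intro ballI innerH_tendsto)
      fix r assume r: "r \<in> {0..t}"
      have ev: "\<forall>\<^sub>F x in at r within {0..t}. x \<in> {0..t}" by (simp add: eventually_at_filter)
      show "\<forall>\<^sub>F x in at r within {0..t}. S x h \<in> spH sbar" "\<forall>\<^sub>F x in at r within {0..t}. LV \<mu> (t - x) v \<in> spH sbar"
        using ev by (auto elim!: eventually_mono intro: S_spH LvH hH)
      show "S r h \<in> spH sbar" "LV \<mu> (t - r) v \<in> spH sbar" using r by (auto intro: S_spH LvH hH)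
      show "((\<lambda>x. normH sbar (\<lambda>s. S x h s - S r h s)) \<longlongrightarrow> 0) (at r within {0..t})"
        using S_cont[of r h] r hH by (auto intro: tendsto_within_subset)
      show "((\<lambda>x. normH sbar (\<lambda>s. LV \<mu> (t - x) v s - LV \<mu> (t - r) v s)) \<longlongrightarrow> 0) (at r within {0..t})"
        using r ev by (intro LV_tendsto v) (auto intro!: tendsto_intros elim!: eventually_mono)
    qed
    fix r assume r: "0 \<le> r" "r < t"
    define k yk where "k = S r h" and "yk = S r y"
    have ky: "(k, yk) \<in> A0_graph sbar \<mu>" unfolding k_def yk_def by (rule A0_graph_S[OF hy r(1)])
    then have kH: "k \<in> spH sbar" and ykH: "yk \<in> spH sbar"
      and lim: "((\<lambda>d. normH sbar (\<lambda>s. (1 / d) * (S d k s - k s) - yk s)) \<longlongrightarrow> 0) (at_right 0)"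
      by (auto simp: A0_graph_iff)
    define w where "w = LV \<mu> (t - r) v"
    define M where "M = normH sbar yk * normH sbar (src sbar \<mu> v)"
    have ev: "\<forall>\<^sub>F d in at_right 0. 0 < d \<and> d < t - r"
      using r unfolding eventually_at_right_field by (intro exI[of _ "t - r"]) auto
    \<comment> \<open>Product rule for the pairing: this is the contribution of the varying
      \<open>S r h\<close>. The next claim treats the varying \<open>LV\<close>, and the two limits
      cancel.\<close>
    have first: "((\<lambda>d. innerH sbar (\<lambda>s. (1 / d) * (S d k s - k s)) (LV \<mu> (t - r - d) v)) \<longlongrightarrow> innerH sbar yk w) (at_right 0)"
    proof (rule innerH_tendsto[OF _ ykH lim])
      show "\<forall>\<^sub>F d in at_right 0. (\<lambda>s. (1 / d) * (S d k s - k s)) \<in> spH sbar"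
        using ev
      proof eventually_elim
        case (elim d)
        show ?case using spH_lincomb[OF S_spH[of d k] kH, of "1/d" "-1/d"] elim kH by (simp add: diff_divide_distrib)
      qed
      show "w \<in> spH sbar" unfolding w_def using r by (intro LvH) simp
      show "\<forall>\<^sub>F d in at_right 0. LV \<mu> (t - r - d) v \<in> spH sbar" using ev by eventually_elim (auto intro: LvH)
      have "((\<lambda>d. t - r - d) \<longlongrightarrow> t - r - 0) (at_right 0)" by (intro tendsto_intros)
      then show "((\<lambda>d. normH sbar (\<lambda>s. LV \<mu> (t - r - d) v s - w s)) \<longlongrightarrow> 0) (at_right 0)"
        unfolding w_def using r ev by (intro LV_tendsto v) (auto elim!: eventually_mono)
    qed
    have second: "((\<lambda>d. (innerH sbar k (LV \<mu> (t - r - d) v) - innerH sbar k w) / d) \<longlongrightarrow> - innerH sbar yk w) (at_right 0)"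
    proof (rule LIM_zero_cancel, rule Lim_null_comparison)
      have "((\<lambda>d. d * M) \<longlongrightarrow> 0 * M) (at_right 0)" by (intro tendsto_intros)
      then show "((\<lambda>d. d * M) \<longlongrightarrow> 0) (at_right 0)" by simp
      show "\<forall>\<^sub>F d in at_right 0. norm ((innerH sbar k (LV \<mu> (t - r - d) v) - innerH sbar k w) / d - - innerH sbar yk w) \<le> d * M"
        using ev
      proof eventually_elim
        case (elim d)
        define w' where "w' = LV \<mu> (t - r - d) v"
        have w': "w' \<in> spV sbar" unfolding w'_def using elim by (intro LV_spV mu v) simp
        have w: "w = LV \<mu> d w'" unfolding w_def w'_def using elim by (simp add: LV_add)
        have d: "0 \<le> d" using elim by simp
        note inc = LV_increment[OF mu kH w' d]
        \<comment> \<open>Adjointness moves the derivative from the translate of \<open>v\<close> to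
          \<open>k\<close>. The integrand is then within \<open>d * M\<close> of
          \<open>- innerH sbar yk w\<close>, and so is its mean over \<open>(0, d)\<close>.\<close>
        have val: "innerH sbar k (LH sbar \<mu> \<rho> (src sbar \<mu> w')) = - innerH sbar yk (LV \<mu> (t - r - d + \<rho>) v)" if "0 < \<rho>" for \<rho>
        proof -
          have "innerH sbar k (LH sbar \<mu> \<rho> (src sbar \<mu> w')) = innerH sbar k (src sbar \<mu> (LV \<mu> \<rho> w'))"
            by (rule innerH_src_LV[symmetric]) (use mu w' that kH in auto)
          also have "\<dots> = - innerH sbar yk (LV \<mu> \<rho> w')"
            using A0_adjoint[OF mu ky LV_spV[OF mu w', of \<rho>]] that by simp
          finally show ?thesis using elim that by (simp add: w'_def LV_add add.commute)
        qed
        have ind: "integrable lborel (\<lambda>\<rho>. indicator {0<..<d} \<rho> * innerH sbar yk w)"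
          using elim by (auto intro!: integrable_real_indicator)
        have "(LBINT \<rho>:{0<..<d}. innerH sbar k (LH sbar \<mu> \<rho> (src sbar \<mu> w')) + innerH sbar yk w)
            = (LBINT \<rho>:{0<..<d}. innerH sbar k (LH sbar \<mu> \<rho> (src sbar \<mu> w'))) + d * innerH sbar yk w"
          using inc(1) ind elim by (subst set_integral_add(2)) (auto simp: set_integrable_def set_lebesgue_integral_def)
        moreover have "\<bar>LBINT \<rho>:{0<..<d}. innerH sbar k (LH sbar \<mu> \<rho> (src sbar \<mu> w')) + innerH sbar yk w\<bar> \<le> d * (d * M)"
        proof (rule Ioo_integral_bound[OF mu _ d])
          show "set_integrable lborel {0<..<d} (\<lambda>\<rho>. innerH sbar k (LH sbar \<mu> \<rho> (src sbar \<mu> w')) + innerH sbar yk w)"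
            using inc(1) ind by (intro set_integral_add(1)) (auto simp: set_integrable_def)
          fix \<rho> assume \<rho>: "0 < \<rho>" "\<rho> < d"
          have LL: "LV \<mu> (t - r - d + \<rho>) v \<in> spH sbar" "w \<in> spH sbar" unfolding w_def using \<rho> elim by (auto intro!: LvH)
          have eq: "innerH sbar k (LH sbar \<mu> \<rho> (src sbar \<mu> w')) + innerH sbar yk w = innerH sbar yk (\<lambda>s. w s - LV \<mu> (t - r - d + \<rho>) v s)"
            using val[OF \<rho>(1)] LL ykH by (simp add: innerH_diff_right)
          have "\<bar>innerH sbar yk (\<lambda>s. w s - LV \<mu> (t - r - d + \<rho>) v s)\<bar>
              \<le> normH sbar yk * normH sbar (\<lambda>s. w s - LV \<mu> (t - r - d + \<rho>) v s)"
            by (rule innerH_CS[OF ykH spH_diff[OF LL(2) LL(1)]])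
          also have "\<dots> \<le> normH sbar yk * (\<bar>t - r - (t - r - d + \<rho>)\<bar> * normH sbar (src sbar \<mu> v))"
          proof (rule mult_left_mono)
            have "0 \<le> t - r" "0 \<le> t - r - d + \<rho>" using \<rho> elim by linarith+
            then show "normH sbar (\<lambda>s. w s - LV \<mu> (t - r - d + \<rho>) v s)
                \<le> \<bar>t - r - (t - r - d + \<rho>)\<bar> * normH sbar (src sbar \<mu> v)"
              unfolding w_def by (rule LV_close[OF v])
          qed simp
          also have "\<dots> \<le> normH sbar yk * (d * normH sbar (src sbar \<mu> v))"
          proof (intro mult_left_mono mult_right_mono)
            show "\<bar>t - r - (t - r - d + \<rho>)\<bar> \<le> d" using \<rho> by linarith
          qed simp_all
          finally show "\<bar>innerH sbar k (LH sbar \<mu> \<rho> (src sbar \<mu> w')) + innerH sbar yk w\<bar> \<le> d * M"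
            unfolding eq M_def by (simp only: mult_ac)
        qed
        moreover have "innerH sbar k w' - innerH sbar k w = (LBINT \<rho>:{0<..<d}. innerH sbar k (LH sbar \<mu> \<rho> (src sbar \<mu> w')))"
          using inc(2) by (simp add: w)
        ultimately have "\<bar>innerH sbar k w' - innerH sbar k w + d * innerH sbar yk w\<bar> \<le> d * (d * M)" by simp
        moreover have "(innerH sbar k w' - innerH sbar k w) / d - - innerH sbar yk w = (innerH sbar k w' - innerH sbar k w + d * innerH sbar yk w) / d"
          using elim by (simp add: field_simps)
        ultimately show ?case using elim unfolding w'_def[symmetric] by (simp add: abs_divide divide_le_eq mult.commute)
      qed
    qed
    have "((\<lambda>d. innerH sbar (\<lambda>s. (1 / d) * (S d k s - k s)) (LV \<mu> (t - r - d) v)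
        + (innerH sbar k (LV \<mu> (t - r - d) v) - innerH sbar k w) / d) \<longlongrightarrow> innerH sbar yk w + - innerH sbar yk w) (at_right 0)"
      by (rule tendsto_add[OF first second])
    then have "((\<lambda>d. innerH sbar (\<lambda>s. (1 / d) * (S d k s - k s)) (LV \<mu> (t - r - d) v)
        + (innerH sbar k (LV \<mu> (t - r - d) v) - innerH sbar k w) / d) \<longlongrightarrow> 0) (at_right 0)" by simp
    then show "((\<lambda>d. (\<phi> (r + d) - \<phi> r) / d) \<longlongrightarrow> 0) (at_right 0)"
    proof (rule Lim_transform_eventually)
      show "\<forall>\<^sub>F d in at_right 0. innerH sbar (\<lambda>s. (1 / d) * (S d k s - k s)) (LV \<mu> (t - r - d) v)
        + (innerH sbar k (LV \<mu> (t - r - d) v) - innerH sbar k w) / d = (\<phi> (r + d) - \<phi> r) / d"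
        using ev
      proof eventually_elim
        case (elim d)
        have SH: "S d k \<in> spH sbar" "S (d + r) h \<in> spH sbar" using elim kH hH r by (auto intro!: S_spH)
        have LL: "LV \<mu> (t - r - d) v \<in> spH sbar" using elim by (intro LvH) simp
        have "innerH sbar (S (d + r) h) (LV \<mu> (t - r - d) v) = innerH sbar (S d k) (LV \<mu> (t - r - d) v)"
          using S_add[of d r h] elim r hH SH LL by (intro innerH_cong_AE_left) (auto simp: k_def)
        moreover have "innerH sbar (\<lambda>s. (1 / d) * (S d k s - k s)) (LV \<mu> (t - r - d) v)
            = (innerH sbar (S d k) (LV \<mu> (t - r - d) v) - innerH sbar k (LV \<mu> (t - r - d) v)) / d"
          using innerH_lincomb[OF SH(1) kH LL, of "1 / d" "- 1 / d"] by (simp add: right_diff_distrib diff_divide_distrib)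
        ultimately show ?case
          by (simp add: \<phi>_def k_def w_def add.commute diff_divide_distrib diff_diff_add)
      qed
    qed
  qed
  moreover have "\<phi> t = innerH sbar (S t h) v" using v by (simp add: \<phi>_def LV_0)
  moreover have "\<phi> 0 = innerH sbar h (LV \<mu> t v)"
    unfolding \<phi>_def using S_0[OF hH] hH t LvH by (auto intro!: innerH_cong_AE_left S_spH)
  ultimately show ?thesis by simp
qed

end

context
  fixes sbar :: ereal and \<mu> :: real and S :: "real \<Rightarrow> fn \<Rightarrow> fn"
  assumes mu: "0 < \<mu>" and S: "generates_A0 sbar \<mu> S"
begin

text \<open>For fixed \<open>v\<close> both sides are bounded and linear in \<open>h\<close>, so the
  identity passes from the domain of \<open>A\<^sub>0\<close> to H.\<close>

lemma S_adjoint_spV: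
  assumes h: "h \<in> spH sbar" and v: "v \<in> spV sbar" and t: "0 \<le> t"
  shows "innerH sbar (S t h) v = innerH sbar h (LV \<mu> t v)"
proof -
  define F where "F = (\<lambda>f. innerH sbar (S t f) v - innerH sbar f (LV \<mu> t v))"
  have vH: "v \<in> spH sbar" "LV \<mu> t v \<in> spH sbar" using v t mu by (auto intro: spV_spH LV_spV)
  obtain C where C: "\<And>x. x \<in> spH sbar \<Longrightarrow> normH sbar (S t x) \<le> C * normH sbar x"
    using S_bdd[OF mu S t] by blast
  have "F h = 0"
  proof (rule functional_zero_on_A0[OF _ _ _ h, of F "C * normH sbar v + normH sbar (LV \<mu> t v)" \<mu>])
    fix f g a b assume fg: "f \<in> spH sbar" "g \<in> spH sbar"
    have "innerH sbar (S t (\<lambda>x. a * f x + b * g x)) v = innerH sbar (\<lambda>x. a * S t f x + b * S t g x) v"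
      using S_lin[OF mu S t fg, of a b] fg t vH
      by (intro innerH_cong_AE_left) (auto intro!: S_spH[OF mu S] spH_lincomb)
    then show "F (\<lambda>x. a * f x + b * g x) = a * F f + b * F g"
      using fg vH t S_spH[OF mu S] by (simp add: F_def innerH_lincomb algebra_simps)
  next
    fix f assume f: "f \<in> spH sbar"
    have "\<bar>F f\<bar> \<le> normH sbar (S t f) * normH sbar v + normH sbar f * normH sbar (LV \<mu> t v)"
      using innerH_CS[OF S_spH[OF mu S t f] vH(1)] innerH_CS[OF f vH(2)] by (simp add: F_def)
    moreover have "normH sbar (S t f) * normH sbar v \<le> (C * normH sbar f) * normH sbar v"
      by (intro mult_right_mono C f) simp
    ultimately show "\<bar>F f\<bar> \<le> (C * normH sbar v + normH sbar (LV \<mu> t v)) * normH sbar f"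
      by (simp add: algebra_simps)
  next
    show "(\<forall>f y. (f, y) \<in> A0_graph sbar \<mu> \<longrightarrow> F f = 0) \<or> (\<forall>v\<in>spV sbar. F v = 0)"
      using S_adjoint_domain[OF mu S _ v t] by (auto simp: F_def)
  qed
  then show ?thesis by (simp add: F_def)
qed

text \<open>For fixed \<open>h\<close> both sides are bounded and linear in the other argument, so
  the identity passes from V to H.\<close>

lemma S_adjoint:
  assumes h: "h \<in> spH sbar" and b: "b \<in> spH sbar" and t: "0 \<le> t"
  shows "innerH sbar (S t h) b = innerH sbar h (LH sbar \<mu> t b)"
proof -
  define F where "F = (\<lambda>f. innerH sbar (S t h) f - innerH sbar h (LH sbar \<mu> t f))"
  have Sh: "S t h \<in> spH sbar" by (rule S_spH[OF mu S t h])
  have "F b = 0"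
  proof (rule functional_zero_on_A0[OF _ _ _ b, of F "normH sbar (S t h) + normH sbar h" \<mu>])
    fix f g a b assume fg: "f \<in> spH sbar" "g \<in> spH sbar"
    have "LH sbar \<mu> t (\<lambda>x. a * f x + b * g x) = (\<lambda>x. a * LH sbar \<mu> t f x + b * LH sbar \<mu> t g x)"
      by (simp add: LH_def zx_lincomb fun_eq_iff algebra_simps)
    then show "F (\<lambda>x. a * f x + b * g x) = a * F f + b * F g"
      using fg Sh h by (simp add: F_def innerH_lincomb' LH_spH algebra_simps)
  next
    fix f assume f: "f \<in> spH sbar"
    have "normH sbar h * normH sbar (LH sbar \<mu> t f) \<le> normH sbar h * (1 * normH sbar f)"
    proof (rule mult_left_mono)
      have "normH sbar (LH sbar \<mu> t f) \<le> exp (- \<mu> * t) * normH sbar f" by (rule LH_normH[OF f])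
      also have "\<dots> \<le> 1 * normH sbar f" using mu t by (intro mult_right_mono) auto
      finally show "normH sbar (LH sbar \<mu> t f) \<le> 1 * normH sbar f" .
    qed simp
    then show "\<bar>F f\<bar> \<le> (normH sbar (S t h) + normH sbar h) * normH sbar f"
      using innerH_CS[OF Sh f] innerH_CS[OF h LH_spH[OF f], of \<mu> t] by (simp add: F_def distrib_right)
  next
    show "(\<forall>f y. (f, y) \<in> A0_graph sbar \<mu> \<longrightarrow> F f = 0) \<or> (\<forall>v\<in>spV sbar. F v = 0)"
      using S_adjoint_spV[OF h _ t] innerH_LV[OF _ t, of _ sbar h \<mu>] by (auto simp: F_def)
  qed
  then show ?thesis by (simp add: F_def)
qed

text \<open>Translations are contractions, so expanding the square bounds the squared distance from
  \<open>LH sbar \<mu> d b\<close> to \<open>b\<close> by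
  \<open>2 * (innerH sbar b b - innerH sbar (S d b) b)\<close>. Strong continuity of translations is
  thus inherited from \<open>S\<close>, without approximation by continuous functions.\<close>

lemma LH_continuous_0:
  assumes b: "b \<in> spH sbar"
  shows "((\<lambda>d. normH sbar (\<lambda>s. LH sbar \<mu> d b s - b s)) \<longlongrightarrow> 0) (at 0 within {0..})"
proof -
  have bound: "(normH sbar (\<lambda>s. LH sbar \<mu> d b s - b s))\<^sup>2 \<le> 2 * (innerH sbar b b - innerH sbar (S d b) b)" if d: "0 \<le> d" for d
  proof -
    define L where "L = LH sbar \<mu> d b"
    have L: "L \<in> spH sbar" using b by (simp add: L_def LH_spH)
    have "(normH sbar (\<lambda>s. L s - b s))\<^sup>2 = innerH sbar L L - 2 * innerH sbar b L + innerH sbar b b"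
      unfolding normH_power2 using L b by (simp add: innerH_diff_left innerH_diff_right spH_diff innerH_commute[of sbar L b])
    moreover have "innerH sbar L L \<le> innerH sbar b b"
      unfolding normH_power2[symmetric]
    proof (rule power_mono)
      have "normH sbar L \<le> exp (- \<mu> * d) * normH sbar b" unfolding L_def by (rule LH_normH[OF b])
      also have "\<dots> \<le> 1 * normH sbar b" using mu d by (intro mult_right_mono) auto
      finally show "normH sbar L \<le> normH sbar b" by simp
    qed simp
    moreover have "innerH sbar b L = innerH sbar (S d b) b" unfolding L_def by (rule S_adjoint[OF b b d, symmetric])
    ultimately show ?thesis by (simp add: L_def)
  qed
  have "((\<lambda>d. innerH sbar (S d b) b) \<longlongrightarrow> innerH sbar (S 0 b) b) (at 0 within {0..})"
  proof (rule innerH_tendsto)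
    show "\<forall>\<^sub>F x in at 0 within {0..}. S x b \<in> spH sbar"
      unfolding eventually_at_filter by (rule always_eventually) (use b in \<open>auto intro: S_spH[OF mu S]\<close>)
  qed (use b S_spH[OF mu S _ b] S_cont[OF mu S _ b] in \<open>auto simp: normH_l2norm\<close>)
  moreover have "innerH sbar (S 0 b) b = innerH sbar b b"
    using S_0[OF mu S b] b S_spH[OF mu S _ b] by (intro innerH_cong_AE_left) auto
  ultimately have "((\<lambda>d. sqrt (2 * (innerH sbar b b - innerH sbar (S d b) b))) \<longlongrightarrow> sqrt (2 * (innerH sbar b b - innerH sbar b b))) (at 0 within {0..})"
    by (intro tendsto_intros) simp
  then have lim: "((\<lambda>d. sqrt (2 * (innerH sbar b b - innerH sbar (S d b) b))) \<longlongrightarrow> 0) (at 0 within {0..})" by simp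
  show ?thesis
  proof (rule Lim_null_comparison[OF _ lim])
    show "\<forall>\<^sub>F d in at 0 within {0..}. norm (normH sbar (\<lambda>s. LH sbar \<mu> d b s - b s)) \<le> sqrt (2 * (innerH sbar b b - innerH sbar (S d b) b))"
      unfolding eventually_at_filter by (rule always_eventually) (use bound in \<open>auto intro!: real_le_rsqrt\<close>)
  qed
qed

lemma LV_diff_spV: "v \<in> spV sbar \<Longrightarrow> 0 \<le> a \<Longrightarrow> 0 \<le> b \<Longrightarrow> (\<lambda>s. LV \<mu> a v s - LV \<mu> b v s) \<in> spV sbar"
  using spV_lincomb[OF LV_spV[OF mu, of v sbar a] LV_spV[OF mu, of v sbar b], of 1 "-1"] by simp

lemma LV_continuous_0:
  assumes v: "v \<in> spV sbar"
  shows "((\<lambda>d. normV sbar \<mu> (\<lambda>s. LV \<mu> d v s - v s)) \<longlongrightarrow> 0) (at 0 within {0..})"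
proof (rule Lim_null_comparison)
  have "((\<lambda>d. \<bar>d - 0\<bar> * normH sbar (src sbar \<mu> v) + normH sbar (\<lambda>s. LH sbar \<mu> d (src sbar \<mu> v) s - src sbar \<mu> v s))
      \<longlongrightarrow> \<bar>0 - 0\<bar> * normH sbar (src sbar \<mu> v) + 0) (at 0 within {0..})"
    by (intro tendsto_intros LH_continuous_0 src_spH v)
  then show "((\<lambda>d. \<bar>d - 0\<bar> * normH sbar (src sbar \<mu> v) + normH sbar (\<lambda>s. LH sbar \<mu> d (src sbar \<mu> v) s - src sbar \<mu> v s)) \<longlongrightarrow> 0) (at 0 within {0..})"
    by simp
  have "normV sbar \<mu> (\<lambda>s. LV \<mu> d v s - v s) \<le> \<bar>d - 0\<bar> * normH sbar (src sbar \<mu> v) + normH sbar (\<lambda>s. LH sbar \<mu> d (src sbar \<mu> v) s - src sbar \<mu> v s)"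
    if d: "0 \<le> d" for d
  proof -
    have Lv: "LV \<mu> d v \<in> spV sbar" by (rule LV_spV[OF mu v d])
    have 1: "normH sbar (\<lambda>s. LV \<mu> d v s - v s) \<le> \<bar>d - 0\<bar> * normH sbar (src sbar \<mu> v)"
      using LV_close[OF mu S v d order_refl] v by (simp add: LV_0)
    have "AE s in ageM sbar. src sbar \<mu> (\<lambda>s. LV \<mu> d v s - v s) s = LH sbar \<mu> d (src sbar \<mu> v) s - src sbar \<mu> v s"
      using src_lincomb[OF mu Lv v, of 1 "-1"] src_LV[OF mu v d] by (auto elim!: eventually_elim2)
    then have 2: "normH sbar (src sbar \<mu> (\<lambda>s. LV \<mu> d v s - v s)) = normH sbar (\<lambda>s. LH sbar \<mu> d (src sbar \<mu> v) s - src sbar \<mu> v s)"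
      using LV_diff_spV[OF v d order_refl] v by (intro normH_cong_AE spH_measurable spH_diff LH_spH src_spH) (auto simp: LV_0)
    show ?thesis using normV_le_sum[of sbar \<mu> "\<lambda>s. LV \<mu> d v s - v s"] 1 2 by simp
  qed
  then show "\<forall>\<^sub>F d in at 0 within {0..}. norm (normV sbar \<mu> (\<lambda>s. LV \<mu> d v s - v s))
      \<le> \<bar>d - 0\<bar> * normH sbar (src sbar \<mu> v) + normH sbar (\<lambda>s. LH sbar \<mu> d (src sbar \<mu> v) s - src sbar \<mu> v s)"
    unfolding eventually_at_filter by (intro always_eventually) auto
qed

text \<open>Translation by the smaller time is a contraction in V, so closeness of the times is all
  that matters and continuity at 0 suffices.\<close>

lemma LV_uniformly_continuous:
  assumes v: "v \<in> spV sbar" and e: "0 < e"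
  obtains d where "0 < d" "\<And>a b. 0 \<le> a \<Longrightarrow> 0 \<le> b \<Longrightarrow> \<bar>a - b\<bar> < d \<Longrightarrow> normV sbar \<mu> (\<lambda>s. LV \<mu> a v s - LV \<mu> b v s) < e"
proof -
  have "\<forall>\<^sub>F d in at 0 within {0..}. dist (normV sbar \<mu> (\<lambda>s. LV \<mu> d v s - v s)) 0 < e"
    using LV_continuous_0[OF v] e by (rule tendstoD)
  then obtain d where d: "0 < d" "\<And>x. x \<in> {0..} \<Longrightarrow> x \<noteq> 0 \<Longrightarrow> \<bar>x\<bar> < d \<Longrightarrow> normV sbar \<mu> (\<lambda>s. LV \<mu> x v s - v s) < e"
    unfolding eventually_at by (auto simp: dist_real_def)
  have main: "normV sbar \<mu> (\<lambda>s. LV \<mu> b v s - LV \<mu> a v s) < e" if "0 \<le> a" "a \<le> b" "b - a < d" for a b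
  proof (cases "a = b")
    case True
    then show ?thesis using e normV_cmult[OF mu v, of 0] by simp
  next
    case False
    have "(\<lambda>s. LV \<mu> b v s - LV \<mu> a v s) = LV \<mu> a (\<lambda>s. 1 * LV \<mu> (b - a) v s + (- 1) * v s)"
      unfolding LV_lincomb using that by (simp add: LV_add)
    moreover have "(\<lambda>s. 1 * LV \<mu> (b - a) v s + (- 1) * v s) \<in> spV sbar"
      using that by (intro spV_lincomb LV_spV mu v) auto
    ultimately have "normV sbar \<mu> (\<lambda>s. LV \<mu> b v s - LV \<mu> a v s) \<le> normV sbar \<mu> (\<lambda>s. 1 * LV \<mu> (b - a) v s + (- 1) * v s)"
      using LV_normV_le[OF mu] that by simp
    also have "\<dots> < e" using d(2)[of "b - a"] that False by simp
    finally show ?thesis .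
  qed
  have sym: "normV sbar \<mu> (\<lambda>s. LV \<mu> a v s - LV \<mu> b v s) = normV sbar \<mu> (\<lambda>s. LV \<mu> b v s - LV \<mu> a v s)" if "0 \<le> a" "0 \<le> b" for a b
    using normV_cmult[OF mu LV_diff_spV[OF v that], of "-1"] by simp
  show ?thesis
  proof (rule that[OF d(1)])
    fix a b :: real assume "0 \<le> a" "0 \<le> b" "\<bar>a - b\<bar> < d"
    then show "normV sbar \<mu> (\<lambda>s. LV \<mu> a v s - LV \<mu> b v s) < e"
      using main[of a b] main[of b a] sym[of a b] by (cases "a \<le> b") auto
  qed
qed

lemma spVd_LV_continuous:
  assumes x: "x \<in> spVd sbar \<mu>" and v: "v \<in> spV sbar"
  shows "continuous_on {0..} (\<lambda>t. x (LV \<mu> t v))"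
proof (rule continuous_onI)
  fix a e :: real assume a: "a \<in> {0..}" and e: "0 < e"
  define N where "N = \<bar>normVd sbar \<mu> x\<bar> + 1"
  have N: "0 < N" by (simp add: N_def)
  obtain d where d: "0 < d" "\<And>a b. 0 \<le> a \<Longrightarrow> 0 \<le> b \<Longrightarrow> \<bar>a - b\<bar> < d \<Longrightarrow> normV sbar \<mu> (\<lambda>s. LV \<mu> a v s - LV \<mu> b v s) < e / N"
    using LV_uniformly_continuous[OF v, of "e / N"] e N by auto
  show "\<exists>d>0. \<forall>b\<in>{0..}. dist b a < d \<longrightarrow> dist (x (LV \<mu> b v)) (x (LV \<mu> a v)) \<le> e"
  proof (intro exI[of _ d] conjI ballI impI d(1))
    fix b assume b: "b \<in> {0..}" "dist b a < d"
    have ab: "0 \<le> a" "0 \<le> b" using a b by auto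
    have "x (LV \<mu> b v) - x (LV \<mu> a v) = x (\<lambda>s. LV \<mu> b v s - LV \<mu> a v s)"
      using spVd_lincomb[OF x LV_spV[OF mu v ab(2)] LV_spV[OF mu v ab(1)], of 1 "-1"] by simp
    then have "\<bar>x (LV \<mu> b v) - x (LV \<mu> a v)\<bar> \<le> normVd sbar \<mu> x * normV sbar \<mu> (\<lambda>s. LV \<mu> b v s - LV \<mu> a v s)"
      using spVd_bound[OF mu x LV_diff_spV[OF v ab(2,1)]] by simp
    also have "\<dots> \<le> N * (e / N)"
      using d(2)[OF ab(2,1)] b by (intro mult_mono) (auto simp: N_def dist_real_def)
    finally show "dist (x (LV \<mu> b v)) (x (LV \<mu> a v)) \<le> e" using N by (simp add: dist_real_def)
  qed
qed

end

section \<open>Norm and linear structure of V'\<close>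

lemma spVd_outside: "x \<in> spVd sbar \<mu> \<Longrightarrow> v \<notin> spV sbar \<Longrightarrow> x v = 0"
  by (simp add: spVd_def)

lemma spVdI:
  assumes "\<And>v. v \<notin> spV sbar \<Longrightarrow> x v = 0"
    "\<And>v w a b. v \<in> spV sbar \<Longrightarrow> w \<in> spV sbar \<Longrightarrow> x (\<lambda>s. a * v s + b * w s) = a * x v + b * x w"
    "\<And>v. v \<in> spV sbar \<Longrightarrow> \<bar>x v\<bar> \<le> C * normV sbar \<mu> v"
  shows "x \<in> spVd sbar \<mu>"
proof -
  have "a *\<^sub>R v + b *\<^sub>R w = (\<lambda>s. a * v s + b * w s)" for a b and v w :: fn
    by (simp add: fun_eq_iff scaleR_fun_def)
  moreover have "\<exists>C. \<forall>v\<in>spV sbar. \<bar>x v\<bar> \<le> C * normV sbar \<mu> v" using assms(3) by blast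
  ultimately show ?thesis using assms(1,2) unfolding spVd_def by simp
qed

lemma spVd_lincomb_closed:
  assumes x: "x \<in> spVd sbar \<mu>" and y: "y \<in> spVd sbar \<mu>"
  shows "a *\<^sub>R x + b *\<^sub>R y \<in> spVd sbar \<mu>"
proof -
  obtain C where C: "\<And>v. v \<in> spV sbar \<Longrightarrow> \<bar>x v\<bar> \<le> C * normV sbar \<mu> v" using x unfolding spVd_def by blast
  obtain D where D: "\<And>v. v \<in> spV sbar \<Longrightarrow> \<bar>y v\<bar> \<le> D * normV sbar \<mu> v" using y unfolding spVd_def by blast
  show ?thesis
  proof (rule spVdI)
    fix v assume v: "v \<in> spV sbar"
    have "\<bar>a * x v + b * y v\<bar> \<le> \<bar>a\<bar> * \<bar>x v\<bar> + \<bar>b\<bar> * \<bar>y v\<bar>" by (metis abs_mult abs_triangle_ineq)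
    also have "\<dots> \<le> \<bar>a\<bar> * (C * normV sbar \<mu> v) + \<bar>b\<bar> * (D * normV sbar \<mu> v)"
      by (intro add_mono mult_left_mono C D v) auto
    finally show "\<bar>(a *\<^sub>R x + b *\<^sub>R y) v\<bar> \<le> (\<bar>a\<bar> * C + \<bar>b\<bar> * D) * normV sbar \<mu> v"
      by (simp add: scaleR_fun_def algebra_simps)
  qed (auto simp: scaleR_fun_def spVd_outside[OF x] spVd_outside[OF y] spVd_lincomb[OF x] spVd_lincomb[OF y] algebra_simps)
qed

lemma spVd_eqI:
  assumes "x \<in> spVd sbar \<mu>" "y \<in> spVd sbar \<mu>" "\<And>v. v \<in> spV sbar \<Longrightarrow> x v = y v"
  shows "x = y"
proof
  show "x v = y v" for v
    using assms by (cases "v \<in> spV sbar") (auto simp: spVd_outside)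
qed

lemma normVd_nonneg:
  assumes "0 < \<mu>" "x \<in> spVd sbar \<mu>" shows "0 \<le> normVd sbar \<mu> x"
proof -
  have "(\<lambda>s. 0) \<in> spH sbar" by (simp add: spH_L2)
  then have z: "(\<lambda>s. 0) \<in> spV sbar" using zero_spV[OF bres_spV[OF zero_less_one]] by blast
  then have "normV sbar \<mu> (\<lambda>s. 0) \<le> 1" using normV_cmult[OF assms(1) z, of 0] by simp
  then have "\<bar>x (\<lambda>s. 0)\<bar> \<le> normVd sbar \<mu> x" unfolding normVd_def using z by (intro cSUP_upper spVd_bdd assms) simp
  then show ?thesis by linarith
qed

lemma normVd_zero_iff:
  assumes "0 < \<mu>" "x \<in> spVd sbar \<mu>" shows "normVd sbar \<mu> x = 0 \<longleftrightarrow> x = 0"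
proof
  assume "normVd sbar \<mu> x = 0"
  then have "x v = 0" for v
    using spVd_bound[OF assms, of v] spVd_outside[OF assms(2), of v] by (cases "v \<in> spV sbar") auto
  then show "x = 0" by (simp add: fun_eq_iff)
next
  assume "x = 0"
  then have "normVd sbar \<mu> x \<le> 0" using assms(1) by (intro normVd_le) auto
  then show "normVd sbar \<mu> x = 0" using normVd_nonneg[OF assms] by simp
qed

lemma emb_spVd:
  assumes "h \<in> spH sbar" shows "emb sbar h \<in> spVd sbar \<mu>"
proof (rule spVdI)
  fix v assume v: "v \<in> spV sbar"
  have "\<bar>innerH sbar h v\<bar> \<le> normH sbar h * normH sbar v" by (intro innerH_CS assms spV_spH v)
  also have "\<dots> \<le> normH sbar h * normV sbar \<mu> v" by (intro mult_left_mono normH_le_normV) simp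
  finally show "\<bar>emb sbar h v\<bar> \<le> normH sbar h * normV sbar \<mu> v" using v by (simp add: emb_def)
qed (use assms in \<open>auto simp: emb_def spV_lincomb innerH_lincomb' spV_spH\<close>)

lemma delta0_spVd: "0 < \<mu> \<Longrightarrow> delta0 sbar \<in> spVd sbar \<mu>"
proof (rule spVdI)
  fix v assume "0 < \<mu>" "v \<in> spV sbar"
  then show "\<bar>delta0 sbar v\<bar> \<le> (1 / sqrt (2 * \<mu>)) * normV sbar \<mu> v"
    using spV_bound[of \<mu> v sbar 0] by (simp add: delta0_def)
qed (auto simp: delta0_def spV_lincomb)

lemma opB_spVd: "0 < \<mu> \<Longrightarrow> u \<in> spU sbar \<Longrightarrow> opB sbar u \<in> spVd sbar \<mu>"
  using spVd_lincomb_closed[OF emb_spVd delta0_spVd, of "snd u" sbar \<mu> 1 "fst u"] by (auto simp: opB_def spU_def)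

section \<open>The generator on \<open>V'\<close>\<close>

lemma normVd_lincomb_le:
  assumes "0 < \<mu>" "x \<in> spVd sbar \<mu>" "y \<in> spVd sbar \<mu>"
  shows "normVd sbar \<mu> (a *\<^sub>R x + b *\<^sub>R y) \<le> \<bar>a\<bar> * normVd sbar \<mu> x + \<bar>b\<bar> * normVd sbar \<mu> y"
proof (rule normVd_le[OF _ _ assms(1)])
  show "0 \<le> \<bar>a\<bar> * normVd sbar \<mu> x + \<bar>b\<bar> * normVd sbar \<mu> y"
    using normVd_nonneg assms by (intro add_nonneg_nonneg mult_nonneg_nonneg) auto
  fix v assume v: "v \<in> spV sbar"
  have "\<bar>a * x v + b * y v\<bar> \<le> \<bar>a\<bar> * \<bar>x v\<bar> + \<bar>b\<bar> * \<bar>y v\<bar>" by (metis abs_mult abs_triangle_ineq)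
  also have "\<dots> \<le> \<bar>a\<bar> * (normVd sbar \<mu> x * normV sbar \<mu> v) + \<bar>b\<bar> * (normVd sbar \<mu> y * normV sbar \<mu> v)"
    by (intro add_mono mult_left_mono spVd_bound assms v) auto
  finally show "\<bar>(a *\<^sub>R x + b *\<^sub>R y) v\<bar> \<le> (\<bar>a\<bar> * normVd sbar \<mu> x + \<bar>b\<bar> * normVd sbar \<mu> y) * normV sbar \<mu> v"
    by (simp add: scaleR_fun_def algebra_simps)
qed

lemma spVd_diff: "x \<in> spVd sbar \<mu> \<Longrightarrow> y \<in> spVd sbar \<mu> \<Longrightarrow> x - y \<in> spVd sbar \<mu>"
  using spVd_lincomb_closed[of x sbar \<mu> y 1 "-1"] by simp

lemma spVd_scaleR: "x \<in> spVd sbar \<mu> \<Longrightarrow> a *\<^sub>R x \<in> spVd sbar \<mu>"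
  using spVd_lincomb_closed[of x sbar \<mu> x a 0] by simp

lemma spVd_add: "x \<in> spVd sbar \<mu> \<Longrightarrow> y \<in> spVd sbar \<mu> \<Longrightarrow> x + y \<in> spVd sbar \<mu>"
  using spVd_lincomb_closed[of x sbar \<mu> y 1 1] by simp

text \<open>The operator A on H, obtained by transposing \<open>A0_star\<close>, which is
  \<open>- src\<close>.\<close>

definition Aop :: "ereal \<Rightarrow> real \<Rightarrow> fn \<Rightarrow> funct" where
  "Aop sbar \<mu> h = (\<lambda>v. if v \<in> spV sbar then - innerH sbar h (src sbar \<mu> v) else 0)"

lemma Aop_spVd:
  assumes mu: "0 < \<mu>" and h: "h \<in> spH sbar" shows "Aop sbar \<mu> h \<in> spVd sbar \<mu>"
proof (rule spVdI)
  fix v w :: fn and a b :: real assume vw: "v \<in> spV sbar" "w \<in> spV sbar"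
  have "innerH sbar h (src sbar \<mu> (\<lambda>s. a * v s + b * w s)) = innerH sbar h (\<lambda>s. a * src sbar \<mu> v s + b * src sbar \<mu> w s)"
    using src_lincomb[OF mu vw, of a b] h vw
    by (intro innerH_cong_AE spH_measurable) (auto intro!: src_spH spV_lincomb spH_lincomb)
  then show "Aop sbar \<mu> h (\<lambda>s. a * v s + b * w s) = a * Aop sbar \<mu> h v + b * Aop sbar \<mu> h w"
    using vw h by (simp add: Aop_def spV_lincomb innerH_lincomb' src_spH)
next
  fix v assume v: "v \<in> spV sbar"
  have "\<bar>innerH sbar h (src sbar \<mu> v)\<bar> \<le> normH sbar h * normH sbar (src sbar \<mu> v)" by (intro innerH_CS h src_spH v)
  also have "\<dots> \<le> normH sbar h * normV sbar \<mu> v" by (intro mult_left_mono normH_src_le_normV) simp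
  finally show "\<bar>Aop sbar \<mu> h v\<bar> \<le> normH sbar h * normV sbar \<mu> v" using v by (simp add: Aop_def)
qed (simp add: Aop_def)

text \<open>Surjectivity of A from H onto V', which is the Riesz representation with the sign moved
  into \<open>h\<close>. The summand \<open>0 * k s\<close> only brings the negative of
  \<open>k\<close> into the form of \<open>spH_lincomb\<close>.\<close>

lemma spVd_eq_Aop:
  assumes mu: "0 < \<mu>" and x: "x \<in> spVd sbar \<mu>"
  obtains h where "h \<in> spH sbar" "x = Aop sbar \<mu> h"
proof -
  obtain k where k: "k \<in> spH sbar" "\<And>v. v \<in> spV sbar \<Longrightarrow> x v = innerH sbar k (src sbar \<mu> v)"
    using spVd_Riesz[OF mu x] by blast
  define h where "h = (\<lambda>s. (- 1) * k s + 0 * k s)"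
  have h: "h \<in> spH sbar" unfolding h_def by (intro spH_lincomb k)
  have "x v = Aop sbar \<mu> h v" for v
    using k innerH_lincomb[OF k(1) k(1) src_spH, of v "-1" 0 \<mu>] spVd_outside[OF x, of v]
    by (auto simp: Aop_def h_def)
  then show ?thesis using that[OF h] by (simp add: fun_eq_iff)
qed

context
  fixes sbar :: ereal and \<mu> :: real and S :: "real \<Rightarrow> fn \<Rightarrow> fn" and T :: "real \<Rightarrow> funct \<Rightarrow> funct"
  assumes mu: "0 < \<mu>" and S: "generates_A0 sbar \<mu> S" and T: "extends_to_Vd sbar \<mu> S T"
begin

private lemma C0_T: "C0_semigroup (spVd sbar \<mu>) (normVd sbar \<mu>) T" and
  ext: "\<And>t h. 0 \<le> t \<Longrightarrow> h \<in> spH sbar \<Longrightarrow> T t (emb sbar h) = emb sbar (S t h)"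
  using T by (auto simp: extends_to_Vd_def)

lemma T_spVd: "0 \<le> t \<Longrightarrow> x \<in> spVd sbar \<mu> \<Longrightarrow> T t x \<in> spVd sbar \<mu>"
  using C0_T by (simp add: C0_semigroup_def)

lemma T_lin:
  assumes "0 \<le> t" "x \<in> spVd sbar \<mu>" "y \<in> spVd sbar \<mu>"
  shows "T t (a *\<^sub>R x + b *\<^sub>R y) = a *\<^sub>R T t x + b *\<^sub>R T t y"
proof -
  have "normVd sbar \<mu> (T t (a *\<^sub>R x + b *\<^sub>R y) - (a *\<^sub>R T t x + b *\<^sub>R T t y)) = 0"
    using C0_T assms by (simp only: C0_semigroup_def)
  then have "T t (a *\<^sub>R x + b *\<^sub>R y) - (a *\<^sub>R T t x + b *\<^sub>R T t y) = 0"
    using assms by (subst (asm) normVd_zero_iff[OF mu]) (auto intro!: spVd_diff T_spVd spVd_lincomb_closed)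
  then show ?thesis by simp
qed

lemma T_bdd: "0 \<le> t \<Longrightarrow> \<exists>C. \<forall>x\<in>spVd sbar \<mu>. normVd sbar \<mu> (T t x) \<le> C * normVd sbar \<mu> x"
  using C0_T by (simp add: C0_semigroup_def)

text \<open>Tested on \<open>v\<close>, the difference quotient is minus the time average of
  \<open>innerH sbar (S \<rho> h) (src sbar \<mu> v)\<close>. Strong continuity of \<open>S\<close>
  makes its convergence uniform over the unit ball of V, which is convergence in the norm of
  V'.\<close>

lemma genA_emb:
  assumes h: "h \<in> spH sbar"
  shows "(emb sbar h, Aop sbar \<mu> h) \<in> genA sbar \<mu> T"
  unfolding genA_def generator_def
proof (intro CollectI case_prodI conjI emb_spVd Aop_spVd mu h)
  show "((\<lambda>t. normVd sbar \<mu> ((1 / t) *\<^sub>R (T t (emb sbar h) - emb sbar h) - Aop sbar \<mu> h)) \<longlongrightarrow> 0) (at_right 0)"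
  proof (rule tendstoI)
    fix e :: real assume e: "0 < e"
    have "\<forall>\<^sub>F r in at 0 within {0..}. dist (normH sbar (\<lambda>s. S r h s - S 0 h s)) 0 < e / 2"
      using S_cont[OF mu S order_refl h] e by (intro tendstoD) auto
    then obtain d where d: "0 < d" "\<And>r. 0 < r \<Longrightarrow> r < d \<Longrightarrow> normH sbar (\<lambda>s. S r h s - S 0 h s) < e / 2"
      unfolding eventually_at by (auto simp: dist_real_def)
    have "normVd sbar \<mu> ((1 / t) *\<^sub>R (T t (emb sbar h) - emb sbar h) - Aop sbar \<mu> h) \<le> e / 2" if t: "0 < t" "t < d" for t
    proof (rule normVd_le)
      have t0: "0 \<le> t" using t by simp
      fix v assume v: "v \<in> spV sbar"
      define b where "b = src sbar \<mu> v"
      have b: "b \<in> spH sbar" using v by (simp add: b_def src_spH)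
      define I where "I = (LBINT \<rho>:{0<..<t}. innerH sbar h (LH sbar \<mu> \<rho> b) - innerH sbar h b)"
      note inc = LV_increment[OF mu h v t0, folded b_def]
      have ind: "integrable lborel (\<lambda>\<rho>. indicator {0<..<t} \<rho> * innerH sbar h b)"
        using t by (auto intro!: integrable_real_indicator)
      have I: "I = (LBINT \<rho>:{0<..<t}. innerH sbar h (LH sbar \<mu> \<rho> b)) - t * innerH sbar h b"
        unfolding I_def using inc(1) ind t by (subst set_integral_diff(2)) (auto simp: set_integrable_def set_lebesgue_integral_def)
      have "\<bar>I\<bar> \<le> t * (e / 2 * normV sbar \<mu> v)"
        unfolding I_def
      proof (rule Ioo_integral_bound[OF mu _ t0])
        show "set_integrable lborel {0<..<t} (\<lambda>\<rho>. innerH sbar h (LH sbar \<mu> \<rho> b) - innerH sbar h b)"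
          using inc(1) ind by (intro set_integral_diff(1)) (auto simp: set_integrable_def)
        fix \<rho> assume \<rho>: "0 < \<rho>" "\<rho> < t"
        have SH: "S \<rho> h \<in> spH sbar" "S 0 h \<in> spH sbar" using \<rho> h by (auto intro: S_spH[OF mu S])
        have "innerH sbar h (LH sbar \<mu> \<rho> b) - innerH sbar h b = innerH sbar (S \<rho> h) b - innerH sbar (S 0 h) b"
          using S_adjoint[OF mu S h b, of \<rho>] \<rho> innerH_cong_AE_left[OF SH(2) h b S_0[OF mu S h]] by simp
        also have "\<dots> = innerH sbar (\<lambda>s. S \<rho> h s - S 0 h s) b" using SH b by (simp add: innerH_diff_left)
        finally have eq: "innerH sbar h (LH sbar \<mu> \<rho> b) - innerH sbar h b = innerH sbar (\<lambda>s. S \<rho> h s - S 0 h s) b" .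
        have "\<bar>innerH sbar (\<lambda>s. S \<rho> h s - S 0 h s) b\<bar> \<le> normH sbar (\<lambda>s. S \<rho> h s - S 0 h s) * normH sbar b"
          by (rule innerH_CS[OF spH_diff[OF SH] b])
        also have "\<dots> \<le> e / 2 * normV sbar \<mu> v"
          unfolding b_def using d(2)[of \<rho>] \<rho> t e by (intro mult_mono normH_src_le_normV) auto
        finally show "\<bar>innerH sbar h (LH sbar \<mu> \<rho> b) - innerH sbar h b\<bar> \<le> e / 2 * normV sbar \<mu> v" unfolding eq .
      qed
      moreover have "((1 / t) *\<^sub>R (T t (emb sbar h) - emb sbar h) - Aop sbar \<mu> h) v = - (I / t)"
      proof -
        have "T t (emb sbar h) v = innerH sbar h (LV \<mu> t v)"
          using ext[OF t0 h] v S_adjoint_spV[OF mu S h v t0] by (simp add: emb_def)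
        then have "((1 / t) *\<^sub>R (T t (emb sbar h) - emb sbar h) - Aop sbar \<mu> h) v
            = (1 / t) * (innerH sbar h (LV \<mu> t v) - innerH sbar h v) + innerH sbar h b"
          using v by (simp add: scaleR_fun_def emb_def Aop_def b_def)
        also have "innerH sbar h (LV \<mu> t v) - innerH sbar h v = - (I + t * innerH sbar h b)"
          using inc(2) I by simp
        also have "(1 / t) * - (I + t * innerH sbar h b) + innerH sbar h b = - (I / t)"
          using t by (simp add: field_simps)
        finally show ?thesis .
      qed
      ultimately show "\<bar>((1 / t) *\<^sub>R (T t (emb sbar h) - emb sbar h) - Aop sbar \<mu> h) v\<bar> \<le> e / 2 * normV sbar \<mu> v"
        using t by (simp add: abs_divide divide_le_eq mult.commute)
    qed (use e mu in auto)
    moreover have "0 \<le> normVd sbar \<mu> ((1 / t) *\<^sub>R (T t (emb sbar h) - emb sbar h) - Aop sbar \<mu> h)" if "0 < t" for t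
      using that h by (intro normVd_nonneg[OF mu] spVd_diff spVd_scaleR T_spVd emb_spVd Aop_spVd mu) auto
    ultimately show "\<forall>\<^sub>F t in at_right 0. dist (normVd sbar \<mu> ((1 / t) *\<^sub>R (T t (emb sbar h) - emb sbar h) - Aop sbar \<mu> h)) 0 < e"
      unfolding eventually_at_right_field using d(1) e by (intro exI[of _ d]) (force simp: dist_real_def)
  qed
qed

lemma genA_D:
  assumes "(x, y) \<in> genA sbar \<mu> T"
  shows "x \<in> spVd sbar \<mu>" "y \<in> spVd sbar \<mu>"
    and "v \<in> spV sbar \<Longrightarrow> ((\<lambda>t. (1 / t) * (T t x v - x v)) \<longlongrightarrow> y v) (at_right 0)"
proof -
  show xy: "x \<in> spVd sbar \<mu>" "y \<in> spVd sbar \<mu>"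
    using assms by (auto simp: genA_def generator_def)
  have lim: "((\<lambda>t. normVd sbar \<mu> ((1 / t) *\<^sub>R (T t x - x) - y)) \<longlongrightarrow> 0) (at_right 0)"
    using assms by (auto simp: genA_def generator_def)
  assume v: "v \<in> spV sbar"
  show "((\<lambda>t. (1 / t) * (T t x v - x v)) \<longlongrightarrow> y v) (at_right 0)"
  proof (rule LIM_zero_cancel, rule Lim_null_comparison)
    show "((\<lambda>t. normVd sbar \<mu> ((1 / t) *\<^sub>R (T t x - x) - y) * normV sbar \<mu> v) \<longlongrightarrow> 0) (at_right 0)"
      using tendsto_mult[OF lim tendsto_const, of "normV sbar \<mu> v"] by simp
    show "\<forall>\<^sub>F t in at_right 0. norm ((1 / t) * (T t x v - x v) - y v) \<le> normVd sbar \<mu> ((1 / t) *\<^sub>R (T t x - x) - y) * normV sbar \<mu> v"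
      using eventually_at_right_less[of "0::real"]
    proof eventually_elim
      case (elim t)
      have "(1 / t) *\<^sub>R (T t x - x) - y \<in> spVd sbar \<mu>"
        using elim xy by (intro spVd_diff spVd_scaleR T_spVd) auto
      from spVd_bound[OF mu this v] show ?case by (simp add: scaleR_fun_def)
    qed
  qed
qed

text \<open>\<open>T\<close> is prescribed on H only. Every \<open>x\<close> in V' is A applied to
  some \<open>h\<close> in H, hence the limit of the difference quotients \<open>q r\<close>, which
  come from H. There the formula is the adjointness of \<open>S\<close> and \<open>LV\<close>, and
  boundedness of \<open>T t\<close> carries it to the limit.\<close>

lemma T_eq:
  assumes x: "x \<in> spVd sbar \<mu>" and t: "0 \<le> t" and v: "v \<in> spV sbar"
  shows "T t x v = x (LV \<mu> t v)"
proof -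
  obtain h where h: "h \<in> spH sbar" "x = Aop sbar \<mu> h" using spVd_eq_Aop[OF mu x] .
  have Lv: "LV \<mu> t v \<in> spV sbar" by (rule LV_spV[OF mu v t])
  have gen: "(emb sbar h, x) \<in> genA sbar \<mu> T" using genA_emb[OF h(1)] by (simp add: h(2))
  define q where "q = (\<lambda>r. (1 / r) *\<^sub>R (T r (emb sbar h) - emb sbar h))"
  have qV: "q r \<in> spVd sbar \<mu>" if "0 < r" for r
    unfolding q_def using that h by (intro spVd_scaleR spVd_diff T_spVd emb_spVd) auto
  have lim: "((\<lambda>r. normVd sbar \<mu> (q r - x)) \<longlongrightarrow> 0) (at_right 0)"
    using gen by (auto simp: genA_def generator_def q_def)
  obtain C where C: "\<And>x. x \<in> spVd sbar \<mu> \<Longrightarrow> normVd sbar \<mu> (T t x) \<le> C * normVd sbar \<mu> x" using T_bdd[OF t] by blast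
  have 1: "((\<lambda>r. T t (q r) v) \<longlongrightarrow> T t x v) (at_right 0)"
  proof (rule LIM_zero_cancel, rule Lim_null_comparison)
    show "((\<lambda>r. (C * normVd sbar \<mu> (q r - x)) * normV sbar \<mu> v) \<longlongrightarrow> 0) (at_right 0)"
      using tendsto_mult[OF tendsto_mult[OF tendsto_const lim, of C] tendsto_const, of "normV sbar \<mu> v"] by simp
    show "\<forall>\<^sub>F r in at_right 0. norm (T t (q r) v - T t x v) \<le> (C * normVd sbar \<mu> (q r - x)) * normV sbar \<mu> v"
      using eventually_at_right_less[of "0::real"]
    proof eventually_elim
      case (elim r)
      have d: "q r - x \<in> spVd sbar \<mu>" by (intro spVd_diff qV elim x)
      have "T t (q r) v - T t x v = T t (q r - x) v"
        using T_lin[OF t qV[OF elim] x, of 1 "-1"] by simp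
      moreover have "\<bar>T t (q r - x) v\<bar> \<le> normVd sbar \<mu> (T t (q r - x)) * normV sbar \<mu> v"
        by (rule spVd_bound[OF mu T_spVd[OF t d] v])
      moreover have "\<dots> \<le> (C * normVd sbar \<mu> (q r - x)) * normV sbar \<mu> v"
        by (intro mult_right_mono C d) simp
      ultimately show ?case by simp
    qed
  qed
  have "T t (q r) v = (1 / r) * (T r (emb sbar h) (LV \<mu> t v) - emb sbar h (LV \<mu> t v))" if r: "0 < r" for r
  proof -
    have SH: "S r h \<in> spH sbar" using r h by (intro S_spH[OF mu S]) auto
    have "q r = (1 / r) *\<^sub>R emb sbar (S r h) + (- 1 / r) *\<^sub>R emb sbar h"
      using ext[of r h] r h unfolding q_def by (simp add: scaleR_diff_right)
    then have "T t (q r) = (1 / r) *\<^sub>R T t (emb sbar (S r h)) + (- 1 / r) *\<^sub>R T t (emb sbar h)"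
      using T_lin[OF t emb_spVd[OF SH] emb_spVd[OF h(1)], of "1 / r" "- 1 / r"] by (simp only:)
    then have "T t (q r) v = (1 / r) * (innerH sbar (S t (S r h)) v - innerH sbar (S t h) v)"
      using ext[OF t SH] ext[OF t h(1)] v by (simp add: scaleR_fun_def emb_def diff_divide_distrib)
    also have "\<dots> = (1 / r) * (T r (emb sbar h) (LV \<mu> t v) - emb sbar h (LV \<mu> t v))"
      using S_adjoint_spV[OF mu S SH v t] S_adjoint_spV[OF mu S h(1) v t] ext[of r h] r h Lv
      by (simp add: emb_def)
    finally show ?thesis .
  qed
  then have "((\<lambda>r. T t (q r) v) \<longlongrightarrow> x (LV \<mu> t v)) (at_right 0)"
    using genA_D(3)[OF gen Lv] by (elim Lim_transform_eventually) (auto simp: eventually_at_right_field intro: exI[of _ 1])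
  then show ?thesis using tendsto_unique[OF _ 1] by simp
qed

lemma spVd_LV_set_integrable:
  assumes y: "y \<in> spVd sbar \<mu>" and v: "v \<in> spV sbar"
  shows "set_integrable lborel {0<..<t} (\<lambda>\<sigma>. y (LV \<mu> \<sigma> v))"
proof -
  have "set_integrable lborel {0..t} (\<lambda>\<sigma>. y (LV \<mu> \<sigma> v))"
    by (intro borel_integrable_atLeastAtMost' continuous_on_subset[OF spVd_LV_continuous[OF mu S y v]]) auto
  then show ?thesis by (rule set_integrable_subset) auto
qed

text \<open>The right derivative of \<open>x (LV \<mu> r v)\<close> in \<open>r\<close> is
  \<open>y (LV \<mu> r v)\<close>, by the definition of the generator tested on translates of
  \<open>v\<close>. Subtracting a primitive leaves a continuous function with zero right
  derivative.\<close>

lemma genA_integral: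
  assumes xy: "(x, y) \<in> genA sbar \<mu> T" and v: "v \<in> spV sbar" and t: "0 \<le> t"
  shows "x (LV \<mu> t v) - x v = (LBINT \<sigma>:{0<..<t}. y (LV \<mu> \<sigma> v))"
proof -
  note xV = genA_D(1)[OF xy] and yV = genA_D(2)[OF xy]
  define c where "c = (\<lambda>r. y (LV \<mu> r v))"
  define I where "I = (\<lambda>r. integral {0..r} c)"
  have cont: "continuous_on {0..t} c"
    unfolding c_def by (rule continuous_on_subset[OF spVd_LV_continuous[OF mu S yV v]]) auto
  define f where "f = (\<lambda>r. x (LV \<mu> r v) - I r)"
  have "f t = f 0"
  proof (rule right_derivative_zero_const[OF t])
    have "c integrable_on {0..t}" by (rule integrable_continuous_real[OF cont])
    then show "continuous_on {0..t} f"
      unfolding f_def I_def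
      by (intro continuous_intros indefinite_integral_continuous_1 continuous_on_subset[OF spVd_LV_continuous[OF mu S xV v]]) auto
    fix r assume r: "0 \<le> r" "r < t"
    have Lr: "LV \<mu> r v \<in> spV sbar" by (rule LV_spV[OF mu v r(1)])
    have "(I has_vector_derivative c r) (at r within {0..t})"
      unfolding I_def using r by (intro integral_has_vector_derivative[OF cont]) auto
    then have "((\<lambda>z. (I z - I r) / (z - r)) \<longlongrightarrow> c r) (at r within {0..t})"
      by (simp add: has_real_derivative_iff_has_vector_derivative[symmetric] has_field_derivative_iff)
    then have "((\<lambda>z. (I z - I r) / (z - r)) \<longlongrightarrow> c r) (at r within {r..t})"
      by (rule tendsto_within_subset) (use r in auto)
    then have "((\<lambda>z. (I z - I r) / (z - r)) \<longlongrightarrow> c r) (at_right r)"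
      using r by (simp add: at_within_Icc_at_right)
    then have 1: "((\<lambda>d. (I (r + d) - I r) / d) \<longlongrightarrow> c r) (at_right 0)"
      by (subst (asm) at_right_to_0) (simp add: filterlim_filtermap add.commute)
    have "((\<lambda>d. (1 / d) * (T d x (LV \<mu> r v) - x (LV \<mu> r v))) \<longlongrightarrow> c r) (at_right 0)"
      unfolding c_def by (rule genA_D(3)[OF xy Lr])
    then have "((\<lambda>d. (1 / d) * (T d x (LV \<mu> r v) - x (LV \<mu> r v)) - (I (r + d) - I r) / d) \<longlongrightarrow> c r - c r) (at_right 0)"
      by (rule tendsto_diff[OF _ 1])
    then have "((\<lambda>d. (1 / d) * (T d x (LV \<mu> r v) - x (LV \<mu> r v)) - (I (r + d) - I r) / d) \<longlongrightarrow> 0) (at_right 0)" by simp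
    then show "((\<lambda>d. (f (r + d) - f r) / d) \<longlongrightarrow> 0) (at_right 0)"
    proof (rule Lim_transform_eventually)
      show "\<forall>\<^sub>F d in at_right 0. (1 / d) * (T d x (LV \<mu> r v) - x (LV \<mu> r v)) - (I (r + d) - I r) / d = (f (r + d) - f r) / d"
        using eventually_at_right_less[of "0::real"]
      proof eventually_elim
        case (elim d)
        have "T d x (LV \<mu> r v) = x (LV \<mu> (r + d) v)"
          using T_eq[OF xV _ Lr, of d] elim r by (simp add: LV_add add.commute)
        then show ?case by (simp add: f_def diff_divide_distrib)
      qed
    qed
  qed
  moreover have "I t = (LBINT \<sigma>:{0<..<t}. c \<sigma>)"
  proof -
    have "I t = (LBINT \<sigma>:{0..t}. c \<sigma>)"
      unfolding I_def by (rule set_borel_integral_eq_integral(2)[symmetric]) (rule borel_integrable_atLeastAtMost'[OF cont])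
    also have "\<dots> = (LBINT \<sigma>:{0<..<t}. c \<sigma>)"
    proof (rule set_integral_cong_set)
      show "set_borel_measurable lborel {0..t} c"
        using borel_integrable_atLeastAtMost'[OF cont] by (auto simp: set_integrable_def set_borel_measurable_def)
      show "set_borel_measurable lborel {0<..<t} c"
        using spVd_LV_set_integrable[OF yV v, of t] by (auto simp: set_integrable_def set_borel_measurable_def c_def)
      show "AE x in lborel. (x \<in> {0<..<t}) = (x \<in> {0..t})"
        using AE_lborel_singleton[of 0] AE_lborel_singleton[of t] by eventually_elim auto
    qed
    finally show ?thesis .
  qed
  ultimately show ?thesis using v by (simp add: f_def c_def I_def LV_0)
qed

text \<open>Injectivity of A: the difference of two preimages is invariant under all translations,
  yet it decays like \<open>exp (- \<mu> * t)\<close>.\<close>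

lemma genA_unique:
  assumes "(x, y) \<in> genA sbar \<mu> T" "(x', y) \<in> genA sbar \<mu> T"
  shows "x = x'"
proof (rule spVd_eqI[OF genA_D(1)[OF assms(1)] genA_D(1)[OF assms(2)]])
  note xV = genA_D(1)[OF assms(1)] and xV' = genA_D(1)[OF assms(2)]
  fix v assume v: "v \<in> spV sbar"
  have eq: "x v - x' v = (x - x') (LV \<mu> t v)" if "0 \<le> t" for t
    using genA_integral[OF assms(1) v that] genA_integral[OF assms(2) v that] by simp
  define D where "D = normVd sbar \<mu> (x - x')"
  have le: "\<bar>x v - x' v\<bar> \<le> D * (exp (- \<mu> * t) * normV sbar \<mu> v)" if "0 \<le> t" for t
  proof -
    have "\<bar>x v - x' v\<bar> \<le> D * normV sbar \<mu> (LV \<mu> t v)"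
      unfolding eq[OF that] D_def by (intro spVd_bound mu spVd_diff xV xV' LV_spV v that)
    also have "\<dots> \<le> D * (exp (- \<mu> * t) * normV sbar \<mu> v)"
      unfolding D_def by (intro mult_left_mono LV_normV mu v that normVd_nonneg spVd_diff xV xV')
    finally show ?thesis .
  qed
  have "filterlim (\<lambda>t. \<mu> * t) at_top at_top"
    by (rule filterlim_tendsto_pos_mult_at_top[OF tendsto_const mu filterlim_ident])
  then have "((\<lambda>t. exp (- (\<mu> * t))) \<longlongrightarrow> 0) at_top"
    by (intro filterlim_compose[OF exp_at_bot] filterlim_compose[OF filterlim_uminus_at_bot_at_top])
  then have "((\<lambda>t. D * (exp (- (\<mu> * t)) * normV sbar \<mu> v)) \<longlongrightarrow> D * (0 * normV sbar \<mu> v)) at_top"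
    by (intro tendsto_mult tendsto_const)
  then have "\<bar>x v - x' v\<bar> \<le> D * (0 * normV sbar \<mu> v)"
    by (rule tendsto_lowerbound) (use le in \<open>auto intro!: eventually_mono[OF eventually_ge_at_top[of 0]]\<close>)
  then show "x v = x' v" by simp
qed

text \<open>The definite description in \<open>A_inv\<close> is meaningful by surjectivity of A onto
  V' and by injectivity.\<close>

lemma A_inv_genA:
  assumes "z \<in> spVd sbar \<mu>"
  shows "(A_inv sbar \<mu> T z, z) \<in> genA sbar \<mu> T"
proof -
  obtain h where h: "h \<in> spH sbar" "z = Aop sbar \<mu> h" using spVd_eq_Aop[OF mu assms] .
  have "(emb sbar h, z) \<in> genA sbar \<mu> T" using genA_emb[OF h(1)] by (simp add: h(2))
  then have "\<exists>!x. (x, z) \<in> genA sbar \<mu> T" by (blast intro: genA_unique)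
  then show ?thesis unfolding A_inv_def by (rule theI')
qed

text \<open>Both pairs come from elements of H, by surjectivity and injectivity, and there linearity
  is that of the inner product.\<close>

lemma genA_lincomb:
  assumes "(x, y) \<in> genA sbar \<mu> T" "(x', y') \<in> genA sbar \<mu> T"
  shows "(a *\<^sub>R x + b *\<^sub>R x', a *\<^sub>R y + b *\<^sub>R y') \<in> genA sbar \<mu> T"
proof -
  obtain h where h: "h \<in> spH sbar" "y = Aop sbar \<mu> h" using spVd_eq_Aop[OF mu genA_D(2)[OF assms(1)]] .
  obtain h' where h': "h' \<in> spH sbar" "y' = Aop sbar \<mu> h'" using spVd_eq_Aop[OF mu genA_D(2)[OF assms(2)]] .
  have x: "x = emb sbar h" by (rule genA_unique[OF assms(1)]) (simp add: h genA_emb)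
  have x': "x' = emb sbar h'" by (rule genA_unique[OF assms(2)]) (simp add: h' genA_emb)
  define k where "k = (\<lambda>s. a * h s + b * h' s)"
  have k: "k \<in> spH sbar" unfolding k_def by (intro spH_lincomb h h')
  have "a *\<^sub>R x + b *\<^sub>R x' = emb sbar k"
    unfolding x x' k_def using h h' by (auto simp: fun_eq_iff scaleR_fun_def emb_def innerH_lincomb spV_spH)
  moreover have "a *\<^sub>R y + b *\<^sub>R y' = Aop sbar \<mu> k"
    unfolding h(2) h'(2) k_def using h h' by (auto simp: fun_eq_iff scaleR_fun_def Aop_def innerH_lincomb src_spH algebra_simps)
  ultimately show ?thesis using genA_emb[OF k] by simp
qed

end

text \<open>The functional calculus version of \<open>(\<lambda> - A\<^sub>0\<^sup>*)\<^sup>-\<^sup>1 = \<integral> exp(- \<lambda> t) L(t) dt\<close>.\<close>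

lemma spVd_resolvent:
  assumes mu: "0 < \<mu>" and lam: "0 < lam" and x: "x \<in> spVd sbar \<mu>" and \<alpha>: "\<alpha> \<in> spV sbar"
  shows "set_integrable lborel {0<..} (\<lambda>t. exp (- lam * t) * x (LV \<mu> t \<alpha>))"
    and "(LBINT t:{0<..}. exp (- lam * t) * x (LV \<mu> t \<alpha>)) = x (resolvent_star sbar \<mu> lam \<alpha>)"
proof -
  obtain h where h: "h \<in> spH sbar" "\<And>v. v \<in> spV sbar \<Longrightarrow> x v = innerH sbar h (src sbar \<mu> v)"
    using spVd_Riesz[OF mu x] by blast
  define \<kappa> where "\<kappa> = lam + \<mu>"
  have \<kappa>: "0 < \<kappa>" using lam mu by (simp add: \<kappa>_def)
  define a where "a = src sbar \<mu> \<alpha>"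
  have a: "a \<in> spH sbar" using \<alpha> by (simp add: a_def src_spH)
  have za: "zx sbar a \<in> L2 lborel" and zh: "zx sbar h \<in> L2 lborel" using a h by (simp_all add: spH_zx)
  have [measurable]: "zx sbar a \<in> borel_measurable borel" "zx sbar h \<in> borel_measurable borel"
    using a h by (simp_all add: spH_def measurable_ageM)
  define K where "K = (\<lambda>(t, s). zx sbar h s * (ekern \<kappa> 0 t * zx sbar a (s + t)))"
  have slice: "(LBINT t. ekern \<kappa> 0 t * f (s + t)) = (LBINT r. ekern \<kappa> s r * f r)" for f s
  proof -
    have "(LBINT r. ekern \<kappa> s r * f r) = (LBINT t. ekern \<kappa> s (s + 1 * t) * f (s + 1 * t))"
      using lborel_integral_real_affine[of 1 "\<lambda>r. ekern \<kappa> s r * f r" s] by simp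
    also have "\<dots> = (LBINT t. ekern \<kappa> 0 t * f (s + t))"
      using ekern_shift[of \<kappa> s 1 0] by simp
    finally show ?thesis by simp
  qed
  \<comment> \<open>With absolute values inside, the inner integral over \<open>t\<close> is again a
    \<open>bres\<close>, which is square integrable and can be paired with \<open>h\<close>.\<close>
  have K: "integrable (lborel \<Otimes>\<^sub>M lborel) K"
  proof -
    have "integrable (lborel \<Otimes>\<^sub>M lborel) (\<lambda>(s, t). K (t, s))"
    proof (rule lborel_pair.Fubini_integrable)
      show "(\<lambda>(s, t). K (t, s)) \<in> borel_measurable (lborel \<Otimes>\<^sub>M lborel)" unfolding K_def by measurable
      have i: "integrable lborel (\<lambda>t. ekern \<kappa> 0 t * zx sbar a (s + t))" for s
      proof -
        have "(\<lambda>t. zx sbar a (s + t)) \<in> L2 lborel"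
          using lborel_integrable_real_affine[OF L2_integrable_sq[OF za], of 1 s] by (simp add: L2_def)
        then show ?thesis by (intro L2_integrable_mult ekern_L2 \<kappa>)
      qed
      then show "AE s in lborel. integrable lborel (\<lambda>t. case (s, t) of (s, t) \<Rightarrow> K (t, s))" by (simp add: K_def)
      have absa: "(\<lambda>s. \<bar>a s\<bar>) \<in> spH sbar" using a by (auto simp: spH_L2 L2_def)
      have "(\<lambda>s. \<bar>zx sbar h s\<bar>) \<in> L2 lborel" using zh by (auto simp: L2_def)
      then have "integrable lborel (\<lambda>s. \<bar>zx sbar h s\<bar> * bres sbar \<kappa> (\<lambda>s. \<bar>a s\<bar>) s)"
        by (rule L2_integrable_mult[OF _ bres_L2[OF \<kappa> absa]])
      moreover have "\<bar>zx sbar h s\<bar> * bres sbar \<kappa> (\<lambda>s. \<bar>a s\<bar>) s = (LBINT t. norm (case (s, t) of (s, t) \<Rightarrow> K (t, s)))" for s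
      proof (cases "0 \<le> s")
        case True
        have "zx sbar (\<lambda>s. \<bar>a s\<bar>) r = \<bar>zx sbar a r\<bar>" for r by (simp add: zx_def indicator_def)
        then show ?thesis using True slice[of "\<lambda>r. \<bar>zx sbar a r\<bar>" s] by (simp add: K_def bres_def abs_mult)
      qed (simp add: K_def zx_def ages_def)
      ultimately show "integrable lborel (\<lambda>s. LBINT t. norm (case (s, t) of (s, t) \<Rightarrow> K (t, s)))" by simp
    qed
    from lborel_pair.integrable_product_swap[OF this] show ?thesis by (simp add: split_beta')
  qed
  have inner: "(LBINT s. K (t, s)) = indicator {0<..} t * (exp (- lam * t) * x (LV \<mu> t \<alpha>))" for t
  proof (cases "0 < t")
    case True
    then have t: "0 \<le> t" by simp
    have e: "exp (- (\<kappa> * t)) = exp (- (lam * t)) * exp (- (\<mu> * t))"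
      by (simp add: \<kappa>_def algebra_simps flip: exp_add)
    have "(LBINT s. K (t, s)) = (LBINT s. exp (- lam * t) * (zx sbar h s * LH sbar \<mu> t a s))"
      unfolding K_def using True
      by (intro Bochner_Integration.integral_cong refl)
        (simp add: ekern_def LH_def e)
    also have "\<dots> = exp (- lam * t) * innerH sbar h (LH sbar \<mu> t a)" by (simp add: innerH_zx_left)
    also have "innerH sbar h (LH sbar \<mu> t a) = x (LV \<mu> t \<alpha>)"
      unfolding a_def using innerH_src_LV[OF mu \<alpha> t h(1)] h(2)[OF LV_spV[OF mu \<alpha> t]] by simp
    finally show ?thesis using True by simp
  qed (simp add: K_def ekern_def)
  show "set_integrable lborel {0<..} (\<lambda>t. exp (- lam * t) * x (LV \<mu> t \<alpha>))"
    using lborel_pair.integrable_fst'[OF K] unfolding inner by (simp add: set_integrable_def)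
  have "(LBINT t:{0<..}. exp (- lam * t) * x (LV \<mu> t \<alpha>)) = (LBINT t. LBINT s. K (t, s))"
    unfolding inner by (simp add: set_lebesgue_integral_def)
  also have "\<dots> = (LBINT s. LBINT t. K (t, s))"
    using lborel_pair.Fubini_integral[of "\<lambda>t s. K (t, s)"] K by simp
  also have "\<dots> = (LBINT s. zx sbar h s * bres sbar \<kappa> a s)"
  proof (intro Bochner_Integration.integral_cong refl)
    show "(LBINT t. K (t, s)) = zx sbar h s * bres sbar \<kappa> a s" for s
      using slice[of "zx sbar a" s] by (cases "0 \<le> s") (auto simp: K_def bres_def zx_def ages_def)
  qed
  also have "\<dots> = innerH sbar h (bres sbar \<kappa> a)" by (simp add: innerH_zx_left)
  \<comment> \<open>So far the resolvent acts on \<open>src sbar \<mu> \<alpha>\<close>. Commuting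
    it with \<open>src\<close> lets the representation of \<open>x\<close> be read
    backwards.\<close>
  also have "\<dots> = innerH sbar h (src sbar \<mu> (bres sbar \<kappa> \<alpha>))"
    using src_bres_shifted[OF mu lam \<alpha>, folded \<kappa>_def a_def]
      bres_spH[OF \<kappa> a] src_spH[OF bres_spV[OF \<kappa> spV_spH[OF \<alpha>]], of \<mu>] h(1)
    by (intro innerH_cong_AE spH_measurable) (auto elim!: eventually_mono)
  also have "\<dots> = x (resolvent_star sbar \<mu> lam \<alpha>)"
    using h(2)[OF bres_spV[OF \<kappa> spV_spH[OF \<alpha>]]] resolvent_star_bres[OF mu lam \<alpha>] by (simp add: \<kappa>_def)
  finally show "(LBINT t:{0<..}. exp (- lam * t) * x (LV \<mu> t \<alpha>)) = x (resolvent_star sbar \<mu> lam \<alpha>)" .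
qed

section \<open>The control cost and its conjugate\<close>

text \<open>The two functionals are compared along the line through \<open>k\<close> only, where
  homogeneity suffices.\<close>

lemma frechet_deriv_unique:
  assumes L: "frechet_deriv_on X N F x L" and L': "frechet_deriv_on X N F x L'"
    and k: "\<And>c. c *\<^sub>R k \<in> X" "\<And>c. N (c *\<^sub>R k) = \<bar>c\<bar> * N k"
    and hom: "\<And>c. L (c *\<^sub>R k) = c * L k" "\<And>c. L' (c *\<^sub>R k) = c * L' k"
  shows "L k = L' k"
proof -
  \<comment> \<open>\<open>N\<close> is an arbitrary function here. A negative value would lie
    within every radius and bound an absolute value by a negative number.\<close>
  have "0 \<le> N k"
  proof (rule ccontr)
    assume neg: "\<not> 0 \<le> N k"
    obtain d where d: "0 < d" "\<And>k. k \<in> X \<Longrightarrow> N k < d \<Longrightarrow> \<bar>F (x + k) - F x - L k\<bar> \<le> 1 * N k"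
      using L zero_less_one unfolding frechet_deriv_on_def by blast
    have "\<bar>F (x + k) - F x - L k\<bar> \<le> 1 * N k" using k(1)[of 1] neg d(1) by (intro d(2)) auto
    then show False using neg by simp
  qed
  have small: "\<bar>L k - L' k\<bar> \<le> 2 * e * N k" if e: "0 < e" for e
  proof -
    obtain d where d: "0 < d" "\<And>k. k \<in> X \<Longrightarrow> N k < d \<Longrightarrow> \<bar>F (x + k) - F x - L k\<bar> \<le> e * N k"
      using L e unfolding frechet_deriv_on_def by blast
    obtain d' where d': "0 < d'" "\<And>k. k \<in> X \<Longrightarrow> N k < d' \<Longrightarrow> \<bar>F (x + k) - F x - L' k\<bar> \<le> e * N k"
      using L' e unfolding frechet_deriv_on_def by blast
    \<comment> \<open>Scales \<open>k\<close> into both radii; the added 1 covers the case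
      \<open>N k = 0\<close>.\<close>
    define c where "c = min d d' / (2 * (N k + 1))"
    have c: "0 < c" using d d' \<open>0 \<le> N k\<close> by (simp add: c_def)
    have "c * N k \<le> c * (N k + 1)" using c by simp
    also have "\<dots> = min d d' / 2" using \<open>0 \<le> N k\<close> by (simp add: c_def field_simps)
    also have "\<dots> < min d d'" using d(1) d'(1) by (auto simp: min_def)
    finally have small: "N (c *\<^sub>R k) < d" "N (c *\<^sub>R k) < d'" using c k(2)[of c] by auto
    have "\<bar>L (c *\<^sub>R k) - L' (c *\<^sub>R k)\<bar> \<le> 2 * (e * N (c *\<^sub>R k))"
      using d(2)[OF k(1) small(1)] d'(2)[OF k(1) small(2)] by linarith
    then have "c * \<bar>L k - L' k\<bar> \<le> c * (2 * e * N k)"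
      using c by (simp add: hom k(2) abs_mult mult_ac flip: right_diff_distrib)
    then show ?thesis using c by simp
  qed
  have "\<bar>L k - L' k\<bar> \<le> 0 + e" if "0 < e" for e
  proof -
    have "\<bar>L k - L' k\<bar> \<le> 2 * (e / (2 * (N k + 1))) * N k"
      by (rule small) (use that \<open>0 \<le> N k\<close> in simp)
    also have "\<dots> \<le> e" using that \<open>0 \<le> N k\<close> by (simp add: field_simps)
    finally show ?thesis by simp
  qed
  then have "\<bar>L k - L' k\<bar> \<le> 0" by (rule field_le_epsilon)
  then show ?thesis by simp
qed

section \<open>The control space U and the operator B\<close>

lemma spU_lincomb: "u \<in> spU sbar \<Longrightarrow> w \<in> spU sbar \<Longrightarrow> a *\<^sub>R u + b *\<^sub>R w \<in> spU sbar"
  using spH_lincomb[of "snd u" sbar "snd w" a b]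
  by (auto simp: spU_def scaleR_fun_def plus_fun_def)

lemma spU_diff: "u \<in> spU sbar \<Longrightarrow> w \<in> spU sbar \<Longrightarrow> u - w \<in> spU sbar"
  using spU_lincomb[of u sbar w 1 "-1"] by simp

lemma spU_scaleR: "u \<in> spU sbar \<Longrightarrow> a *\<^sub>R u \<in> spU sbar"
  using spU_lincomb[of u sbar u a 0] by simp

lemma spU_snd: "u \<in> spU sbar \<Longrightarrow> snd u \<in> spH sbar"
  by (auto simp: spU_def)

lemma normU_power2: "(normU sbar u)\<^sup>2 = (fst u)\<^sup>2 + (normH sbar (snd u))\<^sup>2"
proof -
  have "innerU sbar u u = (fst u)\<^sup>2 + (normH sbar (snd u))\<^sup>2"
    by (simp add: innerU_def power2_eq_square flip: normH_power2)
  then show ?thesis by (simp add: normU_def)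
qed

lemma normU_nonneg [simp]: "0 \<le> normU sbar u"
proof -
  have "0 \<le> innerH sbar (snd u) (snd u)" by (simp flip: normH_power2)
  then show ?thesis by (simp add: normU_def innerU_def)
qed

lemma fst_le_normU: "\<bar>fst u\<bar> \<le> normU sbar u"
  by (rule power2_le_imp_le) (simp_all add: normU_power2)

lemma snd_le_normU: "normH sbar (snd u) \<le> normU sbar u"
  by (rule power2_le_imp_le) (simp_all add: normU_power2)

lemma normU_scaleR: "normU sbar (a *\<^sub>R u) = \<bar>a\<bar> * normU sbar u"
proof -
  have "(normU sbar (a *\<^sub>R u))\<^sup>2 = (\<bar>a\<bar> * normU sbar u)\<^sup>2"
    by (simp add: normU_power2 scaleR_fun_def normH_cmult power_mult_distrib distrib_left)
  then show ?thesis by (simp add: power2_eq_iff_nonneg)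
qed

lemma innerU_lincomb:
  assumes "u \<in> spU sbar" "w \<in> spU sbar" "z \<in> spU sbar"
  shows "innerU sbar z (a *\<^sub>R u + b *\<^sub>R w) = a * innerU sbar z u + b * innerU sbar z w"
  using innerH_lincomb'[of "snd u" sbar "snd w" "snd z" a b] assms
  by (simp add: innerU_def scaleR_fun_def plus_fun_def spU_snd algebra_simps)

lemma innerU_diff: "u \<in> spU sbar \<Longrightarrow> w \<in> spU sbar \<Longrightarrow> z \<in> spU sbar \<Longrightarrow>
    innerU sbar z (u - w) = innerU sbar z u - innerU sbar z w"
  using innerU_lincomb[of u sbar w z 1 "-1"] by simp

lemma innerU_commute: "innerU sbar u w = innerU sbar w u"
  by (simp add: innerU_def innerH_commute[of sbar "snd u"] mult.commute)

text \<open>The factor 2 comes from estimating the two components separately by the full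
  norms.\<close>

lemma innerU_CS:
  assumes "u \<in> spU sbar" "w \<in> spU sbar"
  shows "\<bar>innerU sbar u w\<bar> \<le> 2 * (normU sbar u * normU sbar w)"
proof -
  have "\<bar>innerU sbar u w\<bar> \<le> \<bar>fst u\<bar> * \<bar>fst w\<bar> + normH sbar (snd u) * normH sbar (snd w)"
    using innerH_CS[OF spU_snd[OF assms(1)] spU_snd[OF assms(2)]] abs_triangle_ineq[of "fst u * fst w" "innerH sbar (snd u) (snd w)"]
    by (simp add: innerU_def abs_mult)
  also have "\<dots> \<le> normU sbar u * normU sbar w + normU sbar u * normU sbar w"
    by (intro add_mono mult_mono fst_le_normU snd_le_normU) auto
  finally show ?thesis by simp
qed

lemma opB_star_spU: "v \<in> spV sbar \<Longrightarrow> opB_star v \<in> spU sbar"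
  by (simp add: opB_star_def spU_def spV_spH)

lemma opB_innerU: "v \<in> spV sbar \<Longrightarrow> opB sbar u v = innerU sbar u (opB_star v)"
  by (simp add: opB_def emb_def delta0_def scaleR_fun_def innerU_def opB_star_def)

lemma opB_lincomb: 
  assumes "u \<in> spU sbar" "w \<in> spU sbar"
  shows "opB sbar (a *\<^sub>R u + b *\<^sub>R w) = a *\<^sub>R opB sbar u + b *\<^sub>R opB sbar w"
proof
  fix v
  show "opB sbar (a *\<^sub>R u + b *\<^sub>R w) v = (a *\<^sub>R opB sbar u + b *\<^sub>R opB sbar w) v"
  proof (cases "v \<in> spV sbar")
    case True
    then show ?thesis
      using innerU_lincomb[OF assms opB_star_spU[OF True], of a b]
      by (simp add: opB_innerU scaleR_fun_def innerU_commute[of sbar _ "opB_star v"])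
  qed (simp add: opB_def emb_def delta0_def scaleR_fun_def)
qed

text \<open>Bound for B: 1 stems from the embedding of V into H, \<open>1 / sqrt (2 * \<mu>)\<close>
  from evaluation at 0.\<close>

definition KB :: "real \<Rightarrow> real" where "KB \<mu> = 1 + 1 / sqrt (2 * \<mu>)"

lemma KB_pos: "0 < \<mu> \<Longrightarrow> 0 < KB \<mu>"
  by (simp add: KB_def add_pos_nonneg)

lemma opB_bound:
  assumes mu: "0 < \<mu>" and u: "u \<in> spU sbar" and v: "v \<in> spV sbar"
  shows "\<bar>opB sbar u v\<bar> \<le> KB \<mu> * normV sbar \<mu> v * normU sbar u"
proof -
  have "\<bar>opB sbar u v\<bar> \<le> \<bar>innerH sbar (snd u) v\<bar> + \<bar>fst u\<bar> * \<bar>v 0\<bar>"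
    using v abs_triangle_ineq[of "innerH sbar (snd u) v" "fst u * v 0"]
    by (simp add: opB_innerU innerU_def opB_star_def abs_mult)
  also have "\<dots> \<le> normU sbar u * normV sbar \<mu> v + normU sbar u * (normV sbar \<mu> v / sqrt (2 * \<mu>))"
  proof (intro add_mono mult_mono fst_le_normU spV_bound mu v)
    have "\<bar>innerH sbar (snd u) v\<bar> \<le> normH sbar (snd u) * normH sbar v"
      by (intro innerH_CS spU_snd[OF u] spV_spH[OF v])
    also have "\<dots> \<le> normU sbar u * normV sbar \<mu> v"
      by (intro mult_mono snd_le_normU normH_le_normV) auto
    finally show "\<bar>innerH sbar (snd u) v\<bar> \<le> normU sbar u * normV sbar \<mu> v" .
  qed auto
  finally show ?thesis by (simp add: KB_def algebra_simps)
qed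

context
  fixes sbar :: ereal and \<beta> q :: ctrl and \<epsilon> :: real
  assumes eps: "0 < \<epsilon>" "\<epsilon> \<le> fst \<beta>" "AE s in ageM sbar. \<epsilon> \<le> snd \<beta> s"
    "snd \<beta> \<in> borel_measurable (ageM sbar)" "\<exists>C. AE s in ageM sbar. \<bar>snd \<beta> s\<bar> \<le> C"
    and q: "q \<in> spU sbar"
begin

lemma beta_spH: "f \<in> spH sbar \<Longrightarrow> (\<lambda>s. snd \<beta> s * f s) \<in> spH sbar"
proof -
  obtain C where C: "AE s in ageM sbar. \<bar>snd \<beta> s\<bar> \<le> C" using eps(5) by blast
  assume f: "f \<in> spH sbar"
  show ?thesis
    unfolding spH_L2
  proof (rule L2_bound)
    show "f \<in> L2 (ageM sbar)" using f by (simp add: spH_L2)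
    show "AE s in ageM sbar. \<bar>snd \<beta> s * f s\<bar> \<le> C * \<bar>f s\<bar>"
      using C by eventually_elim (simp add: abs_mult mult_right_mono)
  qed (use f eps(4) in \<open>auto simp: spH_def\<close>)
qed

lemma opM_spU: "u \<in> spU sbar \<Longrightarrow> opM \<beta> u \<in> spU sbar"
proof -
  assume u: "u \<in> spU sbar"
  have "(\<lambda>s. snd u s / (2 * snd \<beta> s)) \<in> L2 (ageM sbar)"
  proof (rule L2_bound[of "snd u" _ _ "1 / (2 * \<epsilon>)"])
    show "snd u \<in> L2 (ageM sbar)" using spU_snd[OF u] by (simp add: spH_L2)
    show "AE s in ageM sbar. \<bar>snd u s / (2 * snd \<beta> s)\<bar> \<le> 1 / (2 * \<epsilon>) * \<bar>snd u s\<bar>"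
      using eps(3)
    proof eventually_elim
      case (elim s)
      have "\<bar>snd u s\<bar> / (2 * snd \<beta> s) \<le> \<bar>snd u s\<bar> / (2 * \<epsilon>)"
        using elim eps(1) by (intro divide_left_mono) auto
      then show ?case using elim eps(1) by (simp add: abs_divide)
    qed
  qed (use spU_snd[OF u] eps(4) in \<open>auto simp: spH_def\<close>)
  then show ?thesis by (simp add: opM_def spU_def spH_L2)
qed

text \<open>Quadratic part of the cost, which is also its exact second-order remainder about any
  control.\<close>

definition hq :: "ctrl \<Rightarrow> real" where
  "hq v = innerH sbar (\<lambda>s. snd \<beta> s * snd v s) (snd v) + fst \<beta> * (fst v)\<^sup>2"

lemma hq_lower: "v \<in> spU sbar \<Longrightarrow> \<epsilon> * (normU sbar v)\<^sup>2 \<le> hq v"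
proof -
  assume v: "v \<in> spU sbar"
  note vH = spU_snd[OF v]
  have "\<epsilon> * (normH sbar (snd v))\<^sup>2 = (LINT s|ageM sbar. \<epsilon> * (snd v s)\<^sup>2)"
    by (simp add: normH_l2norm l2norm_power2)
  also have "\<dots> \<le> (LINT s|ageM sbar. snd \<beta> s * snd v s * snd v s)"
  proof (rule integral_mono_AE)
    show "integrable (ageM sbar) (\<lambda>s. \<epsilon> * (snd v s)\<^sup>2)" using vH by (simp add: spH_def)
    show "integrable (ageM sbar) (\<lambda>s. snd \<beta> s * snd v s * snd v s)"
      using L2_integrable_mult[of _ "ageM sbar" "snd v"] beta_spH[OF vH] vH by (simp add: spH_L2)
    show "AE s in ageM sbar. \<epsilon> * (snd v s)\<^sup>2 \<le> snd \<beta> s * snd v s * snd v s"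
      using eps(3) by eventually_elim (simp add: power2_eq_square mult.assoc mult_right_mono)
  qed
  finally have "\<epsilon> * (normH sbar (snd v))\<^sup>2 \<le> innerH sbar (\<lambda>s. snd \<beta> s * snd v s) (snd v)" by (simp add: innerH_def)
  moreover have "\<epsilon> * (fst v)\<^sup>2 \<le> fst \<beta> * (fst v)\<^sup>2" using eps(2) by (intro mult_right_mono) auto
  ultimately show ?thesis by (simp add: hq_def normU_power2 distrib_left)
qed

lemma hq_upper: "\<exists>C\<ge>0. \<forall>v\<in>spU sbar. hq v \<le> C * (normU sbar v)\<^sup>2"
proof -
  obtain C where C: "AE s in ageM sbar. \<bar>snd \<beta> s\<bar> \<le> C" using eps(5) by blast
  have "hq v \<le> (\<bar>C\<bar> + fst \<beta>) * (normU sbar v)\<^sup>2" if v: "v \<in> spU sbar" for v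
  proof -
    note vH = spU_snd[OF v]
    have "(LINT s|ageM sbar. snd \<beta> s * snd v s * snd v s) \<le> (LINT s|ageM sbar. \<bar>C\<bar> * (snd v s)\<^sup>2)"
    proof (rule integral_mono_AE)
      show "integrable (ageM sbar) (\<lambda>s. \<bar>C\<bar> * (snd v s)\<^sup>2)" using vH by (simp add: spH_def)
      show "integrable (ageM sbar) (\<lambda>s. snd \<beta> s * snd v s * snd v s)"
        using L2_integrable_mult[of _ "ageM sbar" "snd v"] beta_spH[OF vH] vH by (simp add: spH_L2)
      show "AE s in ageM sbar. snd \<beta> s * snd v s * snd v s \<le> \<bar>C\<bar> * (snd v s)\<^sup>2"
        using C
      proof eventually_elim
        case (elim s)
        then have "snd \<beta> s \<le> \<bar>C\<bar>" by linarith
        then show ?case by (simp add: power2_eq_square mult.assoc mult_right_mono)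
      qed
    qed
    then have "innerH sbar (\<lambda>s. snd \<beta> s * snd v s) (snd v) \<le> \<bar>C\<bar> * (normH sbar (snd v))\<^sup>2"
      by (simp add: innerH_def normH_l2norm l2norm_power2)
    also have "\<dots> \<le> \<bar>C\<bar> * (normU sbar v)\<^sup>2" by (intro mult_left_mono) (auto simp: normU_power2)
    finally have "innerH sbar (\<lambda>s. snd \<beta> s * snd v s) (snd v) \<le> \<bar>C\<bar> * (normU sbar v)\<^sup>2" .
    moreover have "fst \<beta> * (fst v)\<^sup>2 \<le> fst \<beta> * (normU sbar v)\<^sup>2"
      using eps by (intro mult_left_mono) (auto simp: normU_power2)
    ultimately show ?thesis by (simp add: hq_def distrib_right)
  qed
  moreover have "0 \<le> \<bar>C\<bar> + fst \<beta>" using eps by simp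
  ultimately show ?thesis by blast
qed

lemma h0_eq: "u \<in> spU sbar \<Longrightarrow> h0 sbar \<beta> q u = hq u + innerU sbar q u"
proof -
  assume u: "u \<in> spU sbar"
  note uH = spU_snd[OF u]
  have "(LINT s|ageM sbar. snd u s * (snd \<beta> s * snd u s + snd q s)) =
      (LINT s|ageM sbar. snd \<beta> s * snd u s * snd u s + snd q s * snd u s)"
    by (simp add: algebra_simps)
  also have "\<dots> = innerH sbar (\<lambda>s. snd \<beta> s * snd u s) (snd u) + innerH sbar (snd q) (snd u)"
    unfolding innerH_def
    using L2_integrable_mult[of "\<lambda>s. snd \<beta> s * snd u s" "ageM sbar" "snd u"] L2_integrable_mult[of "snd q" "ageM sbar" "snd u"]
      beta_spH[OF uH] uH spU_snd[OF q]
    by (intro Bochner_Integration.integral_add) (auto simp: spH_L2)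
  finally show ?thesis by (simp add: h0_def hq_def innerU_def power2_eq_square algebra_simps)
qed

text \<open>At \<open>w\<close> the gradient \<open>2 * \<beta> * w + q\<close> of the cost equals
  \<open>z\<close>, and the expansion of a quadratic function is exact. As the remainder is
  nonnegative, \<open>w\<close> attains the supremum in the conjugate at \<open>z\<close>.\<close>

lemma h0_expand:
  assumes z: "z \<in> spU sbar" and u: "u \<in> spU sbar" and w: "w = opM \<beta> (z - q)"
  shows "h0 sbar \<beta> q u = h0 sbar \<beta> q w + innerU sbar z (u - w) + hq (u - w)"
proof -
  have wU: "w \<in> spU sbar" unfolding w by (intro opM_spU spU_diff z q)
  note H = spU_snd[OF z] spU_snd[OF u] spU_snd[OF wU] spU_snd[OF q]
  note bH = beta_spH[OF H(2)] beta_spH[OF H(3)]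
  have sym: "innerH sbar (\<lambda>s. snd \<beta> s * f s) g = innerH sbar (\<lambda>s. snd \<beta> s * g s) f" for f g
    by (simp add: innerH_def mult_ac)
  define d where "d = snd (u - w)"
  have d: "d = (\<lambda>s. snd u s - snd w s)" by (simp add: d_def fun_diff_def)
  have dH: "d \<in> spH sbar" unfolding d by (intro spH_diff H)
  note bd = beta_spH[OF dH]
  have u_eq: "snd u = (\<lambda>s. 1 * snd w s + 1 * d s)" by (simp add: d)
  have bu: "(\<lambda>s. snd \<beta> s * snd u s) = (\<lambda>s. 1 * (snd \<beta> s * snd w s) + 1 * (snd \<beta> s * d s))"
    by (simp add: d algebra_simps)
  have quad: "innerH sbar (\<lambda>s. snd \<beta> s * snd u s) (snd u)
      = innerH sbar (\<lambda>s. snd \<beta> s * snd w s) (snd w) + 2 * innerH sbar (\<lambda>s. snd \<beta> s * snd w s) d + innerH sbar (\<lambda>s. snd \<beta> s * d s) d"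
    unfolding bu innerH_lincomb[OF bH(2) bd H(2)]
    unfolding u_eq innerH_lincomb'[OF H(3) dH bH(2)] innerH_lincomb'[OF H(3) dH bd]
    using sym[of d "snd w"] by simp
  have "AE s in ageM sbar. 2 * (snd \<beta> s * snd w s) + 1 * snd q s = snd z s"
    using eps(3)
  proof eventually_elim
    case (elim s)
    then have "snd \<beta> s \<noteq> 0" using eps(1) by auto
    then have "2 * (snd \<beta> s * snd w s) = snd z s - snd q s" by (simp add: w opM_def)
    then show ?case by simp
  qed
  then have "innerH sbar (\<lambda>s. 2 * (snd \<beta> s * snd w s) + 1 * snd q s) d = innerH sbar (snd z) d"
    using spH_lincomb[OF bH(2) H(4), of 2 1] H(1) dH by (intro innerH_cong_AE_left)
  then have lin: "2 * innerH sbar (\<lambda>s. snd \<beta> s * snd w s) d + innerH sbar (snd q) d = innerH sbar (snd z) d"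
    using innerH_lincomb[OF bH(2) H(4) dH, of 2 1] by simp
  have qd: "innerH sbar (snd q) (snd u) = innerH sbar (snd q) (snd w) + innerH sbar (snd q) d"
    unfolding u_eq using innerH_lincomb'[OF H(3) dH H(4), of 1 1] by simp
  have "2 * fst \<beta> * fst w = fst z - fst q" using eps(1,2) by (simp add: w opM_def)
  then have f: "2 * fst \<beta> * fst w + fst q = fst z" by simp
  have f2: "fst \<beta> * (fst u)\<^sup>2 + fst q * fst u = fst \<beta> * (fst w)\<^sup>2 + fst q * fst w + fst z * (fst u - fst w) + fst \<beta> * (fst u - fst w)\<^sup>2"
    unfolding f[symmetric] by (simp add: power2_eq_square algebra_simps)
  show ?thesis
    unfolding h0_eq[OF u] h0_eq[OF wU] hq_def innerU_def d_def[symmetric] quad qd fst_diff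
    using lin f2 by linarith
qed

lemma h0_conj_eq:
  assumes z: "z \<in> spU sbar" and w: "w = opM \<beta> (z - q)"
  shows "bdd_above ((\<lambda>u. innerU sbar z u - h0 sbar \<beta> q u) ` spU sbar)"
    and "h0_conj sbar \<beta> q z = innerU sbar z w - h0 sbar \<beta> q w"
proof -
  have wU: "w \<in> spU sbar" unfolding w by (intro opM_spU spU_diff z q)
  have le: "innerU sbar z u - h0 sbar \<beta> q u \<le> innerU sbar z w - h0 sbar \<beta> q w" if u: "u \<in> spU sbar" for u
  proof -
    have "0 \<le> \<epsilon> * (normU sbar (u - w))\<^sup>2" using eps(1) by simp
    also have "\<dots> \<le> hq (u - w)" by (rule hq_lower[OF spU_diff[OF u wU]])
    finally show ?thesis using h0_expand[OF z u w] innerU_diff[OF u wU z] by simp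
  qed
  then show bdd: "bdd_above ((\<lambda>u. innerU sbar z u - h0 sbar \<beta> q u) ` spU sbar)" by (intro bdd_aboveI2)
  show "h0_conj sbar \<beta> q z = innerU sbar z w - h0 sbar \<beta> q w"
    unfolding h0_conj_def by (rule cSup_eq_maximum) (use wU le in auto)
qed

text \<open>From below, \<open>w\<close> competes in the supremum at \<open>z + k\<close>. From
  above, Young's inequality splits the cross term between \<open>k\<close> and \<open>u - w\<close>,
  and the part in \<open>u - w\<close> is absorbed by the strong convexity of \<open>hq\<close>. The
  error is quadratic in \<open>k\<close>.\<close>

lemma h0_conj_frechet:
  assumes z: "z \<in> spU sbar"
  shows "frechet_deriv_on (spU sbar) (normU sbar) (h0_conj sbar \<beta> q) z (innerU sbar (opM \<beta> (z - q)))"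
proof -
  define w where "w = opM \<beta> (z - q)"
  have wU: "w \<in> spU sbar" unfolding w_def by (intro opM_spU spU_diff z q)
  have main: "\<bar>h0_conj sbar \<beta> q (z + k) - h0_conj sbar \<beta> q z - innerU sbar w k\<bar> \<le> (normU sbar k)\<^sup>2 / \<epsilon>"
    if k: "k \<in> spU sbar" for k
  proof -
    have zk: "z + k \<in> spU sbar" using spU_lincomb[OF z k, of 1 1] by simp
    have add: "innerU sbar (z + k) u = innerU sbar z u + innerU sbar k u" if "u \<in> spU sbar" for u
      using innerU_lincomb[OF z k that, of 1 1] by (simp add: innerU_commute[of sbar _ u])
    have lo: "innerU sbar (z + k) w - h0 sbar \<beta> q w \<le> h0_conj sbar \<beta> q (z + k)"
      unfolding h0_conj_def[of _ _ _ "z + k"] by (rule cSUP_upper[OF wU h0_conj_eq(1)[OF zk refl]])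
    have up: "h0_conj sbar \<beta> q (z + k) \<le> h0_conj sbar \<beta> q z + innerU sbar k w + (normU sbar k)\<^sup>2 / \<epsilon>"
      unfolding h0_conj_def[of _ _ _ "z + k"]
    proof (rule cSUP_least)
      show "spU sbar \<noteq> {}" using z by blast
      fix u assume u: "u \<in> spU sbar"
      note d = spU_diff[OF u wU]
      have "innerU sbar k (u - w) \<le> 2 * (normU sbar k * normU sbar (u - w))" using innerU_CS[OF k d] by simp
      also have "\<dots> \<le> (normU sbar k)\<^sup>2 / \<epsilon> + \<epsilon> * (normU sbar (u - w))\<^sup>2"
      proof -
        have "0 \<le> (normU sbar k - \<epsilon> * normU sbar (u - w))\<^sup>2 / \<epsilon>" using eps(1) by simp
        also have "\<dots> = (normU sbar k)\<^sup>2 / \<epsilon> + \<epsilon> * (normU sbar (u - w))\<^sup>2 - 2 * (normU sbar k * normU sbar (u - w))"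
          using eps(1) by (simp add: power2_eq_square field_simps)
        finally show ?thesis by simp
      qed
      also have "\<dots> \<le> (normU sbar k)\<^sup>2 / \<epsilon> + hq (u - w)" using hq_lower[OF d] by simp
      finally show "innerU sbar (z + k) u - h0 sbar \<beta> q u \<le> h0_conj sbar \<beta> q z + innerU sbar k w + (normU sbar k)\<^sup>2 / \<epsilon>"
        using h0_expand[OF z u w_def] add[OF u] h0_conj_eq(2)[OF z w_def] innerU_diff[OF u wU z] innerU_diff[OF u wU k]
        by simp
    qed
    have "0 \<le> (normU sbar k)\<^sup>2 / \<epsilon>" using eps(1) by simp
    then show ?thesis using lo up add[OF wU] h0_conj_eq(2)[OF z w_def] innerU_commute[of sbar w k] by simp
  qed
  show ?thesis
    unfolding frechet_deriv_on_def w_def[symmetric]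
  proof (intro allI impI)
    fix e :: real assume e: "0 < e"
    show "\<exists>d>0. \<forall>k\<in>spU sbar. normU sbar k < d \<longrightarrow> \<bar>h0_conj sbar \<beta> q (z + k) - h0_conj sbar \<beta> q z - innerU sbar w k\<bar> \<le> e * normU sbar k"
    proof (intro exI[of _ "e * \<epsilon>"] conjI ballI impI)
      show "0 < e * \<epsilon>" using e eps(1) by simp
      fix k assume k: "k \<in> spU sbar" "normU sbar k < e * \<epsilon>"
      have "(normU sbar k)\<^sup>2 / \<epsilon> \<le> e * normU sbar k"
        using k(2) eps(1) mult_right_mono[of "normU sbar k" "e * \<epsilon>" "normU sbar k"]
        by (simp add: power2_eq_square divide_le_eq mult_ac)
      then show "\<bar>h0_conj sbar \<beta> q (z + k) - h0_conj sbar \<beta> q z - innerU sbar w k\<bar> \<le> e * normU sbar k"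
        using main[OF k(1)] by linarith
    qed
  qed
qed

text \<open>Controls are representatives, so the gradient determines \<open>w\<close> only up to
  null functions. The directions \<open>opB_star v\<close> recover \<open>opB sbar w\<close>, and
  only that enters the closed loop equation.\<close>

lemma h0_conj_frechet_opB:
  assumes z: "z \<in> spU sbar" and w: "w \<in> spU sbar"
    and F: "frechet_deriv_on (spU sbar) (normU sbar) (h0_conj sbar \<beta> q) z (innerU sbar w)"
  shows "opB sbar w = opB sbar (opM \<beta> (z - q))"
proof
  fix v
  have w': "opM \<beta> (z - q) \<in> spU sbar" by (intro opM_spU spU_diff z q)
  show "opB sbar w v = opB sbar (opM \<beta> (z - q)) v"
  proof (cases "v \<in> spV sbar")
    case True
    note k = opB_star_spU[OF True]
    have "innerU sbar w (opB_star v) = innerU sbar (opM \<beta> (z - q)) (opB_star v)"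
      by (rule frechet_deriv_unique[OF F h0_conj_frechet[OF z]])
        (use innerU_lincomb[OF k k w, of _ 0] innerU_lincomb[OF k k w', of _ 0] in
          \<open>auto simp: spU_scaleR k normU_scaleR\<close>)
    then show ?thesis by (simp add: opB_innerU True)
  qed (simp add: opB_def emb_def delta0_def scaleR_fun_def)
qed

end

section \<open>Admissible controls and the state\<close>

lemma bochnerE:
  fixes u :: "real \<Rightarrow> 'x::real_vector"
  assumes "bochner_measurable X N u"
  obtains \<phi> :: "nat \<Rightarrow> real \<Rightarrow> 'x" where "\<forall>n. finite (\<phi> n ` {0<..})" "\<forall>n. \<phi> n ` {0<..} \<subseteq> X"
      "\<forall>n x. {\<tau>. 0 < \<tau> \<and> \<phi> n \<tau> = x} \<in> sets borel" "\<forall>\<tau>>0. (\<lambda>n. N (\<phi> n \<tau> - u \<tau>)) \<longlonglongrightarrow> 0"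
proof -
  have "\<exists>\<phi> :: nat \<Rightarrow> real \<Rightarrow> 'x. (\<forall>n. finite (\<phi> n ` {0<..}) \<and> \<phi> n ` {0<..} \<subseteq> X \<and>
      (\<forall>x. {\<tau>. 0 < \<tau> \<and> \<phi> n \<tau> = x} \<in> sets borel)) \<and> (\<forall>\<tau>>0. (\<lambda>n. N (\<phi> n \<tau> - u \<tau>)) \<longlonglongrightarrow> 0)"
    using assms unfolding bochner_measurable_def by (rule conjunct2)
  then obtain \<phi> :: "nat \<Rightarrow> real \<Rightarrow> 'x" where \<phi>: "(\<forall>n. finite (\<phi> n ` {0<..}) \<and> \<phi> n ` {0<..} \<subseteq> X \<and>
      (\<forall>x. {\<tau>. 0 < \<tau> \<and> \<phi> n \<tau> = x} \<in> sets borel)) \<and> (\<forall>\<tau>>0. (\<lambda>n. N (\<phi> n \<tau> - u \<tau>)) \<longlonglongrightarrow> 0)"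
    by (rule exE)
  show ?thesis
    by (rule that[of \<phi>]) (use \<phi> in simp_all)
qed

lemma bochner_measurable_in: "bochner_measurable X N u \<Longrightarrow> 0 < \<tau> \<Longrightarrow> u \<tau> \<in> X"
  by (simp add: bochner_measurable_def)

text \<open>For a simple function the composite is a finite sum of products of indicators and
  sections \<open>G x\<close>; sequential continuity in the seminorm carries joint measurability to
  the limit. The parameter space \<open>P\<close> prepares for Fubini.\<close>

lemma bochner_joint_measurable:
  fixes G :: "'x::real_vector \<Rightarrow> 'p \<Rightarrow> real"
  assumes u: "bochner_measurable X N u"
    and meas: "\<And>x. x \<in> X \<Longrightarrow> G x \<in> borel_measurable P"
    and cont: "\<And>p \<psi> x. p \<in> space P \<Longrightarrow> (\<And>n::nat. \<psi> n \<in> X) \<Longrightarrow> x \<in> X \<Longrightarrow>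
        (\<lambda>n. N (\<psi> n - x)) \<longlonglongrightarrow> 0 \<Longrightarrow> (\<lambda>n. G (\<psi> n) p) \<longlonglongrightarrow> G x p"
  shows "(\<lambda>(p, \<sigma>). indicator {0<..} \<sigma> * G (u \<sigma>) p) \<in> borel_measurable (P \<Otimes>\<^sub>M borel)"
proof -
  obtain \<phi> :: "nat \<Rightarrow> real \<Rightarrow> 'x" where \<phi>: "\<forall>n. finite (\<phi> n ` {0<..})" "\<forall>n. \<phi> n ` {0<..} \<subseteq> X"
      "\<forall>n x. {\<tau>. 0 < \<tau> \<and> \<phi> n \<tau> = x} \<in> sets borel" "\<forall>\<tau>>0. (\<lambda>n. N (\<phi> n \<tau> - u \<tau>)) \<longlonglongrightarrow> 0"
    using bochnerE[OF u] .
  note \<phi> = \<phi>[rule_format]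
  have uX: "\<And>\<tau>. 0 < \<tau> \<Longrightarrow> u \<tau> \<in> X" by (rule bochner_measurable_in[OF u])
  define g where "g = (\<lambda>n (p, \<sigma>). \<Sum>x\<in>\<phi> n ` {0<..}. indicator {\<tau>. 0 < \<tau> \<and> \<phi> n \<tau> = x} \<sigma> * G x p)"
  have gm: "g n \<in> borel_measurable (P \<Otimes>\<^sub>M borel)" for n
    unfolding g_def split_beta'
  proof (intro borel_measurable_sum borel_measurable_times)
    fix x assume "x \<in> \<phi> n ` {0<..}"
    then have x: "x \<in> X" using \<phi>(2) by blast
    have [measurable]: "G x \<in> borel_measurable P" by (rule meas[OF x])
    show "(\<lambda>y. G x (fst y)) \<in> borel_measurable (P \<Otimes>\<^sub>M borel)" by measurable
    have [measurable]: "{\<tau>. 0 < \<tau> \<and> \<phi> n \<tau> = x} \<in> sets borel" by (rule \<phi>)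
    have "indicat_real {\<tau>. 0 < \<tau> \<and> \<phi> n \<tau> = x} \<in> borel_measurable borel" by measurable
    then show "(\<lambda>y. indicat_real {\<tau>. 0 < \<tau> \<and> \<phi> n \<tau> = x} (snd y)) \<in> borel_measurable (P \<Otimes>\<^sub>M borel)"
      by (rule measurable_compose[OF measurable_snd])
  qed
  show ?thesis
  proof (rule borel_measurable_LIMSEQ_real[OF _ gm])
    fix y :: "'p \<times> real" assume "y \<in> space (P \<Otimes>\<^sub>M borel)"
    then obtain p \<sigma> where y: "y = (p, \<sigma>)" "p \<in> space P" by (auto simp: space_pair_measure)
    show "(\<lambda>n. g n y) \<longlonglongrightarrow> (case y of (p, \<sigma>) \<Rightarrow> indicator {0<..} \<sigma> * G (u \<sigma>) p)"
    proof (cases "0 < \<sigma>")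
      case True
      have "g n y = G (\<phi> n \<sigma>) p" for n
      proof -
        have "g n y = (\<Sum>x\<in>\<phi> n ` {0<..}. if x = \<phi> n \<sigma> then G x p else 0)"
          unfolding g_def y using True by (auto intro!: sum.cong simp: indicator_def)
        also have "\<dots> = G (\<phi> n \<sigma>) p" using \<phi>(1)[of n] True by (simp add: sum.delta)
        finally show ?thesis .
      qed
      moreover have "(\<lambda>n. G (\<phi> n \<sigma>) p) \<longlonglongrightarrow> G (u \<sigma>) p"
        using \<phi>(2,4) True uX by (intro cont y) auto
      ultimately show ?thesis using True by (simp add: y)
    next
      case False
      then have "g n y = 0" for n unfolding g_def y by (auto intro!: sum.neutral)
      then show ?thesis using False by (simp add: y)
    qed
  qed
qed

lemma bochner_measurable_compose:
  fixes G :: "'x::real_vector \<Rightarrow> real"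
  assumes u: "bochner_measurable X N u"
    and cont: "\<And>\<psi> x. (\<And>n::nat. \<psi> n \<in> X) \<Longrightarrow> x \<in> X \<Longrightarrow> (\<lambda>n. N (\<psi> n - x)) \<longlonglongrightarrow> 0 \<Longrightarrow> (\<lambda>n. G (\<psi> n)) \<longlonglongrightarrow> G x"
  shows "(\<lambda>\<sigma>. indicator {0<..} \<sigma> * G (u \<sigma>)) \<in> borel_measurable borel"
proof -
  have "(\<lambda>(p :: real, \<sigma>). indicator {0<..} \<sigma> * G (u \<sigma>)) \<in> borel_measurable (borel \<Otimes>\<^sub>M borel)"
    using bochner_joint_measurable[OF u, of "\<lambda>x p. G x" "borel :: real measure"] cont by simp
  then have "(\<lambda>\<sigma>. (case (0 :: real, \<sigma>) of (p, \<sigma>) \<Rightarrow> indicator {0<..} \<sigma> * G (u \<sigma>))) \<in> borel_measurable borel"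
    by (rule measurable_compose[rotated]) measurable
  then show ?thesis by simp
qed

lemma bochner_measurable_lincomb:
  fixes u w :: "real \<Rightarrow> 'x::real_vector"
  assumes u: "bochner_measurable X N u" and w: "bochner_measurable X N w"
    and X: "\<And>x y. x \<in> X \<Longrightarrow> y \<in> X \<Longrightarrow> a *\<^sub>R x + b *\<^sub>R y \<in> X"
    and N: "\<And>x y. x \<in> X \<Longrightarrow> y \<in> X \<Longrightarrow> 0 \<le> N (a *\<^sub>R x + b *\<^sub>R y) \<and> N (a *\<^sub>R x + b *\<^sub>R y) \<le> \<bar>a\<bar> * N x + \<bar>b\<bar> * N y"
    and diff: "\<And>x y. x \<in> X \<Longrightarrow> y \<in> X \<Longrightarrow> x - y \<in> X"
  shows "bochner_measurable X N (\<lambda>\<tau>. a *\<^sub>R u \<tau> + b *\<^sub>R w \<tau>)"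
proof -
  obtain \<phi> :: "nat \<Rightarrow> real \<Rightarrow> 'x" where \<phi>: "\<forall>n. finite (\<phi> n ` {0<..})" "\<forall>n. \<phi> n ` {0<..} \<subseteq> X"
      "\<forall>n x. {\<tau>. 0 < \<tau> \<and> \<phi> n \<tau> = x} \<in> sets borel" "\<forall>\<tau>>0. (\<lambda>n. N (\<phi> n \<tau> - u \<tau>)) \<longlonglongrightarrow> 0"
    using bochnerE[OF u] .
  note \<phi> = \<phi>[rule_format]
  obtain \<psi> :: "nat \<Rightarrow> real \<Rightarrow> 'x" where \<psi>: "\<forall>n. finite (\<psi> n ` {0<..})" "\<forall>n. \<psi> n ` {0<..} \<subseteq> X"
      "\<forall>n x. {\<tau>. 0 < \<tau> \<and> \<psi> n \<tau> = x} \<in> sets borel" "\<forall>\<tau>>0. (\<lambda>n. N (\<psi> n \<tau> - w \<tau>)) \<longlonglongrightarrow> 0"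
    using bochnerE[OF w] .
  note \<psi> = \<psi>[rule_format]
  have uX: "\<And>\<tau>. 0 < \<tau> \<Longrightarrow> u \<tau> \<in> X" "\<And>\<tau>. 0 < \<tau> \<Longrightarrow> w \<tau> \<in> X"
    using bochner_measurable_in[OF u] bochner_measurable_in[OF w] by blast+
  define \<zeta> where "\<zeta> = (\<lambda>n \<tau>. a *\<^sub>R \<phi> n \<tau> + b *\<^sub>R \<psi> n \<tau>)"
  have fin: "finite (\<zeta> n ` {0<..})" for n
    by (rule finite_subset[of _ "(\<lambda>(x, y). a *\<^sub>R x + b *\<^sub>R y) ` (\<phi> n ` {0<..} \<times> \<psi> n ` {0<..})"])
      (use \<phi>(1)[of n] \<psi>(1)[of n] in \<open>auto simp: \<zeta>_def\<close>)
  have sub: "\<zeta> n ` {0<..} \<subseteq> X" for n using \<phi>(2)[of n] \<psi>(2)[of n] by (auto simp: \<zeta>_def intro!: X)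
  have sets: "{\<tau>. 0 < \<tau> \<and> \<zeta> n \<tau> = x} \<in> sets borel" for n x
  proof -
    have "{\<tau>. 0 < \<tau> \<and> \<zeta> n \<tau> = x} = (\<Union>(y, z)\<in>{(y, z) \<in> \<phi> n ` {0<..} \<times> \<psi> n ` {0<..}. a *\<^sub>R y + b *\<^sub>R z = x}.
        {\<tau>. 0 < \<tau> \<and> \<phi> n \<tau> = y} \<inter> {\<tau>. 0 < \<tau> \<and> \<psi> n \<tau> = z})"
      by (auto simp: \<zeta>_def)
    also have "\<dots> \<in> sets borel"
    proof (rule sets.finite_UN)
      show "finite {(y, z) \<in> \<phi> n ` {0<..} \<times> \<psi> n ` {0<..}. a *\<^sub>R y + b *\<^sub>R z = x}"
        by (rule finite_subset[of _ "\<phi> n ` {0<..} \<times> \<psi> n ` {0<..}"]) (use \<phi>(1)[of n] \<psi>(1)[of n] in auto)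
    qed (use \<phi>(3) \<psi>(3) in auto)
    finally show ?thesis .
  qed
  have conv: "(\<lambda>n. N (\<zeta> n \<tau> - (a *\<^sub>R u \<tau> + b *\<^sub>R w \<tau>))) \<longlonglongrightarrow> 0" if \<tau>: "0 < \<tau>" for \<tau>
  proof (rule Lim_null_comparison)
    show "\<forall>\<^sub>F n in sequentially. norm (N (\<zeta> n \<tau> - (a *\<^sub>R u \<tau> + b *\<^sub>R w \<tau>)))
        \<le> \<bar>a\<bar> * N (\<phi> n \<tau> - u \<tau>) + \<bar>b\<bar> * N (\<psi> n \<tau> - w \<tau>)"
    proof (rule always_eventually, rule allI)
      fix n
      have eq: "\<zeta> n \<tau> - (a *\<^sub>R u \<tau> + b *\<^sub>R w \<tau>) = a *\<^sub>R (\<phi> n \<tau> - u \<tau>) + b *\<^sub>R (\<psi> n \<tau> - w \<tau>)"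
        by (simp add: \<zeta>_def scaleR_diff_right algebra_simps)
      have X: "\<phi> n \<tau> - u \<tau> \<in> X" "\<psi> n \<tau> - w \<tau> \<in> X"
        using \<phi>(2)[of n] \<psi>(2)[of n] uX \<tau> by (auto intro!: diff)
      show "norm (N (\<zeta> n \<tau> - (a *\<^sub>R u \<tau> + b *\<^sub>R w \<tau>))) \<le> \<bar>a\<bar> * N (\<phi> n \<tau> - u \<tau>) + \<bar>b\<bar> * N (\<psi> n \<tau> - w \<tau>)"
        using N[OF X] unfolding eq by simp
    qed
    have "(\<lambda>n. \<bar>a\<bar> * N (\<phi> n \<tau> - u \<tau>) + \<bar>b\<bar> * N (\<psi> n \<tau> - w \<tau>)) \<longlonglongrightarrow> \<bar>a\<bar> * 0 + \<bar>b\<bar> * 0"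
      by (intro tendsto_intros \<phi> \<psi> \<tau>)
    then show "(\<lambda>n. \<bar>a\<bar> * N (\<phi> n \<tau> - u \<tau>) + \<bar>b\<bar> * N (\<psi> n \<tau> - w \<tau>)) \<longlonglongrightarrow> 0" by simp
  qed
  show ?thesis
    unfolding bochner_measurable_def
    using uX X fin sub sets conv by (intro conjI allI impI exI[of _ \<zeta>]) auto
qed

lemma bochner_measurable_shift:
  assumes u: "bochner_measurable X N u" and t: "0 \<le> t"
  shows "bochner_measurable X N (\<lambda>\<tau>. u (t + \<tau>))"
proof -
  obtain \<phi> :: "nat \<Rightarrow> real \<Rightarrow> 'a" where \<phi>: "\<forall>n. finite (\<phi> n ` {0<..})" "\<forall>n. \<phi> n ` {0<..} \<subseteq> X"
      "\<forall>n x. {\<tau>. 0 < \<tau> \<and> \<phi> n \<tau> = x} \<in> sets borel" "\<forall>\<tau>>0. (\<lambda>n. N (\<phi> n \<tau> - u \<tau>)) \<longlonglongrightarrow> 0"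
    using bochnerE[OF u] .
  note \<phi> = \<phi>[rule_format]
  define \<zeta> where "\<zeta> = (\<lambda>n \<tau>. \<phi> n (t + \<tau>))"
  have img: "\<zeta> n ` {0<..} \<subseteq> \<phi> n ` {0<..}" for n using t by (auto simp: \<zeta>_def)
  have "{\<tau>. 0 < \<tau> \<and> \<zeta> n \<tau> = x} \<in> sets borel" for n x
  proof -
    have "(\<lambda>\<tau>. t + \<tau>) -` {\<tau>. 0 < \<tau> \<and> \<phi> n \<tau> = x} \<inter> space borel \<in> sets borel"
      by (rule measurable_sets[OF _ \<phi>(3)]) measurable
    \<comment> \<open>Positivity of \<open>t + \<tau>\<close> does not force \<tau> to be positive,
      hence the intersection.\<close>
    then have "((\<lambda>\<tau>. t + \<tau>) -` {\<tau>. 0 < \<tau> \<and> \<phi> n \<tau> = x}) \<inter> {0<..} \<in> sets borel" by auto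
    also have "((\<lambda>\<tau>. t + \<tau>) -` {\<tau>. 0 < \<tau> \<and> \<phi> n \<tau> = x}) \<inter> {0<..} = {\<tau>. 0 < \<tau> \<and> \<zeta> n \<tau> = x}"
      using t by (auto simp: \<zeta>_def)
    finally show ?thesis .
  qed
  moreover have "u (t + \<tau>) \<in> X" if "0 < \<tau>" for \<tau> using bochner_measurable_in[OF u] t that by simp
  moreover have "(\<lambda>n. N (\<zeta> n \<tau> - u (t + \<tau>))) \<longlonglongrightarrow> 0" if "0 < \<tau>" for \<tau>
    using \<phi>(4)[of "t + \<tau>"] t that by (simp add: \<zeta>_def)
  moreover have "finite (\<zeta> n ` {0<..})" "\<zeta> n ` {0<..} \<subseteq> X" for n
    using img[of n] \<phi>(1,2)[of n] by (auto intro: finite_subset)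
  ultimately show ?thesis
    unfolding bochner_measurable_def by (intro conjI allI impI exI[of _ \<zeta>]) auto
qed

lemma bochner_measurable_const:
  assumes "w \<in> X" "N 0 = 0" shows "bochner_measurable X N (\<lambda>\<tau>. w)"
proof -
  have "{\<tau> :: real. 0 < \<tau> \<and> w = x} \<in> sets borel" for x by (cases "w = x") (auto simp flip: greaterThan_def)
  moreover have "finite ((\<lambda>\<tau>. w) ` {0<..})" by (rule finite_subset[of _ "{w}"]) auto
  ultimately show ?thesis
    unfolding bochner_measurable_def using assms by (intro conjI allI impI exI[of _ "\<lambda>n \<tau>. w"]) auto
qed

lemma normU_triangle:
  assumes "u \<in> spU sbar" "w \<in> spU sbar"
  shows "normU sbar (u + w) \<le> normU sbar u + normU sbar w"
proof (rule power2_le_imp_le)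
  have s: "normH sbar (snd (u + w)) \<le> normH sbar (snd u) + normH sbar (snd w)"
    using normH_triangle[OF spU_snd[OF assms(1)] spU_snd[OF assms(2)]] by (simp add: plus_fun_def)
  define a b c d where "a = fst u" and "b = normH sbar (snd u)" and "c = fst w" and "d = normH sbar (snd w)"
  have "a * c + b * d \<le> normU sbar u * normU sbar w"
  proof (rule power2_le_imp_le)
    have "0 \<le> (a * d - b * c)\<^sup>2" by simp
    then show "(a * c + b * d)\<^sup>2 \<le> (normU sbar u * normU sbar w)\<^sup>2"
      unfolding power_mult_distrib normU_power2 a_def[symmetric] b_def[symmetric] c_def[symmetric] d_def[symmetric]
      by (simp add: power2_eq_square algebra_simps)
  qed simp
  moreover have "(normU sbar (u + w))\<^sup>2 \<le> (a + c)\<^sup>2 + (b + d)\<^sup>2"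
    unfolding normU_power2 a_def b_def c_def d_def using s by (auto intro!: power_mono)
  moreover have "(normU sbar u)\<^sup>2 = a\<^sup>2 + b\<^sup>2" "(normU sbar w)\<^sup>2 = c\<^sup>2 + d\<^sup>2"
    by (simp_all add: normU_power2 a_def b_def c_def d_def)
  ultimately show "(normU sbar (u + w))\<^sup>2 \<le> (normU sbar u + normU sbar w)\<^sup>2"
    by (simp add: power2_sum)
qed simp

lemma normU_lincomb:
  assumes "u \<in> spU sbar" "w \<in> spU sbar"
  shows "normU sbar (a *\<^sub>R u + b *\<^sub>R w) \<le> \<bar>a\<bar> * normU sbar u + \<bar>b\<bar> * normU sbar w"
  using normU_triangle[OF spU_scaleR[OF assms(1)] spU_scaleR[OF assms(2)], of a b] by (simp add: normU_scaleR)

lemma normU_zero: "normU sbar 0 = 0"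
  using normU_scaleR[of sbar 0 0] by simp

lemma indicator_exp: "(\<lambda>t. indicator {0<..} t *\<^sub>R exp (- c * t)) = (\<lambda>x::real. if 0 < x then exp (- c * x) else 0)"
  by (auto simp: indicator_def fun_eq_iff)

lemma exp_neg_set_integrable: "0 < c \<Longrightarrow> set_integrable lborel {0<..} (\<lambda>t::real. exp (- c * t))"
  unfolding set_integrable_def indicator_exp by (rule exp_kernel_integrable)

lemma exp_neg_set_integral: "0 < c \<Longrightarrow> (LBINT t:{0<..}. exp (- c * t)) = 1 / (c :: real)"
  unfolding set_lebesgue_integral_def indicator_exp by (rule exp_kernel_integral)

lemma admissible_iff:
  "u \<in> admissible sbar lam \<longleftrightarrow> bochner_measurable (spU sbar) (normU sbar) u \<and>
     set_integrable lborel {0<..} (\<lambda>\<tau>. exp (- lam * \<tau>) * (normU sbar (u \<tau>))\<^sup>2)"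
proof -
  have "(normU sbar (exp (- lam * \<tau> / 2) *\<^sub>R u \<tau>))\<^sup>2 = exp (- lam * \<tau>) * (normU sbar (u \<tau>))\<^sup>2" for \<tau>
  proof -
    have "(exp (- lam * \<tau> / 2))\<^sup>2 = exp (- lam * \<tau>)" by (simp add: power2_eq_square flip: exp_add)
    then show ?thesis unfolding normU_scaleR by (simp add: power_mult_distrib)
  qed
  then show ?thesis by (simp add: admissible_def)
qed

lemma admissible_spU: "u \<in> admissible sbar lam \<Longrightarrow> 0 < \<tau> \<Longrightarrow> u \<tau> \<in> spU sbar"
  by (simp add: admissible_iff bochner_measurable_def)

lemma admissible_const:
  assumes "0 < lam" "w \<in> spU sbar" shows "(\<lambda>\<tau>. w) \<in> admissible sbar lam"
  unfolding admissible_iff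
  using bochner_measurable_const[of w "spU sbar" "normU sbar"] assms exp_neg_set_integrable[of lam]
  by (simp add: normU_zero)

text \<open>Measurability is read off from the integrability in the definition by removing the
  weight and taking the square root.\<close>

lemma admissible_normU_measurable:
  assumes u: "u \<in> admissible sbar lam"
  shows "(\<lambda>\<tau>. indicator {0<..} \<tau> * normU sbar (u \<tau>)) \<in> borel_measurable borel"
proof -
  have "(\<lambda>\<tau>. indicator {0<..} \<tau> * (exp (- lam * \<tau>) * (normU sbar (u \<tau>))\<^sup>2)) \<in> borel_measurable borel"
    using u by (auto simp: admissible_iff set_integrable_def dest: borel_measurable_integrable)
  then have "(\<lambda>\<tau>. sqrt (exp (lam * \<tau>) * (indicator {0<..} \<tau> * (exp (- lam * \<tau>) * (normU sbar (u \<tau>))\<^sup>2)))) \<in> borel_measurable borel"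
    by measurable
  also have "(\<lambda>\<tau>. sqrt (exp (lam * \<tau>) * (indicator {0<..} \<tau> * (exp (- lam * \<tau>) * (normU sbar (u \<tau>))\<^sup>2))))
      = (\<lambda>\<tau>. indicator {0<..} \<tau> * normU sbar (u \<tau>))"
  proof
    fix \<tau>
    have e: "exp (lam * \<tau>) * (exp (- (lam * \<tau>)) * y) = y" for y
      by (simp flip: mult.assoc exp_add)
    show "sqrt (exp (lam * \<tau>) * (indicator {0<..} \<tau> * (exp (- lam * \<tau>) * (normU sbar (u \<tau>))\<^sup>2)))
        = indicator {0<..} \<tau> * normU sbar (u \<tau>)"
      by (cases "0 < \<tau>") (simp_all add: e)
  qed
  finally show ?thesis .
qed

lemma admissible_lincomb:
  assumes u: "u \<in> admissible sbar lam" and w: "w \<in> admissible sbar lam"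
  shows "(\<lambda>\<tau>. a *\<^sub>R u \<tau> + b *\<^sub>R w \<tau>) \<in> admissible sbar lam"
proof -
  let ?z = "\<lambda>\<tau>. a *\<^sub>R u \<tau> + b *\<^sub>R w \<tau>"
  have bm: "bochner_measurable (spU sbar) (normU sbar) ?z"
    by (rule bochner_measurable_lincomb)
      (use u w normU_lincomb in \<open>auto simp: admissible_iff spU_diff intro!: spU_lincomb\<close>)
  have sq: "(\<lambda>\<tau>. indicator {0<..} \<tau> * (normU sbar (?z \<tau>))\<^sup>2) \<in> borel_measurable borel"
  proof (rule bochner_measurable_compose[OF bm])
    fix \<psi> :: "nat \<Rightarrow> ctrl" and x assume \<psi>: "\<And>n. \<psi> n \<in> spU sbar" "x \<in> spU sbar" "(\<lambda>n. normU sbar (\<psi> n - x)) \<longlonglongrightarrow> 0"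
    have "(\<lambda>n. normU sbar (\<psi> n)) \<longlonglongrightarrow> normU sbar x"
    proof (rule LIM_zero_cancel, rule Lim_null_comparison[OF always_eventually \<psi>(3)], rule allI)
      fix n
      have "normU sbar (x - \<psi> n) = normU sbar (\<psi> n - x)" using normU_scaleR[of sbar "-1" "\<psi> n - x"] by simp
      then show "norm (normU sbar (\<psi> n) - normU sbar x) \<le> normU sbar (\<psi> n - x)"
        using normU_triangle[OF spU_diff[OF \<psi>(1)[of n] \<psi>(2)] \<psi>(2)] normU_triangle[OF spU_diff[OF \<psi>(2) \<psi>(1)[of n]] \<psi>(1)[of n]]
        by (simp add: abs_le_iff)
    qed
    then show "(\<lambda>n. (normU sbar (\<psi> n))\<^sup>2) \<longlonglongrightarrow> (normU sbar x)\<^sup>2" by (intro tendsto_intros)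
  qed
  have "set_integrable lborel {0<..} (\<lambda>\<tau>. exp (- lam * \<tau>) * (normU sbar (?z \<tau>))\<^sup>2)"
    unfolding set_integrable_def
  proof (rule Bochner_Integration.integrable_bound)
    show "integrable lborel (\<lambda>\<tau>. 2 * a\<^sup>2 * (indicator {0<..} \<tau> *\<^sub>R (exp (- lam * \<tau>) * (normU sbar (u \<tau>))\<^sup>2))
        + 2 * b\<^sup>2 * (indicator {0<..} \<tau> *\<^sub>R (exp (- lam * \<tau>) * (normU sbar (w \<tau>))\<^sup>2)))"
    proof (intro Bochner_Integration.integrable_add Bochner_Integration.integrable_mult_right)
      show "integrable lborel (\<lambda>\<tau>. indicator {0<..} \<tau> *\<^sub>R (exp (- lam * \<tau>) * (normU sbar (u \<tau>))\<^sup>2))"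
        "integrable lborel (\<lambda>\<tau>. indicator {0<..} \<tau> *\<^sub>R (exp (- lam * \<tau>) * (normU sbar (w \<tau>))\<^sup>2))"
        using u w by (simp_all add: admissible_iff set_integrable_def)
    qed
    have "(\<lambda>\<tau>. exp (- lam * \<tau>) * (indicator {0<..} \<tau> * (normU sbar (?z \<tau>))\<^sup>2)) \<in> borel_measurable borel"
      using sq by measurable
    then show "(\<lambda>\<tau>. indicator {0<..} \<tau> *\<^sub>R (exp (- lam * \<tau>) * (normU sbar (?z \<tau>))\<^sup>2)) \<in> borel_measurable lborel"
      by (simp add: mult.left_commute)
    show "AE \<tau> in lborel. norm (indicator {0<..} \<tau> *\<^sub>R (exp (- lam * \<tau>) * (normU sbar (?z \<tau>))\<^sup>2))
        \<le> norm (2 * a\<^sup>2 * (indicator {0<..} \<tau> *\<^sub>R (exp (- lam * \<tau>) * (normU sbar (u \<tau>))\<^sup>2))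
        + 2 * b\<^sup>2 * (indicator {0<..} \<tau> *\<^sub>R (exp (- lam * \<tau>) * (normU sbar (w \<tau>))\<^sup>2)))"
    proof (rule AE_I2)
      fix \<tau>
      show "norm (indicator {0<..} \<tau> *\<^sub>R (exp (- lam * \<tau>) * (normU sbar (?z \<tau>))\<^sup>2))
        \<le> norm (2 * a\<^sup>2 * (indicator {0<..} \<tau> *\<^sub>R (exp (- lam * \<tau>) * (normU sbar (u \<tau>))\<^sup>2))
        + 2 * b\<^sup>2 * (indicator {0<..} \<tau> *\<^sub>R (exp (- lam * \<tau>) * (normU sbar (w \<tau>))\<^sup>2)))"
      proof (cases "0 < \<tau>")
        case True
        define p r where "p = \<bar>a\<bar> * normU sbar (u \<tau>)" and "r = \<bar>b\<bar> * normU sbar (w \<tau>)"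
        have "(normU sbar (?z \<tau>))\<^sup>2 \<le> (p + r)\<^sup>2"
          unfolding p_def r_def using True u w by (intro power_mono normU_lincomb admissible_spU) auto
        also have "\<dots> \<le> 2 * p\<^sup>2 + 2 * r\<^sup>2" using sum_squares_bound[of p r] by (simp add: power2_sum)
        also have "\<dots> = 2 * a\<^sup>2 * (normU sbar (u \<tau>))\<^sup>2 + 2 * b\<^sup>2 * (normU sbar (w \<tau>))\<^sup>2"
          by (simp add: p_def r_def power_mult_distrib)
        finally have "exp (- lam * \<tau>) * (normU sbar (?z \<tau>))\<^sup>2
            \<le> exp (- lam * \<tau>) * (2 * a\<^sup>2 * (normU sbar (u \<tau>))\<^sup>2 + 2 * b\<^sup>2 * (normU sbar (w \<tau>))\<^sup>2)"
          by (intro mult_left_mono) auto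
        then show ?thesis using True by (simp add: distrib_left mult.left_commute abs_of_nonneg)
      qed simp
    qed
  qed
  then show ?thesis using bm by (simp add: admissible_iff)
qed

lemma admissible_shift:
  assumes u: "u \<in> admissible sbar lam" and t: "0 \<le> t"
  shows "(\<lambda>\<tau>. u (t + \<tau>)) \<in> admissible sbar lam"
proof -
  define F where "F = (\<lambda>\<tau>. indicator {0<..} \<tau> *\<^sub>R (exp (- lam * \<tau>) * (normU sbar (u \<tau>))\<^sup>2))"
  have F: "integrable lborel F" using u by (simp add: admissible_iff set_integrable_def F_def)
  have "integrable lborel (\<lambda>\<tau>. exp (lam * t) * F (t + 1 * \<tau>))"
    using lborel_integrable_real_affine[OF F, of 1 t] by simp
  then have "integrable lborel (\<lambda>\<tau>. indicator {0<..} \<tau> *\<^sub>R (exp (lam * t) * F (t + 1 * \<tau>)))"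
    by (rule integrable_mult_indicator[rotated]) simp
  also have "(\<lambda>\<tau>. indicator {0<..} \<tau> *\<^sub>R (exp (lam * t) * F (t + 1 * \<tau>)))
      = (\<lambda>\<tau>. indicator {0<..} \<tau> *\<^sub>R (exp (- lam * \<tau>) * (normU sbar (u (t + \<tau>)))\<^sup>2))"
  proof
    fix \<tau>
    have "exp (lam * t) * (exp (- lam * (t + \<tau>)) * y) = exp (- lam * \<tau>) * y" for y
      by (simp add: algebra_simps flip: mult.assoc exp_add)
    then show "indicator {0<..} \<tau> *\<^sub>R (exp (lam * t) * F (t + 1 * \<tau>))
        = indicator {0<..} \<tau> *\<^sub>R (exp (- lam * \<tau>) * (normU sbar (u (t + \<tau>)))\<^sup>2)"
      using t by (cases "0 < \<tau>") (simp_all add: F_def)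
  qed
  finally show ?thesis
    using bochner_measurable_shift[OF _ t, of "spU sbar" "normU sbar" u] u
    by (simp add: admissible_iff set_integrable_def)
qed

section \<open>The state as a convolution\<close>

locale vintage =
  fixes sbar :: ereal and \<mu> lam \<epsilon> :: real and S :: "real \<Rightarrow> fn \<Rightarrow> fn"
    and T :: "real \<Rightarrow> funct \<Rightarrow> funct" and \<beta> q :: ctrl
  assumes mu: "0 < \<mu>" and lam: "0 < lam"
    and S: "generates_A0 sbar \<mu> S" and T: "extends_to_Vd sbar \<mu> S T"
    and eps: "0 < \<epsilon>" "\<epsilon> \<le> fst \<beta>" "AE s in ageM sbar. \<epsilon> \<le> snd \<beta> s"
      "snd \<beta> \<in> borel_measurable (ageM sbar)" "\<exists>C. AE s in ageM sbar. \<bar>snd \<beta> s\<bar> \<le> C"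
    and q: "q \<in> spU sbar"
begin

abbreviation adm :: "(real \<Rightarrow> ctrl) set" where "adm \<equiv> admissible sbar lam"

text \<open>The control part of the state at time \<open>\<tau>\<close>, paired with \<open>v\<close>.\<close>

definition cv :: "(real \<Rightarrow> ctrl) \<Rightarrow> fn \<Rightarrow> real \<Rightarrow> real" where
  "cv u v \<tau> = (LBINT \<sigma>:{0<..<\<tau>}. opB sbar (u \<sigma>) (LV \<mu> (\<tau> - \<sigma>) v))"

text \<open>The integrand of \<open>cv\<close>, extended by zero to a kernel on the plane to which
  Fubini applies.\<close>

definition cvk :: "(real \<Rightarrow> ctrl) \<Rightarrow> fn \<Rightarrow> real \<Rightarrow> real \<Rightarrow> real" where
  "cvk u v \<tau> \<sigma> = indicator {0<..<\<tau>} \<sigma> * opB sbar (u \<sigma>) (LV \<mu> (\<tau> - \<sigma>) v)"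

definition nU :: "(real \<Rightarrow> ctrl) \<Rightarrow> real \<Rightarrow> real" where
  "nU u \<sigma> = indicator {0<..} \<sigma> * normU sbar (u \<sigma>)"

lemma cv_cvk: "cv u v \<tau> = (LBINT \<sigma>. cvk u v \<tau> \<sigma>)"
  by (simp add: cv_def cvk_def set_lebesgue_integral_def)

lemma nU_nonneg [simp]: "0 \<le> nU u \<sigma>"
  by (simp add: nU_def)

lemma nU_measurable [measurable]: "u \<in> adm \<Longrightarrow> nU u \<in> borel_measurable borel"
  unfolding nU_def[abs_def] by (rule admissible_normU_measurable)

lemma nU_sq_integrable: "u \<in> adm \<Longrightarrow> integrable lborel (\<lambda>\<sigma>. exp (- lam * \<sigma>) * (nU u \<sigma>)\<^sup>2)"
proof -
  assume u: "u \<in> adm"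
  have "(\<lambda>\<sigma>. exp (- lam * \<sigma>) * (nU u \<sigma>)\<^sup>2) = (\<lambda>\<tau>. indicator {0<..} \<tau> *\<^sub>R (exp (- lam * \<tau>) * (normU sbar (u \<tau>))\<^sup>2))"
    by (auto simp: nU_def indicator_def)
  then show ?thesis using u by (simp add: admissible_iff set_integrable_def)
qed

lemma nU_integrable: "u \<in> adm \<Longrightarrow> integrable lborel (\<lambda>\<sigma>. exp (- lam * \<sigma>) * nU u \<sigma>)"
proof (rule Bochner_Integration.integrable_bound)
  assume u: "u \<in> adm"
  have e: "integrable lborel (\<lambda>\<sigma>. indicator {0<..} \<sigma> * exp (- lam * \<sigma>))"
    using exp_neg_set_integrable[OF lam] by (simp add: set_integrable_def)
  show "integrable lborel (\<lambda>\<sigma>. indicator {0<..} \<sigma> * exp (- lam * \<sigma>) + exp (- lam * \<sigma>) * (nU u \<sigma>)\<^sup>2)"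
    by (rule Bochner_Integration.integrable_add[OF e nU_sq_integrable[OF u]])
  show "(\<lambda>\<sigma>. exp (- lam * \<sigma>) * nU u \<sigma>) \<in> borel_measurable lborel" using u by measurable
  show "AE \<sigma> in lborel. norm (exp (- lam * \<sigma>) * nU u \<sigma>) \<le> norm (indicator {0<..} \<sigma> * exp (- lam * \<sigma>) + exp (- lam * \<sigma>) * (nU u \<sigma>)\<^sup>2)"
  proof (rule AE_I2)
    fix \<sigma>
    have "y \<le> 1 + y\<^sup>2" for y :: real 
    proof -
      have "0 \<le> (y - 1)\<^sup>2 + y\<^sup>2 + 1" by simp
      then show ?thesis by (simp add: power2_diff)
    qed
    from this[of "nU u \<sigma>"] have "exp (- lam * \<sigma>) * nU u \<sigma> \<le> exp (- lam * \<sigma>) * (1 + (nU u \<sigma>)\<^sup>2)"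
      by (intro mult_left_mono) auto
    then show "norm (exp (- lam * \<sigma>) * nU u \<sigma>) \<le> norm (indicator {0<..} \<sigma> * exp (- lam * \<sigma>) + exp (- lam * \<sigma>) * (nU u \<sigma>)\<^sup>2)"
      by (cases "0 < \<sigma>") (simp_all add: nU_def abs_of_nonneg distrib_left)
  qed
qed

lemma opB_LV_bound:
  assumes u: "u \<in> adm" and v: "v \<in> spV sbar" and \<sigma>: "0 < \<sigma>" "\<sigma> < \<tau>"
  shows "\<bar>opB sbar (u \<sigma>) (LV \<mu> (\<tau> - \<sigma>) v)\<bar> \<le> KB \<mu> * normV sbar \<mu> v * (ekern \<mu> \<sigma> \<tau> * nU u \<sigma>)"
proof -
  have uU: "u \<sigma> \<in> spU sbar" using admissible_spU[OF u \<sigma>(1)] .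
  have "\<bar>opB sbar (u \<sigma>) (LV \<mu> (\<tau> - \<sigma>) v)\<bar> \<le> KB \<mu> * normV sbar \<mu> (LV \<mu> (\<tau> - \<sigma>) v) * normU sbar (u \<sigma>)"
    using \<sigma> by (intro opB_bound mu uU LV_spV v) auto
  also have "\<dots> \<le> KB \<mu> * (exp (- \<mu> * (\<tau> - \<sigma>)) * normV sbar \<mu> v) * normU sbar (u \<sigma>)"
    using \<sigma> KB_pos[OF mu] by (intro mult_right_mono mult_left_mono LV_normV mu v) auto
  finally show ?thesis using \<sigma> by (simp add: ekern_def nU_def mult_ac)
qed

lemma cvk_bound:
  assumes u: "u \<in> adm" and v: "v \<in> spV sbar"
  shows "\<bar>cvk u v \<tau> \<sigma>\<bar> \<le> KB \<mu> * normV sbar \<mu> v * (ekern \<mu> \<sigma> \<tau> * nU u \<sigma>)"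
proof (cases "0 < \<sigma> \<and> \<sigma> < \<tau>")
  case True
  then show ?thesis using opB_LV_bound[OF u v, of \<sigma> \<tau>] by (simp add: cvk_def)
next
  case False
  then have "cvk u v \<tau> \<sigma> = 0" by (auto simp: cvk_def)
  moreover have "0 \<le> KB \<mu> * normV sbar \<mu> v * (ekern \<mu> \<sigma> \<tau> * nU u \<sigma>)"
    using KB_pos[OF mu] by (intro mult_nonneg_nonneg) auto
  ultimately show ?thesis by simp
qed

text \<open>With the translation time \<open>p\<close> as a separate parameter, joint measurability
  follows from that of the control; the substitution \<open>p = \<tau> - \<sigma>\<close> then gives
  the convolution kernel.\<close>

lemma cvk_measurable:
  assumes u: "u \<in> adm" and v: "v \<in> spV sbar"
  shows "(\<lambda>(\<tau>, \<sigma>). cvk u v \<tau> \<sigma>) \<in> borel_measurable (lborel \<Otimes>\<^sub>M lborel)"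
proof -
  have bm: "bochner_measurable (spU sbar) (normU sbar) u" using u by (simp add: admissible_iff)
  \<comment> \<open>Continuity in the translation time is established on the nonnegative axis, hence
    \<open>max 0 p\<close>.\<close>
  have "(\<lambda>(p, \<sigma>). indicator {0<..} \<sigma> * opB sbar (u \<sigma>) (LV \<mu> (max 0 p) v)) \<in> borel_measurable (borel \<Otimes>\<^sub>M borel)"
  proof (rule bochner_joint_measurable[OF bm])
    fix x assume x: "x \<in> spU sbar"
    have "continuous_on UNIV (\<lambda>p. opB sbar x (LV \<mu> (max 0 p) v))"
      by (rule continuous_on_compose2[OF spVd_LV_continuous[OF mu S opB_spVd[OF mu x] v]])
        (auto intro!: continuous_intros)
    then show "(\<lambda>p. opB sbar x (LV \<mu> (max 0 p) v)) \<in> borel_measurable borel"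
      by (rule borel_measurable_continuous_onI)
  next
    fix p :: real and \<psi> :: "nat \<Rightarrow> ctrl" and x
    assume \<psi>: "\<And>n. \<psi> n \<in> spU sbar" "x \<in> spU sbar" "(\<lambda>n. normU sbar (\<psi> n - x)) \<longlonglongrightarrow> 0"
    define w where "w = LV \<mu> (max 0 p) v"
    have w: "w \<in> spV sbar" unfolding w_def by (intro LV_spV mu v) simp
    show "(\<lambda>n. opB sbar (\<psi> n) (LV \<mu> (max 0 p) v)) \<longlonglongrightarrow> opB sbar x (LV \<mu> (max 0 p) v)"
      unfolding w_def[symmetric]
    proof (rule LIM_zero_cancel, rule Lim_null_comparison)
      show "\<forall>\<^sub>F n in sequentially. norm (opB sbar (\<psi> n) w - opB sbar x w) \<le> KB \<mu> * normV sbar \<mu> w * normU sbar (\<psi> n - x)"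
      proof (rule always_eventually, rule allI)
        fix n
        have "opB sbar (\<psi> n) w - opB sbar x w = opB sbar (\<psi> n - x) w"
          using opB_lincomb[OF \<psi>(1)[of n] \<psi>(2), of 1 "-1"] by simp
        then show "norm (opB sbar (\<psi> n) w - opB sbar x w) \<le> KB \<mu> * normV sbar \<mu> w * normU sbar (\<psi> n - x)"
          using opB_bound[OF mu spU_diff[OF \<psi>(1)[of n] \<psi>(2)] w] by simp
      qed
      show "(\<lambda>n. KB \<mu> * normV sbar \<mu> w * normU sbar (\<psi> n - x)) \<longlonglongrightarrow> 0"
        using tendsto_mult[OF tendsto_const \<psi>(3), of "KB \<mu> * normV sbar \<mu> w"] by simp
    qed
  qed
  then have J: "(\<lambda>(p, \<sigma>). indicator {0<..} \<sigma> * opB sbar (u \<sigma>) (LV \<mu> (max 0 p) v)) \<in> borel_measurable (borel \<Otimes>\<^sub>M borel)" .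
  have "(\<lambda>y :: real \<times> real. (fst y - snd y, snd y)) \<in> (lborel \<Otimes>\<^sub>M lborel) \<rightarrow>\<^sub>M (borel \<Otimes>\<^sub>M borel)" by measurable
  from measurable_compose[OF this J]
  have J': "(\<lambda>y. indicator {0<..} (snd y) * opB sbar (u (snd y)) (LV \<mu> (max 0 (fst y - snd y)) v)) \<in> borel_measurable (lborel \<Otimes>\<^sub>M lborel)"
    by simp
  have "(\<lambda>y. (if snd y < fst y then indicator {0<..} (snd y) * opB sbar (u (snd y)) (LV \<mu> (max 0 (fst y - snd y)) v) else 0)) \<in> borel_measurable (lborel \<Otimes>\<^sub>M lborel)"
    by (intro measurable_If J') measurable
  also have "(\<lambda>y. (if snd y < fst y then indicator {0<..} (snd y) * opB sbar (u (snd y)) (LV \<mu> (max 0 (fst y - snd y)) v) else 0))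
      = (\<lambda>(\<tau>, \<sigma>). cvk u v \<tau> \<sigma>)"
    by (auto simp: fun_eq_iff cvk_def indicator_def max_def)
  finally show ?thesis .
qed

lemma cvk_slice_measurable: "u \<in> adm \<Longrightarrow> v \<in> spV sbar \<Longrightarrow> cvk u v \<tau> \<in> borel_measurable borel"
  using measurable_compose[of "\<lambda>\<sigma>. (\<tau>, \<sigma>)" borel "lborel \<Otimes>\<^sub>M lborel", OF _ cvk_measurable] by simp

lemma ekern_nU_sq_integrable:
  assumes u: "u \<in> adm" shows "integrable lborel (\<lambda>\<sigma>. ekern \<mu> \<sigma> \<tau> * (nU u \<sigma>)\<^sup>2)"
proof (rule Bochner_Integration.integrable_bound)
  show "integrable lborel (\<lambda>\<sigma>. exp (lam * \<tau>) * (exp (- lam * \<sigma>) * (nU u \<sigma>)\<^sup>2))"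
    using nU_sq_integrable[OF u] by simp
  show "(\<lambda>\<sigma>. ekern \<mu> \<sigma> \<tau> * (nU u \<sigma>)\<^sup>2) \<in> borel_measurable lborel" using u by measurable
  show "AE \<sigma> in lborel. norm (ekern \<mu> \<sigma> \<tau> * (nU u \<sigma>)\<^sup>2) \<le> norm (exp (lam * \<tau>) * (exp (- lam * \<sigma>) * (nU u \<sigma>)\<^sup>2))"
  proof (rule AE_I2)
    fix \<sigma>
    have "ekern \<mu> \<sigma> \<tau> \<le> exp (lam * \<tau>) * exp (- lam * \<sigma>)"
    proof (cases "\<sigma> < \<tau>")
      case True
      then have "ekern \<mu> \<sigma> \<tau> \<le> 1" using mu by (simp add: ekern_def)
      also have "1 \<le> exp (lam * (\<tau> - \<sigma>))" using lam True by simp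
      finally show ?thesis by (simp add: algebra_simps flip: exp_add)
    qed (simp add: ekern_def)
    then have "ekern \<mu> \<sigma> \<tau> * (nU u \<sigma>)\<^sup>2 \<le> exp (lam * \<tau>) * exp (- lam * \<sigma>) * (nU u \<sigma>)\<^sup>2"
      by (intro mult_right_mono) auto
    then show "norm (ekern \<mu> \<sigma> \<tau> * (nU u \<sigma>)\<^sup>2) \<le> norm (exp (lam * \<tau>) * (exp (- lam * \<sigma>) * (nU u \<sigma>)\<^sup>2))"
      by (simp add: abs_mult mult.assoc)
  qed
qed

lemma ekern_nU_integrable:
  assumes u: "u \<in> adm" shows "integrable lborel (\<lambda>\<sigma>. ekern \<mu> \<sigma> \<tau> * nU u \<sigma>)"
  by (rule weighted_Jensen(1)[OF ekern_back_integrable[OF mu] _ _ ekern_nU_sq_integrable[OF u]])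
    (use u in auto)

lemma cvk_integrable:
  assumes u: "u \<in> adm" and v: "v \<in> spV sbar" shows "integrable lborel (cvk u v \<tau>)"
proof (rule Bochner_Integration.integrable_bound)
  show "integrable lborel (\<lambda>\<sigma>. KB \<mu> * normV sbar \<mu> v * (ekern \<mu> \<sigma> \<tau> * nU u \<sigma>))"
    using ekern_nU_integrable[OF u] by simp
  show "AE \<sigma> in lborel. norm (cvk u v \<tau> \<sigma>) \<le> norm (KB \<mu> * normV sbar \<mu> v * (ekern \<mu> \<sigma> \<tau> * nU u \<sigma>))"
    using cvk_bound[OF u v] by (intro AE_I2) (auto intro: order_trans[OF _ abs_ge_self])
qed (use cvk_slice_measurable[OF u v] in simp)

lemma cv_set_integrable:
  assumes u: "u \<in> adm" and v: "v \<in> spV sbar"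
  shows "set_integrable lborel {0<..<\<tau>} (\<lambda>\<sigma>. opB sbar (u \<sigma>) (LV \<mu> (\<tau> - \<sigma>) v))"
  using cvk_integrable[OF u v, of \<tau>] by (simp add: set_integrable_def cvk_def[abs_def])

lemma nU_loc_integrable:
  assumes u: "u \<in> adm" shows "set_integrable lborel {0<..<\<tau>} (nU u)" "set_integrable lborel {0<..<\<tau>} (\<lambda>\<sigma>. (nU u \<sigma>)\<^sup>2)"
proof -
  have loc: "set_integrable lborel {0<..<\<tau>} F"
    if F: "integrable lborel (\<lambda>\<sigma>. exp (- lam * \<sigma>) * F \<sigma>)" "F \<in> borel_measurable borel" for F
    unfolding set_integrable_def
  proof (rule Bochner_Integration.integrable_bound)
    show "integrable lborel (\<lambda>\<sigma>. exp (lam * \<tau>) * (exp (- lam * \<sigma>) * F \<sigma>))" using F by simp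
    show "AE \<sigma> in lborel. norm (indicator {0<..<\<tau>} \<sigma> *\<^sub>R F \<sigma>) \<le> norm (exp (lam * \<tau>) * (exp (- lam * \<sigma>) * F \<sigma>))"
    proof (rule AE_I2)
      fix \<sigma>
      show "norm (indicator {0<..<\<tau>} \<sigma> *\<^sub>R F \<sigma>) \<le> norm (exp (lam * \<tau>) * (exp (- lam * \<sigma>) * F \<sigma>))"
      proof (cases "0 < \<sigma> \<and> \<sigma> < \<tau>")
        case True
        then have "1 \<le> exp (lam * (\<tau> - \<sigma>))" using lam by simp
        then have "1 * \<bar>F \<sigma>\<bar> \<le> exp (lam * (\<tau> - \<sigma>)) * \<bar>F \<sigma>\<bar>" by (intro mult_right_mono) auto
        also have "exp (lam * (\<tau> - \<sigma>)) * \<bar>F \<sigma>\<bar> = exp (lam * \<tau>) * (exp (- lam * \<sigma>) * \<bar>F \<sigma>\<bar>)"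
          by (simp add: algebra_simps flip: mult.assoc exp_add)
        finally show ?thesis using True by (simp add: abs_mult)
      qed auto
    qed
  qed (use F in measurable)
  show "set_integrable lborel {0<..<\<tau>} (nU u)" by (rule loc[OF nU_integrable[OF u]]) (use u in measurable)
  show "set_integrable lborel {0<..<\<tau>} (\<lambda>\<sigma>. (nU u \<sigma>)\<^sup>2)" by (rule loc[OF nU_sq_integrable[OF u]]) (use u in measurable)
qed

text \<open>Discards the decay of the translation in return for a bound that is uniform over all
  times up to \<open>t\<close>.\<close>

lemma cv_bound_loc:
  assumes u: "u \<in> adm" and v: "v \<in> spV sbar" and t: "\<tau> \<le> t"
  shows "\<bar>cv u v \<tau>\<bar> \<le> KB \<mu> * normV sbar \<mu> v * (LBINT \<sigma>:{0<..<t}. nU u \<sigma>)"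
proof -
  have i: "integrable lborel (\<lambda>\<sigma>. KB \<mu> * normV sbar \<mu> v * (indicator {0<..<t} \<sigma> *\<^sub>R nU u \<sigma>))"
    using nU_loc_integrable(1)[OF u, of t] by (simp add: set_integrable_def)
  have "\<bar>cv u v \<tau>\<bar> \<le> (LBINT \<sigma>. KB \<mu> * normV sbar \<mu> v * (indicator {0<..<t} \<sigma> *\<^sub>R nU u \<sigma>))"
    unfolding cv_cvk
  proof (rule integral_abs_bound_integral[OF cvk_integrable[OF u v] i])
    fix \<sigma>
    show "\<bar>cvk u v \<tau> \<sigma>\<bar> \<le> KB \<mu> * normV sbar \<mu> v * (indicator {0<..<t} \<sigma> *\<^sub>R nU u \<sigma>)"
    proof (cases "0 < \<sigma> \<and> \<sigma> < \<tau>")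
      case True
      have "\<bar>cvk u v \<tau> \<sigma>\<bar> \<le> KB \<mu> * normV sbar \<mu> v * (ekern \<mu> \<sigma> \<tau> * nU u \<sigma>)" by (rule cvk_bound[OF u v])
      also have "\<dots> \<le> KB \<mu> * normV sbar \<mu> v * (1 * nU u \<sigma>)"
        using KB_pos[OF mu] mu by (intro mult_left_mono mult_right_mono) (auto simp: ekern_def)
      finally show ?thesis using True t by simp
    next
      case False
      then have "cvk u v \<tau> \<sigma> = 0" by (auto simp: cvk_def)
      then show ?thesis using KB_pos[OF mu] by simp
    qed
  qed
  then show ?thesis by (simp add: set_lebesgue_integral_def)
qed

lemma cv_measurable:
  assumes u: "u \<in> adm" and v: "v \<in> spV sbar" shows "cv u v \<in> borel_measurable borel"
proof -
  have "(\<lambda>\<tau>. LBINT \<sigma>. cvk u v \<tau> \<sigma>) \<in> borel_measurable lborel"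
    by (rule lborel.borel_measurable_lebesgue_integral) (rule cvk_measurable[OF u v])
  then show ?thesis by (simp add: cv_cvk[abs_def])
qed

lemma cv_nonpos: "\<tau> \<le> 0 \<Longrightarrow> cv u v \<tau> = 0"
  by (simp add: cv_def set_lebesgue_integral_def)

lemma discounted_kernel_integrable:
  assumes F: "integrable lborel F"
  shows "integrable (lborel \<Otimes>\<^sub>M lborel) (\<lambda>(\<tau>, \<sigma>). ekern (lam + \<mu>) \<sigma> \<tau> * F \<sigma>)"
proof -
  have "ekern (lam + \<mu>) 0 (\<tau> - \<sigma>) = ekern (lam + \<mu>) \<sigma> \<tau>" for \<tau> \<sigma> by (simp add: ekern_def)
  then show ?thesis
    using L1_convolution[OF ekern_integrable[of "lam + \<mu>" 0] F] lam mu by simp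
qed

text \<open>The discount factor splits between the kernel, whose rate becomes
  \<open>lam + \<mu>\<close>, and the time \<sigma> at which the control acts.\<close>

lemma ekern_discount: "exp (- lam * \<tau>) * (ekern \<mu> \<sigma> \<tau> * y) = ekern (lam + \<mu>) \<sigma> \<tau> * (exp (- lam * \<sigma>) * y)"
proof -
  have "exp (- lam * \<tau>) * (exp (- \<mu> * (\<tau> - \<sigma>)) * y) = exp (- (lam + \<mu>) * (\<tau> - \<sigma>)) * (exp (- lam * \<sigma>) * y)"
    by (simp add: algebra_simps flip: mult.assoc exp_add)
  then show ?thesis by (simp add: ekern_def)
qed

text \<open>Jensen with the kernel \<open>ekern \<mu>\<close> bounds the square by a convolution of
  the squared control norm. The discount moves into the kernel, and the convolution of two
  integrable functions is integrable.\<close>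

lemma cv_sq_integrable:
  assumes u: "u \<in> adm" and v: "v \<in> spV sbar"
  shows "set_integrable lborel {0<..} (\<lambda>\<tau>. exp (- lam * \<tau>) * (cv u v \<tau>)\<^sup>2)"
proof -
  define A where "A = KB \<mu> * normV sbar \<mu> v"
  have A: "0 \<le> A" using KB_pos[OF mu] by (simp add: A_def)
  define G where "G = (\<lambda>\<tau>. LBINT \<sigma>. ekern (lam + \<mu>) \<sigma> \<tau> * (exp (- lam * \<sigma>) * (nU u \<sigma>)\<^sup>2))"
  have G: "integrable lborel G"
    unfolding G_def using lborel_pair.integrable_fst[OF discounted_kernel_integrable[OF nU_sq_integrable[OF u]]] .
  have bound: "exp (- lam * \<tau>) * (cv u v \<tau>)\<^sup>2 \<le> A\<^sup>2 / \<mu> * G \<tau>" for \<tau>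
  proof -
    have "\<bar>cv u v \<tau>\<bar> \<le> (LBINT \<sigma>. A * (ekern \<mu> \<sigma> \<tau> * nU u \<sigma>))"
      unfolding cv_cvk using ekern_nU_integrable[OF u] cvk_bound[OF u v]
      by (intro integral_abs_bound_integral cvk_integrable[OF u v]) (auto simp: A_def)
    then have "\<bar>cv u v \<tau>\<bar> \<le> A * (LBINT \<sigma>. ekern \<mu> \<sigma> \<tau> * nU u \<sigma>)" by simp
    then have "\<bar>cv u v \<tau>\<bar>\<^sup>2 \<le> (A * (LBINT \<sigma>. ekern \<mu> \<sigma> \<tau> * nU u \<sigma>))\<^sup>2" by (intro power_mono) auto
    also have "\<dots> = A\<^sup>2 * (LBINT \<sigma>. ekern \<mu> \<sigma> \<tau> * nU u \<sigma>)\<^sup>2" by (rule power_mult_distrib)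
    also have "\<dots> \<le> A\<^sup>2 * ((LBINT \<sigma>. ekern \<mu> \<sigma> \<tau>) * (LBINT \<sigma>. ekern \<mu> \<sigma> \<tau> * (nU u \<sigma>)\<^sup>2))"
      by (intro mult_left_mono weighted_Jensen(2)[OF ekern_back_integrable[OF mu] _ _ ekern_nU_sq_integrable[OF u]])
        (use u in auto)
    finally have "(cv u v \<tau>)\<^sup>2 \<le> A\<^sup>2 / \<mu> * (LBINT \<sigma>. ekern \<mu> \<sigma> \<tau> * (nU u \<sigma>)\<^sup>2)"
      by (simp add: ekern_back_integral[OF mu])
    then have "exp (- lam * \<tau>) * (cv u v \<tau>)\<^sup>2 \<le> exp (- lam * \<tau>) * (A\<^sup>2 / \<mu> * (LBINT \<sigma>. ekern \<mu> \<sigma> \<tau> * (nU u \<sigma>)\<^sup>2))"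
      by (intro mult_left_mono) auto
    also have "\<dots> = A\<^sup>2 / \<mu> * (LBINT \<sigma>. exp (- lam * \<tau>) * (ekern \<mu> \<sigma> \<tau> * (nU u \<sigma>)\<^sup>2))" by simp
    finally show ?thesis unfolding ekern_discount G_def .
  qed
  show ?thesis
    unfolding set_integrable_def
  proof (rule Bochner_Integration.integrable_bound)
    show "integrable lborel (\<lambda>\<tau>. A\<^sup>2 / \<mu> * G \<tau>)" using G by simp
    show "AE \<tau> in lborel. norm (indicator {0<..} \<tau> *\<^sub>R (exp (- lam * \<tau>) * (cv u v \<tau>)\<^sup>2)) \<le> norm (A\<^sup>2 / \<mu> * G \<tau>)"
    proof (rule AE_I2)
      fix \<tau>
      have "norm (indicator {0<..} \<tau> *\<^sub>R (exp (- lam * \<tau>) * (cv u v \<tau>)\<^sup>2)) \<le> exp (- lam * \<tau>) * (cv u v \<tau>)\<^sup>2"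
        by (simp add: indicator_def)
      also have "\<dots> \<le> norm (A\<^sup>2 / \<mu> * G \<tau>)" using bound[of \<tau>] by (simp only: real_norm_def)
      finally show "norm (indicator {0<..} \<tau> *\<^sub>R (exp (- lam * \<tau>) * (cv u v \<tau>)\<^sup>2)) \<le> norm (A\<^sup>2 / \<mu> * G \<tau>)" .
    qed
    have [measurable]: "cv u v \<in> borel_measurable borel" by (rule cv_measurable[OF u v])
    show "(\<lambda>\<tau>. indicator {0<..} \<tau> *\<^sub>R (exp (- lam * \<tau>) * (cv u v \<tau>)\<^sup>2)) \<in> borel_measurable lborel" by measurable
  qed
qed

text \<open>Fubini for the discounted convolution: the time integral turns \<open>L\<close> into its resolvent.\<close>

lemma cv_discounted:
  assumes u: "u \<in> adm" and v: "v \<in> spV sbar"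
  shows "set_integrable lborel {0<..} (\<lambda>\<tau>. exp (- lam * \<tau>) * cv u v \<tau>)"
    and "set_integrable lborel {0<..} (\<lambda>\<sigma>. exp (- lam * \<sigma>) * opB sbar (u \<sigma>) (resolvent_star sbar \<mu> lam v))"
    and "(LBINT \<tau>:{0<..}. exp (- lam * \<tau>) * cv u v \<tau>)
      = (LBINT \<sigma>:{0<..}. exp (- lam * \<sigma>) * opB sbar (u \<sigma>) (resolvent_star sbar \<mu> lam v))"
proof -
  define A where "A = KB \<mu> * normV sbar \<mu> v"
  define W where "W = (\<lambda>(\<tau>, \<sigma>). exp (- lam * \<tau>) * cvk u v \<tau> \<sigma>)"
  have [measurable]: "(\<lambda>y. cvk u v (fst y) (snd y)) \<in> borel_measurable (lborel \<Otimes>\<^sub>M lborel)"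
    using cvk_measurable[OF u v] by (simp add: split_beta')
  have W: "integrable (lborel \<Otimes>\<^sub>M lborel) W"
  proof (rule Bochner_Integration.integrable_bound)
    show "integrable (lborel \<Otimes>\<^sub>M lborel) (\<lambda>y. A * (case y of (\<tau>, \<sigma>) \<Rightarrow> ekern (lam + \<mu>) \<sigma> \<tau> * (exp (- lam * \<sigma>) * nU u \<sigma>)))"
      using discounted_kernel_integrable[OF nU_integrable[OF u]] by (rule Bochner_Integration.integrable_mult_right)
    show "W \<in> borel_measurable (lborel \<Otimes>\<^sub>M lborel)" unfolding W_def split_beta' by measurable
    show "AE y in lborel \<Otimes>\<^sub>M lborel. norm (W y) \<le> norm (A * (case y of (\<tau>, \<sigma>) \<Rightarrow> ekern (lam + \<mu>) \<sigma> \<tau> * (exp (- lam * \<sigma>) * nU u \<sigma>)))"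
    proof (rule AE_I2)
      fix y :: "real \<times> real"
      obtain \<tau> \<sigma> where y: "y = (\<tau>, \<sigma>)" by (cases y)
      have "\<bar>cvk u v \<tau> \<sigma>\<bar> \<le> A * (ekern \<mu> \<sigma> \<tau> * nU u \<sigma>)" using cvk_bound[OF u v] by (simp add: A_def)
      then have "norm (W y) \<le> exp (- lam * \<tau>) * (A * (ekern \<mu> \<sigma> \<tau> * nU u \<sigma>))"
        unfolding y W_def by (simp add: abs_mult)
      also have "\<dots> = A * (ekern (lam + \<mu>) \<sigma> \<tau> * (exp (- lam * \<sigma>) * nU u \<sigma>))"
        using ekern_discount[of \<tau> \<sigma> "nU u \<sigma>"] by (simp add: mult.left_commute)
      finally show "norm (W y) \<le> norm (A * (case y of (\<tau>, \<sigma>) \<Rightarrow> ekern (lam + \<mu>) \<sigma> \<tau> * (exp (- lam * \<sigma>) * nU u \<sigma>)))"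
        unfolding y by (simp only: real_norm_def split_conv)
    qed
  qed
  have in1: "(LBINT \<sigma>. W (\<tau>, \<sigma>)) = indicator {0<..} \<tau> *\<^sub>R (exp (- lam * \<tau>) * cv u v \<tau>)" for \<tau>
    by (cases "0 < \<tau>") (simp_all add: W_def cv_cvk[symmetric] cv_nonpos)
  have in2: "(LBINT \<tau>. W (\<tau>, \<sigma>)) = indicator {0<..} \<sigma> *\<^sub>R (exp (- lam * \<sigma>) * opB sbar (u \<sigma>) (resolvent_star sbar \<mu> lam v))" for \<sigma>
  proof (cases "0 < \<sigma>")
    case True
    have x: "opB sbar (u \<sigma>) \<in> spVd sbar \<mu>" by (rule opB_spVd[OF mu admissible_spU[OF u True]])
    \<comment> \<open>Time is counted from the moment \<sigma> at which the control acts, which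
      splits off the discount up to \<sigma> and leaves the resolvent integral.\<close>
    have "(LBINT \<tau>. W (\<tau>, \<sigma>)) = (LBINT \<tau>. W (\<sigma> + 1 * \<tau>, \<sigma>))"
      using lborel_integral_real_affine[of 1 "\<lambda>\<tau>. W (\<tau>, \<sigma>)" \<sigma>] by simp
    also have "\<dots> = (LBINT \<tau>. exp (- lam * \<sigma>) * (indicator {0<..} \<tau> *\<^sub>R (exp (- lam * \<tau>) * opB sbar (u \<sigma>) (LV \<mu> \<tau> v))))"
    proof (intro Bochner_Integration.integral_cong refl)
      fix \<tau>
      have "exp (- lam * (\<sigma> + \<tau>)) * y = exp (- lam * \<sigma>) * (exp (- lam * \<tau>) * y)" for y
        by (simp add: algebra_simps flip: mult.assoc exp_add)
      then show "W (\<sigma> + 1 * \<tau>, \<sigma>) = exp (- lam * \<sigma>) * (indicator {0<..} \<tau> *\<^sub>R (exp (- lam * \<tau>) * opB sbar (u \<sigma>) (LV \<mu> \<tau> v)))"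
        using True by (cases "0 < \<tau>") (simp_all add: W_def cvk_def)
    qed
    also have "\<dots> = exp (- lam * \<sigma>) * opB sbar (u \<sigma>) (resolvent_star sbar \<mu> lam v)"
      using spVd_resolvent(2)[OF mu lam x v] by (simp add: set_lebesgue_integral_def)
    finally show ?thesis using True by simp
  qed (simp add: W_def cvk_def)
  show "set_integrable lborel {0<..} (\<lambda>\<tau>. exp (- lam * \<tau>) * cv u v \<tau>)"
    using lborel_pair.integrable_fst'[OF W] unfolding in1 set_integrable_def .
  have W': "integrable (lborel \<Otimes>\<^sub>M lborel) (case_prod (\<lambda>\<tau> \<sigma>. W (\<tau>, \<sigma>)))" using W by simp
  show "set_integrable lborel {0<..} (\<lambda>\<sigma>. exp (- lam * \<sigma>) * opB sbar (u \<sigma>) (resolvent_star sbar \<mu> lam v))"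
    using lborel_pair.integrable_snd[OF W'] unfolding in2 set_integrable_def .
  show "(LBINT \<tau>:{0<..}. exp (- lam * \<tau>) * cv u v \<tau>)
      = (LBINT \<sigma>:{0<..}. exp (- lam * \<sigma>) * opB sbar (u \<sigma>) (resolvent_star sbar \<mu> lam v))"
    using lborel_pair.Fubini_integral[OF W'] unfolding in1 in2 by (simp add: set_lebesgue_integral_def)
qed

lemma state_eq:
  assumes u: "u \<in> adm" and x: "x \<in> spVd sbar \<mu>" and v: "v \<in> spV sbar" and \<tau>: "0 \<le> \<tau>"
  shows "state sbar T x u \<tau> v = x (LV \<mu> \<tau> v) + cv u v \<tau>"
proof -
  have "(LBINT \<sigma>:{0<..<\<tau>}. T (\<tau> - \<sigma>) (opB sbar (u \<sigma>)) v) = cv u v \<tau>"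
    unfolding cv_def
    by (intro set_lebesgue_integral_cong)
      (auto intro!: T_eq[OF mu S T] opB_spVd mu admissible_spU[OF u] v)
  then show ?thesis using T_eq[OF mu S T x \<tau> v] by (simp add: state_def)
qed

lemma cv_lincomb_v:
  assumes u: "u \<in> adm" and v: "v \<in> spV sbar" "w \<in> spV sbar"
  shows "cv u (\<lambda>s. a * v s + b * w s) \<tau> = a * cv u v \<tau> + b * cv u w \<tau>"
proof -
  have "cv u (\<lambda>s. a * v s + b * w s) \<tau> = (LBINT \<sigma>:{0<..<\<tau>}. a * opB sbar (u \<sigma>) (LV \<mu> (\<tau> - \<sigma>) v) + b * opB sbar (u \<sigma>) (LV \<mu> (\<tau> - \<sigma>) w))"
    unfolding cv_def LV_lincomb
    by (intro set_lebesgue_integral_cong)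
      (auto intro!: spVd_lincomb[OF opB_spVd[OF mu admissible_spU[OF u]]] LV_spV mu v)
  also have "\<dots> = a * cv u v \<tau> + b * cv u w \<tau>"
    unfolding cv_def using cv_set_integrable[OF u v(1)] cv_set_integrable[OF u v(2)]
    by (subst set_integral_add(2)) auto
  finally show ?thesis .
qed

lemma cv_lincomb_u:
  assumes u: "u \<in> adm" "w \<in> adm" and v: "v \<in> spV sbar"
  shows "cv (\<lambda>\<tau>. a *\<^sub>R u \<tau> + b *\<^sub>R w \<tau>) v \<tau> = a * cv u v \<tau> + b * cv w v \<tau>"
proof -
  have "cv (\<lambda>\<tau>. a *\<^sub>R u \<tau> + b *\<^sub>R w \<tau>) v \<tau> = (LBINT \<sigma>:{0<..<\<tau>}. a * opB sbar (u \<sigma>) (LV \<mu> (\<tau> - \<sigma>) v) + b * opB sbar (w \<sigma>) (LV \<mu> (\<tau> - \<sigma>) v))"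
    unfolding cv_def
    by (intro set_lebesgue_integral_cong) (auto simp: opB_lincomb[OF admissible_spU[OF u(1)] admissible_spU[OF u(2)]] scaleR_fun_def)
  also have "\<dots> = a * cv u v \<tau> + b * cv w v \<tau>"
    unfolding cv_def using cv_set_integrable[OF u(1) v] cv_set_integrable[OF u(2) v]
    by (subst set_integral_add(2)) auto
  finally show ?thesis .
qed

text \<open>For dynamic programming the state must itself be an initial datum; its boundedness on V
  comes from the local integrability of the control norm.\<close>

lemma state_spVd:
  assumes u: "u \<in> adm" and x: "x \<in> spVd sbar \<mu>" and t: "0 \<le> t"
  shows "state sbar T x u t \<in> spVd sbar \<mu>"
proof (rule spVdI)
  fix v assume v: "v \<notin> spV sbar"
  have "(LBINT \<sigma>:{0<..<t}. T (t - \<sigma>) (opB sbar (u \<sigma>)) v) = (LBINT \<sigma>:{0<..<t}. 0)"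
    by (intro set_lebesgue_integral_cong)
      (auto intro!: spVd_outside[OF T_spVd[OF mu S T _ opB_spVd[OF mu admissible_spU[OF u]]] v])
  then show "state sbar T x u t v = 0" using spVd_outside[OF T_spVd[OF mu S T t x] v] by (simp add: state_def)
next
  fix v w :: fn and a b :: real assume vw: "v \<in> spV sbar" "w \<in> spV sbar"
  show "state sbar T x u t (\<lambda>s. a * v s + b * w s) = a * state sbar T x u t v + b * state sbar T x u t w"
    using vw spVd_lincomb[OF x LV_spV[OF mu vw(1) t] LV_spV[OF mu vw(2) t], of a b]
    by (simp add: state_eq[OF u x _ t] spV_lincomb cv_lincomb_v[OF u] LV_lincomb algebra_simps)
next
  fix v assume v: "v \<in> spV sbar"
  have "\<bar>x (LV \<mu> t v)\<bar> \<le> normVd sbar \<mu> x * normV sbar \<mu> (LV \<mu> t v)"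
    by (intro spVd_bound mu x LV_spV v t)
  also have "\<dots> \<le> normVd sbar \<mu> x * normV sbar \<mu> v"
    by (intro mult_left_mono LV_normV_le mu v t normVd_nonneg x)
  finally have "\<bar>x (LV \<mu> t v)\<bar> \<le> normVd sbar \<mu> x * normV sbar \<mu> v" .
  moreover have "\<bar>cv u v t\<bar> \<le> KB \<mu> * normV sbar \<mu> v * (LBINT \<sigma>:{0<..<t}. nU u \<sigma>)"
    by (rule cv_bound_loc[OF u v order_refl])
  ultimately show "\<bar>state sbar T x u t v\<bar> \<le> (normVd sbar \<mu> x + KB \<mu> * (LBINT \<sigma>:{0<..<t}. nU u \<sigma>)) * normV sbar \<mu> v"
    using abs_triangle_ineq[of "x (LV \<mu> t v)" "cv u v t"]
    by (simp add: state_eq[OF u x v t] algebra_simps)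
qed

text \<open>The flow property behind dynamic programming: what the control did before
  \<open>t\<close> is transported by \<open>LV \<mu> s\<close>, what it does later is the response
  to the shifted control.\<close>

lemma state_cocycle:
  assumes u: "u \<in> adm" and x: "x \<in> spVd sbar \<mu>" and v: "v \<in> spV sbar" and t: "0 \<le> t" "0 \<le> s"
  shows "state sbar T x u (t + s) v = state sbar T (state sbar T x u t) (\<lambda>\<tau>. u (t + \<tau>)) s v"
proof -
  have ts: "0 \<le> t + s" using t by simp
  have Ls: "LV \<mu> s v \<in> spV sbar" by (rule LV_spV[OF mu v t(2)])
  have "cv u v (t + s) = (LBINT \<sigma>. indicator {0<..<t} \<sigma> * opB sbar (u \<sigma>) (LV \<mu> (t - \<sigma>) (LV \<mu> s v))
      + indicator {t<..<t+s} \<sigma> * cvk u v (t + s) \<sigma>)"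
    unfolding cv_cvk
  proof (rule integral_cong_AE)
    have m1: "cvk u (LV \<mu> s v) t \<in> borel_measurable borel" by (rule cvk_slice_measurable[OF u Ls])
    have m2: "cvk u v (t + s) \<in> borel_measurable borel" by (rule cvk_slice_measurable[OF u v])
    show "cvk u v (t + s) \<in> borel_measurable lborel" using m2 by simp
    have "(\<lambda>\<sigma>. cvk u (LV \<mu> s v) t \<sigma> + indicator {t<..<t+s} \<sigma> * cvk u v (t + s) \<sigma>) \<in> borel_measurable borel"
      using m1 m2 by measurable
    then show "(\<lambda>\<sigma>. indicator {0<..<t} \<sigma> * opB sbar (u \<sigma>) (LV \<mu> (t - \<sigma>) (LV \<mu> s v)) + indicator {t<..<t+s} \<sigma> * cvk u v (t + s) \<sigma>) \<in> borel_measurable lborel"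
      by (simp add: cvk_def[of _ _ t])
    show "AE \<sigma> in lborel. cvk u v (t + s) \<sigma> = indicator {0<..<t} \<sigma> * opB sbar (u \<sigma>) (LV \<mu> (t - \<sigma>) (LV \<mu> s v))
      + indicator {t<..<t+s} \<sigma> * cvk u v (t + s) \<sigma>"
      using AE_lborel_singleton[of t]
    proof eventually_elim
      case (elim \<sigma>)
      have "LV \<mu> (t - \<sigma>) (LV \<mu> s v) = LV \<mu> (t + s - \<sigma>) v" if "\<sigma> < t"
        using that t by (simp add: LV_add algebra_simps)
      then show ?case using elim t by (cases "\<sigma> < t") (auto simp: cvk_def indicator_def)
    qed
  qed
  also have "\<dots> = cv u (LV \<mu> s v) t + (LBINT \<sigma>. indicator {t<..<t+s} \<sigma> * cvk u v (t + s) \<sigma>)"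
  proof -
    have "integrable lborel (\<lambda>\<sigma>. indicator {t<..<t+s} \<sigma> * cvk u v (t + s) \<sigma>)"
      using integrable_mult_indicator[OF _ cvk_integrable[OF u v, of "t + s"], of "{t<..<t+s}"] by simp
    then show ?thesis
      using cvk_integrable[OF u Ls, of t] unfolding cv_cvk
      by (subst Bochner_Integration.integral_add) (auto simp: cvk_def[abs_def])
  qed
  also have "(LBINT \<sigma>. indicator {t<..<t+s} \<sigma> * cvk u v (t + s) \<sigma>) = cv (\<lambda>\<tau>. u (t + \<tau>)) v s"
  proof -
    have "(LBINT \<sigma>. indicator {t<..<t+s} \<sigma> * cvk u v (t + s) \<sigma>) = (LBINT \<sigma>. indicator {t<..<t+s} (t + 1 * \<sigma>) * cvk u v (t + s) (t + 1 * \<sigma>))"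
      using lborel_integral_real_affine[of 1 "\<lambda>\<sigma>. indicator {t<..<t+s} \<sigma> * cvk u v (t + s) \<sigma>" t] by simp
    also have "\<dots> = cv (\<lambda>\<tau>. u (t + \<tau>)) v s"
      unfolding cv_cvk using t
      by (intro Bochner_Integration.integral_cong refl) (auto simp: cvk_def indicator_def)
    finally show ?thesis .
  qed
  finally have "cv u v (t + s) = cv u (LV \<mu> s v) t + cv (\<lambda>\<tau>. u (t + \<tau>)) v s" .
  then show ?thesis
    using state_eq[OF u x v ts] state_eq[OF admissible_shift[OF u t(1)] state_spVd[OF u x t(1)] v t(2)]
      state_eq[OF u x Ls t(1)] t
    by (simp add: LV_add)
qed

end

section \<open>Stationary points are equilibrium points\<close>

text \<open>\<open>D\<close> is the derivative of \<open>- R\<close>.\<close>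

locale vintage_cost = vintage +
  fixes \<alpha> :: fn and R D :: "real \<Rightarrow> real" and C :: real
  assumes \<alpha>: "\<alpha> \<in> spV sbar"
    and R_convex: "\<And>P Q. - R Q + D Q * (P - Q) \<le> - R P"
    and R_smooth: "\<And>P Q. - R P \<le> - R Q + D Q * (P - Q) + C * (P - Q)\<^sup>2"
    and C_nonneg: "0 \<le> C"
    and R_cont: "continuous_on UNIV R"
begin

lemmas opMU = opM_spU[OF eps q]
lemmas hqL = hq_lower[OF eps q] and hqU = hq_upper[OF eps q]
lemmas h0E = h0_expand[OF eps q]

definition rv :: fn where "rv = resolvent_star sbar \<mu> lam \<alpha>"

lemma rv_spV: "rv \<in> spV sbar"
  unfolding rv_def resolvent_star_bres[OF mu lam \<alpha>] using mu lam by (intro bres_spV spV_spH \<alpha>) simp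

text \<open>Encodes the gradient of the cost at \<open>x\<close>, which is
  \<open>2 *\<^sub>R bet x + q\<close>.\<close>

definition bet :: "ctrl \<Rightarrow> ctrl" where
  "bet x = (fst \<beta> * fst x, \<lambda>s. snd \<beta> s * snd x s)"

lemma bet_spU: "x \<in> spU sbar \<Longrightarrow> bet x \<in> spU sbar"
  using beta_spH[OF eps q spU_snd] by (simp add: bet_def spU_def)

text \<open>The exact second-order expansion about an arbitrary control, whereas
  \<open>h0_expand\<close> starts from a prescribed slope.\<close>

lemma h0_subgradient:
  assumes x: "x \<in> spU sbar" and u: "u \<in> spU sbar"
  shows "h0 sbar \<beta> q u = h0 sbar \<beta> q x + innerU sbar (2 *\<^sub>R bet x + 1 *\<^sub>R q) (u - x) + hq sbar \<beta> (u - x)"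
proof -
  define d where "d = u - x"
  have d: "d \<in> spU sbar" unfolding d_def by (rule spU_diff[OF u x])
  have u_eq: "snd u = (\<lambda>s. 1 * snd x s + 1 * snd d s)" "fst u = fst x + fst d" by (auto simp: d_def)
  note H = spU_snd[OF x] spU_snd[OF d] spU_snd[OF u]
  note bH = beta_spH[OF eps q H(1)] beta_spH[OF eps q H(2)]
  have sym: "innerH sbar (\<lambda>s. snd \<beta> s * f s) g = innerH sbar (\<lambda>s. snd \<beta> s * g s) f" for f g
    by (simp add: innerH_def mult_ac)
  have bu: "(\<lambda>s. snd \<beta> s * snd u s) = (\<lambda>s. 1 * (snd \<beta> s * snd x s) + 1 * (snd \<beta> s * snd d s))"
    by (simp add: u_eq algebra_simps)
  have "innerH sbar (\<lambda>s. snd \<beta> s * snd u s) (snd u)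
      = innerH sbar (\<lambda>s. snd \<beta> s * snd x s) (snd x) + 2 * innerH sbar (\<lambda>s. snd \<beta> s * snd x s) (snd d) + innerH sbar (\<lambda>s. snd \<beta> s * snd d s) (snd d)"
    unfolding bu innerH_lincomb[OF bH(1) bH(2) H(3)]
    unfolding u_eq innerH_lincomb'[OF H(1) H(2) bH(1)] innerH_lincomb'[OF H(1) H(2) bH(2)]
    using sym[of "snd d" "snd x"] by simp
  then have quad: "hq sbar \<beta> u = hq sbar \<beta> x + 2 * innerU sbar (bet x) d + hq sbar \<beta> d"
    by (simp add: hq_def[OF eps q] innerU_def bet_def u_eq(2) power2_eq_square algebra_simps)
  have "innerU sbar (2 *\<^sub>R bet x + 1 *\<^sub>R q) d = 2 * innerU sbar (bet x) d + innerU sbar q d"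
    using innerU_lincomb[OF bet_spU[OF x] q d, of 2 1] by (simp add: innerU_commute[of sbar _ d])
  moreover have "innerU sbar q d = innerU sbar q u - innerU sbar q x"
    unfolding d_def by (rule innerU_diff[OF u x q])
  ultimately show ?thesis
    unfolding h0_eq[OF eps q x] h0_eq[OF eps q u] quad d_def[symmetric] by simp
qed

lemma h0_ge: "x \<in> spU sbar \<Longrightarrow> u \<in> spU sbar \<Longrightarrow>
    h0 sbar \<beta> q x + innerU sbar (2 *\<^sub>R bet x + 1 *\<^sub>R q) (u - x) \<le> h0 sbar \<beta> q u"
proof -
  assume x: "x \<in> spU sbar" and u: "u \<in> spU sbar"
  have "0 \<le> \<epsilon> * (normU sbar (u - x))\<^sup>2" using eps(1) by simp
  also have "\<dots> \<le> hq sbar \<beta> (u - x)" by (rule hqL[OF spU_diff[OF u x]])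
  finally show ?thesis using h0_subgradient[OF x u] by simp
qed

text \<open>Averages the supporting inequalities at the mixed control, where the linear terms
  cancel.\<close>

lemma h0_convex:
  assumes u: "u \<in> spU sbar" "w \<in> spU sbar" and s: "0 \<le> s" "s \<le> 1"
  shows "h0 sbar \<beta> q ((1 - s) *\<^sub>R u + s *\<^sub>R w) \<le> (1 - s) * h0 sbar \<beta> q u + s * h0 sbar \<beta> q w"
proof -
  define M where "M = (1 - s) *\<^sub>R u + s *\<^sub>R w"
  have M: "M \<in> spU sbar" unfolding M_def by (intro spU_lincomb u)
  define L where "L = 2 *\<^sub>R bet M + 1 *\<^sub>R q"
  have L: "L \<in> spU sbar" unfolding L_def by (intro spU_lincomb bet_spU M q)
  have "(1 - s) * (h0 sbar \<beta> q M + innerU sbar L (u - M)) + s * (h0 sbar \<beta> q M + innerU sbar L (w - M))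
      \<le> (1 - s) * h0 sbar \<beta> q u + s * h0 sbar \<beta> q w"
    using s h0_ge[OF M u(1)] h0_ge[OF M u(2)] by (intro add_mono mult_left_mono) (auto simp: L_def)
  moreover have "innerU sbar L M = (1 - s) * innerU sbar L u + s * innerU sbar L w"
    unfolding M_def by (rule innerU_lincomb[OF u L])
  ultimately show ?thesis
    unfolding M_def[symmetric] innerU_diff[OF u(1) M L] innerU_diff[OF u(2) M L] by (simp add: algebra_simps)
qed

text \<open>Sequential continuity in the seminorm is what makes the running cost of a measurable
  control measurable.\<close>

lemma h0_tendsto:
  fixes \<psi> :: "nat \<Rightarrow> ctrl"
  assumes \<psi>: "\<And>n. \<psi> n \<in> spU sbar" "x \<in> spU sbar" "(\<lambda>n. normU sbar (\<psi> n - x)) \<longlonglongrightarrow> 0"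
  shows "(\<lambda>n. h0 sbar \<beta> q (\<psi> n)) \<longlonglongrightarrow> h0 sbar \<beta> q x"
proof -
  obtain Cb where Cb: "0 \<le> Cb" "\<And>v. v \<in> spU sbar \<Longrightarrow> hq sbar \<beta> v \<le> Cb * (normU sbar v)\<^sup>2" using hqU by blast
  define L where "L = 2 *\<^sub>R bet x + 1 *\<^sub>R q"
  have L: "L \<in> spU sbar" unfolding L_def by (intro spU_lincomb bet_spU \<psi>(2) q)
  show ?thesis
  proof (rule LIM_zero_cancel, rule Lim_null_comparison)
  have "(\<lambda>n. 2 * (normU sbar L * normU sbar (\<psi> n - x)) + Cb * (normU sbar (\<psi> n - x))\<^sup>2) \<longlonglongrightarrow> 2 * (normU sbar L * 0) + Cb * 0\<^sup>2"
    by (intro tendsto_intros \<psi>(3))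
  then show "(\<lambda>n. 2 * (normU sbar L * normU sbar (\<psi> n - x)) + Cb * (normU sbar (\<psi> n - x))\<^sup>2) \<longlonglongrightarrow> 0" by simp
  show "\<forall>\<^sub>F n in sequentially. norm (h0 sbar \<beta> q (\<psi> n) - h0 sbar \<beta> q x)
      \<le> 2 * (normU sbar L * normU sbar (\<psi> n - x)) + Cb * (normU sbar (\<psi> n - x))\<^sup>2"
  proof (rule always_eventually, rule allI)
    fix n
    have d: "\<psi> n - x \<in> spU sbar" by (rule spU_diff[OF \<psi>(1,2)])
    have "0 \<le> \<epsilon> * (normU sbar (\<psi> n - x))\<^sup>2" using eps(1) by simp
    also have "\<dots> \<le> hq sbar \<beta> (\<psi> n - x)" by (rule hqL[OF d])
    finally show "norm (h0 sbar \<beta> q (\<psi> n) - h0 sbar \<beta> q x)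
        \<le> 2 * (normU sbar L * normU sbar (\<psi> n - x)) + Cb * (normU sbar (\<psi> n - x))\<^sup>2"
      using h0_subgradient[OF \<psi>(2) \<psi>(1)[of n]] innerU_CS[OF L d] Cb(2)[OF d] by (simp add: L_def)
  qed
  qed
qed

lemma h0_growth: "\<exists>A\<ge>0. \<forall>u\<in>spU sbar. \<bar>h0 sbar \<beta> q u\<bar> \<le> A * (1 + (normU sbar u)\<^sup>2)"
proof -
  obtain Cb where Cb: "0 \<le> Cb" "\<And>v. v \<in> spU sbar \<Longrightarrow> hq sbar \<beta> v \<le> Cb * (normU sbar v)\<^sup>2" using hqU by blast
  have z: "0 \<in> spU sbar" using spU_scaleR[OF q, of 0] by simp
  have h00: "h0 sbar \<beta> q 0 = 0" by (simp add: h0_def)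
  define L where "L = 2 *\<^sub>R bet 0 + 1 *\<^sub>R q"
  have L: "L \<in> spU sbar" unfolding L_def by (intro spU_lincomb bet_spU z q)
  have "\<bar>h0 sbar \<beta> q u\<bar> \<le> (normU sbar L + (normU sbar L + Cb)) * (1 + (normU sbar u)\<^sup>2)" if u: "u \<in> spU sbar" for u
  proof -
    define N where "N = normU sbar u"
    have "0 \<le> \<epsilon> * N\<^sup>2" using eps(1) by simp
    also have "\<dots> \<le> hq sbar \<beta> u" unfolding N_def by (rule hqL[OF u])
    finally have "\<bar>h0 sbar \<beta> q u\<bar> \<le> 2 * (normU sbar L * N) + Cb * N\<^sup>2"
      using h0_subgradient[OF z u] h00 innerU_CS[OF L u] Cb(2)[OF u] by (simp add: L_def N_def)
    also have "\<dots> \<le> normU sbar L * (1 + N\<^sup>2) + (normU sbar L + Cb) * (1 + N\<^sup>2)"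
    proof -
      have "0 \<le> (N - 1)\<^sup>2" by simp
      then have "2 * N \<le> 1 + N\<^sup>2" by (simp add: power2_diff)
      then have "normU sbar L * (2 * N) \<le> normU sbar L * (1 + N\<^sup>2)" by (intro mult_left_mono) auto
      moreover have "Cb * N\<^sup>2 \<le> (normU sbar L + Cb) * (1 + N\<^sup>2)" using Cb(1) by (intro mult_mono) auto
      ultimately show ?thesis by linarith
    qed
    finally show ?thesis unfolding N_def by (simp add: distrib_right)
  qed
  moreover have "0 \<le> normU sbar L + (normU sbar L + Cb)" using Cb(1) by simp
  ultimately show ?thesis by blast
qed

text \<open>\<open>- R\<close> is squeezed between its supporting line and a parabola at 0.\<close>

lemma R_growth: "\<exists>A\<ge>0. \<forall>P. \<bar>R P\<bar> \<le> A * (1 + P\<^sup>2)"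
proof -
  have "\<bar>R P\<bar> \<le> (\<bar>R 0\<bar> + \<bar>D 0\<bar> + C) * (1 + P\<^sup>2)" for P
  proof -
    have "0 \<le> (\<bar>P\<bar> - 1)\<^sup>2 + P\<^sup>2 + 1" by simp
    then have p: "\<bar>P\<bar> \<le> 1 + P\<^sup>2" by (simp add: power2_diff)
    have "\<bar>R P\<bar> \<le> \<bar>R 0\<bar> * 1 + \<bar>D 0\<bar> * \<bar>P\<bar> + C * P\<^sup>2"
      using R_convex[of 0 P] R_smooth[of P 0] abs_ge_self[of "D 0 * P"] abs_ge_minus_self[of "D 0 * P"] C_nonneg
        mult_nonneg_nonneg[OF C_nonneg zero_le_power2[of P]]
      by (simp add: abs_mult abs_le_iff) linarith
    also have "\<dots> \<le> \<bar>R 0\<bar> * (1 + P\<^sup>2) + \<bar>D 0\<bar> * (1 + P\<^sup>2) + C * (1 + P\<^sup>2)"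
      using p C_nonneg by (intro add_mono mult_left_mono) auto
    finally show ?thesis by (simp add: distrib_right)
  qed
  moreover have "0 \<le> \<bar>R 0\<bar> + \<bar>D 0\<bar> + C" using C_nonneg by simp
  ultimately show ?thesis by blast
qed

section \<open>The cost functional\<close>

definition J :: "funct \<Rightarrow> (real \<Rightarrow> ctrl) \<Rightarrow> real" where
  "J x u = (LBINT \<tau>:{0<..}. exp (- lam * \<tau>) * (- R (state sbar T x u \<tau> \<alpha>) + h0 sbar \<beta> q (u \<tau>)))"

abbreviation val :: "funct \<Rightarrow> real" where "val \<equiv> value_fun sbar lam T \<beta> q \<alpha> R"

lemma val_J: "val x = (INF u\<in>adm. J x u)"
  by (simp add: value_fun_def J_def)

lemma set_integrable_bound':
  assumes "set_integrable lborel A g" "(\<lambda>x. indicator A x * f x) \<in> borel_measurable borel"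
    "\<And>x. x \<in> A \<Longrightarrow> \<bar>f x\<bar> \<le> (g x :: real)"
  shows "set_integrable lborel A (f :: real \<Rightarrow> real)"
  unfolding set_integrable_def
  by (rule Bochner_Integration.integrable_bound[OF assms(1)[unfolded set_integrable_def]])
    (use assms(2,3) in \<open>auto simp: indicator_def intro: order_trans[OF _ abs_ge_self]\<close>)

lemma LV_discount_bound: "x \<in> spVd sbar \<mu> \<Longrightarrow> v \<in> spV sbar \<Longrightarrow> 0 \<le> \<tau> \<Longrightarrow> \<bar>x (LV \<mu> \<tau> v)\<bar> \<le> normVd sbar \<mu> x * normV sbar \<mu> v"
  by (rule order_trans[OF spVd_bound[OF mu _ LV_spV[OF mu]] mult_left_mono[OF LV_normV_le[OF mu] normVd_nonneg[OF mu]]])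

lemma state_measurable:
  fixes F :: "real \<Rightarrow> real"
  assumes u: "u \<in> adm" and x: "x \<in> spVd sbar \<mu>" and v: "v \<in> spV sbar" and F: "F \<in> borel_measurable borel"
  shows "(\<lambda>\<tau>. indicator {0<..} \<tau> * F (state sbar T x u \<tau> v)) \<in> borel_measurable borel"
proof -
  have "continuous_on UNIV (\<lambda>p. x (LV \<mu> (max 0 p) v))"
    by (rule continuous_on_compose2[OF spVd_LV_continuous[OF mu S x v]]) (auto intro!: continuous_intros)
  then have [measurable]: "(\<lambda>p. x (LV \<mu> (max 0 p) v)) \<in> borel_measurable borel" by (rule borel_measurable_continuous_onI)
  have [measurable]: "cv u v \<in> borel_measurable borel" by (rule cv_measurable[OF u v])
  have f: "(\<lambda>\<tau>. F (x (LV \<mu> (max 0 \<tau>) v) + cv u v \<tau>)) \<in> borel_measurable borel"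
    by (rule measurable_compose[OF _ F]) measurable
  have "(\<lambda>\<tau>. indicator {0<..} \<tau> * F (x (LV \<mu> (max 0 \<tau>) v) + cv u v \<tau>)) \<in> borel_measurable borel"
    by (rule borel_measurable_times[OF _ f]) measurable
  also have "(\<lambda>\<tau>. indicator {0<..} \<tau> * F (x (LV \<mu> (max 0 \<tau>) v) + cv u v \<tau>)) = (\<lambda>\<tau>. indicator {0<..} \<tau> * F (state sbar T x u \<tau> v))"
    by (auto simp: fun_eq_iff indicator_def state_eq[OF u x v] max_def)
  finally show ?thesis .
qed

lemma state_discount_sq:
  assumes u: "u \<in> adm" and x: "x \<in> spVd sbar \<mu>" and v: "v \<in> spV sbar"
  shows "set_integrable lborel {0<..} (\<lambda>\<tau>. exp (- lam * \<tau>) * (state sbar T x u \<tau> v)\<^sup>2)"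
proof (rule set_integrable_bound')
  define N where "N = normVd sbar \<mu> x * normV sbar \<mu> v"
  show "set_integrable lborel {0<..} (\<lambda>\<tau>. (2 * N\<^sup>2) * exp (- lam * \<tau>) + 2 * (exp (- lam * \<tau>) * (cv u v \<tau>)\<^sup>2))"
    using exp_neg_set_integrable[OF lam] cv_sq_integrable[OF u v] by (intro set_integral_add(1)) auto
  have [measurable]: "(\<lambda>\<tau>. indicator {0<..} \<tau> * (state sbar T x u \<tau> v)\<^sup>2) \<in> borel_measurable borel"
    by (rule state_measurable[OF u x v, of "\<lambda>P. P\<^sup>2"]) measurable
  have "(\<lambda>\<tau>. exp (- lam * \<tau>) * (indicator {0<..} \<tau> * (state sbar T x u \<tau> v)\<^sup>2)) \<in> borel_measurable borel"
    by measurable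
  then show "(\<lambda>\<tau>. indicator {0<..} \<tau> * (exp (- lam * \<tau>) * (state sbar T x u \<tau> v)\<^sup>2)) \<in> borel_measurable borel"
    by (simp add: mult.left_commute)
  fix \<tau> :: real assume "\<tau> \<in> {0<..}"
  then have \<tau>: "0 \<le> \<tau>" by simp
  have "(x (LV \<mu> \<tau> v))\<^sup>2 \<le> N\<^sup>2"
    using power_mono[OF LV_discount_bound[OF x v \<tau>], of 2] by (simp add: N_def)
  moreover have "(state sbar T x u \<tau> v)\<^sup>2 \<le> 2 * (x (LV \<mu> \<tau> v))\<^sup>2 + 2 * (cv u v \<tau>)\<^sup>2"
    unfolding state_eq[OF u x v \<tau>] using sum_squares_bound[of "x (LV \<mu> \<tau> v)" "cv u v \<tau>"] by (simp add: power2_sum)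
  ultimately have "(state sbar T x u \<tau> v)\<^sup>2 \<le> 2 * N\<^sup>2 + 2 * (cv u v \<tau>)\<^sup>2" by linarith
  then have "exp (- lam * \<tau>) * (state sbar T x u \<tau> v)\<^sup>2 \<le> exp (- lam * \<tau>) * (2 * N\<^sup>2 + 2 * (cv u v \<tau>)\<^sup>2)"
    by (intro mult_left_mono) auto
  then show "\<bar>exp (- lam * \<tau>) * (state sbar T x u \<tau> v)\<^sup>2\<bar> \<le> (2 * N\<^sup>2) * exp (- lam * \<tau>) + 2 * (exp (- lam * \<tau>) * (cv u v \<tau>)\<^sup>2)"
    by (simp add: algebra_simps)
qed

text \<open>The state is free evolution plus convolution, and discounted integration turns the
  translation in either part into the resolvent.\<close>

lemma state_discount:
  assumes u: "u \<in> adm" and x: "x \<in> spVd sbar \<mu>" and v: "v \<in> spV sbar"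
  shows "set_integrable lborel {0<..} (\<lambda>\<tau>. exp (- lam * \<tau>) * state sbar T x u \<tau> v)"
    and "(LBINT \<tau>:{0<..}. exp (- lam * \<tau>) * state sbar T x u \<tau> v) = x (resolvent_star sbar \<mu> lam v)
      + (LBINT \<sigma>:{0<..}. exp (- lam * \<sigma>) * opB sbar (u \<sigma>) (resolvent_star sbar \<mu> lam v))"
proof -
  have eq: "indicator {0<..} \<tau> *\<^sub>R (exp (- lam * \<tau>) * state sbar T x u \<tau> v)
      = indicator {0<..} \<tau> *\<^sub>R (exp (- lam * \<tau>) * x (LV \<mu> \<tau> v) + exp (- lam * \<tau>) * cv u v \<tau>)" for \<tau>
    by (cases "0 < \<tau>") (simp_all add: state_eq[OF u x v] distrib_left)
  note i = spVd_resolvent(1)[OF mu lam x v] cv_discounted(1)[OF u v]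
  show "set_integrable lborel {0<..} (\<lambda>\<tau>. exp (- lam * \<tau>) * state sbar T x u \<tau> v)"
    using set_integral_add(1)[OF i] unfolding set_integrable_def eq .
  have "(LBINT \<tau>:{0<..}. exp (- lam * \<tau>) * state sbar T x u \<tau> v)
      = (LBINT \<tau>:{0<..}. exp (- lam * \<tau>) * x (LV \<mu> \<tau> v) + exp (- lam * \<tau>) * cv u v \<tau>)"
    unfolding set_lebesgue_integral_def eq ..
  then show "(LBINT \<tau>:{0<..}. exp (- lam * \<tau>) * state sbar T x u \<tau> v) = x (resolvent_star sbar \<mu> lam v)
      + (LBINT \<sigma>:{0<..}. exp (- lam * \<sigma>) * opB sbar (u \<sigma>) (resolvent_star sbar \<mu> lam v))"
    unfolding set_integral_add(2)[OF i] spVd_resolvent(2)[OF mu lam x v] cv_discounted(3)[OF u v] .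
qed

text \<open>Both running costs grow at most quadratically, and the squares of state and control norm
  are integrable after discounting.\<close>

lemma cost_integrable:
  assumes u: "u \<in> adm" and x: "x \<in> spVd sbar \<mu>"
  shows "set_integrable lborel {0<..} (\<lambda>\<tau>. exp (- lam * \<tau>) * (- R (state sbar T x u \<tau> \<alpha>)))"
    and "set_integrable lborel {0<..} (\<lambda>\<tau>. exp (- lam * \<tau>) * h0 sbar \<beta> q (u \<tau>))"
    and "set_integrable lborel {0<..} (\<lambda>\<tau>. exp (- lam * \<tau>) * (- R (state sbar T x u \<tau> \<alpha>) + h0 sbar \<beta> q (u \<tau>)))"
proof -
  have bm: "bochner_measurable (spU sbar) (normU sbar) u" and
    uint: "set_integrable lborel {0<..} (\<lambda>\<tau>. exp (- lam * \<tau>) * (normU sbar (u \<tau>))\<^sup>2)"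
    using u by (simp_all add: admissible_iff)
  obtain A where A: "0 \<le> A" "\<And>P. \<bar>R P\<bar> \<le> A * (1 + P\<^sup>2)" using R_growth by blast
  obtain B where B: "0 \<le> B" "\<And>u. u \<in> spU sbar \<Longrightarrow> \<bar>h0 sbar \<beta> q u\<bar> \<le> B * (1 + (normU sbar u)\<^sup>2)" using h0_growth by blast
  have Rm: "R \<in> borel_measurable borel" by (rule borel_measurable_continuous_onI[OF R_cont])
  show 1: "set_integrable lborel {0<..} (\<lambda>\<tau>. exp (- lam * \<tau>) * (- R (state sbar T x u \<tau> \<alpha>)))"
  proof (rule set_integrable_bound')
    show "set_integrable lborel {0<..} (\<lambda>\<tau>. A * exp (- lam * \<tau>) + A * (exp (- lam * \<tau>) * (state sbar T x u \<tau> \<alpha>)\<^sup>2))"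
      using exp_neg_set_integrable[OF lam] state_discount_sq[OF u x \<alpha>] by (intro set_integral_add(1)) auto
    note state_measurable[OF u x \<alpha> Rm, measurable]
    have "(\<lambda>\<tau>. - exp (- lam * \<tau>) * (indicator {0<..} \<tau> * R (state sbar T x u \<tau> \<alpha>))) \<in> borel_measurable borel"
      by measurable
    then show "(\<lambda>\<tau>. indicator {0<..} \<tau> * (exp (- lam * \<tau>) * (- R (state sbar T x u \<tau> \<alpha>)))) \<in> borel_measurable borel"
      by (simp add: mult.left_commute)
    fix \<tau> :: real
    have "exp (- lam * \<tau>) * \<bar>R (state sbar T x u \<tau> \<alpha>)\<bar> \<le> exp (- lam * \<tau>) * (A * (1 + (state sbar T x u \<tau> \<alpha>)\<^sup>2))"
      by (intro mult_left_mono A) auto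
    then show "\<bar>exp (- lam * \<tau>) * (- R (state sbar T x u \<tau> \<alpha>))\<bar> \<le> A * exp (- lam * \<tau>) + A * (exp (- lam * \<tau>) * (state sbar T x u \<tau> \<alpha>)\<^sup>2)"
      by (simp add: abs_mult algebra_simps)
  qed
  show 2: "set_integrable lborel {0<..} (\<lambda>\<tau>. exp (- lam * \<tau>) * h0 sbar \<beta> q (u \<tau>))"
  proof (rule set_integrable_bound')
    show "set_integrable lborel {0<..} (\<lambda>\<tau>. B * exp (- lam * \<tau>) + B * (exp (- lam * \<tau>) * (normU sbar (u \<tau>))\<^sup>2))"
      using exp_neg_set_integrable[OF lam] uint by (intro set_integral_add(1)) auto
    have [measurable]: "(\<lambda>\<tau>. indicator {0<..} \<tau> * h0 sbar \<beta> q (u \<tau>)) \<in> borel_measurable borel"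
      by (rule bochner_measurable_compose[OF bm]) (rule h0_tendsto)
    have "(\<lambda>\<tau>. exp (- lam * \<tau>) * (indicator {0<..} \<tau> * h0 sbar \<beta> q (u \<tau>))) \<in> borel_measurable borel"
      by measurable
    then show "(\<lambda>\<tau>. indicator {0<..} \<tau> * (exp (- lam * \<tau>) * h0 sbar \<beta> q (u \<tau>))) \<in> borel_measurable borel"
      by (simp add: mult.left_commute)
    fix \<tau> :: real assume "\<tau> \<in> {0<..}"
    then have "exp (- lam * \<tau>) * \<bar>h0 sbar \<beta> q (u \<tau>)\<bar> \<le> exp (- lam * \<tau>) * (B * (1 + (normU sbar (u \<tau>))\<^sup>2))"
      by (intro mult_left_mono B admissible_spU[OF u]) auto
    then show "\<bar>exp (- lam * \<tau>) * h0 sbar \<beta> q (u \<tau>)\<bar> \<le> B * exp (- lam * \<tau>) + B * (exp (- lam * \<tau>) * (normU sbar (u \<tau>))\<^sup>2)"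
      by (simp add: abs_mult algebra_simps)
  qed
  show "set_integrable lborel {0<..} (\<lambda>\<tau>. exp (- lam * \<tau>) * (- R (state sbar T x u \<tau> \<alpha>) + h0 sbar \<beta> q (u \<tau>)))"
    unfolding distrib_left by (rule set_integral_add(1)[OF 1 2])
qed

text \<open>\<open>wp p\<close> is the gradient of the conjugate cost at \<open>- B\<^sup>* p\<close>.\<close>

definition wp :: "fn \<Rightarrow> ctrl" where "wp p = opM \<beta> (- opB_star p - q)"

lemma uminus_opB_star_spU: "p \<in> spV sbar \<Longrightarrow> - opB_star p \<in> spU sbar"
  using spU_scaleR[OF opB_star_spU, of p sbar "-1"] by simp

lemma wp_spU: "p \<in> spV sbar \<Longrightarrow> wp p \<in> spU sbar"
  unfolding wp_def by (intro opMU spU_diff uminus_opB_star_spU q)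

text \<open>The exact expansion at the feedback control: the slope pairs with the deviation as B
  does with the costate \<open>p\<close>, and the strong convexity term is kept because the
  short-time argument lives on it.\<close>

lemma h0_wp:
  assumes p: "p \<in> spV sbar" and u: "u \<in> spU sbar"
  shows "h0 sbar \<beta> q (wp p) - opB sbar (u - wp p) p + \<epsilon> * (normU sbar (u - wp p))\<^sup>2 \<le> h0 sbar \<beta> q u"
proof -
  note z = uminus_opB_star_spU[OF p] and d = spU_diff[OF u wp_spU[OF p]]
  have "innerU sbar (- opB_star p) (u - wp p) = - opB sbar (u - wp p) p"
    using innerU_lincomb[OF opB_star_spU[OF p] opB_star_spU[OF p] d, of "-1" 0]
    by (simp add: opB_innerU[OF p] innerU_commute[of sbar _ "u - wp p"])
  then show ?thesis using h0E[OF z u wp_def] hqL[OF d] by simp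
qed

lemma opB_diff: "u \<in> spU sbar \<Longrightarrow> w \<in> spU sbar \<Longrightarrow> opB sbar (u - w) = opB sbar u - opB sbar w"
  using opB_lincomb[of u sbar w 1 "-1"] by simp

text \<open>The costate at a stationary point \<open>x\<close> with \<open>\<langle>\<alpha>, x\<rangle> = Q\<close>.\<close>

definition pv :: "real \<Rightarrow> fn" where "pv Q = (\<lambda>s. D Q * rv s)"

lemma pv_spV: "pv Q \<in> spV sbar"
  unfolding pv_def using spV_lincomb[OF rv_spV rv_spV, of "D Q" 0] by simp

lemma spVd_pv: "x \<in> spVd sbar \<mu> \<Longrightarrow> x (pv Q) = D Q * x rv"
  unfolding pv_def using spVd_lincomb[of x sbar \<mu> rv rv "D Q" 0] rv_spV by simp

text \<open>Convexity of both cost terms, with supporting slopes matched so that the control enters only through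
  its expectation, which cancels by Fubini.\<close>

lemma J_lower:
  fixes Q0 :: real
  assumes u: "u \<in> adm" and x: "x \<in> spVd sbar \<mu>"
  shows "(- R Q0 - D Q0 * Q0 + h0 sbar \<beta> q (wp (pv Q0)) + opB sbar (wp (pv Q0)) (pv Q0)) / lam + x (pv Q0) \<le> J x u"
proof -
  define w where "w = wp (pv Q0)"
  have w: "w \<in> spU sbar" unfolding w_def by (rule wp_spU[OF pv_spV])
  \<comment> \<open>Collects what does not depend on \<open>u\<close>. The remaining terms are
    \<open>D Q0\<close> times the state and \<open>- D Q0\<close> times the pairing of the control
    with \<open>rv\<close>; after discounted integration the control drops out of their sum.\<close>
  define K where "K = - R Q0 - D Q0 * Q0 + h0 sbar \<beta> q w + opB sbar w (pv Q0)"
  note i1 = state_discount[OF u x \<alpha>, folded rv_def]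
  note i2 = cv_discounted(2)[OF u \<alpha>, folded rv_def]
  have i: "set_integrable lborel {0<..} (\<lambda>\<tau>. K * exp (- lam * \<tau>))"
    "set_integrable lborel {0<..} (\<lambda>\<tau>. D Q0 * (exp (- lam * \<tau>) * state sbar T x u \<tau> \<alpha>))"
    "set_integrable lborel {0<..} (\<lambda>\<tau>. (- D Q0) * (exp (- lam * \<tau>) * opB sbar (u \<tau>) rv))"
    by (rule set_integrable_mult_right, rule exp_neg_set_integrable[OF lam] i1(1) i2)+
  have ii: "set_integrable lborel {0<..} (\<lambda>\<tau>. K * exp (- lam * \<tau>) + (D Q0 * (exp (- lam * \<tau>) * state sbar T x u \<tau> \<alpha>)
      + (- D Q0) * (exp (- lam * \<tau>) * opB sbar (u \<tau>) rv)))"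
    by (intro set_integral_add(1) i)
  have "K / lam + x (pv Q0) = (LBINT \<tau>:{0<..}. K * exp (- lam * \<tau>) + (D Q0 * (exp (- lam * \<tau>) * state sbar T x u \<tau> \<alpha>)
      + (- D Q0) * (exp (- lam * \<tau>) * opB sbar (u \<tau>) rv)))"
    unfolding set_integral_add(2)[OF i(1) set_integral_add(1)[OF i(2,3)]] set_integral_add(2)[OF i(2,3)]
      set_integral_mult_right i1(2) exp_neg_set_integral[OF lam] spVd_pv[OF x]
    by (simp add: algebra_simps)
  also have "\<dots> \<le> J x u"
    unfolding J_def
  proof (rule set_integral_mono[OF ii cost_integrable(3)[OF u x]])
    fix \<tau> :: real assume "\<tau> \<in> {0<..}"
    then have uU: "u \<tau> \<in> spU sbar" using admissible_spU[OF u] by simp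
    have "0 \<le> \<epsilon> * (normU sbar (u \<tau> - w))\<^sup>2" using eps(1) by simp
    then have "h0 sbar \<beta> q w - opB sbar (u \<tau> - w) (pv Q0) \<le> h0 sbar \<beta> q (u \<tau>)"
      using h0_wp[OF pv_spV uU, of Q0] by (simp add: w_def)
    moreover have "opB sbar (u \<tau> - w) (pv Q0) = D Q0 * opB sbar (u \<tau>) rv - opB sbar w (pv Q0)"
      using opB_diff[OF uU w] spVd_pv[OF opB_spVd[OF mu uU], of Q0] by simp
    moreover have "- R Q0 + D Q0 * (state sbar T x u \<tau> \<alpha> - Q0) \<le> - R (state sbar T x u \<tau> \<alpha>)" by (rule R_convex)
    ultimately have "K + D Q0 * state sbar T x u \<tau> \<alpha> - D Q0 * opB sbar (u \<tau>) rv \<le> - R (state sbar T x u \<tau> \<alpha>) + h0 sbar \<beta> q (u \<tau>)"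
      by (simp add: K_def algebra_simps)
    then have "exp (- lam * \<tau>) * (K + D Q0 * state sbar T x u \<tau> \<alpha> - D Q0 * opB sbar (u \<tau>) rv)
        \<le> exp (- lam * \<tau>) * (- R (state sbar T x u \<tau> \<alpha>) + h0 sbar \<beta> q (u \<tau>))"
      by (intro mult_left_mono) auto
    then show "K * exp (- lam * \<tau>) + (D Q0 * (exp (- lam * \<tau>) * state sbar T x u \<tau> \<alpha>) + (- D Q0) * (exp (- lam * \<tau>) * opB sbar (u \<tau>) rv))
        \<le> exp (- lam * \<tau>) * (- R (state sbar T x u \<tau> \<alpha>) + h0 sbar \<beta> q (u \<tau>))"
      by (simp add: algebra_simps)
  qed
  finally show ?thesis by (simp add: K_def w_def)
qed

text \<open>\<open>J_lower\<close> bounds the costs from below uniformly in the control, so the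
  infimum is a genuine one.\<close>

lemma val_le: "u \<in> adm \<Longrightarrow> x \<in> spVd sbar \<mu> \<Longrightarrow> val x \<le> J x u"
  unfolding val_J by (rule cINF_lower) (auto intro!: bdd_belowI2 J_lower)

lemma adm_const: "w \<in> spU sbar \<Longrightarrow> (\<lambda>\<tau>. w) \<in> adm"
  by (rule admissible_const[OF lam])

lemma val_ge: "(\<And>u. u \<in> adm \<Longrightarrow> c \<le> J x u) \<Longrightarrow> c \<le> val x"
  unfolding val_J using adm_const[OF q] by (intro cINF_greatest) auto

text \<open>\<open>A x + B w = 0\<close> integrated along translations: under the constant control
  \<open>w\<close> the state rests at \<open>x\<close>.\<close>

lemma cv_const_eq:
  assumes xw: "(x, - opB sbar w) \<in> genA sbar \<mu> T" and v: "v \<in> spV sbar" and \<tau>: "0 \<le> \<tau>"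
  shows "x (LV \<mu> \<tau> v) + cv (\<lambda>\<tau>. w) v \<tau> = x v"
proof -
  have "cv (\<lambda>\<tau>. w) v \<tau> = (LBINT \<sigma>. indicator {0<..<\<tau>} (\<tau> + - 1 * \<sigma>) * opB sbar w (LV \<mu> (\<tau> - (\<tau> + - 1 * \<sigma>)) v))"
    unfolding cv_def set_lebesgue_integral_def
    using lborel_integral_real_affine[of "- 1" "\<lambda>\<sigma>. indicator {0<..<\<tau>} \<sigma> * opB sbar w (LV \<mu> (\<tau> - \<sigma>) v)" \<tau>] by simp
  also have "\<dots> = (LBINT \<sigma>:{0<..<\<tau>}. opB sbar w (LV \<mu> \<sigma> v))"
    unfolding set_lebesgue_integral_def
    by (intro Bochner_Integration.integral_cong refl) (auto simp: indicator_def)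
  finally have "cv (\<lambda>\<tau>. w) v \<tau> = - (LBINT \<sigma>:{0<..<\<tau>}. (- opB sbar w) (LV \<mu> \<sigma> v))"
    by (simp add: set_lebesgue_integral_def)
  then show ?thesis using genA_integral[OF mu S T xw v \<tau>] by simp
qed

lemma state_const:
  assumes xw: "(x, - opB sbar w) \<in> genA sbar \<mu> T" and w: "w \<in> spU sbar" and k: "k \<in> spVd sbar \<mu>"
    and v: "v \<in> spV sbar" and \<tau>: "0 \<le> \<tau>"
  shows "state sbar T (x + k) (\<lambda>\<tau>. w) \<tau> v = x v + k (LV \<mu> \<tau> v)"
  using state_eq[OF adm_const[OF w] spVd_add[OF genA_D(1)[OF mu S T xw] k] v \<tau>] cv_const_eq[OF xw v \<tau>] by simp

text \<open>With the control kept constant, the perturbation \<open>k\<close> of the initial state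
  evolves freely. Its first-order cost is \<open>D (x \<alpha>)\<close> times the discounted
  integral of \<open>k (LV \<mu> \<tau> \<alpha>)\<close>, which the resolvent formula turns into
  \<open>k (pv (x \<alpha>))\<close>; the rest is quadratic in \<open>k\<close>.\<close>

lemma J_const_upper:
  assumes xw: "(x, - opB sbar w) \<in> genA sbar \<mu> T" and w: "w \<in> spU sbar" and k: "k \<in> spVd sbar \<mu>"
  shows "J (x + k) (\<lambda>\<tau>. w) \<le> (- R (x \<alpha>) + h0 sbar \<beta> q w) / lam + k (pv (x \<alpha>)) + C * (normVd sbar \<mu> k * normV sbar \<mu> \<alpha>)\<^sup>2 / lam"
proof -
  define Q0 where "Q0 = x \<alpha>"
  define N where "N = normVd sbar \<mu> k * normV sbar \<mu> \<alpha>"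
  define K where "K = - R Q0 + h0 sbar \<beta> q w + C * N\<^sup>2"
  have xk: "x + k \<in> spVd sbar \<mu>" by (rule spVd_add[OF genA_D(1)[OF mu S T xw] k])
  note r = spVd_resolvent[OF mu lam k \<alpha>, folded rv_def]
  have i: "set_integrable lborel {0<..} (\<lambda>\<tau>. K * exp (- lam * \<tau>))"
    "set_integrable lborel {0<..} (\<lambda>\<tau>. D Q0 * (exp (- lam * \<tau>) * k (LV \<mu> \<tau> \<alpha>)))"
    using exp_neg_set_integrable[OF lam] r(1) by auto
  have "J (x + k) (\<lambda>\<tau>. w) \<le> (LBINT \<tau>:{0<..}. K * exp (- lam * \<tau>) + D Q0 * (exp (- lam * \<tau>) * k (LV \<mu> \<tau> \<alpha>)))"
    unfolding J_def
  proof (rule set_integral_mono[OF cost_integrable(3)[OF adm_const[OF w] xk] set_integral_add(1)[OF i]])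
    fix \<tau> :: real assume "\<tau> \<in> {0<..}"
    then have \<tau>: "0 \<le> \<tau>" by simp
    have "C * (k (LV \<mu> \<tau> \<alpha>))\<^sup>2 \<le> C * N\<^sup>2"
      using power_mono[OF LV_discount_bound[OF k \<alpha> \<tau>], of 2] C_nonneg by (intro mult_left_mono) (auto simp: N_def)
    then have "- R (state sbar T (x + k) (\<lambda>\<tau>. w) \<tau> \<alpha>) + h0 sbar \<beta> q w \<le> K + D Q0 * k (LV \<mu> \<tau> \<alpha>)"
      using R_smooth[of "state sbar T (x + k) (\<lambda>\<tau>. w) \<tau> \<alpha>" Q0] unfolding state_const[OF xw w k \<alpha> \<tau>] by (simp add: Q0_def K_def)
    then have "exp (- lam * \<tau>) * (- R (state sbar T (x + k) (\<lambda>\<tau>. w) \<tau> \<alpha>) + h0 sbar \<beta> q w) \<le> exp (- lam * \<tau>) * (K + D Q0 * k (LV \<mu> \<tau> \<alpha>))"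
      by (intro mult_left_mono) auto
    then show "exp (- lam * \<tau>) * (- R (state sbar T (x + k) (\<lambda>\<tau>. w) \<tau> \<alpha>) + h0 sbar \<beta> q w) \<le> K * exp (- lam * \<tau>) + D Q0 * (exp (- lam * \<tau>) * k (LV \<mu> \<tau> \<alpha>))"
      by (simp add: algebra_simps)
  qed
  also have "\<dots> = K / lam + k (pv Q0)"
    unfolding set_integral_add(2)[OF i] set_integral_mult_right exp_neg_set_integral[OF lam] r(2) spVd_pv[OF k] by simp
  finally show ?thesis by (simp add: K_def Q0_def N_def add_divide_distrib)
qed

text \<open>The discounted integral of a resting state, computed in two ways. It identifies the
  constant in \<open>J_lower\<close> with the cost of resting.\<close>

lemma stationary_balance:
  assumes xw: "(x, - opB sbar w) \<in> genA sbar \<mu> T" and w: "w \<in> spU sbar"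
  shows "x \<alpha> / lam = x rv + opB sbar w rv / lam"
proof -
  note xV = genA_D(1)[OF mu S T xw]
  have "(LBINT \<tau>:{0<..}. exp (- lam * \<tau>) * state sbar T x (\<lambda>\<tau>. w) \<tau> \<alpha>) = (LBINT \<tau>:{0<..}. x \<alpha> * exp (- lam * \<tau>))"
    using state_eq[OF adm_const[OF w] xV \<alpha>] cv_const_eq[OF xw \<alpha>]
    by (intro set_lebesgue_integral_cong) auto
  also have "\<dots> = x \<alpha> / lam" unfolding set_integral_mult_right exp_neg_set_integral[OF lam] by simp
  moreover have "(LBINT \<sigma>:{0<..}. exp (- lam * \<sigma>) * opB sbar w rv) = opB sbar w rv / lam"
    unfolding set_integral_mult_left exp_neg_set_integral[OF lam] by simp
  ultimately show ?thesis
    using state_discount(2)[OF adm_const[OF w] xV \<alpha>, folded rv_def] by simp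
qed

text \<open>A sandwich: \<open>J_lower\<close> with its slope taken at \<open>x \<alpha>\<close>
  from below, the constant control from above. The two agree at \<open>k = 0\<close> and to first
  order, and differ by a quadratic term in \<open>k\<close>.\<close>

lemma frechet_at_stationary:
  assumes xw: "(x, - opB sbar (wp (pv (x \<alpha>)))) \<in> genA sbar \<mu> T"
  shows "frechet_deriv_on (spVd sbar \<mu>) (normVd sbar \<mu>) val x (\<lambda>k. k (pv (x \<alpha>)))"
proof -
  define Q0 w where "Q0 = x \<alpha>" and "w = wp (pv Q0)"
  have xw: "(x, - opB sbar w) \<in> genA sbar \<mu> T" using xw by (simp add: w_def Q0_def)
  have w: "w \<in> spU sbar" unfolding w_def by (rule wp_spU[OF pv_spV])
  note xV = genA_D(1)[OF mu S T xw]
  define J0 where "J0 = (- R Q0 + h0 sbar \<beta> q w) / lam"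
  define M where "M = C * (normV sbar \<mu> \<alpha>)\<^sup>2 / lam"
  have M: "0 \<le> M" using C_nonneg lam by (simp add: M_def)
  have lower: "J0 + k (pv Q0) \<le> val (x + k)" if k: "k \<in> spVd sbar \<mu>" for k
  proof (rule val_ge)
    fix u assume u: "u \<in> adm"
    have "D Q0 * Q0 / lam = x (pv Q0) + opB sbar w (pv Q0) / lam"
      using arg_cong[OF stationary_balance[OF xw w], of "\<lambda>z. D Q0 * z"] spVd_pv[OF xV, of Q0] spVd_pv[OF opB_spVd[OF mu w], of Q0]
      by (simp add: Q0_def distrib_left)
    then show "J0 + k (pv Q0) \<le> J (x + k) u"
      using J_lower[OF u spVd_add[OF xV k], of Q0] unfolding w_def[symmetric] J0_def
      by (simp add: add_divide_distrib diff_divide_distrib)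
  qed
  have upper: "val (x + k) \<le> J0 + k (pv Q0) + M * (normVd sbar \<mu> k)\<^sup>2" if k: "k \<in> spVd sbar \<mu>" for k
    using val_le[OF adm_const[OF w] spVd_add[OF xV k]] J_const_upper[OF xw w k]
    by (simp add: J0_def M_def Q0_def power_mult_distrib mult_ac)
  have z: "0 \<in> spVd sbar \<mu>" using spVd_scaleR[OF xV, of 0] by simp
  have "normVd sbar \<mu> 0 = 0" using normVd_zero_iff[OF mu z] by simp
  then have v0: "val x = J0" using lower[OF z] upper[OF z] by simp
  show ?thesis
    unfolding frechet_deriv_on_def
  proof (intro allI impI)
    fix e :: real assume e: "0 < e"
    show "\<exists>d>0. \<forall>k\<in>spVd sbar \<mu>. normVd sbar \<mu> k < d \<longrightarrow> \<bar>val (x + k) - val x - k (pv (x \<alpha>))\<bar> \<le> e * normVd sbar \<mu> k"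
    proof (intro exI[of _ "e / (M + 1)"] conjI ballI impI)
      show "0 < e / (M + 1)" using e M by simp
      fix k assume k: "k \<in> spVd sbar \<mu>" "normVd sbar \<mu> k < e / (M + 1)"
      have n: "0 \<le> normVd sbar \<mu> k" by (rule normVd_nonneg[OF mu k(1)])
      have "M * (normVd sbar \<mu> k)\<^sup>2 \<le> (M + 1) * (normVd sbar \<mu> k * normVd sbar \<mu> k)"
        by (simp add: power2_eq_square mult_right_mono)
      also have "\<dots> \<le> (M + 1) * (e / (M + 1) * normVd sbar \<mu> k)"
        using k(2) n M by (intro mult_left_mono mult_right_mono) auto
      also have "\<dots> = e * normVd sbar \<mu> k" using M by simp
      finally show "\<bar>val (x + k) - val x - k (pv (x \<alpha>))\<bar> \<le> e * normVd sbar \<mu> k"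
        using lower[OF k(1)] upper[OF k(1)] v0 unfolding Q0_def[symmetric] by simp
    qed
  qed
qed

end

section \<open>Equilibrium points are stationary\<close>

lemma set_integral_split_shift:
  fixes F :: "real \<Rightarrow> real"
  assumes F: "set_integrable lborel {0<..} F" and t: "0 \<le> t"
  shows "set_integrable lborel {0<..<t} F" "set_integrable lborel {0<..} (\<lambda>\<tau>. F (t + \<tau>))"
    "(LBINT \<tau>:{0<..}. F \<tau>) = (LBINT \<tau>:{0<..<t}. F \<tau>) + (LBINT \<tau>:{0<..}. F (t + \<tau>))"
proof -
  show 1: "set_integrable lborel {0<..<t} F" by (rule set_integrable_subset[OF F]) auto
  have 2: "set_integrable lborel {t<..} F" by (rule set_integrable_subset[OF F]) (use t in auto)
  have ind: "indicator {t<..} (t + 1 * \<tau>) = (indicator {0<..} \<tau> :: real)" for \<tau> :: real by (simp add: indicator_def)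
  show "set_integrable lborel {0<..} (\<lambda>\<tau>. F (t + \<tau>))"
    using lborel_integrable_real_affine[OF 2[unfolded set_integrable_def], of 1 t] unfolding ind by (simp add: set_integrable_def)
  have "(LBINT \<tau>:{0<..}. F \<tau>) = (LBINT \<tau>. indicator {0<..<t} \<tau> *\<^sub>R F \<tau> + indicator {t<..} \<tau> *\<^sub>R F \<tau>)"
    unfolding set_lebesgue_integral_def
  proof (rule integral_cong_AE)
    show "AE \<tau> in lborel. indicator {0<..} \<tau> *\<^sub>R F \<tau> = indicator {0<..<t} \<tau> *\<^sub>R F \<tau> + indicator {t<..} \<tau> *\<^sub>R F \<tau>"
      using AE_lborel_singleton[of t] by eventually_elim (use t in \<open>auto simp: indicator_def\<close>)
  qed (use F 1 2 in \<open>auto simp: set_integrable_def dest: borel_measurable_integrable\<close>)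
  also have "\<dots> = (LBINT \<tau>:{0<..<t}. F \<tau>) + (LBINT \<tau>:{t<..}. F \<tau>)"
    using 1 2 by (simp add: set_integrable_def set_lebesgue_integral_def)
  also have "(LBINT \<tau>:{t<..}. F \<tau>) = (LBINT \<tau>:{0<..}. F (t + \<tau>))"
    using lborel_integral_real_affine[of 1 "\<lambda>\<tau>. indicator {t<..} \<tau> *\<^sub>R F \<tau>" t] unfolding ind by (simp add: set_lebesgue_integral_def)
  finally show "(LBINT \<tau>:{0<..}. F \<tau>) = (LBINT \<tau>:{0<..<t}. F \<tau>) + (LBINT \<tau>:{0<..}. F (t + \<tau>))" .
qed

context vintage_cost
begin

text \<open>The state is affine in the pair of initial datum and control, and both running costs are
  convex.\<close>

lemma J_convex:
  assumes u: "u \<in> adm" "u' \<in> adm" and x: "x \<in> spVd sbar \<mu>" "x' \<in> spVd sbar \<mu>" and s: "0 \<le> s" "s \<le> 1"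
  shows "J ((1 - s) *\<^sub>R x + s *\<^sub>R x') (\<lambda>\<tau>. (1 - s) *\<^sub>R u \<tau> + s *\<^sub>R u' \<tau>) \<le> (1 - s) * J x u + s * J x' u'"
proof -
  define y where "y = (1 - s) *\<^sub>R x + s *\<^sub>R x'"
  define w where "w = (\<lambda>\<tau>. (1 - s) *\<^sub>R u \<tau> + s *\<^sub>R u' \<tau>)"
  have y: "y \<in> spVd sbar \<mu>" unfolding y_def by (rule spVd_lincomb_closed[OF x])
  have w: "w \<in> adm" unfolding w_def by (rule admissible_lincomb[OF u])
  note i = cost_integrable(3)[OF u(1) x(1)] cost_integrable(3)[OF u(2) x(2)]
  have i': "set_integrable lborel {0<..} (\<lambda>\<tau>. (1 - s) * (exp (- lam * \<tau>) * (- R (state sbar T x u \<tau> \<alpha>) + h0 sbar \<beta> q (u \<tau>))))"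
    "set_integrable lborel {0<..} (\<lambda>\<tau>. s * (exp (- lam * \<tau>) * (- R (state sbar T x' u' \<tau> \<alpha>) + h0 sbar \<beta> q (u' \<tau>))))"
    by (rule set_integrable_mult_right, rule i)+
  have "J y w \<le> (LBINT \<tau>:{0<..}. (1 - s) * (exp (- lam * \<tau>) * (- R (state sbar T x u \<tau> \<alpha>) + h0 sbar \<beta> q (u \<tau>)))
      + s * (exp (- lam * \<tau>) * (- R (state sbar T x' u' \<tau> \<alpha>) + h0 sbar \<beta> q (u' \<tau>))))"
    unfolding J_def
  proof (rule set_integral_mono[OF cost_integrable(3)[OF w y] set_integral_add(1)[OF i']])
    fix \<tau> :: real assume "\<tau> \<in> {0<..}"
    then have \<tau>: "0 < \<tau>" "0 \<le> \<tau>" by auto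
    define P P' where "P = state sbar T x u \<tau> \<alpha>" and "P' = state sbar T x' u' \<tau> \<alpha>"
    define M where "M = (1 - s) * P + s * P'"
    have st: "state sbar T y w \<tau> \<alpha> = M"
      using cv_lincomb_u[OF u \<alpha>, of "1 - s" s \<tau>]
      unfolding state_eq[OF w y \<alpha> \<tau>(2)] M_def P_def P'_def state_eq[OF u(1) x(1) \<alpha> \<tau>(2)] state_eq[OF u(2) x(2) \<alpha> \<tau>(2)]
      by (simp add: w_def y_def scaleR_fun_def algebra_simps)
    have "(1 - s) * (- R M + D M * (P - M)) + s * (- R M + D M * (P' - M)) \<le> (1 - s) * (- R P) + s * (- R P')"
      using s by (intro add_mono mult_left_mono R_convex) auto
    moreover have "(1 - s) * (- R M + D M * (P - M)) + s * (- R M + D M * (P' - M)) = - R M"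
    proof -
      have "(1 - s) * (P - M) + s * (P' - M) = 0" by (simp add: M_def algebra_simps)
      then have "D M * ((1 - s) * (P - M) + s * (P' - M)) = 0" by simp
      then show ?thesis by (simp add: algebra_simps)
    qed
    ultimately have "- R M \<le> (1 - s) * (- R P) + s * (- R P')" by linarith
    moreover have "h0 sbar \<beta> q (w \<tau>) \<le> (1 - s) * h0 sbar \<beta> q (u \<tau>) + s * h0 sbar \<beta> q (u' \<tau>)"
      unfolding w_def by (rule h0_convex[OF admissible_spU[OF u(1) \<tau>(1)] admissible_spU[OF u(2) \<tau>(1)] s])
    ultimately have "- R M + h0 sbar \<beta> q (w \<tau>) \<le> (1 - s) * (- R P + h0 sbar \<beta> q (u \<tau>)) + s * (- R P' + h0 sbar \<beta> q (u' \<tau>))"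
      unfolding distrib_left by linarith
    then have "exp (- lam * \<tau>) * (- R M + h0 sbar \<beta> q (w \<tau>))
        \<le> exp (- lam * \<tau>) * ((1 - s) * (- R P + h0 sbar \<beta> q (u \<tau>)) + s * (- R P' + h0 sbar \<beta> q (u' \<tau>)))"
      by (intro mult_left_mono) auto
    then show "exp (- lam * \<tau>) * (- R (state sbar T y w \<tau> \<alpha>) + h0 sbar \<beta> q (w \<tau>))
        \<le> (1 - s) * (exp (- lam * \<tau>) * (- R (state sbar T x u \<tau> \<alpha>) + h0 sbar \<beta> q (u \<tau>)))
        + s * (exp (- lam * \<tau>) * (- R (state sbar T x' u' \<tau> \<alpha>) + h0 sbar \<beta> q (u' \<tau>)))"
      unfolding st P_def[symmetric] P'_def[symmetric] by (simp only: distrib_left mult.left_commute)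
  qed
  also have "\<dots> = (1 - s) * J x u + s * J x' u'"
    unfolding set_integral_add(2)[OF i'] set_integral_mult_right J_def ..
  finally show ?thesis by (simp add: y_def w_def)
qed

lemma val_approx:
  assumes x: "x \<in> spVd sbar \<mu>" and e: "0 < e"
  obtains u where "u \<in> adm" "J x u < val x + e"
proof -
  have "\<exists>u\<in>adm. J x u < val x + e"
  proof (rule ccontr)
    assume "\<not> ?thesis"
    then have "val x + e \<le> val x" by (intro val_ge) force
    then show False using e by simp
  qed
  then show ?thesis using that by blast
qed

lemma val_convex:
  assumes x: "x \<in> spVd sbar \<mu>" "x' \<in> spVd sbar \<mu>" and s: "0 \<le> s" "s \<le> 1"
  shows "val ((1 - s) *\<^sub>R x + s *\<^sub>R x') \<le> (1 - s) * val x + s * val x'"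
proof (rule field_le_epsilon)
  fix e :: real assume e: "0 < e"
  obtain u where u: "u \<in> adm" "J x u < val x + e" by (rule val_approx[OF x(1) e])
  obtain u' where u': "u' \<in> adm" "J x' u' < val x' + e" by (rule val_approx[OF x(2) e])
  have "val ((1 - s) *\<^sub>R x + s *\<^sub>R x') \<le> J ((1 - s) *\<^sub>R x + s *\<^sub>R x') (\<lambda>\<tau>. (1 - s) *\<^sub>R u \<tau> + s *\<^sub>R u' \<tau>)"
    by (rule val_le[OF admissible_lincomb[OF u(1) u'(1)] spVd_lincomb_closed[OF x]])
  also have "\<dots> \<le> (1 - s) * J x u + s * J x' u'" by (rule J_convex[OF u(1) u'(1) x s])
  also have "\<dots> \<le> (1 - s) * (val x + e) + s * (val x' + e)"
    using s u u' by (intro add_mono mult_left_mono) auto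
  finally show "val ((1 - s) *\<^sub>R x + s *\<^sub>R x') \<le> (1 - s) * val x + s * val x' + e" by (simp add: algebra_simps)
qed

text \<open>Convexity makes the derivative global: the difference quotient along a small multiple of
  \<open>k\<close> is at most the full increment.\<close>

lemma val_subgradient:
  assumes x: "x \<in> spVd sbar \<mu>" and p: "p \<in> spV sbar"
    and F: "frechet_deriv_on (spVd sbar \<mu>) (normVd sbar \<mu>) val x (\<lambda>k. k p)" and k: "k \<in> spVd sbar \<mu>"
  shows "val x + k p \<le> val (x + k)"
proof (rule field_le_epsilon)
  fix e :: real assume e: "0 < e"
  define N where "N = normVd sbar \<mu> k"
  have N: "0 \<le> N" unfolding N_def by (rule normVd_nonneg[OF mu k])
  define e' where "e' = e / (N + 1)"
  have e': "0 < e'" using e N by (simp add: e'_def)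
  obtain d where d: "0 < d" "\<And>k. k \<in> spVd sbar \<mu> \<Longrightarrow> normVd sbar \<mu> k < d \<Longrightarrow> \<bar>val (x + k) - val x - k p\<bar> \<le> e' * normVd sbar \<mu> k"
    using F e' unfolding frechet_deriv_on_def by blast
  \<comment> \<open>Capped at 1 to be a convexity weight, and small enough to bring
    \<open>s *\<^sub>R k\<close> within the radius \<open>d\<close>; the added 1 avoids division by
    zero.\<close>
  define s where "s = min 1 (d / (2 * (N + 1)))"
  have s: "0 < s" "s \<le> 1" using d N by (auto simp: s_def)
  have sk: "s *\<^sub>R k \<in> spVd sbar \<mu>" by (rule spVd_scaleR[OF k])
  have n: "normVd sbar \<mu> (s *\<^sub>R k) \<le> s * N"
    using normVd_lincomb_le[OF mu k k, of s 0] s by (simp add: N_def)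
  have "s * N \<le> d / (2 * (N + 1)) * N" using N by (intro mult_right_mono) (auto simp: s_def)
  also have "\<dots> < d" using d N by (simp add: field_simps) (smt (verit) mult_nonneg_nonneg)
  finally have "normVd sbar \<mu> (s *\<^sub>R k) < d" using n by simp
  from d(2)[OF sk this] have "\<bar>val (x + s *\<^sub>R k) - val x - s * k p\<bar> \<le> e' * (s * N)"
    using mult_left_mono[OF n less_imp_le[OF e']] by (simp add: scaleR_fun_def)
  moreover have "val (x + s *\<^sub>R k) \<le> (1 - s) * val x + s * val (x + k)"
  proof -
    have "x + s *\<^sub>R k = (1 - s) *\<^sub>R x + s *\<^sub>R (x + k)" by (simp add: algebra_simps)
    then show ?thesis using val_convex[OF x spVd_add[OF x k], of s] s by simp
  qed
  ultimately have "s * (val x + k p) \<le> s * (val (x + k) + e' * N)" by (simp add: algebra_simps abs_le_iff)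
  then have "val x + k p \<le> val (x + k) + e' * N" using s(1) by (simp only: mult_le_cancel_left_pos)
  moreover have "e' * N \<le> e" using e N by (simp add: e'_def field_simps)
  ultimately show "val x + k p \<le> val (x + k) + e" by linarith
qed

text \<open>Additivity in time and the flow property; restarting the clock at \<open>t\<close>
  produces the factor \<open>exp (- lam * t)\<close>.\<close>

lemma J_split:
  assumes u: "u \<in> adm" and x: "x \<in> spVd sbar \<mu>" and t: "0 \<le> t"
  shows "J x u = (LBINT \<tau>:{0<..<t}. exp (- lam * \<tau>) * (- R (state sbar T x u \<tau> \<alpha>) + h0 sbar \<beta> q (u \<tau>)))
    + exp (- lam * t) * J (state sbar T x u t) (\<lambda>\<tau>. u (t + \<tau>))"
proof -
  define F where "F = (\<lambda>\<tau>. exp (- lam * \<tau>) * (- R (state sbar T x u \<tau> \<alpha>) + h0 sbar \<beta> q (u \<tau>)))"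
  have F: "set_integrable lborel {0<..} F" unfolding F_def by (rule cost_integrable(3)[OF u x])
  have "(LBINT \<tau>:{0<..}. F (t + \<tau>)) = (LBINT \<tau>:{0<..}. exp (- lam * t) *
      (exp (- lam * \<tau>) * (- R (state sbar T (state sbar T x u t) (\<lambda>\<tau>. u (t + \<tau>)) \<tau> \<alpha>) + h0 sbar \<beta> q (u (t + \<tau>)))))"
  proof (rule set_lebesgue_integral_cong)
    show "\<forall>\<tau>. \<tau> \<in> {0<..} \<longrightarrow> F (t + \<tau>) = exp (- lam * t) *
      (exp (- lam * \<tau>) * (- R (state sbar T (state sbar T x u t) (\<lambda>\<tau>. u (t + \<tau>)) \<tau> \<alpha>) + h0 sbar \<beta> q (u (t + \<tau>))))"
    proof (intro allI impI)
      fix \<tau> :: real assume "\<tau> \<in> {0<..}"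
      then have \<tau>: "0 \<le> \<tau>" by simp
      have "exp (- lam * (t + \<tau>)) * y = exp (- lam * t) * (exp (- lam * \<tau>) * y)" for y
        by (simp add: algebra_simps flip: mult.assoc exp_add)
      then show "F (t + \<tau>) = exp (- lam * t) *
        (exp (- lam * \<tau>) * (- R (state sbar T (state sbar T x u t) (\<lambda>\<tau>. u (t + \<tau>)) \<tau> \<alpha>) + h0 sbar \<beta> q (u (t + \<tau>))))"
        unfolding F_def state_cocycle[OF u x \<alpha> t \<tau>] by blast
    qed
  qed simp
  also have "\<dots> = exp (- lam * t) * J (state sbar T x u t) (\<lambda>\<tau>. u (t + \<tau>))"
    unfolding set_integral_mult_right J_def ..
  finally show ?thesis
    using set_integral_split_shift(3)[OF F t] unfolding J_def F_def by simp
qed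

lemma opB_set_measurable:
  assumes u: "u \<in> adm" and p: "p \<in> spV sbar"
  shows "(\<lambda>\<sigma>. indicator {0<..} \<sigma> * opB sbar (u \<sigma>) p) \<in> borel_measurable borel"
proof (rule bochner_measurable_compose[of "spU sbar" "normU sbar" u "\<lambda>y. opB sbar y p"])
  show "bochner_measurable (spU sbar) (normU sbar) u" using u by (simp add: admissible_iff)
  fix \<psi> :: "nat \<Rightarrow> ctrl" and y assume \<psi>: "\<And>n. \<psi> n \<in> spU sbar" "y \<in> spU sbar" "(\<lambda>n. normU sbar (\<psi> n - y)) \<longlonglongrightarrow> 0"
  show "(\<lambda>n. opB sbar (\<psi> n) p) \<longlonglongrightarrow> opB sbar y p"
  proof (rule LIM_zero_cancel, rule Lim_null_comparison)
    show "\<forall>\<^sub>F n in sequentially. norm (opB sbar (\<psi> n) p - opB sbar y p) \<le> KB \<mu> * normV sbar \<mu> p * normU sbar (\<psi> n - y)"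
      using opB_bound[OF mu spU_diff[OF \<psi>(1,2)] p] by (intro always_eventually allI) (simp add: opB_diff[OF \<psi>(1,2)])
    show "(\<lambda>n. KB \<mu> * normV sbar \<mu> p * normU sbar (\<psi> n - y)) \<longlonglongrightarrow> 0"
      using tendsto_mult[OF tendsto_const \<psi>(3), of "KB \<mu> * normV sbar \<mu> p"] by simp
  qed
qed

text \<open>The cost of replacing the discounted and transported costate by the costate itself:
  \<omega> measures the transport, \<open>lam * t\<close> the discount.\<close>

lemma discounted_LV_error:
  assumes w: "w \<in> spU sbar" and p: "p \<in> spV sbar" and \<rho>: "0 \<le> \<rho>" "\<rho> \<le> t"
    and \<omega>: "normV sbar \<mu> (\<lambda>s. LV \<mu> \<rho> p s - p s) \<le> \<omega>"
  shows "\<bar>exp (- lam * \<rho>) * opB sbar w (LV \<mu> \<rho> p) - opB sbar w p\<bar> \<le> KB \<mu> * (\<omega> + lam * t * normV sbar \<mu> p) * normU sbar w"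
proof -
  note Lp = LV_spV[OF mu p \<rho>(1)]
  define a where "a = opB sbar w (LV \<mu> \<rho> p)"
  have K: "0 \<le> KB \<mu>" using KB_pos[OF mu] by simp
  have d: "(\<lambda>s. LV \<mu> \<rho> p s - p s) \<in> spV sbar" using spV_lincomb[OF Lp p, of 1 "-1"] by simp
  have "a - opB sbar w p = opB sbar w (\<lambda>s. LV \<mu> \<rho> p s - p s)"
    using spVd_lincomb[OF opB_spVd[OF mu w] Lp p, of 1 "-1"] by (simp add: a_def)
  then have 1: "\<bar>a - opB sbar w p\<bar> \<le> KB \<mu> * \<omega> * normU sbar w"
    using opB_bound[OF mu w d] mult_right_mono[OF mult_left_mono[OF \<omega> K], of "normU sbar w"] by simp
  have 2: "\<bar>a\<bar> \<le> KB \<mu> * normV sbar \<mu> p * normU sbar w"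
  proof -
    have "\<bar>a\<bar> \<le> KB \<mu> * normV sbar \<mu> (LV \<mu> \<rho> p) * normU sbar w" unfolding a_def by (rule opB_bound[OF mu w Lp])
    also have "\<dots> \<le> KB \<mu> * normV sbar \<mu> p * normU sbar w"
      by (intro mult_right_mono mult_left_mono LV_normV_le mu p \<rho> K) simp
    finally show ?thesis .
  qed
  have e: "0 \<le> 1 - exp (- lam * \<rho>)" "1 - exp (- lam * \<rho>) \<le> lam * t"
  proof -
    show "0 \<le> 1 - exp (- lam * \<rho>)" using lam \<rho> by simp
    have "1 - lam * \<rho> \<le> exp (- lam * \<rho>)" using exp_ge_add_one_self[of "- lam * \<rho>"] by simp
    moreover have "lam * \<rho> \<le> lam * t" using lam \<rho> by simp
    ultimately show "1 - exp (- lam * \<rho>) \<le> lam * t" by linarith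
  qed
  have "exp (- lam * \<rho>) * a - opB sbar w p = (a - opB sbar w p) - (1 - exp (- lam * \<rho>)) * a" by (simp add: algebra_simps)
  then have "\<bar>exp (- lam * \<rho>) * a - opB sbar w p\<bar> \<le> \<bar>a - opB sbar w p\<bar> + (1 - exp (- lam * \<rho>)) * \<bar>a\<bar>"
    using abs_triangle_ineq4[of "a - opB sbar w p" "(1 - exp (- lam * \<rho>)) * a"] e(1) by (simp add: abs_mult)
  also have "\<dots> \<le> KB \<mu> * \<omega> * normU sbar w + (lam * t) * (KB \<mu> * normV sbar \<mu> p * normU sbar w)"
    using e lam \<rho> by (intro add_mono 1 mult_mono 2) auto
  finally show ?thesis by (simp add: a_def algebra_simps)
qed

text \<open>Dynamic programming on \<open>[0, t]\<close>: every control costs at least as much as staying at the stationary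
  point, up to \<open>t\<close> times a quantity that vanishes as \<open>t \<rightarrow> 0\<close>.\<close>

lemma J_lower_short_time:
  assumes p: "p \<in> spV sbar" and xw: "(x, - opB sbar (wp p)) \<in> genA sbar \<mu> T"
    and sub: "\<And>k. k \<in> spVd sbar \<mu> \<Longrightarrow> val x + k p \<le> val (x + k)"
    and t: "0 < t" "t \<le> 1" and \<omega>: "\<And>\<rho>. 0 \<le> \<rho> \<Longrightarrow> \<rho> \<le> t \<Longrightarrow> normV sbar \<mu> (\<lambda>s. LV \<mu> \<rho> p s - p s) \<le> \<omega>"
    and m: "m = t * (\<bar>D (x \<alpha>)\<bar> * (KB \<mu> * normV sbar \<mu> \<alpha>)) + KB \<mu> * (\<omega> + lam * t * normV sbar \<mu> p)"
    and u: "u \<in> adm"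
  shows "(1 - exp (- lam * t)) / lam * (- R (x \<alpha>) + h0 sbar \<beta> q (wp p)) + exp (- lam * t) * val x
      - t * (m\<^sup>2 / (4 * (exp (- lam) * \<epsilon>))) \<le> J x u"
proof -
  define w Q0 l0 where "w = wp p" and "Q0 = x \<alpha>" and "l0 = - R Q0 + h0 sbar \<beta> q w"
  have xw: "(x, - opB sbar w) \<in> genA sbar \<mu> T" using xw by (simp add: w_def)
  have w: "w \<in> spU sbar" unfolding w_def by (rule wp_spU[OF p])
  note x = genA_D(1)[OF mu S T xw]
  have t0: "0 \<le> t" using t by simp
  \<comment> \<open>The deviation from the constant control. As \<open>w\<close> keeps the state at
    \<open>x\<close>, the state deviates by the response to \<open>z\<close> alone.\<close>
  define z where "z = (\<lambda>\<tau>. 1 *\<^sub>R u \<tau> + (- 1) *\<^sub>R w)"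
  have z: "z \<in> adm" unfolding z_def by (rule admissible_lincomb[OF u adm_const[OF w]])
  have zw: "z \<tau> = u \<tau> - w" for \<tau> by (simp add: z_def)
  have st: "state sbar T x u \<tau> v = x v + cv z v \<tau>" if "v \<in> spV sbar" "0 \<le> \<tau>" for v \<tau>
    using state_eq[OF u x that] cv_const_eq[OF xw that] cv_lincomb_u[OF u adm_const[OF w] that(1), of 1 "-1" \<tau>]
    by (simp add: z_def)
  define f where "f = nU z"
  have f0: "0 \<le> f \<sigma>" for \<sigma> by (simp add: f_def)
  have fz: "f \<sigma> = normU sbar (z \<sigma>)" if "0 < \<sigma>" for \<sigma> using that by (simp add: f_def nU_def)
  define A where "A = KB \<mu> * normV sbar \<mu> \<alpha>"
  define B where "B = KB \<mu> * (\<omega> + lam * t * normV sbar \<mu> p)"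
  \<comment> \<open>A lower bound for the discounted convexity constant on \<open>[0, t]\<close>,
    valid because \<open>t \<le> 1\<close>.\<close>
  define c where "c = exp (- lam) * \<epsilon>"
  have c: "0 < c" using eps(1) by (simp add: c_def)
  note fi = nU_loc_integrable(1)[OF z, of t, folded f_def] and fi2 = nU_loc_integrable(2)[OF z, of t, folded f_def]
  define F where "F = (LBINT \<sigma>:{0<..<t}. f \<sigma>)"
  define g where "g = (\<lambda>\<sigma>. exp (- lam * \<sigma>) * opB sbar (z \<sigma>) p)"
  have gi: "set_integrable lborel {0<..<t} g"
  proof (rule set_integrable_bound')
    show "set_integrable lborel {0<..<t} (\<lambda>\<sigma>. (KB \<mu> * normV sbar \<mu> p) * f \<sigma>)" using fi by simp
    note opB_set_measurable[OF z p, measurable]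
    have "(\<lambda>\<sigma>. indicator {0<..<t} \<sigma> * exp (- lam * \<sigma>) * (indicator {0<..} \<sigma> * opB sbar (z \<sigma>) p)) \<in> borel_measurable borel" by measurable
    also have "(\<lambda>\<sigma>. indicator {0<..<t} \<sigma> * exp (- lam * \<sigma>) * (indicator {0<..} \<sigma> * opB sbar (z \<sigma>) p)) = (\<lambda>\<sigma>. indicator {0<..<t} \<sigma> * g \<sigma>)"
      by (auto simp: g_def indicator_def)
    finally show "(\<lambda>\<sigma>. indicator {0<..<t} \<sigma> * g \<sigma>) \<in> borel_measurable borel" .
    fix \<sigma> assume \<sigma>: "\<sigma> \<in> {0<..<t}"
    then have "\<bar>opB sbar (z \<sigma>) p\<bar> \<le> KB \<mu> * normV sbar \<mu> p * f \<sigma>"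
      using opB_bound[OF mu admissible_spU[OF z] p, of \<sigma>] by (simp add: fz)
    moreover have "exp (- lam * \<sigma>) * \<bar>opB sbar (z \<sigma>) p\<bar> \<le> 1 * \<bar>opB sbar (z \<sigma>) p\<bar>"
      using \<sigma> lam by (intro mult_right_mono) auto
    ultimately show "\<bar>g \<sigma>\<bar> \<le> (KB \<mu> * normV sbar \<mu> p) * f \<sigma>" by (simp add: g_def abs_mult)
  qed
  have ei: "set_integrable lborel {0<..<t} (\<lambda>\<tau>. exp (- lam * \<tau>))"
    and E: "(LBINT \<tau>:{0<..<t}. exp (- lam * \<tau>)) = (1 - exp (- lam * t)) / lam"
  proof -
    note s = set_integral_split_shift[OF exp_neg_set_integrable[OF lam] t0]
    show "set_integrable lborel {0<..<t} (\<lambda>\<tau>. exp (- lam * \<tau>))" by (rule s(1))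
    have "exp (- lam * (t + \<tau>)) = exp (- lam * t) * exp (- lam * \<tau>)" for \<tau> by (simp add: algebra_simps flip: exp_add)
    then have "(LBINT \<tau>:{0<..}. exp (- lam * (t + \<tau>))) = exp (- lam * t) / lam"
      using exp_neg_set_integral[OF lam] by simp
    then show "(LBINT \<tau>:{0<..<t}. exp (- lam * \<tau>)) = (1 - exp (- lam * t)) / lam"
      using s(3) exp_neg_set_integral[OF lam] by (simp add: diff_divide_distrib)
  qed
  have ci: "set_integrable lborel {0<..<t} (\<lambda>\<tau>. k)" for k :: real
    unfolding set_integrable_def by (auto intro!: integrable_real_indicator simp: t0)
  have cI: "(LBINT \<tau>:{0<..<t}. k) = t * k" for k :: real
    using t0 by (simp add: set_lebesgue_integral_def)
  \<comment> \<open>Bounds the first-order change of the revenue: its slope times the deviation of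
    the state, which is at most \<open>A * F\<close>.\<close>
  define k1 where "k1 = \<bar>D Q0\<bar> * (A * F)"
  have low: "l0 * exp (- lam * \<tau>) + ((- k1) + ((- 1) * g \<tau> + c * (f \<tau>)\<^sup>2))
      \<le> exp (- lam * \<tau>) * (- R (state sbar T x u \<tau> \<alpha>) + h0 sbar \<beta> q (u \<tau>))" if \<tau>: "\<tau> \<in> {0<..<t}" for \<tau>
  proof -
    have \<tau>0: "0 < \<tau>" "0 \<le> \<tau>" "\<tau> \<le> t" using \<tau> by auto
    have "\<bar>cv z \<alpha> \<tau>\<bar> \<le> A * F" using cv_bound_loc[OF z \<alpha> \<tau>0(3)] by (simp add: A_def F_def f_def)
    then have "\<bar>D Q0\<bar> * \<bar>cv z \<alpha> \<tau>\<bar> \<le> k1" unfolding k1_def by (rule mult_left_mono) simp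
    then have "- k1 \<le> D Q0 * cv z \<alpha> \<tau>" using abs_ge_minus_self[of "D Q0 * cv z \<alpha> \<tau>"] by (simp add: abs_mult)
    moreover have "- R Q0 + D Q0 * cv z \<alpha> \<tau> \<le> - R (state sbar T x u \<tau> \<alpha>)"
      using R_convex[of Q0 "state sbar T x u \<tau> \<alpha>"] st[OF \<alpha> \<tau>0(2)] by (simp add: Q0_def)
    moreover have "h0 sbar \<beta> q w - opB sbar (z \<tau>) p + \<epsilon> * (f \<tau>)\<^sup>2 \<le> h0 sbar \<beta> q (u \<tau>)"
      using h0_wp[OF p admissible_spU[OF u \<tau>0(1)]] by (simp add: w_def[symmetric] zw[symmetric] fz[OF \<tau>0(1)])
    ultimately have "l0 - k1 - opB sbar (z \<tau>) p + \<epsilon> * (f \<tau>)\<^sup>2 \<le> - R (state sbar T x u \<tau> \<alpha>) + h0 sbar \<beta> q (u \<tau>)"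
      unfolding l0_def by linarith
    then have "exp (- lam * \<tau>) * (l0 - k1 - opB sbar (z \<tau>) p + \<epsilon> * (f \<tau>)\<^sup>2)
        \<le> exp (- lam * \<tau>) * (- R (state sbar T x u \<tau> \<alpha>) + h0 sbar \<beta> q (u \<tau>))" by (rule mult_left_mono) simp
    moreover have "exp (- lam * \<tau>) * k1 \<le> 1 * k1"
    proof (rule mult_right_mono)
      have "0 \<le> F" unfolding F_def set_lebesgue_integral_def by (rule Bochner_Integration.integral_nonneg) (use f0 in auto)
      then show "0 \<le> k1" using KB_pos[OF mu] by (simp add: k1_def A_def)
    qed (use lam \<tau>0 in simp)
    moreover have "c * (f \<tau>)\<^sup>2 \<le> exp (- lam * \<tau>) * (\<epsilon> * (f \<tau>)\<^sup>2)"
    proof -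
      have "lam * \<tau> \<le> lam * 1" using lam \<tau>0 t by (intro mult_left_mono) auto
      then have "exp (- lam) \<le> exp (- lam * \<tau>)" by simp
      then have "exp (- lam) * (\<epsilon> * (f \<tau>)\<^sup>2) \<le> exp (- lam * \<tau>) * (\<epsilon> * (f \<tau>)\<^sup>2)"
        using eps(1) by (intro mult_right_mono) auto
      then show ?thesis by (simp add: c_def)
    qed
    moreover have "exp (- lam * \<tau>) * (l0 - k1 - opB sbar (z \<tau>) p + \<epsilon> * (f \<tau>)\<^sup>2)
        = l0 * exp (- lam * \<tau>) - exp (- lam * \<tau>) * k1 - g \<tau> + exp (- lam * \<tau>) * (\<epsilon> * (f \<tau>)\<^sup>2)"
      by (simp add: g_def algebra_simps)
    ultimately show ?thesis by linarith
  qed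
  have ints: "set_integrable lborel {0<..<t} (\<lambda>\<tau>. l0 * exp (- lam * \<tau>))"
    "set_integrable lborel {0<..<t} (\<lambda>\<tau>. (- 1) * g \<tau>)" "set_integrable lborel {0<..<t} (\<lambda>\<tau>. c * (f \<tau>)\<^sup>2)"
    by (rule set_integrable_mult_right, rule ei gi fi2)+
  note i3 = set_integral_add[OF ints(2,3)]
  note i2 = set_integral_add[OF ci[of "- k1"] i3(1)]
  note i1 = set_integral_add[OF ints(1) i2(1)]
  have "(LBINT \<tau>:{0<..<t}. l0 * exp (- lam * \<tau>) + ((- k1) + ((- 1) * g \<tau> + c * (f \<tau>)\<^sup>2)))
      \<le> (LBINT \<tau>:{0<..<t}. exp (- lam * \<tau>) * (- R (state sbar T x u \<tau> \<alpha>) + h0 sbar \<beta> q (u \<tau>)))"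
    by (rule set_integral_mono[OF i1(1) set_integral_split_shift(1)[OF cost_integrable(3)[OF u x] t0] low])
  then have I: "l0 * ((1 - exp (- lam * t)) / lam) + (t * (- k1) + (- (LBINT \<tau>:{0<..<t}. g \<tau>) + c * (LBINT \<tau>:{0<..<t}. (f \<tau>)\<^sup>2)))
      \<le> (LBINT \<tau>:{0<..<t}. exp (- lam * \<tau>) * (- R (state sbar T x u \<tau> \<alpha>) + h0 sbar \<beta> q (u \<tau>)))"
    unfolding i1(2) i2(2) i3(2) set_integral_mult_right E cI by simp
  define y where "y = state sbar T x u t"
  have y: "y \<in> spVd sbar \<mu>" unfolding y_def by (rule state_spVd[OF u x t0])
  \<comment> \<open>The subgradient inequality replaces the unknown value at the endpoint
    \<open>y\<close> by \<open>val x + cv z p t\<close>.\<close>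
  have "val x + (y - x) p \<le> val (x + (y - x))" by (rule sub[OF spVd_diff[OF y x]])
  then have "val x + cv z p t \<le> val y" using st[OF p t0] by (simp add: y_def)
  also have "val y \<le> J y (\<lambda>\<tau>. u (t + \<tau>))" by (rule val_le[OF admissible_shift[OF u t0] y])
  finally have Y: "exp (- lam * t) * (val x + cv z p t) \<le> exp (- lam * t) * J y (\<lambda>\<tau>. u (t + \<tau>))"
    by (rule mult_left_mono) simp
  \<comment> \<open>The costate charge \<open>g\<close> accumulated over \<open>[0, t]\<close> and
    the costate gain at the endpoint nearly cancel; they differ by the transport and discount error
    only.\<close>
  have "B * F \<ge> - (exp (- lam * t) * cv z p t - (LBINT \<tau>:{0<..<t}. g \<tau>))"
  proof -
    have hi: "set_integrable lborel {0<..<t} (\<lambda>\<sigma>. exp (- lam * t) * opB sbar (z \<sigma>) (LV \<mu> (t - \<sigma>) p))"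
      by (rule set_integrable_mult_right) (rule cv_set_integrable[OF z p])
    have "- (exp (- lam * t) * cv z p t - (LBINT \<tau>:{0<..<t}. g \<tau>))
        = (LBINT \<sigma>:{0<..<t}. g \<sigma> - exp (- lam * t) * opB sbar (z \<sigma>) (LV \<mu> (t - \<sigma>) p))"
      unfolding set_integral_diff(2)[OF gi hi] set_integral_mult_right cv_def by simp
    also have "\<dots> \<le> (LBINT \<sigma>:{0<..<t}. B * f \<sigma>)"
    proof (rule set_integral_mono)
      show "set_integrable lborel {0<..<t} (\<lambda>\<sigma>. B * f \<sigma>)" using fi by simp
      show "set_integrable lborel {0<..<t} (\<lambda>\<sigma>. g \<sigma> - exp (- lam * t) * opB sbar (z \<sigma>) (LV \<mu> (t - \<sigma>) p))"
        by (rule set_integral_diff(1)[OF gi hi])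
      fix \<sigma> assume "\<sigma> \<in> {0<..<t}"
      then have \<sigma>: "0 < \<sigma>" "\<sigma> < t" by auto
      have zU: "z \<sigma> \<in> spU sbar" by (rule admissible_spU[OF z \<sigma>(1)])
      define a b where "a = opB sbar (z \<sigma>) (LV \<mu> (t - \<sigma>) p)" and "b = opB sbar (z \<sigma>) p"
      have err: "\<bar>exp (- lam * (t - \<sigma>)) * a - b\<bar> \<le> B * f \<sigma>"
        unfolding a_def b_def B_def fz[OF \<sigma>(1)] using \<sigma> by (intro discounted_LV_error zU p \<omega>) auto
      have "exp (- lam * t) = exp (- lam * \<sigma>) * exp (- lam * (t - \<sigma>))" by (simp add: algebra_simps flip: exp_add)
      then have "g \<sigma> - exp (- lam * t) * a = exp (- lam * \<sigma>) * (b - exp (- lam * (t - \<sigma>)) * a)"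
        by (simp add: g_def b_def right_diff_distrib mult.assoc)
      also have "\<dots> \<le> exp (- lam * \<sigma>) * (B * f \<sigma>)"
      proof (rule mult_left_mono)
        show "b - exp (- lam * (t - \<sigma>)) * a \<le> B * f \<sigma>" using err by linarith
      qed simp
      also have "\<dots> \<le> 1 * (B * f \<sigma>)"
      proof (rule mult_right_mono)
        show "0 \<le> B * f \<sigma>" using err by linarith
      qed (use lam \<sigma> in simp)
      finally show "g \<sigma> - exp (- lam * t) * opB sbar (z \<sigma>) (LV \<mu> (t - \<sigma>) p) \<le> B * f \<sigma>" by (simp add: a_def)
    qed
    finally show ?thesis unfolding set_integral_mult_right F_def .
  qed
  \<comment> \<open>Completing the square pointwise: \<open>c * f^2 - m * f\<close> is at least
    \<open>- m^2 / (4 * c)\<close>, whatever the deviation.\<close>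
  moreover have "- (t * (m\<^sup>2 / (4 * c))) \<le> c * (LBINT \<tau>:{0<..<t}. (f \<tau>)\<^sup>2) - m * F"
  proof -
    have mi: "set_integrable lborel {0<..<t} (\<lambda>\<tau>. m * f \<tau>)" by (rule set_integrable_mult_right) (rule fi)
    have "t * (- (m\<^sup>2 / (4 * c))) = (LBINT \<tau>:{0<..<t}. - (m\<^sup>2 / (4 * c)))" by (rule cI[symmetric])
    also have "\<dots> \<le> (LBINT \<tau>:{0<..<t}. c * (f \<tau>)\<^sup>2 - m * f \<tau>)"
    proof (rule set_integral_mono[OF ci set_integral_diff(1)[OF ints(3) mi]])
      fix \<tau>
      have "0 \<le> (2 * c * f \<tau> - m)\<^sup>2 / (4 * c)" using c by simp
      also have "\<dots> = c * (f \<tau>)\<^sup>2 - m * f \<tau> + m\<^sup>2 / (4 * c)" using c by (simp add: power2_eq_square field_simps)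
      finally show "- (m\<^sup>2 / (4 * c)) \<le> c * (f \<tau>)\<^sup>2 - m * f \<tau>" by simp
    qed
    also have "\<dots> = c * (LBINT \<tau>:{0<..<t}. (f \<tau>)\<^sup>2) - m * F"
      unfolding set_integral_diff(2)[OF ints(3) mi] set_integral_mult_right F_def ..
    finally show ?thesis by simp
  qed
  \<comment> \<open>\<open>m\<close> collects exactly the two errors that are linear in the
    deviation.\<close>
  moreover have "m * F = t * k1 + B * F"
    unfolding m B_def k1_def A_def Q0_def by (simp only: distrib_right mult.assoc)
  ultimately have fin: "l0 * ((1 - exp (- lam * t)) / lam) + exp (- lam * t) * val x - t * (m\<^sup>2 / (4 * c)) \<le>
      (LBINT \<tau>:{0<..<t}. exp (- lam * \<tau>) * (- R (state sbar T x u \<tau> \<alpha>) + h0 sbar \<beta> q (u \<tau>))) + exp (- lam * t) * J y (\<lambda>\<tau>. u (t + \<tau>))"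
    using I Y unfolding distrib_left[of "exp (- lam * t)" "val x"] by linarith
  then show ?thesis
    unfolding J_split[OF u x t0] y_def[symmetric] c_def l0_def Q0_def w_def by (simp only: mult.commute)
qed

text \<open>If the value fell short of the resting cost by \<Gamma>, discounting over
  \<open>[0, t]\<close> would demand a gain of order \<open>t * \<Gamma>\<close>. A deviation gains
  at most \<open>t * m^2 / (4 * c)\<close>, and \<open>m\<close> becomes small with
  \<open>t\<close>. Only the subgradient inequality at \<open>x\<close> is used.\<close>

lemma val_stationary:
  assumes p: "p \<in> spV sbar" and xw: "(x, - opB sbar (wp p)) \<in> genA sbar \<mu> T"
    and sub: "\<And>k. k \<in> spVd sbar \<mu> \<Longrightarrow> val x + k p \<le> val (x + k)"
  shows "(- R (x \<alpha>) + h0 sbar \<beta> q (wp p)) / lam \<le> val x"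
proof (rule ccontr)
  define l0 where "l0 = - R (x \<alpha>) + h0 sbar \<beta> q (wp p)"
  define c where "c = exp (- lam) * \<epsilon>"
  define \<Gamma> where "\<Gamma> = l0 / lam - val x"
  assume "\<not> (- R (x \<alpha>) + h0 sbar \<beta> q (wp p)) / lam \<le> val x"
  then have \<Gamma>: "0 < \<Gamma>" by (simp add: \<Gamma>_def l0_def)
  have c: "0 < c" using eps(1) by (simp add: c_def)
  have K: "0 < KB \<mu>" by (rule KB_pos[OF mu])
  \<comment> \<open>Chosen so that \<open>\<eta>^2 / (4 * c)\<close> is half of
    \<open>lam * exp (- lam) * \<Gamma>\<close>; it then suffices to reach
    \<open>m \<le> \<eta>\<close>.\<close>
  define \<eta> where "\<eta> = sqrt (2 * c * (lam * exp (- lam) * \<Gamma>))"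
  have \<eta>2: "\<eta>\<^sup>2 = 2 * c * (lam * exp (- lam) * \<Gamma>)" and \<eta>: "0 < \<eta>" using c lam \<Gamma> by (simp_all add: \<eta>_def)
  define B where "B = \<bar>D (x \<alpha>)\<bar> * (KB \<mu> * normV sbar \<mu> \<alpha>) + KB \<mu> * (lam * normV sbar \<mu> p)"
  have B: "0 \<le> B" using K lam by (simp add: B_def)
  \<comment> \<open>Half of the budget \<eta> is spent on the transport error, the other half on the
    terms proportional to \<open>t\<close>.\<close>
  define \<omega> where "\<omega> = \<eta> / (2 * KB \<mu>)"
  have \<omega>: "0 < \<omega>" using \<eta> K by (simp add: \<omega>_def)
  obtain d where d: "0 < d" "\<And>a b. 0 \<le> a \<Longrightarrow> 0 \<le> b \<Longrightarrow> \<bar>a - b\<bar> < d \<Longrightarrow> normV sbar \<mu> (\<lambda>s. LV \<mu> a p s - LV \<mu> b p s) < \<omega>"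
    using LV_uniformly_continuous[OF mu S p \<omega>] by blast
  define t where "t = min 1 (min (d / 2) (\<eta> / (2 * (B + 1))))"
  have "0 < \<eta> / (2 * (B + 1))" using \<eta> B by simp
  then have t: "0 < t" "t \<le> 1" "t < d" "t \<le> \<eta> / (2 * (B + 1))" using d(1) unfolding t_def by linarith+
  define m where "m = t * (\<bar>D (x \<alpha>)\<bar> * (KB \<mu> * normV sbar \<mu> \<alpha>)) + KB \<mu> * (\<omega> + lam * t * normV sbar \<mu> p)"
  have om: "normV sbar \<mu> (\<lambda>s. LV \<mu> \<rho> p s - p s) \<le> \<omega>" if "0 \<le> \<rho>" "\<rho> \<le> t" for \<rho>
    using d(2)[of \<rho> 0] that t p by (simp add: LV_0)
  have "m = t * B + KB \<mu> * \<omega>" by (simp add: m_def B_def algebra_simps)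
  also have "KB \<mu> * \<omega> = \<eta> / 2" using K by (simp add: \<omega>_def)
  also have "t * B \<le> \<eta> / (2 * (B + 1)) * B" using t B by (intro mult_right_mono) auto
  also have "\<dots> \<le> \<eta> / 2" using B \<eta> by (simp add: field_simps)
  finally have m\<eta>: "m \<le> \<eta>" by simp
  have m0: "0 \<le> m" using t lam \<omega> K by (simp add: m_def)
  have "(1 - exp (- lam * t)) / lam * l0 + exp (- lam * t) * val x - t * (m\<^sup>2 / (4 * c)) \<le> val x"
    unfolding l0_def c_def
    by (rule val_ge) (rule J_lower_short_time[OF p xw sub t(1,2) om m_def])
  then have "(1 - exp (- lam * t)) * \<Gamma> \<le> t * (m\<^sup>2 / (4 * c))"
    using lam by (simp add: \<Gamma>_def algebra_simps diff_divide_distrib)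
  moreover have "t * (lam * exp (- lam)) \<le> 1 - exp (- lam * t)"
  proof -
    have "1 + lam * t \<le> exp (lam * t)" by (rule exp_ge_add_one_self)
    then have "exp (- lam * t) * (1 + lam * t) \<le> exp (- lam * t) * exp (lam * t)" by (intro mult_left_mono) auto
    then have "exp (- lam * t) * (lam * t) \<le> 1 - exp (- lam * t)" by (simp add: algebra_simps flip: exp_add)
    moreover have "exp (- lam) * (lam * t) \<le> exp (- lam * t) * (lam * t)"
      using lam t by (intro mult_right_mono) (auto intro: mult_left_le)
    ultimately show ?thesis by (simp add: mult_ac)
  qed
  ultimately have "t * (lam * exp (- lam)) * \<Gamma> \<le> t * (m\<^sup>2 / (4 * c))"
    using mult_right_mono[of "t * (lam * exp (- lam))" "1 - exp (- lam * t)" \<Gamma>] \<Gamma> by linarith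
  then have "lam * exp (- lam) * \<Gamma> \<le> m\<^sup>2 / (4 * c)" using t(1) unfolding mult.assoc by (simp only: mult_le_cancel_left_pos)
  also have "\<dots> \<le> \<eta>\<^sup>2 / (4 * c)" using m0 m\<eta> c by (intro divide_right_mono power_mono) auto
  also have "\<dots> = lam * exp (- lam) * \<Gamma> / 2" unfolding \<eta>2 using c by simp
  finally show False using lam \<Gamma> by simp
qed

text \<open>Point evaluations separate the elements of V, which are functions and not
  classes.\<close>

lemma delta_spVd: "(\<lambda>v. if v \<in> spV sbar then v s else 0) \<in> spVd sbar \<mu>"
proof (rule spVdI)
  fix v assume "v \<in> spV sbar"
  then show "\<bar>if v \<in> spV sbar then v s else 0\<bar> \<le> (1 / sqrt (2 * \<mu>)) * normV sbar \<mu> v"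
    using spV_bound[OF mu, of v sbar s] by simp
qed (auto simp: spV_lincomb)

lemma spV_eq_if_spVd_eq:
  assumes p: "p \<in> spV sbar" "p' \<in> spV sbar" and eq: "\<And>k. k \<in> spVd sbar \<mu> \<Longrightarrow> k p = k p'"
  shows "p = p'"
proof
  show "p s = p' s" for s using eq[OF delta_spVd[of s]] p by simp
qed

text \<open>By \<open>val_stationary\<close> the constant control attains the value at
  \<open>x\<close>, so its cost along \<open>x + s *\<^sub>R k\<close> touches the value function
  from above at \<open>s = 0\<close>. Comparing slopes for \<open>k\<close> and for
  \<open>- k\<close> equates the derivatives.\<close>

lemma frechet_stationary_unique:
  assumes p: "p \<in> spV sbar" and xw: "(x, - opB sbar (wp p)) \<in> genA sbar \<mu> T"
    and F: "frechet_deriv_on (spVd sbar \<mu>) (normVd sbar \<mu>) val x (\<lambda>k. k p)"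
  shows "p = pv (x \<alpha>)"
proof (rule spV_eq_if_spVd_eq[OF p pv_spV])
  note x = genA_D(1)[OF mu S T xw]
  note sub = val_subgradient[OF x p F]
  note w = wp_spU[OF p]
  have le: "k p \<le> k (pv (x \<alpha>))" if k: "k \<in> spVd sbar \<mu>" for k
  proof -
    define M where "M = C * (normVd sbar \<mu> k * normV sbar \<mu> \<alpha>)\<^sup>2 / lam"
    have M: "0 \<le> M" using C_nonneg lam by (simp add: M_def)
    \<comment> \<open>Division by \<open>s\<close> leaves the quadratic remainder as
      \<open>s * M\<close>, which vanishes with \<open>s\<close>.\<close>
    have step: "k p \<le> k (pv (x \<alpha>)) + s * M" if s: "0 < s" for s
    proof -
      have sk: "s *\<^sub>R k \<in> spVd sbar \<mu>" by (rule spVd_scaleR[OF k])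
      have "val x + (s *\<^sub>R k) p \<le> val (x + s *\<^sub>R k)" by (rule sub[OF sk])
      also have "\<dots> \<le> J (x + s *\<^sub>R k) (\<lambda>\<tau>. wp p)" by (rule val_le[OF adm_const[OF w] spVd_add[OF x sk]])
      also have "\<dots> \<le> (- R (x \<alpha>) + h0 sbar \<beta> q (wp p)) / lam + (s *\<^sub>R k) (pv (x \<alpha>)) + C * (normVd sbar \<mu> (s *\<^sub>R k) * normV sbar \<mu> \<alpha>)\<^sup>2 / lam"
        by (rule J_const_upper[OF xw w sk])
      also have "(- R (x \<alpha>) + h0 sbar \<beta> q (wp p)) / lam \<le> val x" by (rule val_stationary[OF p xw sub])
      finally have "s * k p \<le> s * k (pv (x \<alpha>)) + C * (normVd sbar \<mu> (s *\<^sub>R k) * normV sbar \<mu> \<alpha>)\<^sup>2 / lam"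
        by (simp add: scaleR_fun_def)
      also have "C * (normVd sbar \<mu> (s *\<^sub>R k) * normV sbar \<mu> \<alpha>)\<^sup>2 / lam \<le> C * (s * normVd sbar \<mu> k * normV sbar \<mu> \<alpha>)\<^sup>2 / lam"
      proof (intro divide_right_mono mult_left_mono power_mono mult_right_mono)
        show "normVd sbar \<mu> (s *\<^sub>R k) \<le> s * normVd sbar \<mu> k"
          using normVd_lincomb_le[OF mu k k, of s 0] s by simp
        show "0 \<le> normVd sbar \<mu> (s *\<^sub>R k) * normV sbar \<mu> \<alpha>" using normVd_nonneg[OF mu sk] by simp
      qed (use C_nonneg lam in auto)
      also have "\<dots> = s * (s * M)" by (simp add: M_def power2_eq_square)
      finally have "s * k p \<le> s * (k (pv (x \<alpha>)) + s * M)" by (simp add: distrib_left)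
      then show ?thesis using s by simp
    qed
    show ?thesis
    proof (rule field_le_epsilon)
      fix e :: real assume e: "0 < e"
      have "k p \<le> k (pv (x \<alpha>)) + e / (M + 1) * M" by (rule step) (use e M in simp)
      also have "e / (M + 1) * M \<le> e" using e M by (simp add: field_simps)
      finally show "k p \<le> k (pv (x \<alpha>)) + e" by simp
    qed
  qed
  fix k assume k: "k \<in> spVd sbar \<mu>"
  have "- k p \<le> - k (pv (x \<alpha>))" using le[OF spVd_scaleR[OF k, of "-1"]] by (simp add: scaleR_fun_def)
  then show "k p = k (pv (x \<alpha>))" using le[OF k] by simp
qed

text \<open>The costate quantified in the definition is forced to be \<open>pv (x \<alpha>)\<close>
  in one direction and shown to be the derivative in the other. What remains is an equation for the
  state alone.\<close>

lemma equilibrium_iff_genA: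
  "equilibrium sbar \<mu> lam T \<beta> q \<alpha> R x \<longleftrightarrow> (x, - opB sbar (wp (pv (x \<alpha>)))) \<in> genA sbar \<mu> T"
proof
  assume "equilibrium sbar \<mu> lam T \<beta> q \<alpha> R x"
  then obtain p w y where p: "p \<in> spV sbar" and w: "w \<in> spU sbar"
    and F: "frechet_deriv_on (spVd sbar \<mu>) (normVd sbar \<mu>) val x (\<lambda>k. k p)"
    and Fw: "frechet_deriv_on (spU sbar) (normU sbar) (h0_conj sbar \<beta> q) (- opB_star p) (innerU sbar w)"
    and xy: "(x, y) \<in> genA sbar \<mu> T" and y: "y + opB sbar w = 0"
    unfolding equilibrium_def by blast
  have "opB sbar w = opB sbar (wp p)"
    unfolding wp_def by (rule h0_conj_frechet_opB[OF eps q uminus_opB_star_spU[OF p] w Fw])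
  then have "y = - opB sbar (wp p)" using y by (simp add: eq_neg_iff_add_eq_0)
  then have xw: "(x, - opB sbar (wp p)) \<in> genA sbar \<mu> T" using xy by simp
  have "p = pv (x \<alpha>)" by (rule frechet_stationary_unique[OF p xw F])
  then show "(x, - opB sbar (wp (pv (x \<alpha>)))) \<in> genA sbar \<mu> T" using xw by simp
next
  assume xw: "(x, - opB sbar (wp (pv (x \<alpha>)))) \<in> genA sbar \<mu> T"
  have "frechet_deriv_on (spU sbar) (normU sbar) (h0_conj sbar \<beta> q) (- opB_star (pv (x \<alpha>))) (innerU sbar (wp (pv (x \<alpha>))))"
    unfolding wp_def by (rule h0_conj_frechet[OF eps q uminus_opB_star_spU[OF pv_spV]])
  then show "equilibrium sbar \<mu> lam T \<beta> q \<alpha> R x"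
    unfolding equilibrium_def using frechet_at_stationary[OF xw] xw pv_spV wp_spU[OF pv_spV]
    by (intro bexI[of _ "pv (x \<alpha>)"] bexI[of _ "wp (pv (x \<alpha>))"] exI[of _ "- opB sbar (wp (pv (x \<alpha>)))"]) auto
qed

end

section \<open>The scalar equation\<close>

lemma LBINT_pos_continuous:
  fixes f :: "real \<Rightarrow> real"
  assumes f: "continuous_on {0..} f" "\<And>s. 0 \<le> s \<Longrightarrow> 0 \<le> f s" and s: "0 < s" "0 < f s"
  shows "0 < (LBINT r:{0<..<s}. f r)"
proof -
  have c: "continuous_on (cbox 0 s) f" by (rule continuous_on_subset[OF f(1)]) auto
  have "set_integrable lborel {0..s} f" using c by (intro borel_integrable_atLeastAtMost') simp
  then have i: "set_integrable lborel {0<..<s} f" by (rule set_integrable_subset) auto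
  have "(LBINT r:{0<..<s}. f r) = integral (cbox 0 s) f"
    using set_borel_integral_eq_integral(2)[OF i] by (simp add: integral_open_interval_real)
  moreover have "integral (cbox 0 s) f \<noteq> 0"
  proof
    assume "integral (cbox 0 s) f = 0"
    then have "\<forall>r\<in>cbox 0 s. f r = 0"
      by (subst integral_cbox_eq_0_iff[symmetric, OF c]) (use s f(2) in auto)
    then show False using s by auto
  qed
  moreover have "0 \<le> integral (cbox 0 s) f"
    by (rule integral_nonneg[OF integrable_continuous[OF c]]) (use f(2) in auto)
  ultimately show ?thesis by simp
qed

context vintage_cost
begin

definition w1 :: funct where "w1 = - A_inv sbar \<mu> T (opB sbar (opM \<beta> (opB_star rv)))"
definition w2 :: funct where "w2 = A_inv sbar \<mu> T (opB sbar (opM \<beta> q))"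

lemma w1_genA: "(w1, - opB sbar (opM \<beta> (opB_star rv))) \<in> genA sbar \<mu> T"
  using genA_lincomb[OF mu S T A_inv_genA[OF mu S T] A_inv_genA[OF mu S T],
      of "opB sbar (opM \<beta> (opB_star rv))" "opB sbar (opM \<beta> (opB_star rv))" "-1" 0]
  by (simp add: w1_def opB_spVd mu opMU opB_star_spU rv_spV)

lemma w2_genA: "(w2, opB sbar (opM \<beta> q)) \<in> genA sbar \<mu> T"
  unfolding w2_def by (intro A_inv_genA[OF mu S T] opB_spVd mu opMU q)

text \<open>The feedback control is affine in the slope \<open>D Q\<close>, so the stationary
  equation is solved by combining the two preimages \<open>w1\<close> and \<open>w2\<close>.\<close>

lemma opB_wp_pv: "- opB sbar (wp (pv Q)) = (- D Q) *\<^sub>R (- opB sbar (opM \<beta> (opB_star rv))) + 1 *\<^sub>R opB sbar (opM \<beta> q)"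
proof -
  have "wp (pv Q) = (- D Q) *\<^sub>R opM \<beta> (opB_star rv) + (- 1) *\<^sub>R opM \<beta> q"
    by (simp add: wp_def opM_def pv_def opB_star_def prod_eq_iff fun_eq_iff scaleR_fun_def diff_divide_distrib)
  then have "opB sbar (wp (pv Q)) = (- D Q) *\<^sub>R opB sbar (opM \<beta> (opB_star rv)) + (- 1) *\<^sub>R opB sbar (opM \<beta> q)"
    using opB_lincomb[OF opMU[OF opB_star_spU[OF rv_spV]] opMU[OF q]] by metis
  then show ?thesis by simp
qed

lemma equilibrium_iff_eq:
  "equilibrium sbar \<mu> lam T \<beta> q \<alpha> R x \<longleftrightarrow> x = w2 + (- D (x \<alpha>)) *\<^sub>R w1"
proof -
  have g: "((- D Q) *\<^sub>R w1 + 1 *\<^sub>R w2, - opB sbar (wp (pv Q))) \<in> genA sbar \<mu> T" for Q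
    unfolding opB_wp_pv by (rule genA_lincomb[OF mu S T w1_genA w2_genA])
  have "(x, - opB sbar (wp (pv (x \<alpha>)))) \<in> genA sbar \<mu> T \<longleftrightarrow> x = (- D (x \<alpha>)) *\<^sub>R w1 + 1 *\<^sub>R w2"
    using genA_unique[OF mu S T _ g] g[of "x \<alpha>"] by metis
  then show ?thesis unfolding equilibrium_iff_genA by (simp add: add.commute)
qed

text \<open>The state depends on \<open>x\<close> only through the number \<open>x \<alpha>\<close>;
  pairing with \<alpha> closes the equation for that number.\<close>

lemma equilibrium_iff_scalar:
  "equilibrium sbar \<mu> lam T \<beta> q \<alpha> R x \<longleftrightarrow> (\<exists>\<eta>. \<eta> = - D (w2 \<alpha> + \<eta> * w1 \<alpha>) \<and> x = w2 + \<eta> *\<^sub>R w1)"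
proof -
  have "(w2 + \<eta> *\<^sub>R w1) \<alpha> = w2 \<alpha> + \<eta> * w1 \<alpha>" for \<eta> by (simp add: scaleR_fun_def)
  then show ?thesis unfolding equilibrium_iff_eq by metis
qed

lemma equilibrium_ex1:
  assumes "\<exists>!\<eta>. \<eta> = - D (w2 \<alpha> + \<eta> * w1 \<alpha>)"
  shows "\<exists>!x. equilibrium sbar \<mu> lam T \<beta> q \<alpha> R x"
proof -
  obtain \<eta> where \<eta>: "\<eta> = - D (w2 \<alpha> + \<eta> * w1 \<alpha>)" "\<And>y. y = - D (w2 \<alpha> + y * w1 \<alpha>) \<Longrightarrow> y = \<eta>" using assms by auto
  show ?thesis
    unfolding equilibrium_iff_scalar by (rule ex1I[of _ "w2 + \<eta> *\<^sub>R w1"]) (use \<eta> in blast)+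
qed

text \<open>\<open>w1 \<alpha>\<close> is the integral over all times of
  \<open>opB sbar u (LV \<mu> \<sigma> \<alpha>)\<close> with
  \<open>u = opM \<beta> (opB_star rv)\<close>. The distributed part is nonnegative. The boundary
  part alone contributes \<open>rv 0 / (2 * fst \<beta>)\<close> times the integral of
  \<open>exp (- \<mu> * s) * \<alpha> s\<close>, which is positive.\<close>

lemma w1_pos:
  assumes \<alpha>0: "\<forall>s\<in>ages sbar. 0 \<le> \<alpha> s" "\<exists>s\<in>ages sbar. 0 < \<alpha> s"
  shows "0 < w1 \<alpha>"
proof -
  obtain s0 where s0: "s0 \<in> ages sbar" "0 < \<alpha> s0" using \<alpha>0(2) by blast
  then have s0_pos: "0 < s0" by (simp add: ages_def)
  define f where "f = (\<lambda>s. exp (- \<mu> * s) * \<alpha> s)"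
  have delta: "delta0 sbar (LV \<mu> s \<alpha>) = f s" if "0 \<le> s" for s
    using LV_spV[OF mu \<alpha> that] that by (simp add: delta0_def LV_def f_def)
  have fc: "continuous_on {0..} f"
    using spVd_LV_continuous[OF mu S delta0_spVd[OF mu, of sbar] \<alpha>]
    by (subst continuous_on_cong[OF refl, of _ _ "\<lambda>s. delta0 sbar (LV \<mu> s \<alpha>)"]) (simp_all add: delta)
  have \<alpha>_ages: "0 \<le> \<alpha> s" if "0 < s" for s
    using \<alpha>0(1) spV_outside[OF \<alpha>, of s] that by (cases "ereal s < sbar") (auto simp: ages_def)
  \<comment> \<open>0 is not an age, so nonnegativity there is obtained by continuity.\<close>
  have f0: "0 \<le> f s" if "0 \<le> s" for s
  proof (rule continuous_ge_on_closure[where S = "{0<..}" and f = f])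
    show "continuous_on (closure {0<..}) f" using fc by simp
    show "s \<in> closure {0<..}" using that by simp
    show "0 \<le> f s" if "s \<in> {0<..}" for s using that by (simp add: f_def \<alpha>_ages)
  qed
  have \<alpha>_nonneg: "0 \<le> \<alpha> s" if "0 \<le> s" for s using f0[OF that] by (simp add: f_def zero_le_mult_iff)
  have rv: "rv s = (LBINT r. ekern (lam + \<mu>) s r * zx sbar \<alpha> r)" if "0 \<le> s" for s
    using that unfolding rv_def resolvent_star_bres[OF mu lam \<alpha>] by (simp add: bres_def)
  have z0: "0 \<le> zx sbar \<alpha> r" for r using \<alpha>0(1) by (simp add: zx_def indicator_def)
  have rv_nonneg: "0 \<le> rv s" if "0 \<le> s" for s
    unfolding rv[OF that] by (rule Bochner_Integration.integral_nonneg) (simp add: z0)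
  \<comment> \<open>\<open>rv 0\<close> is a discounted integral of \<alpha> over all ages; by
    continuity, positivity at the single age \<open>s0\<close> makes it positive.\<close>
  have rv0: "0 < rv 0"
  proof -
    define h where "h = (\<lambda>r. exp (- lam * r) * f r)"
    have hc: "continuous_on {0..} h" unfolding h_def by (intro continuous_intros fc)
    have "0 < (LBINT r:{0<..<s0}. h r)"
      using s0 by (intro LBINT_pos_continuous hc s0_pos) (simp_all add: h_def f0, simp add: f_def)
    also have "\<dots> \<le> (LBINT r. ekern (lam + \<mu>) 0 r * zx sbar \<alpha> r)"
      unfolding set_lebesgue_integral_def
    proof (rule integral_mono)
      show "integrable lborel (\<lambda>r. ekern (lam + \<mu>) 0 r * zx sbar \<alpha> r)"
        using mu lam by (intro ekern_zx_integrable spV_spH \<alpha>) simp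
      have "set_integrable lborel {0..s0} h"
        by (intro borel_integrable_atLeastAtMost' continuous_on_subset[OF hc]) auto
      then have "set_integrable lborel {0<..<s0} h" by (rule set_integrable_subset) auto
      then show "integrable lborel (\<lambda>r. indicator {0<..<s0} r *\<^sub>R h r)" by (simp add: set_integrable_def)
      fix r :: real
      show "indicator {0<..<s0} r *\<^sub>R h r \<le> ekern (lam + \<mu>) 0 r * zx sbar \<alpha> r"
      proof (cases "r \<in> {0<..<s0}")
        case True
        then have "ereal r < sbar" using s0(1) by (auto simp: ages_def intro: less_trans[of "ereal r" "ereal s0"])
        then have "r \<in> ages sbar" using True by (simp add: ages_def)
        then show ?thesis using True by (simp add: h_def f_def ekern_def zx_def algebra_simps flip: exp_add mult.assoc)
      qed (simp add: z0)
    qed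
    also have "\<dots> = rv 0" by (simp add: rv)
    finally show ?thesis .
  qed
  define u where "u = opM \<beta> (opB_star rv)"
  have uU: "u \<in> spU sbar" unfolding u_def by (intro opMU opB_star_spU rv_spV)
  define k where "k = fst u"
  have k: "0 < k" using rv0 eps(1,2) by (simp add: k_def u_def opM_def opB_star_def)
  have low: "k * f \<sigma> \<le> opB sbar u (LV \<mu> \<sigma> \<alpha>)" if \<sigma>: "0 \<le> \<sigma>" for \<sigma>
  proof -
    have "0 \<le> innerH sbar (snd u) (LV \<mu> \<sigma> \<alpha>)"
      unfolding innerH_def
    proof (rule integral_nonneg_AE)
      have "AE s in ageM sbar. s \<in> ages sbar" by (rule AE_I2) (simp add: ageM_def space_restrict_space)
      then show "AE s in ageM sbar. 0 \<le> snd u s * LV \<mu> \<sigma> \<alpha> s"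
        using eps(3)
      proof eventually_elim
        case (elim s)
        then have "0 \<le> s" "0 < snd \<beta> s" using eps(1) by (auto simp: ages_def)
        then show ?case using \<sigma> by (simp add: u_def opM_def opB_star_def LV_def \<alpha>_nonneg rv_nonneg)
      qed
    qed
    then show ?thesis
      using LV_spV[OF mu \<alpha> \<sigma>] delta[OF \<sigma>] by (simp add: opB_def emb_def scaleR_fun_def k_def)
  qed
  define G where "G = (LBINT r:{0<..<s0}. f r)"
  have G: "0 < G" unfolding G_def by (rule LBINT_pos_continuous[OF fc f0 s0_pos]) (use s0 in \<open>simp_all add: f_def\<close>)
  have fi: "set_integrable lborel {0<..<t} f" for t
  proof -
    have "set_integrable lborel {0..t} f"
      by (intro borel_integrable_atLeastAtMost' continuous_on_subset[OF fc]) auto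
    then show ?thesis by (rule set_integrable_subset) auto
  qed
  note w = genA_D(1)[OF mu S T w1_genA]
  \<comment> \<open>The bound does not depend on \<open>t\<close>, so it survives the limit in which
    \<open>w1 (LV \<mu> t \<alpha>)\<close> vanishes.\<close>
  have w1t: "k * G \<le> w1 \<alpha> - w1 (LV \<mu> t \<alpha>)" if t: "s0 \<le> t" for t
  proof -
    have "G \<le> (LBINT \<sigma>:{0<..<t}. f \<sigma>)"
      unfolding G_def set_lebesgue_integral_def
      by (rule integral_mono[OF fi[unfolded set_integrable_def] fi[unfolded set_integrable_def]])
        (use t f0 in \<open>auto simp: indicator_def\<close>)
    then have "k * G \<le> (LBINT \<sigma>:{0<..<t}. k * f \<sigma>)" using k by simp
    also have "\<dots> \<le> (LBINT \<sigma>:{0<..<t}. opB sbar u (LV \<mu> \<sigma> \<alpha>))"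
      by (rule set_integral_mono[OF set_integrable_mult_right[OF fi] spVd_LV_set_integrable[OF mu S T opB_spVd[OF mu uU] \<alpha>]]) (simp add: low)
    also have "\<dots> = w1 \<alpha> - w1 (LV \<mu> t \<alpha>)"
      using genA_integral[OF mu S T w1_genA \<alpha>, of t] t s0_pos
      by (simp add: u_def set_lebesgue_integral_def)
    finally show ?thesis .
  qed
  have lim: "((\<lambda>t. w1 (LV \<mu> t \<alpha>)) \<longlongrightarrow> 0) at_top"
  proof (rule Lim_null_comparison)
    show "\<forall>\<^sub>F t in at_top. norm (w1 (LV \<mu> t \<alpha>)) \<le> normVd sbar \<mu> w1 * normV sbar \<mu> \<alpha> * exp (- \<mu> * t)"
      using eventually_ge_at_top[of "0::real"]
    proof eventually_elim
      case (elim t)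
      have "\<bar>w1 (LV \<mu> t \<alpha>)\<bar> \<le> normVd sbar \<mu> w1 * normV sbar \<mu> (LV \<mu> t \<alpha>)"
        by (rule spVd_bound[OF mu w LV_spV[OF mu \<alpha> elim]])
      also have "\<dots> \<le> normVd sbar \<mu> w1 * (exp (- \<mu> * t) * normV sbar \<mu> \<alpha>)"
        by (intro mult_left_mono LV_normV mu \<alpha> elim normVd_nonneg w)
      finally show ?case by (simp add: mult_ac)
    qed
    have "((\<lambda>t. exp (- \<mu> * t)) \<longlongrightarrow> 0) at_top" using mu by real_asymp
    then show "((\<lambda>t. normVd sbar \<mu> w1 * normV sbar \<mu> \<alpha> * exp (- \<mu> * t)) \<longlongrightarrow> 0) at_top"
      by (rule tendsto_mult_right_zero)
  qed
  have "k * G \<le> w1 \<alpha> - 0"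
  proof (rule tendsto_lowerbound)
    show "((\<lambda>t. w1 \<alpha> - w1 (LV \<mu> t \<alpha>)) \<longlongrightarrow> w1 \<alpha> - 0) at_top" by (intro tendsto_intros lim)
    show "\<forall>\<^sub>F t in at_top. k * G \<le> w1 \<alpha> - w1 (LV \<mu> t \<alpha>)"
      using eventually_ge_at_top[of s0] by eventually_elim (rule w1t)
  qed simp
  then show ?thesis using mult_pos_pos[OF k G] by linarith
qed

end

text \<open>One mean value point between \<open>P\<close> and \<open>Q\<close> serves both bounds:
  monotonicity of \<open>D\<close> gives the supporting line, and together with the Lipschitz bound
  the parabola.\<close>

lemma convex_smooth_if_deriv_Lipschitz:
  fixes g D :: "real \<Rightarrow> real"
  assumes der: "\<And>x. (g has_real_derivative D x) (at x)"
    and mono: "\<And>x y. x \<le> y \<Longrightarrow> D x \<le> D y" and lip: "\<And>x y. x \<le> y \<Longrightarrow> D y - D x \<le> C * (y - x)"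
  shows "g Q + D Q * (P - Q) \<le> g P" "g P \<le> g Q + D Q * (P - Q) + C * (P - Q)\<^sup>2"
proof -
  have "g Q + D Q * (P - Q) \<le> g P \<and> g P \<le> g Q + D Q * (P - Q) + C * (P - Q)\<^sup>2"
  proof (cases P Q rule: linorder_cases)
    case less
    obtain z where z: "P < z" "z < Q" "g Q - g P = (Q - P) * D z" using MVT2[OF less der] by blast
    have "(Q - P) * D z \<le> (Q - P) * D Q" using mono[of z Q] less z by (intro mult_left_mono) auto
    moreover have "(Q - P) * (D Q - D P) \<le> (Q - P) * (C * (Q - P))"
      using lip[of P Q] less by (intro mult_left_mono) auto
    moreover have "(Q - P) * D P \<le> (Q - P) * D z" using mono[of P z] less z by (intro mult_left_mono) auto
    ultimately show ?thesis using z(3) by (simp add: power2_eq_square algebra_simps)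
  next
    case greater
    obtain z where z: "Q < z" "z < P" "g P - g Q = (P - Q) * D z" using MVT2[OF greater der] by blast
    have "(P - Q) * D z \<le> (P - Q) * D P" using mono[of z P] greater z by (intro mult_left_mono) auto
    moreover have "(P - Q) * (D P - D Q) \<le> (P - Q) * (C * (P - Q))"
      using lip[of Q P] greater by (intro mult_left_mono) auto
    moreover have "(P - Q) * D Q \<le> (P - Q) * D z" using mono[of Q z] greater z by (intro mult_left_mono) auto
    ultimately show ?thesis using z(3) by (simp add: power2_eq_square algebra_simps)
  qed simp
  then show "g Q + D Q * (P - Q) \<le> g P" "g P \<le> g Q + D Q * (P - Q) + C * (P - Q)\<^sup>2" by auto
qed

text \<open>The common form of the derivatives of both revenues: \<open>k = 1\<close>,
  \<open>\<theta> = 1\<close> in (ii) and \<open>k = \<gamma>\<close>,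
  \<open>\<theta> = 1 - \<gamma>\<close> in (iii). The positive part makes it constant on the linear
  branch.\<close>

definition marginal_revenue :: "real \<Rightarrow> real \<Rightarrow> real \<Rightarrow> real" where
  "marginal_revenue k \<theta> Q = k * (1 + max 0 Q) powr (- \<theta>)"

lemma marginal_revenue_continuous: "continuous_on UNIV (marginal_revenue k \<theta>)"
  unfolding marginal_revenue_def[abs_def] by (intro continuous_intros) (auto simp: add_eq_0_iff max_def)

lemma marginal_revenue_antimono: "0 \<le> k \<Longrightarrow> 0 \<le> \<theta> \<Longrightarrow> x \<le> y \<Longrightarrow> marginal_revenue k \<theta> y \<le> marginal_revenue k \<theta> x"
  unfolding marginal_revenue_def by (intro mult_left_mono powr_mono2') auto

lemma marginal_revenue_le: "0 \<le> k \<Longrightarrow> 0 \<le> \<theta> \<Longrightarrow> marginal_revenue k \<theta> x \<le> k"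
  unfolding marginal_revenue_def using mult_left_mono[OF powr_mono2'[of "- \<theta>" 1 "1 + max 0 x"], of k] by simp

lemma marginal_revenue_pos: "0 < k \<Longrightarrow> 0 < marginal_revenue k \<theta> x"
  by (simp add: marginal_revenue_def add_pos_nonneg)

text \<open>Only positive parts matter, and on the half-line from 0 the power has slope at most
  \<theta> in absolute value.\<close>

lemma marginal_revenue_Lipschitz:
  assumes k: "0 \<le> k" "0 \<le> \<theta>" and xy: "x \<le> y"
  shows "marginal_revenue k \<theta> x - marginal_revenue k \<theta> y \<le> k * \<theta> * (y - x)"
proof (cases "max 0 x = max 0 y")
  case True
  then show ?thesis using k xy by (simp add: marginal_revenue_def)
next
  case False
  define a b where "a = max 0 x" and "b = max 0 y"
  have ab: "0 \<le> a" "a < b" "b - a \<le> y - x" using False xy by (auto simp: a_def b_def)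
  have "((\<lambda>t. (1 + t) powr (- \<theta>)) has_real_derivative - \<theta> * (1 + t) powr (- \<theta> - 1)) (at t)" if "a \<le> t" for t
    using that ab by (auto intro!: derivative_eq_intros)
  then obtain z where z: "a < z" "(1 + b) powr (- \<theta>) - (1 + a) powr (- \<theta>) = (b - a) * (- \<theta> * (1 + z) powr (- \<theta> - 1))"
    using MVT2[OF ab(2), of "\<lambda>t. (1 + t) powr (- \<theta>)" "\<lambda>t. - \<theta> * (1 + t) powr (- \<theta> - 1)"] by blast
  have "(1 + z) powr (- \<theta> - 1) \<le> 1"
    using powr_mono2'[of "- \<theta> - 1" 1 "1 + z"] z(1) ab k by simp
  then have "(b - a) * (\<theta> * (1 + z) powr (- \<theta> - 1)) \<le> (y - x) * (\<theta> * 1)"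
    using ab k by (intro mult_mono mult_left_mono) auto
  then have "(1 + a) powr (- \<theta>) - (1 + b) powr (- \<theta>) \<le> (y - x) * \<theta>" using z(2) by simp
  then have "k * ((1 + a) powr (- \<theta>) - (1 + b) powr (- \<theta>)) \<le> k * ((y - x) * \<theta>)" by (rule mult_left_mono) (rule k)
  then show ?thesis by (simp add: marginal_revenue_def a_def b_def right_diff_distrib mult_ac)
qed

text \<open>The two branches meet at 0 with the common slope \<open>k\<close>, so the derivative
  there is assembled from one-sided limits.\<close>

lemma revenue_deriv:
  assumes F: "\<And>x. 0 \<le> x \<Longrightarrow> (F has_real_derivative k * (1 + x) powr (- \<theta>)) (at x)" and F0: "F 0 = 0"
  shows "((\<lambda>Q. if Q \<ge> 0 then F Q else k * Q) has_real_derivative marginal_revenue k \<theta> Q) (at Q)"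
proof (cases Q "0::real" rule: linorder_cases)
  case less
  have "((\<lambda>Q. k * Q) has_real_derivative k) (at Q)" by (auto intro!: derivative_eq_intros)
  then have "((\<lambda>Q. if Q \<ge> 0 then F Q else k * Q) has_real_derivative k) (at Q)"
    by (rule has_field_derivative_transform_within_open[of _ _ _ "{..<0}"]) (use less in auto)
  then show ?thesis using less by (simp add: marginal_revenue_def)
next
  case greater
  have "(F has_real_derivative k * (1 + Q) powr (- \<theta>)) (at Q)" by (rule F) (use greater in simp)
  then have "((\<lambda>Q. if Q \<ge> 0 then F Q else k * Q) has_real_derivative k * (1 + Q) powr (- \<theta>)) (at Q)"
    by (rule has_field_derivative_transform_within_open[of _ _ _ "{0<..}"]) (use greater in auto)
  then show ?thesis using greater by (simp add: marginal_revenue_def)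
next
  case equal
  have 1: "((\<lambda>y. (F y - F 0) / (y - 0)) \<longlongrightarrow> k) (at_right 0)"
    using has_field_derivative_at_within[OF F[of 0], of "{0<..}"] by (simp add: has_field_derivative_iff)
  have "((\<lambda>y. ((if y \<ge> 0 then F y else k * y) - 0) / (y - 0)) \<longlongrightarrow> k) (at 0)"
  proof (rule filterlim_split_at_real)
    show "((\<lambda>y. ((if y \<ge> 0 then F y else k * y) - 0) / (y - 0)) \<longlongrightarrow> k) (at_right 0)"
      by (rule Lim_transform_eventually[OF 1]) (auto simp: eventually_at_filter F0)
    show "((\<lambda>y. ((if y \<ge> 0 then F y else k * y) - 0) / (y - 0)) \<longlongrightarrow> k) (at_left 0)"
      by (rule Lim_transform_eventually[OF tendsto_const[of k]]) (auto simp: eventually_at_filter)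
  qed
  then show ?thesis unfolding equal has_field_derivative_iff by (simp add: F0 marginal_revenue_def)
qed

lemma log_revenue_deriv:
  "((\<lambda>Q. if Q \<ge> 0 then ln (1 + Q) else Q) has_real_derivative marginal_revenue 1 1 Q) (at Q)"
proof -
  have "((\<lambda>Q. ln (1 + Q)) has_real_derivative 1 * (1 + x) powr - 1) (at x)" if "0 \<le> x" for x :: real
    using that by (auto intro!: derivative_eq_intros simp: powr_minus divide_inverse)
  from revenue_deriv[of "\<lambda>Q. ln (1 + Q)" 1 1, OF this] show ?thesis by (simp cong: if_cong)
qed

lemma power_revenue_deriv:
  "((\<lambda>Q. if Q \<ge> 0 then (1 + Q) powr \<gamma> - 1 else \<gamma> * Q) has_real_derivative marginal_revenue \<gamma> (1 - \<gamma>) Q) (at Q)"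
  by (rule revenue_deriv) (auto intro!: derivative_eq_intros)

text \<open>The identity minus an antitone continuous function is strictly increasing, and the
  values of \<open>marginal_revenue\<close>, lying between 0 and \<open>k\<close>, place its zero in
  \<open>[0, k]\<close>.\<close>

lemma marginal_revenue_fixed_point_ex1:
  assumes k: "0 < k" "0 \<le> \<theta>" and c1: "0 < c1"
  shows "\<exists>!\<eta>. \<eta> = marginal_revenue k \<theta> (c2 + \<eta> * c1)"
proof -
  have mono: "marginal_revenue k \<theta> (c2 + y * c1) \<le> marginal_revenue k \<theta> (c2 + x * c1)" if "x \<le> y" for x y
    using k c1 that by (intro marginal_revenue_antimono) auto
  have "\<exists>x\<ge>0. x \<le> k \<and> x - marginal_revenue k \<theta> (c2 + x * c1) = 0"
  proof (rule IVT')
    show "0 - marginal_revenue k \<theta> (c2 + 0 * c1) \<le> 0" "0 \<le> k - marginal_revenue k \<theta> (c2 + k * c1)"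
      using marginal_revenue_pos[of k \<theta>] marginal_revenue_le[of k \<theta>] k by (auto simp: less_imp_le)
    show "continuous_on {0..k} (\<lambda>x. x - marginal_revenue k \<theta> (c2 + x * c1))"
      by (intro continuous_intros continuous_on_compose2[OF marginal_revenue_continuous]) auto
  qed (use k in simp)
  then obtain x where x: "x = marginal_revenue k \<theta> (c2 + x * c1)" by auto
  show ?thesis
  proof (rule ex1I)
    show "x = marginal_revenue k \<theta> (c2 + x * c1)" by (rule x)
    fix y assume y: "y = marginal_revenue k \<theta> (c2 + y * c1)"
    show "y = x" using mono[of x y] mono[of y x] x y by linarith
  qed
qed

text \<open>On the branch \<open>Q \<ge> 0\<close> the equation is the quadratic
  \<open>c1 * \<eta>^2 + (1 + c2) * \<eta> = 1\<close>, and the formula is its positive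
  root.\<close>

lemma log_fixed_point:
  assumes c1: "0 < c1" and c: "0 \<le> c1 + c2" and \<eta>_eq: "\<eta> = (sqrt ((1 + c2)\<^sup>2 + 4 * c1) - (1 + c2)) / (2 * c1)"
  shows "\<eta> = marginal_revenue 1 1 (c2 + \<eta> * c1)"
proof -
  define r where "r = sqrt ((1 + c2)\<^sup>2 + 4 * c1)"
  have r2: "r\<^sup>2 = (1 + c2)\<^sup>2 + 4 * c1" using c1 by (simp add: r_def)
  have "\<bar>1 + c2\<bar> < r" unfolding r_def using c1 by (intro real_less_rsqrt) simp
  then have \<eta>: "0 < \<eta>" using c1 by (simp add: \<eta>_eq flip: r_def)
  have "r = 2 * c1 * \<eta> + (1 + c2)" using c1 by (simp add: \<eta>_eq flip: r_def)
  then have "(2 * c1 * \<eta> + (1 + c2))\<^sup>2 = (1 + c2)\<^sup>2 + 4 * c1" using r2 by simp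
  then have "4 * c1 * (\<eta> * (1 + (c2 + \<eta> * c1))) = 4 * c1 * 1" by (simp add: power2_eq_square algebra_simps)
  then have e: "\<eta> * (1 + (c2 + \<eta> * c1)) = 1" using c1 by simp
  \<comment> \<open>A negative argument would push \<eta> above 1, and then
    \<open>c2 + \<eta> * c1\<close> would exceed \<open>c2 + c1 \<ge> 0\<close>.\<close>
  have "0 \<le> c2 + \<eta> * c1"
  proof (rule ccontr)
    assume n: "\<not> 0 \<le> c2 + \<eta> * c1"
    then have "\<eta> * (1 + (c2 + \<eta> * c1)) < \<eta> * 1" using \<eta> by (intro mult_strict_left_mono) auto
    then have "1 * c1 < \<eta> * c1" using e c1 by simp
    then show False using n c by linarith
  qed
  then show ?thesis using e by (simp add: marginal_revenue_def powr_minus field_simps)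
qed

text \<open>The condition on the base restricts to arguments where \<open>powr\<close> is the usual
  real power.\<close>

definition power_eta :: "real \<Rightarrow> real \<Rightarrow> real \<Rightarrow> real \<Rightarrow> bool" where
  "power_eta c1 c2 \<gamma> \<eta> \<longleftrightarrow> 0 < \<eta> \<and> 0 < 1 + c1 * \<eta> + c2 \<and> \<eta> = \<gamma> / (1 + c1 * \<eta> + c2) powr (1 - \<gamma>)"

text \<open>With the denominator cleared, the left side is strictly increasing where the base is
  positive; it vanishes at \<open>a\<close> and is at least 1, hence above \<gamma>, at
  \<open>b\<close>.\<close>

lemma power_eta_ex1:
  assumes c1: "0 < c1" and \<gamma>: "0 < \<gamma>" "\<gamma> < 1"
  shows "\<exists>!\<eta>. power_eta c1 c2 \<gamma> \<eta>"
proof -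
  define \<phi> where "\<phi> = (\<lambda>\<eta>. \<eta> * (1 + c1 * \<eta> + c2) powr (1 - \<gamma>))"
  have Sol: "power_eta c1 c2 \<gamma> \<eta> \<longleftrightarrow> 0 < \<eta> \<and> 0 < 1 + c1 * \<eta> + c2 \<and> \<phi> \<eta> = \<gamma>" for \<eta>
    unfolding power_eta_def \<phi>_def by (auto simp: field_simps)
  have mono: "\<phi> x < \<phi> y" if "0 < x" "0 < 1 + c1 * x + c2" "x < y" for x y
  proof -
    have "c1 * x < c1 * y" using that c1 by simp
    then have "(1 + c1 * x + c2) powr (1 - \<gamma>) < (1 + c1 * y + c2) powr (1 - \<gamma>)"
      using that \<gamma> by (intro powr_less_mono2) auto
    then show ?thesis unfolding \<phi>_def using that by (intro mult_strict_mono) auto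
  qed
  \<comment> \<open>The left end of the region where the unknown and the base are both nonnegative;
    one of them vanishes there.\<close>
  define a where "a = max 0 (- (1 + c2) / c1)"
  \<comment> \<open>Large enough for the unknown and the base to be at least 1.\<close>
  define b where "b = 1 + a + 1 / c1"
  have a: "0 \<le> a" "0 \<le> 1 + c1 * a + c2" using c1 by (auto simp: a_def max_def field_simps)
  have "\<phi> a = 0"
  proof (cases "a = 0")
    case False
    then have "a = - (1 + c2) / c1" by (auto simp: a_def max_def split: if_splits)
    then show ?thesis using c1 by (simp add: \<phi>_def)
  qed (simp add: \<phi>_def)
  moreover have "1 * 1 \<le> \<phi> b"
    unfolding \<phi>_def
  proof (rule mult_mono)
    show "1 \<le> b" using a c1 by (simp add: b_def)
    have "1 \<le> 1 + c1 * b + c2" using a c1 by (simp add: b_def algebra_simps)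
    then show "1 \<le> (1 + c1 * b + c2) powr (1 - \<gamma>)" using \<gamma> by (intro ge_one_powr_ge_zero) auto
    show "0 \<le> b" using a c1 by (simp add: b_def)
  qed simp
  moreover have "continuous_on {a..b} \<phi>"
    unfolding \<phi>_def
  proof (intro continuous_on_mult continuous_on_powr' continuous_intros ballI)
    fix x assume "x \<in> {a..b}"
    then have "c1 * a \<le> c1 * x" using c1 by simp
    then show "0 \<le> 1 + c1 * x + c2 \<and> (1 + c1 * x + c2 = 0 \<longrightarrow> 0 < 1 - \<gamma>)" using a \<gamma> by auto
  qed
  moreover have "a \<le> b" using c1 by (simp add: b_def)
  ultimately have "\<exists>x\<ge>a. x \<le> b \<and> \<phi> x = \<gamma>" using \<gamma> by (intro IVT') auto
  then obtain x where x: "a \<le> x" "\<phi> x = \<gamma>" by blast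
  have "c1 * a \<le> c1 * x" using c1 x by simp
  moreover have "x \<noteq> 0" "1 + c1 * x + c2 \<noteq> 0" using x(2) \<gamma> by (auto simp: \<phi>_def)
  ultimately have x_Sol: "0 < x" "0 < 1 + c1 * x + c2" using x(1) a by auto
  show ?thesis
  proof (rule ex1I)
    show "power_eta c1 c2 \<gamma> x" using x_Sol x(2) by (simp add: Sol)
    fix y assume y: "power_eta c1 c2 \<gamma> y"
    show "y = x" using mono[of x y] mono[of y x] x(2) x_Sol y unfolding Sol by (cases x y rule: linorder_cases) auto
  qed
qed

text \<open>As for the logarithm: a negative argument would make the base smaller than 1 and \<eta>
  larger than \<gamma>, against the sign condition.\<close>

lemma power_eta_fixed_point:
  assumes c1: "0 < c1" and \<gamma>: "0 < \<gamma>" "\<gamma> < 1" and c: "0 \<le> \<gamma> * c1 + c2" and \<eta>: "power_eta c1 c2 \<gamma> \<eta>"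
  shows "\<eta> = marginal_revenue \<gamma> (1 - \<gamma>) (c2 + \<eta> * c1)"
proof -
  define b where "b = 1 + c1 * \<eta> + c2"
  have b: "0 < b" "\<eta> = \<gamma> / b powr (1 - \<gamma>)" using \<eta> by (auto simp: power_eta_def b_def)
  have "0 \<le> c2 + \<eta> * c1"
  proof (rule ccontr)
    assume n: "\<not> 0 \<le> c2 + \<eta> * c1"
    then have "b powr (1 - \<gamma>) < 1 powr (1 - \<gamma>)"
      using b(1) \<gamma> by (intro powr_less_mono2) (auto simp: b_def mult.commute)
    then have "\<gamma> * b powr (1 - \<gamma>) < \<gamma> * 1" using \<gamma> by (intro mult_strict_left_mono) auto
    then have "\<gamma> < \<eta>" using b by (simp add: pos_less_divide_eq)
    then have "\<gamma> * c1 < \<eta> * c1" using c1 by simp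
    then show False using n c by linarith
  qed
  then have "1 + max 0 (c2 + \<eta> * c1) = b" by (simp add: b_def mult.commute)
  then show ?thesis using b(2) by (simp only: marginal_revenue_def powr_minus divide_inverse)
qed

section \<open>The three revenue functions\<close>

theorem lemma5p3:
  fixes sbar :: ereal and \<mu> lam \<epsilon> c1 c2 :: real
    and S :: "real \<Rightarrow> fn \<Rightarrow> fn" and T :: "real \<Rightarrow> funct \<Rightarrow> funct"
    and \<alpha> :: fn and \<beta> q :: ctrl and w1 w2 :: funct
  assumes "0 < sbar" and "0 < \<mu>" and "0 < lam"
    and S: "generates_A0 sbar \<mu> S"
    and T: "extends_to_Vd sbar \<mu> S T"
    and \<alpha>: "\<alpha> \<in> spV sbar" "\<forall>s\<in>ages sbar. 0 \<le> \<alpha> s" "\<exists>s\<in>ages sbar. 0 < \<alpha> s"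
    and \<beta>: "0 < \<epsilon>" "\<epsilon> \<le> fst \<beta>" "AE s in ageM sbar. \<epsilon> \<le> snd \<beta> s"
      "snd \<beta> \<in> borel_measurable (ageM sbar)" "\<exists>C. AE s in ageM sbar. \<bar>snd \<beta> s\<bar> \<le> C"
    and q: "q \<in> spU sbar"
    and w1: "w1 = - A_inv sbar \<mu> T (opB sbar (opM \<beta> (opB_star (resolvent_star sbar \<mu> lam \<alpha>))))"
    and w2: "w2 = A_inv sbar \<mu> T (opB sbar (opM \<beta> q))"
    and c1: "c1 = w1 \<alpha>" and c2: "c2 = w2 \<alpha>"
  shows
    "(\<forall>a b. a \<ge> 0 \<longrightarrow>
       (let Eq = equilibrium sbar \<mu> lam T \<beta> q \<alpha> (\<lambda>Q. - a * Q\<^sup>2 + b * Q)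
        in (\<exists>!x. Eq x) \<and> Eq (w2 - ((2 * a * c2 - b) / (1 + 2 * a * c1)) *\<^sub>R w1))) \<and>
     (let Eq = equilibrium sbar \<mu> lam T \<beta> q \<alpha> (\<lambda>Q. if Q \<ge> 0 then ln (1 + Q) else Q)
      in (\<exists>!x. Eq x) \<and>
         (c1 + c2 \<ge> 0 \<longrightarrow>
            Eq (w2 + ((sqrt ((1 + c2)\<^sup>2 + 4 * c1) - (1 + c2)) / (2 * c1)) *\<^sub>R w1))) \<and>
     (\<forall>\<gamma>. 0 < \<gamma> \<and> \<gamma> < 1 \<longrightarrow>
       (let Eq = equilibrium sbar \<mu> lam T \<beta> q \<alpha>
                   (\<lambda>Q. if Q \<ge> 0 then (1 + Q) powr \<gamma> - 1 else \<gamma> * Q);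
            Sol = (\<lambda>\<eta>. 0 < \<eta> \<and> 0 < 1 + c1 * \<eta> + c2 \<and>
                       \<eta> = \<gamma> / (1 + c1 * \<eta> + c2) powr (1 - \<gamma>))
        in (\<exists>!x. Eq x) \<and> (\<exists>!\<eta>. Sol \<eta>) \<and>
           (\<gamma> * c1 + c2 \<ge> 0 \<longrightarrow> (\<forall>\<eta>. Sol \<eta> \<longrightarrow> Eq (w2 + \<eta> *\<^sub>R w1)))))"
proof -
  have vc: "vintage_cost sbar \<mu> lam \<epsilon> S T \<beta> q \<alpha> R D C"
    if "\<And>P Q. - R Q + D Q * (P - Q) \<le> - R P" "\<And>P Q. - R P \<le> - R Q + D Q * (P - Q) + C * (P - Q)\<^sup>2"
      "0 \<le> C" "continuous_on UNIV R" for R D :: "real \<Rightarrow> real" and C :: real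
    by unfold_locales (rule assms(2,3) S T \<alpha>(1) \<beta> q that)+
  \<comment> \<open>The functionals \<open>w1\<close> and \<open>w2\<close> of the locale do not
    involve the revenue, so they are the same in all three cases.\<close>
  have w: "vintage_cost.w1 sbar \<mu> lam T \<beta> \<alpha> = w1 \<and> vintage_cost.w2 sbar \<mu> T \<beta> q = w2"
    if "vintage_cost sbar \<mu> lam \<epsilon> S T \<beta> q \<alpha> R D C" for R D C
    unfolding vintage_cost.w1_def[OF that] vintage_cost.rv_def[OF that] vintage_cost.w2_def[OF that] w1 w2 by simp
  have iff: "equilibrium sbar \<mu> lam T \<beta> q \<alpha> R x \<longleftrightarrow> (\<exists>\<eta>. \<eta> = - D (c2 + \<eta> * c1) \<and> x = w2 + \<eta> *\<^sub>R w1)"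
    if v: "vintage_cost sbar \<mu> lam \<epsilon> S T \<beta> q \<alpha> R D C" for R D C x
    using vintage_cost.equilibrium_iff_scalar[OF v, of x] w[OF v] by (simp only: c1 c2)
  have ex1: "\<exists>!x. equilibrium sbar \<mu> lam T \<beta> q \<alpha> R x"
    if v: "vintage_cost sbar \<mu> lam \<epsilon> S T \<beta> q \<alpha> R D C" and u: "\<exists>!\<eta>. \<eta> = - D (c2 + \<eta> * c1)" for R D C
    using vintage_cost.equilibrium_ex1[OF v] u w[OF v] by (simp only: c1 c2)
  \<comment> \<open>As \<open>w1\<close> is independent of the revenue, its positivity on \<alpha>
    can be taken from the instance with zero revenue.\<close>
  have "vintage_cost sbar \<mu> lam \<epsilon> S T \<beta> q \<alpha> (\<lambda>_. 0) (\<lambda>_. 0) 0" by (rule vc) simp_all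
  from vintage_cost.w1_pos[OF this \<alpha>(2,3)] w[OF this] have c1_pos: "0 < c1" by (simp add: c1)

  have case_i: "(\<exists>!x. equilibrium sbar \<mu> lam T \<beta> q \<alpha> (\<lambda>Q. - a * Q\<^sup>2 + b * Q) x) \<and>
      equilibrium sbar \<mu> lam T \<beta> q \<alpha> (\<lambda>Q. - a * Q\<^sup>2 + b * Q) (w2 - ((2 * a * c2 - b) / (1 + 2 * a * c1)) *\<^sub>R w1)"
    if a: "0 \<le> a" for a b
  proof -
    define D where "D = (\<lambda>Q. 2 * a * Q - b)"
    \<comment> \<open>For a quadratic revenue the second-order expansion is exact, so
      \<open>a\<close> itself is the smoothness constant.\<close>
    have v: "vintage_cost sbar \<mu> lam \<epsilon> S T \<beta> q \<alpha> (\<lambda>Q. - a * Q\<^sup>2 + b * Q) D a"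
    proof (rule vc)
      fix P Q :: real
      have e: "- (- a * P\<^sup>2 + b * P) = - (- a * Q\<^sup>2 + b * Q) + D Q * (P - Q) + a * (P - Q)\<^sup>2"
        by (simp add: D_def power2_eq_square algebra_simps)
      then show "- (- a * P\<^sup>2 + b * P) \<le> - (- a * Q\<^sup>2 + b * Q) + D Q * (P - Q) + a * (P - Q)\<^sup>2" by simp
      have "0 \<le> a * (P - Q)\<^sup>2" using a by simp
      then show "- (- a * Q\<^sup>2 + b * Q) + D Q * (P - Q) \<le> - (- a * P\<^sup>2 + b * P)" using e by linarith
    qed (use a in \<open>auto intro!: continuous_intros\<close>)
    have p: "0 < 1 + 2 * a * c1" using a c1_pos by (simp add: add_pos_nonneg)
    \<comment> \<open>The slope is affine, so the scalar equation is linear with the positive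
      coefficient \<open>1 + 2 * a * c1\<close>.\<close>
    have eq: "\<eta> = - D (c2 + \<eta> * c1) \<longleftrightarrow> \<eta> = - ((2 * a * c2 - b) / (1 + 2 * a * c1))" for \<eta>
    proof -
      have "\<eta> = - D (c2 + \<eta> * c1) \<longleftrightarrow> \<eta> * (1 + 2 * a * c1) = - (2 * a * c2 - b)" by (auto simp: D_def algebra_simps)
      then show ?thesis using p unfolding minus_divide_left by (simp add: eq_divide_eq)
    qed
    show ?thesis
    proof
      show "\<exists>!x. equilibrium sbar \<mu> lam T \<beta> q \<alpha> (\<lambda>Q. - a * Q\<^sup>2 + b * Q) x" by (rule ex1[OF v]) (simp add: eq)
      have "w2 - ((2 * a * c2 - b) / (1 + 2 * a * c1)) *\<^sub>R w1 = w2 + (- ((2 * a * c2 - b) / (1 + 2 * a * c1))) *\<^sub>R w1"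
        by (simp only: scaleR_minus_left diff_conv_add_uminus)
      then show "equilibrium sbar \<mu> lam T \<beta> q \<alpha> (\<lambda>Q. - a * Q\<^sup>2 + b * Q) (w2 - ((2 * a * c2 - b) / (1 + 2 * a * c1)) *\<^sub>R w1)"
        unfolding iff[OF v] eq by blast
    qed
  qed

  \<comment> \<open>The smoothness constant is the Lipschitz constant \<open>k * \<theta>\<close> of
    the marginal revenue.\<close>
  have vR: "vintage_cost sbar \<mu> lam \<epsilon> S T \<beta> q \<alpha> R (\<lambda>Q. - marginal_revenue k \<theta> Q) (k * \<theta>)"
    if R: "\<And>Q. (R has_real_derivative marginal_revenue k \<theta> Q) (at Q)" and k: "0 < k" "0 \<le> \<theta>" for R k \<theta>
  proof -
    note cs = convex_smooth_if_deriv_Lipschitz[of "\<lambda>Q. - R Q" "\<lambda>Q. - marginal_revenue k \<theta> Q" "k * \<theta>"]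
    have d: "((\<lambda>Q. - R Q) has_real_derivative - marginal_revenue k \<theta> Q) (at Q)" for Q by (rule DERIV_minus) (rule R)
    have m: "- marginal_revenue k \<theta> x \<le> - marginal_revenue k \<theta> y" "- marginal_revenue k \<theta> y - - marginal_revenue k \<theta> x \<le> k * \<theta> * (y - x)" if "x \<le> y" for x y
      using marginal_revenue_antimono[of k \<theta> x y] marginal_revenue_Lipschitz[of k \<theta> x y] k that by auto
    show ?thesis
    proof (rule vc)
      show "- R Q + - marginal_revenue k \<theta> Q * (P - Q) \<le> - R P" for P Q by (rule cs(1)[OF d m])
      show "- R P \<le> - R Q + - marginal_revenue k \<theta> Q * (P - Q) + k * \<theta> * (P - Q)\<^sup>2" for P Q by (rule cs(2)[OF d m])
      show "continuous_on UNIV R" by (intro continuous_at_imp_continuous_on ballI DERIV_isCont) (rule R)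
    qed (use k in simp)
  qed
  have ex1R: "\<exists>!x. equilibrium sbar \<mu> lam T \<beta> q \<alpha> R x"
    if "\<And>Q. (R has_real_derivative marginal_revenue k \<theta> Q) (at Q)" "0 < k" "0 \<le> \<theta>" for R k \<theta>
    using ex1[OF vR[OF that]] marginal_revenue_fixed_point_ex1[OF that(2,3) c1_pos, of c2] by simp
  have eqR: "equilibrium sbar \<mu> lam T \<beta> q \<alpha> R (w2 + \<eta> *\<^sub>R w1)"
    if "\<And>Q. (R has_real_derivative marginal_revenue k \<theta> Q) (at Q)" "0 < k" "0 \<le> \<theta>" "\<eta> = marginal_revenue k \<theta> (c2 + \<eta> * c1)" for R k \<theta> \<eta>
    unfolding iff[OF vR[OF that(1-3)]] using that(4) by auto

  have case_ii: "(\<exists>!x. equilibrium sbar \<mu> lam T \<beta> q \<alpha> (\<lambda>Q. if Q \<ge> 0 then ln (1 + Q) else Q) x) \<and>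
      (c1 + c2 \<ge> 0 \<longrightarrow> equilibrium sbar \<mu> lam T \<beta> q \<alpha> (\<lambda>Q. if Q \<ge> 0 then ln (1 + Q) else Q)
        (w2 + ((sqrt ((1 + c2)\<^sup>2 + 4 * c1) - (1 + c2)) / (2 * c1)) *\<^sub>R w1))"
  proof (intro conjI impI)
    assume "c1 + c2 \<ge> 0"
    from eqR[OF log_revenue_deriv _ _ log_fixed_point[OF c1_pos this refl]]
    show "equilibrium sbar \<mu> lam T \<beta> q \<alpha> (\<lambda>Q. if Q \<ge> 0 then ln (1 + Q) else Q)
        (w2 + ((sqrt ((1 + c2)\<^sup>2 + 4 * c1) - (1 + c2)) / (2 * c1)) *\<^sub>R w1)" by simp
  qed (rule ex1R[OF log_revenue_deriv], simp_all)

  have case_iii: "(\<exists>!x. equilibrium sbar \<mu> lam T \<beta> q \<alpha> (\<lambda>Q. if Q \<ge> 0 then (1 + Q) powr \<gamma> - 1 else \<gamma> * Q) x) \<and>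
      (\<exists>!\<eta>. power_eta c1 c2 \<gamma> \<eta>) \<and>
      (\<gamma> * c1 + c2 \<ge> 0 \<longrightarrow> (\<forall>\<eta>. power_eta c1 c2 \<gamma> \<eta> \<longrightarrow>
        equilibrium sbar \<mu> lam T \<beta> q \<alpha> (\<lambda>Q. if Q \<ge> 0 then (1 + Q) powr \<gamma> - 1 else \<gamma> * Q) (w2 + \<eta> *\<^sub>R w1)))"
    if \<gamma>: "0 < \<gamma>" "\<gamma> < 1" for \<gamma>
  proof (intro conjI impI allI)
    show "\<exists>!\<eta>. power_eta c1 c2 \<gamma> \<eta>" by (rule power_eta_ex1[OF c1_pos \<gamma>])
    show "\<exists>!x. equilibrium sbar \<mu> lam T \<beta> q \<alpha> (\<lambda>Q. if Q \<ge> 0 then (1 + Q) powr \<gamma> - 1 else \<gamma> * Q) x"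
      by (rule ex1R[OF power_revenue_deriv]) (use \<gamma> in auto)
    fix \<eta> assume "\<gamma> * c1 + c2 \<ge> 0" "power_eta c1 c2 \<gamma> \<eta>"
    from eqR[OF power_revenue_deriv _ _ power_eta_fixed_point[OF c1_pos \<gamma> this]]
    show "equilibrium sbar \<mu> lam T \<beta> q \<alpha> (\<lambda>Q. if Q \<ge> 0 then (1 + Q) powr \<gamma> - 1 else \<gamma> * Q) (w2 + \<eta> *\<^sub>R w1)"
      using \<gamma> by simp
  qed

  show ?thesis
    unfolding Let_def power_eta_def[symmetric]
    by (rule conjI, intro allI impI, erule case_i, rule conjI, rule case_ii, intro allI impI, erule conjE, rule case_iii)
qed

end
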